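(* Let $a(x,\xi)\in L^\infty S^m_\varrho$ on $\mathbf{R}^n\times\mathbf{R}^n$ with $m\in\mathbf{R}$ and $\varrho\in[0,1]$, and let the phase function $\varphi(x,\xi)\in L^\infty\Phi^2$ satisfy the rough non-degeneracy condition. Then for all $\chi_0(\xi)\in C_0^\infty(\mathbf{R}^n)$ supported around the origin, the Fourier integral operator $$T_0u(x)=\frac1{(2\pi)^n}\int_{\mathbf{R}^n}e^{i\varphi(x,\xi)}a(x,\xi)\chi_0(\xi)\widehat u(\xi)\,d\xi$$ is bounded on $L^p$ for every $p\in[1,\infty]$.
   Context: Notation: $\langle\xi\rangle=(1+|\xi|^2)^{1/2}$; $\widehat u(\xi)=\int e^{-i\langle x,\xi\rangle}u(x)\,dx$. Bounded on $L^p$ means $\|T_0u\|_{L^p}\le C\|u\|_{L^p}$ for all $u\in\mathscr{S}(\mathbf{R}^n)$. Class $L^\infty S^m_\varrho$: functions $a(x,\xi)$, smooth in $\xi$ and bounded measurable in $x$, such that for every multi-index $\alpha$, $\sup_{\xi}\langle\xi\rangle^{-m+\varrho|\alpha|}\|\partial_\xi^\alpha a(\cdot,\xi)\|_{L^\infty(\mathbf{R}^n)}<\infty$. Class $L^\infty\Phi^k$: real-valued $\varphi(x,\xi)$, positively homogeneous of degree $1$ and smooth on $\mathbf{R}^n\setminus0$ in $\xi$, measurable in $x$, with $\sup_{\xi\ne0}|\xi|^{-1+|\alpha|}\|\partial_\xi^\alpha\varphi(\cdot,\xi)\|_{L^\infty(\mathbf{R}^n)}<\infty$ for all $|\alpha|\ge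 k$. Rough non-degeneracy: there is $c>0$ with $|\partial_\xi\varphi(x,\xi)-\partial_\xi\varphi(y,\xi)|\ge c|x-y|$ for all $x,y\in\mathbf{R}^n$, $\xi\in\mathbf{R}^n\setminus0$.
   Formalization: For n = 1 the exponents p = 1 and p = ∞ are excluded, since the claim fails there (a = 1, φ(x,ξ) = x|ξ| gives T₀u decaying only like 1/x); for n ≥ 2 all p in [1,∞] are covered, and for n = 1 all 1 < p < ∞. *)

theory Defs
  imports "HOL-Analysis.Analysis" "HOL-Probability.Essential_Supremum"
begin

section \<open>Iterated partial derivatives and smoothness\<close>

definition partial_deriv :: "'n::finite \<Rightarrow> (real^'n \<Rightarrow> 'b::real_normed_vector) \<Rightarrow> real^'n \<Rightarrow> 'b"
  where "partial_deriv i f x = vector_derivative (\<lambda>t. f (x + t *\<^sub>R axis i 1)) (at 0)"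

text \<open>
  A multi-index is represented by a list of coordinate directions, in which direction \<open>i\<close>
  occurs as often as its multiplicity in the multi-index; its order is the length of the list.
  Distinct lists may represent the same multi-index, but for the smooth functions to which this
  is applied, the order of differentiation is irrelevant.
\<close>

primrec iter_deriv :: "'n::finite list \<Rightarrow> (real^'n \<Rightarrow> 'b::real_normed_vector) \<Rightarrow> real^'n \<Rightarrow> 'b"
  where
    "iter_deriv [] f = f"
  | "iter_deriv (i # \<alpha>) f = partial_deriv i (iter_deriv \<alpha> f)"

definition gradient :: "(real^'n::finite \<Rightarrow> real) \<Rightarrow> real^'n \<Rightarrow> real^'n"
  where "gradient f x = (\<chi> i. partial_deriv i f x)"

text \<open>Only meant for open sets \<open>S\<close>.\<close>

definition smooth_on :: "(real^'n::finite) set \<Rightarrow> (real^'n \<Rightarrow> 'b::real_normed_vector) \<Rightarrow> bool"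
  where "smooth_on S f \<longleftrightarrow> (\<forall>\<alpha>. iter_deriv \<alpha> f differentiable_on S)"

section \<open>Function spaces\<close>

definition japanese_bracket :: "'a::real_normed_vector \<Rightarrow> real"
  where "japanese_bracket \<xi> = sqrt (1 + (norm \<xi>)\<^sup>2)"

definition schwartz_space :: "(real^'n::finite \<Rightarrow> complex) set"
  where "schwartz_space =
    {u. smooth_on UNIV u \<and>
        (\<forall>\<alpha> N. bounded (range (\<lambda>x. japanese_bracket x ^ N *\<^sub>R iter_deriv \<alpha> u x)))}"

definition test_functions :: "(real^'n::finite \<Rightarrow> complex) set"
  where "test_functions = {f. smooth_on UNIV f \<and> compact (closure {x. f x \<noteq> 0})}"

definition fourier :: "(real^'n::finite \<Rightarrow> complex) \<Rightarrow> real^'n \<Rightarrow> complex"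
  where "fourier u \<xi> = (LINT x|lebesgue. exp (- (\<i> * complex_of_real (x \<bullet> \<xi>))) * u x)"

text \<open>
  The essential supremum of a non-measurable function is \<open>top\<close>, so finiteness of this norm
  includes measurability.
\<close>

definition Linf_norm :: "(real^'n::finite \<Rightarrow> 'b::real_normed_vector) \<Rightarrow> ennreal"
  where "Linf_norm f = esssup lebesgue (\<lambda>x. ennreal (norm (f x)))"

definition Lp_norm :: "ennreal \<Rightarrow> (real^'n::finite \<Rightarrow> 'b::real_normed_vector) \<Rightarrow> ennreal"
  where "Lp_norm p f =
    (if p = \<infinity> then Linf_norm f
     else (let I = (\<integral>\<^sup>+x. ennreal (norm (f x) powr enn2real p) \<partial>lebesgue)
           in if I = \<infinity> then \<infinity> else ennreal (enn2real I powr (1 / enn2real p))))"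

definition bounded_on_Lp ::
    "ennreal \<Rightarrow> ((real^'n::finite \<Rightarrow> complex) \<Rightarrow> real^'n \<Rightarrow> complex) \<Rightarrow> bool"
  where "bounded_on_Lp p T \<longleftrightarrow>
    (\<exists>C::real. \<forall>u\<in>schwartz_space.
       T u \<in> borel_measurable lebesgue \<and> Lp_norm p (T u) \<le> ennreal C * Lp_norm p u)"

section \<open>Rough amplitudes and phases\<close>

definition Linf_S :: "real \<Rightarrow> real \<Rightarrow> (real^'n::finite \<Rightarrow> real^'n \<Rightarrow> complex) set"
  where "Linf_S m \<rho> =
    {a. (\<forall>x. smooth_on UNIV (a x)) \<and>
        (\<forall>\<xi>. (\<lambda>x. a x \<xi>) \<in> borel_measurable lebesgue) \<and>
        (\<forall>\<alpha>. (SUP \<xi>. ennreal (japanese_bracket \<xi> powr (- m + \<rho> * real (length \<alpha>))) *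
                      Linf_norm (\<lambda>x. iter_deriv \<alpha> (a x) \<xi>)) < \<infinity>)}"

definition Linf_Phi :: "nat \<Rightarrow> (real^'n::finite \<Rightarrow> real^'n \<Rightarrow> real) set"
  where "Linf_Phi k =
    {\<phi>. (\<forall>x \<xi> t. \<xi> \<noteq> 0 \<and> t > 0 \<longrightarrow> \<phi> x (t *\<^sub>R \<xi>) = t * \<phi> x \<xi>) \<and>
        (\<forall>x. smooth_on (- {0}) (\<phi> x)) \<and>
        (\<forall>\<xi>. \<xi> \<noteq> 0 \<longrightarrow> (\<lambda>x. \<phi> x \<xi>) \<in> borel_measurable lebesgue) \<and>
        (\<forall>\<alpha>. length \<alpha> \<ge> k \<longrightarrow>
           (SUP \<xi>\<in>- {0}. ennreal (norm \<xi> powr (- 1 + real (length \<alpha>))) *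
                          Linf_norm (\<lambda>x. iter_deriv \<alpha> (\<phi> x) \<xi>)) < \<infinity>)}"

definition rough_nondegenerate :: "(real^'n::finite \<Rightarrow> real^'n \<Rightarrow> real) \<Rightarrow> bool"
  where "rough_nondegenerate \<phi> \<longleftrightarrow>
    (\<exists>c>0. \<forall>x y \<xi>. \<xi> \<noteq> 0 \<longrightarrow>
       norm (gradient (\<phi> x) \<xi> - gradient (\<phi> y) \<xi>) \<ge> c * norm (x - y))"

text \<open>
  In dimension one the following operator can be unbounded on the spaces with exponent \<open>1\<close> and
  \<open>\<infinity>\<close>. Since the line without the origin is disconnected, the gradients of the phase on the two
  half-lines are unrelated: for \<open>\<phi> x \<xi> = x * \<bar>\<xi>\<bar>\<close> and amplitude \<open>1\<close>, the image of a Schwartz function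
  with \<open>\<chi>\<^sub>0 0 * fourier u 0 \<noteq> 0\<close> (both factors even) decays only like \<open>1 / x\<close>, and the
  \<open>L\<close>-one norms in \<open>y\<close> of the kernel grow like \<open>ln x\<close>. Dimension one thus needs an exponent
  strictly between \<open>1\<close> and \<open>\<infinity>\<close>.
\<close>

definition low_freq_FIO ::
    "(real^'n::finite \<Rightarrow> real^'n \<Rightarrow> complex) \<Rightarrow> (real^'n \<Rightarrow> real^'n \<Rightarrow> real) \<Rightarrow>
     (real^'n \<Rightarrow> complex) \<Rightarrow> (real^'n \<Rightarrow> complex) \<Rightarrow> real^'n \<Rightarrow> complex"
  where "low_freq_FIO a \<phi> \<chi>\<^sub>0 u x =
    1 / (2 * complex_of_real pi) ^ CARD('n) *
    (LINT \<xi>|lebesgue. exp (\<i> * complex_of_real (\<phi> x \<xi>)) * a x \<xi> * \<chi>\<^sub>0 \<xi> * fourier u \<xi>)"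

end

theory Submission
  imports Defs "HOL-Complex_Analysis.Complex_Analysis"
begin

text \<open>
  Fix a unit vector \<open>\<zeta>\<close> and write the phase as \<open>\<phi> x \<xi> = g x \<bullet> \<xi> + \<theta> x \<xi>\<close>, where
  \<open>g x = gradient (\<phi> x) \<zeta>\<close>. Then the operator is \<open>T u x = \<integral> k\<^sub>x (g x - y) u y dy\<close>, where \<open>k\<^sub>x\<close> is the inverse
  Fourier transform of the compactly supported symbol \<open>\<sigma> x = exp (\<i> \<theta> x) * a x * \<chi>\<^sub>0\<close>. If \<open>\<bar>k\<^sub>x\<bar>\<close> is bounded by
  one integrable weight for almost every \<open>x\<close>, then \<open>\<bar>T u\<bar>\<close> is at most the convolution of this weight
  with \<open>\<bar>u\<bar>\<close>, evaluated at \<open>g x\<close>. Young's inequality (\<open>nn_integral_conv_powr_le\<close>) bounds the convolution.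
  The substitution of \<open>g\<close> costs only a constant: rough non-degeneracy says that \<open>g\<close> expands distances, so
  the preimage of a small cube lies in a cube of comparable size (\<open>nn_integral_expanding_le\<close>).

  In dimension \<open>n \<ge> 2\<close> the weight comes from the size of \<open>\<sigma> x\<close> near the origin. The second derivatives of
  \<open>\<phi> x\<close> are \<open>O(1/\<bar>\<xi>\<bar>)\<close>, and two points of the unit sphere are joined by a path that stays away from the
  origin. Hence \<open>\<theta> x\<close>, which is homogeneous of degree one, has bounded gradient
  (\<open>homogeneous_gradient_oscillation\<close>), \<open>\<sigma> x\<close> is Lipschitz at the origin, and its derivatives of order \<open>k\<close>
  in a coordinate direction are \<open>O(\<bar>\<xi>\<bar> powr (1 - k))\<close>. Let \<open>z $ j\<close> be the largest coordinate of \<open>z\<close>. A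
  translation of the frequency by \<open>\<pi> / (z $ j)\<close> in direction \<open>j\<close> changes the sign of \<open>exp (\<i> z \<bullet> \<xi>)\<close>, so
  \<open>(-2)^(n+1)\<close> times the Fourier integral of \<open>\<sigma> x\<close> is that of its finite difference of order \<open>n + 1\<close>. The
  difference is estimated by the Lipschitz bound near the origin and by the derivative of order \<open>n + 1\<close>
  elsewhere. This gives decay of order \<open>\<bar>z\<bar> powr (- n - 1/2)\<close>, which is integrable (\<open>kernel_decay\<close>).
  The differences take the place of a dyadic decomposition with integration by parts, and each point \<open>z\<close>
  is treated with derivatives in a single direction.

  In dimension one the two half-lines have unrelated gradients \<open>gp\<close> and \<open>gm\<close>, and the symbol of a half-line jumps at
  the origin. The jump is removed by subtracting \<open>a x 0 * \<chi>\<^sub>0 0 * exp (- \<xi>)\<close> on the positive half-line; the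
  remainder is treated as above. The subtracted symbol produces the Cauchy integral of \<open>u\<close> at height one
  above the real line, evaluated at \<open>gp x\<close> and \<open>gm x\<close>. Its boundedness for \<open>1 < p < \<infinity>\<close> is a version of the theorem of
  M. Riesz (\<open>cauchy_op_Lp\<close>). For nonnegative \<open>u\<close> the Cauchy integral \<open>F\<close> takes values in the right half-plane, so
  \<open>F powr p\<close> is holomorphic, and by Cauchy's theorem its integral over the line vanishes. Together with the inequality
  \<open>\<bar>w\<bar> powr p \<le> A * (Re w) powr p - B * Re (w powr p)\<close> for \<open>Re w > 0\<close> and \<open>1 < p \<le> 2\<close>, this bounds \<open>F\<close> by its real
  part, a Poisson integral of \<open>u\<close>. Exponents above two follow by duality.
\<close>

section \<open>Integrals along expanding maps\<close>

text \<open>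
  Two points of the preimage have images in the cube, hence are themselves close: the preimage has
  diameter at most \<open>DIM('a) * s / c\<close> and lies in a cube of comparable side length.
\<close>

lemma emeasure_vimage_cube_le:
  fixes g :: "'a::euclidean_space \<Rightarrow> 'a"
  assumes g: "g \<in> borel_measurable lebesgue" and c: "c > 0"
    and exp: "\<And>x y. c * norm (x - y) \<le> norm (g x - g y)"
    and s: "\<And>i. i \<in> Basis \<Longrightarrow> v \<bullet> i - u \<bullet> i = s" "s > 0"
  shows "emeasure lebesgue (g -` cbox u v)
    \<le> ennreal ((2 * DIM('a) / c) ^ DIM('a)) * emeasure lebesgue (cbox u v)"
proof (cases "g -` cbox u v = {}")
  case False
  then obtain x0 where x0: "g x0 \<in> cbox u v" by auto
  define r where "r = DIM('a) * s / c"
  have r0: "r \<ge> 0" using c s by (simp add: r_def)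
  have sub: "g -` cbox u v \<subseteq> cbox (x0 - r *\<^sub>R One) (x0 + r *\<^sub>R One)"
  proof
    fix x assume "x \<in> g -` cbox u v"
    then have gx: "g x \<in> cbox u v" by simp
    have "norm (g x - g x0) \<le> (\<Sum>i\<in>Basis. \<bar>(g x - g x0) \<bullet> i\<bar>)" by (rule norm_le_l1)
    also have "\<dots> \<le> (\<Sum>i\<in>(Basis::'a set). s)"
    proof (rule sum_mono)
      fix i :: 'a assume i: "i \<in> Basis"
      have "u \<bullet> i \<le> g x \<bullet> i" "g x \<bullet> i \<le> v \<bullet> i" "u \<bullet> i \<le> g x0 \<bullet> i" "g x0 \<bullet> i \<le> v \<bullet> i"
        using gx x0 i by (auto simp: mem_box)
      then show "\<bar>(g x - g x0) \<bullet> i\<bar> \<le> s" using s(1)[OF i] by (simp add: inner_diff_left abs_le_iff)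
    qed
    also have "\<dots> = DIM('a) * s" by simp
    finally have "c * norm (x - x0) \<le> DIM('a) * s" using exp[of x x0] by linarith
    then have nr: "norm (x - x0) \<le> r" using c by (simp add: r_def field_simps)
    show "x \<in> cbox (x0 - r *\<^sub>R One) (x0 + r *\<^sub>R One)"
    proof (subst mem_box, safe)
      fix i :: 'a assume i: "i \<in> Basis"
      have "\<bar>(x - x0) \<bullet> i\<bar> \<le> r" using Basis_le_norm[OF i, of "x - x0"] nr by linarith
      then show "(x0 - r *\<^sub>R One) \<bullet> i \<le> x \<bullet> i" "x \<bullet> i \<le> (x0 + r *\<^sub>R One) \<bullet> i"
        using i by (auto simp: inner_diff_left inner_add_left inner_sum_left inner_Basis if_distrib cong: if_cong)
    qed
  qed
  have "emeasure lebesgue (g -` cbox u v) \<le> emeasure lebesgue (cbox (x0 - r *\<^sub>R One) (x0 + r *\<^sub>R One))"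
    by (rule emeasure_mono[OF sub]) auto
  also have "\<dots> = ennreal ((2 * r) ^ DIM('a))"
  proof -
    have "(\<Prod>b\<in>Basis. ((x0 + r *\<^sub>R One) - (x0 - r *\<^sub>R One)) \<bullet> b) = (\<Prod>b\<in>(Basis::'a set). 2 * r)"
      by (rule prod.cong) (auto simp: inner_diff_left inner_add_left inner_sum_left inner_Basis if_distrib cong: if_cong)
    moreover have "(x0 - r *\<^sub>R One) \<bullet> b \<le> (x0 + r *\<^sub>R One) \<bullet> b" if "b \<in> Basis" for b
      using that r0 by (auto simp: inner_diff_left inner_add_left inner_sum_left inner_Basis if_distrib cong: if_cong)
    ultimately show ?thesis by (simp add: emeasure_lborel_cbox)
  qed
  also have "\<dots> = ennreal ((2 * DIM('a) / c) ^ DIM('a) * s ^ DIM('a))"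
  proof -
    have "2 * r = (2 * DIM('a) / c) * s" by (simp add: r_def)
    then show ?thesis by (simp only: power_mult_distrib)
  qed
  also have "\<dots> = ennreal ((2 * DIM('a) / c) ^ DIM('a)) * emeasure lebesgue (cbox u v)"
  proof -
    have "(\<Prod>b\<in>Basis. (v - u) \<bullet> b) = (\<Prod>b\<in>(Basis::'a set). s)"
      by (rule prod.cong) (auto simp: inner_diff_left s)
    moreover have "u \<bullet> b \<le> v \<bullet> b" if "b \<in> Basis" for b using s(1)[OF that] s(2) by linarith
    ultimately show ?thesis using c s by (simp add: emeasure_lborel_cbox ennreal_mult)
  qed
  finally show ?thesis .
qed simp

text \<open>
  A bounded set is covered up to measure \<open>e\<close> by cubes with disjoint interiors, and the
  estimate for cubes is summed. Disjointness enters because the sum of the volumes is compared with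
  the volume of the union.
\<close>

lemma emeasure_vimage_bounded_le:
  fixes g :: "'a::euclidean_space \<Rightarrow> 'a"
  assumes g: "g \<in> borel_measurable lebesgue" and c: "c > 0"
    and exp: "\<And>x y. c * norm (x - y) \<le> norm (g x - g y)"
    and A: "A \<in> sets borel" "A \<subseteq> cbox (- (m *\<^sub>R One)) (m *\<^sub>R One)" and m: "m > 0"
  shows "emeasure lebesgue (g -` A)
    \<le> ennreal ((2 * DIM('a) / c) ^ DIM('a)) * emeasure lebesgue A"
proof (rule ennreal_le_epsilon)
  let ?K = "(2 * DIM('a) / c) ^ DIM('a)"
  have K0: "?K > 0" using c by simp
  fix e :: real assume e: "e > 0"
  let ?a = "- (m *\<^sub>R One) :: 'a" and ?b = "m *\<^sub>R One :: 'a"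
  have Am: "A \<in> lmeasurable"
    using A by (intro fmeasurableI2[OF lmeasurable_cbox A(2)]) auto
  have bi: "?b \<bullet> i - ?a \<bullet> i = 2 * m" if "i \<in> Basis" for i
    using that by (auto simp: inner_sum_left inner_Basis if_distrib cong: if_cong)
  have boxne: "box ?a ?b \<noteq> {}"
  proof (subst box_ne_empty(2), intro ballI)
    fix i :: 'a assume "i \<in> Basis" then show "?a \<bullet> i < ?b \<bullet> i" using bi[of i] m by linarith
  qed
  obtain D where D: "countable D"
    "\<And>K. K \<in> D \<Longrightarrow> K \<subseteq> cbox ?a ?b \<and> K \<noteq> {} \<and> (\<exists>c d. K = cbox c d)"
    "pairwise (\<lambda>A B. interior A \<inter> interior B = {}) D"
    "\<And>u v. cbox u v \<in> D \<Longrightarrow> \<exists>n. \<forall>i \<in> Basis. v \<bullet> i - u \<bullet> i = (?b \<bullet> i - ?a \<bullet> i)/2^n"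
    "A \<subseteq> \<Union>D" "\<Union>D \<in> lmeasurable" "measure lebesgue (\<Union>D) \<le> measure lebesgue A + e / ?K"
    using measurable_outer_intervals_bounded[OF Am A(2), of "e / ?K"] e K0 by (metis divide_pos_pos)
  have cube: "emeasure lebesgue (g -` Q) \<le> ennreal ?K * emeasure lebesgue (interior Q)"
    and Qs: "Q \<in> sets borel" and Qi: "interior Q \<in> sets borel" if Q: "Q \<in> D" for Q
  proof -
    obtain u v where uv: "Q = cbox u v" using D(2)[OF Q] by auto
    obtain n where n: "\<forall>i \<in> Basis. v \<bullet> i - u \<bullet> i = (?b \<bullet> i - ?a \<bullet> i)/2^n" using D(4)[of u v] Q unfolding uv by fast
    have "emeasure lebesgue (g -` cbox u v) \<le> ennreal ?K * emeasure lebesgue (cbox u v)"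
      by (rule emeasure_vimage_cube_le[OF g c exp, where s = "2 * m / 2^n"]) (use n bi m in auto)
    moreover have "emeasure lebesgue (cbox u v) = emeasure lebesgue (box u v)"
      by (simp add: emeasure_lborel_cbox_eq emeasure_lborel_box_eq)
    ultimately show "emeasure lebesgue (g -` Q) \<le> ennreal ?K * emeasure lebesgue (interior Q)"
      by (simp add: uv)
    show "Q \<in> sets borel" "interior Q \<in> sets borel" by (auto simp: uv)
  qed
  have meas: "g -` Q \<in> sets lebesgue" if "Q \<in> sets borel" for Q
    using measurable_sets[OF g, of Q] that by simp
  have "emeasure lebesgue (g -` A) \<le> emeasure lebesgue (\<Union>Q\<in>D. g -` Q)"
    using D(5) by (intro emeasure_mono sets.countable_UN' D(1)) (auto intro: meas Qs)
  also have "\<dots> \<le> (\<integral>\<^sup>+Q. emeasure lebesgue (g -` Q) \<partial>count_space D)"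
  proof -
    have "emeasure lebesgue (\<Union>Q\<in>D. g -` Q) = (\<integral>\<^sup>+x. indicator (\<Union>Q\<in>D. g -` Q) x \<partial>lebesgue)"
      by (subst nn_integral_indicator) (auto intro!: sets.countable_UN' D(1) meas Qs)
    also have "\<dots> \<le> (\<integral>\<^sup>+x. (\<integral>\<^sup>+Q. indicator (g -` Q) x \<partial>count_space D) \<partial>lebesgue)"
    proof (rule nn_integral_mono)
      fix x
      show "indicator (\<Union>Q\<in>D. g -` Q) x \<le> (\<integral>\<^sup>+Q. indicator (g -` Q) x \<partial>count_space D)"
      proof (cases "x \<in> (\<Union>Q\<in>D. g -` Q)")
        case True
        then obtain Q where Q: "Q \<in> D" "g x \<in> Q" by auto
        have "(1::ennreal) = (\<integral>\<^sup>+R. indicator {Q} R \<partial>count_space D)"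
          using Q by (simp add: nn_integral_indicator)
        also have "\<dots> \<le> (\<integral>\<^sup>+R. indicator (g -` R) x \<partial>count_space D)"
          by (rule nn_integral_mono) (use Q in \<open>auto simp: indicator_def\<close>)
        finally show ?thesis using True by simp
      qed simp
    qed
    also have "\<dots> = (\<integral>\<^sup>+Q. (\<integral>\<^sup>+x. indicator (g -` Q) x \<partial>lebesgue) \<partial>count_space D)"
      by (subst nn_integral_count_space_nn_integral[symmetric]) (use D(1) meas Qs in auto)
    also have "\<dots> = (\<integral>\<^sup>+Q. emeasure lebesgue (g -` Q) \<partial>count_space D)"
      by (rule nn_integral_cong) (auto intro!: nn_integral_indicator meas Qs)
    finally show ?thesis .
  qed
  also have "\<dots> \<le> (\<integral>\<^sup>+Q. ennreal ?K * emeasure lebesgue (interior Q) \<partial>count_space D)"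
    by (rule nn_integral_mono) (use cube in auto)
  also have "\<dots> = ennreal ?K * (\<integral>\<^sup>+Q. emeasure lebesgue (interior Q) \<partial>count_space D)"
    by (rule nn_integral_cmult) auto
  also have "(\<integral>\<^sup>+Q. emeasure lebesgue (interior Q) \<partial>count_space D) = emeasure lebesgue (\<Union>Q\<in>D. interior Q)"
    by (rule emeasure_UN_countable[symmetric])
       (use D(1,3) Qi in \<open>auto simp: disjoint_family_on_def pairwise_def\<close>)
  also have "\<dots> \<le> emeasure lebesgue (\<Union>D)"
    using D(6) interior_subset by (intro emeasure_mono) blast+
  also have "\<dots> \<le> ennreal (measure lebesgue A + e / ?K)"
    unfolding emeasure_eq_measure2[OF D(6)] by (rule ennreal_leI[OF D(7)])
  also have "ennreal ?K * ennreal (measure lebesgue A + e / ?K) = ennreal ?K * emeasure lebesgue A + ennreal e"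
  proof -
    have "ennreal ?K * ennreal (measure lebesgue A + e / ?K) = ennreal (?K * measure lebesgue A + e)"
      using c e by (subst ennreal_mult[symmetric]) (auto simp: algebra_simps)
    also have "\<dots> = ennreal ?K * ennreal (measure lebesgue A) + ennreal e"
      using c e by (simp add: ennreal_plus ennreal_mult)
    finally show ?thesis unfolding emeasure_eq_measure2[OF Am] .
  qed
  finally show "emeasure lebesgue (g -` A) \<le> ennreal ?K * emeasure lebesgue A + ennreal e"
    by (simp add: mult_left_mono)
qed

text \<open>
  A change of variables without a Jacobian, for a merely measurable map: the estimate for bounded sets
  says that the image of Lebesgue measure under \<open>g\<close> is at most a multiple of Lebesgue measure.
\<close>

lemma nn_integral_expanding_le:
  fixes g :: "'a::euclidean_space \<Rightarrow> 'a"
  assumes g: "g \<in> borel_measurable lebesgue" and c: "c > 0"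
    and exp: "\<And>x y. c * norm (x - y) \<le> norm (g x - g y)"
    and f[measurable]: "f \<in> borel_measurable borel"
  shows "(\<integral>\<^sup>+x. f (g x) \<partial>lebesgue)
    \<le> ennreal ((2 * DIM('a) / c) ^ DIM('a)) * (\<integral>\<^sup>+x. f x \<partial>lborel)"
proof -
  let ?K = "(2 * DIM('a) / c) ^ DIM('a)"
  have K0: "?K > 0" using c by simp
  let ?B = "\<lambda>k::nat. cbox (- (real (Suc k) *\<^sub>R One)) (real (Suc k) *\<^sub>R One) :: 'a set"
  have meas: "g -` Q \<in> sets lebesgue" if "Q \<in> sets borel" for Q
    using measurable_sets[OF g, of Q] that by simp
  have le: "emeasure lebesgue (g -` A) \<le> ennreal ?K * emeasure lborel A" if A: "A \<in> sets borel" for A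
  proof -
    have U: "(\<Union>k. ?B k) = UNIV"
    proof safe
      fix x :: 'a
      obtain k where k: "norm x \<le> real k" using real_arch_simple by blast
      have "x \<in> ?B k"
      proof (subst mem_box, intro ballI)
        fix i :: 'a assume i: "i \<in> Basis"
        have "\<bar>x \<bullet> i\<bar> \<le> real k" using Basis_le_norm[OF i, of x] k by linarith
        moreover have "(real (Suc k) *\<^sub>R One) \<bullet> i = real (Suc k)" 
          using i by (auto simp: inner_sum_left inner_Basis if_distrib cong: if_cong)
        ultimately show "- (real (Suc k) *\<^sub>R One) \<bullet> i \<le> x \<bullet> i \<and> x \<bullet> i \<le> (real (Suc k) *\<^sub>R One) \<bullet> i"
          by auto
      qed
      then show "x \<in> (\<Union>k. ?B k)" by blast
    qed simp
    have incB: "incseq ?B"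
      by (rule incseq_SucI, subst subset_box) (auto simp: inner_sum_left inner_Basis if_distrib cong: if_cong)
    have "emeasure lebesgue (g -` A) = (SUP k. emeasure lebesgue (g -` (A \<inter> ?B k)))"
    proof (subst SUP_emeasure_incseq)
      show "range (\<lambda>k. g -` (A \<inter> ?B k)) \<subseteq> sets lebesgue" using A by (auto simp del: vimage_Int intro!: meas)
      show "incseq (\<lambda>k. g -` (A \<inter> ?B k))" using incB by (auto simp: incseq_def)
      have "(\<Union>k. g -` (A \<inter> ?B k)) = g -` A" using U by blast
      then show "emeasure lebesgue (g -` A) = emeasure lebesgue (\<Union>k. g -` (A \<inter> ?B k))" by simp
    qed
    also have "\<dots> \<le> ennreal ?K * emeasure lborel A"
    proof (rule SUP_least)
      fix k
      have "emeasure lebesgue (g -` (A \<inter> ?B k)) \<le> ennreal ?K * emeasure lebesgue (A \<inter> ?B k)"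
        by (rule emeasure_vimage_bounded_le[OF g c exp, where m = "real (Suc k)"]) (use A in auto)
      also have "\<dots> \<le> ennreal ?K * emeasure lebesgue A"
        using A by (intro mult_left_mono emeasure_mono) auto
      finally show "emeasure lebesgue (g -` (A \<inter> ?B k)) \<le> ennreal ?K * emeasure lborel A" using A by simp
    qed
    finally show ?thesis .
  qed
  have "(\<integral>\<^sup>+x. f (g x) \<partial>lebesgue) = (\<integral>\<^sup>+x. f x \<partial>distr lebesgue borel g)"
    by (rule nn_integral_distr[symmetric]) (use g in auto)
  also have "\<dots> \<le> (\<integral>\<^sup>+x. f x \<partial>scale_measure (ennreal ?K) lborel)"
  proof (rule nn_integral_mono_measure)
    have "emeasure (distr lebesgue borel g) A \<le> emeasure (scale_measure (ennreal ?K) lborel) A" for A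
      using le[of A] g by (cases "A \<in> sets borel") (auto simp: emeasure_distr emeasure_notin_sets)
    then show "distr lebesgue borel g \<le> scale_measure (ennreal ?K) lborel"
      by (subst le_measure) (simp_all add: le_fun_def del: emeasure_scale_measure)
  qed simp
  also have "\<dots> = ennreal ?K * (\<integral>\<^sup>+x. f x \<partial>lborel)"
    by (rule nn_integral_scale_measure) simp
  finally show ?thesis .
qed

section \<open>Integrable weights and convolution\<close>

lemma prod_Basis_vec:
  fixes f :: "real \<Rightarrow> 'b::comm_monoid_mult" and x :: "real^'n::finite"
  shows "(\<Prod>b\<in>Basis. f (x \<bullet> b)) = (\<Prod>i\<in>UNIV. f (x $ i))"
proof -
  have B: "(Basis :: (real^'n) set) = (\<lambda>i. axis i 1) ` UNIV"
    by (auto simp: Basis_vec_def)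
  have "inj (\<lambda>i::'n. axis i (1::real))" by (auto simp: inj_def axis_eq_axis)
  then show ?thesis unfolding B by (simp add: prod.reindex cart_eq_inner_axis)
qed

lemma nn_integral_prod_coordinates:
  fixes f :: "real \<Rightarrow> ennreal"
  assumes [measurable]: "f \<in> borel_measurable borel"
  shows "(\<integral>\<^sup>+x. (\<Prod>i\<in>UNIV. f (x $ i)) \<partial>(lborel :: (real^'n::finite) measure))
    = (\<integral>\<^sup>+t. f t \<partial>lborel) ^ CARD('n)"
proof -
  have "(\<integral>\<^sup>+x. (\<Prod>i\<in>UNIV. f (x $ i)) \<partial>(lborel :: (real^'n::finite) measure))
     = (\<integral>\<^sup>+x. (\<Prod>b\<in>Basis. f (x \<bullet> b)) \<partial>(lborel :: (real^'n::finite) measure))"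
    by (simp add: prod_Basis_vec)
  also have "\<dots> = (\<Prod>b\<in>(Basis::(real^'n) set). (\<integral>\<^sup>+t. f t \<partial>lborel))"
    by (rule nn_integral_lborel_prod) auto
  also have "\<dots> = (\<integral>\<^sup>+t. f t \<partial>lborel) ^ CARD('n)" by simp
  finally show ?thesis .
qed

text \<open>
  A one-dimensional function with the singularity \<open>-1 + d\<close> at the origin and the decay \<open>-1 - d\<close>
  at infinity. Products of it over the coordinates dominate both the weight of the kernels and the
  radial function that arises in their proof.
\<close>

lemma nn_integral_two_sided_power_finite:
  fixes d :: real
  assumes d: "0 < d" "d < 1"
  shows "(\<integral>\<^sup>+t. ennreal (\<bar>t\<bar> powr (-1 + d) * (1 + \<bar>t\<bar>) powr (-2 * d)) \<partial>lborel) < \<infinity>"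
proof -
  define q where "q t = ennreal (\<bar>t\<bar> powr (-1 + d) * (1 + \<bar>t\<bar>) powr (-2 * d))" for t :: real
  have [measurable]: "q \<in> borel_measurable borel" unfolding q_def by measurable
  have 1: "(\<integral>\<^sup>+t. ennreal (indicator {0..1} t * t powr (-1 + d)) \<partial>lborel) < \<infinity>"
    by (subst nn_integral_has_integral_lebesgue[OF _ has_integral_powr_from_0]) (use d in auto)
  have 2: "(\<integral>\<^sup>+t. ennreal (indicator {1..} t * t powr (-1 - d)) \<partial>lborel) < \<infinity>"
    by (subst nn_integral_has_integral_lebesgue[OF _ has_integral_powr_to_inf]) (use d in auto)
  have half: "(\<integral>\<^sup>+t. q t * indicator {0..} t \<partial>lborel) < \<infinity>"
  proof -
    have "(\<integral>\<^sup>+t. q t * indicator {0..} t \<partial>lborel) \<le> 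
       (\<integral>\<^sup>+t. ennreal (indicator {0..1} t * t powr (-1 + d)) + ennreal (indicator {1..} t * t powr (-1 - d)) \<partial>lborel)"
    proof (rule nn_integral_mono)
      fix t :: real
      consider "t < 0" | "0 \<le> t" "t < 1" | "t \<ge> 1" by linarith
      then show "q t * indicator {0..} t \<le> ennreal (indicator {0..1} t * t powr (-1 + d)) + ennreal (indicator {1..} t * t powr (-1 - d))"
      proof cases
        case 2
        have "(1 + t) powr (-2 * d) \<le> (1 + t) powr 0" using d 2 by (intro powr_mono) auto
        then have "t powr (-1 + d) * (1 + t) powr (-2 * d) \<le> t powr (-1 + d) * 1"
          using 2 by (intro mult_left_mono) auto
        then show ?thesis using 2 by (auto simp: q_def intro!: ennreal_leI)
      next
        case 3
        have "(1 + t) powr (-2 * d) \<le> t powr (-2 * d)" using d 3 by (intro powr_mono2') auto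
        then have "t powr (-1 + d) * (1 + t) powr (-2 * d) \<le> t powr (-1 + d) * t powr (-2 * d)"
          using 3 by (intro mult_left_mono) auto
        also have "\<dots> = t powr (-1 - d)" by (simp add: powr_add[symmetric] algebra_simps)
        finally have "q t \<le> ennreal (t powr (-1 - d))" using 3 by (auto simp: q_def intro!: ennreal_leI)
        then show ?thesis using 3 by (auto intro: add_increasing)
      qed auto
    qed
    also have "\<dots> < \<infinity>" using 1 2 by (subst nn_integral_add) auto
    finally show ?thesis .
  qed
  have "(\<integral>\<^sup>+t. q t \<partial>lborel) \<le> (\<integral>\<^sup>+t. q t * indicator {0..} t + q (- t) * indicator {0..} (- t) \<partial>lborel)"
    by (rule nn_integral_mono) (auto simp: q_def indicator_def)
  also have "\<dots> = (\<integral>\<^sup>+t. q t * indicator {0..} t \<partial>lborel) + (\<integral>\<^sup>+t. q (- t) * indicator {0..} (- t) \<partial>lborel)"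
    by (rule nn_integral_add) auto
  also have "(\<integral>\<^sup>+t. q (- t) * indicator {0..} (- t) \<partial>lborel) = (\<integral>\<^sup>+t. q t * indicator {0..} t \<partial>lborel)"
    by (subst (2) nn_integral_real_affine[where c = "-1" and t = 0]) auto
  finally show ?thesis using half unfolding q_def by (auto simp: less_top[symmetric] top_unique)
qed

lemma AE_coordinates_nonzero: "AE x in (lborel :: (real^'n::finite) measure). \<forall>i. x $ i \<noteq> 0"
proof -
  have "AE x in (lborel :: (real^'n::finite) measure). x $ i \<noteq> 0" for i
  proof (rule AE_I')
    have "negligible {x::real^'n. x \<bullet> axis i 1 = 0}"
      by (rule negligible_standard_hyperplane) auto
    then have n: "{x::real^'n. x $ i = 0} \<in> null_sets lebesgue"
      by (simp add: negligible_iff_null_sets cart_eq_inner_axis)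
    have "closed {x::real^'n. x $ i = 0}" by (intro closed_Collect_eq continuous_intros)
    then have "{x::real^'n. x $ i = 0} \<in> sets borel" by auto
    with n show "{x::real^'n. x $ i = 0} \<in> null_sets lborel" by (auto simp: null_sets_def)
  qed auto
  then show ?thesis by (simp add: AE_all_countable)
qed

text \<open>
  The excess \<open>1 / (2n)\<close> in each of the \<open>n\<close> coordinates adds up to the exponent \<open>n + 1/2\<close>.
\<close>

definition coord_exponent :: "'n::finite itself \<Rightarrow> real"
  where "coord_exponent _ = 1 / (2 * CARD('n))"

lemma coord_exponent_bounds:
  "0 < coord_exponent TYPE('n::finite)" "coord_exponent TYPE('n) < 1"
  "CARD('n) * coord_exponent TYPE('n) = 1 / 2"
proof -
  define N where "N = real CARD('n)"
  have "CARD('n) \<ge> 1" by (simp add: Suc_leI)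
  then have N: "N \<ge> 1" unfolding N_def by linarith
  have d: "coord_exponent TYPE('n) = 1 / (2 * N)" by (simp add: coord_exponent_def N_def)
  show "0 < coord_exponent TYPE('n::finite)" "coord_exponent TYPE('n) < 1"
    "CARD('n) * coord_exponent TYPE('n) = 1 / 2"
    unfolding N_def[symmetric] d using N by (auto simp: field_simps)
qed

text \<open>
  A product of functions of one variable, so that integrability reduces to dimension one. Where
  the largest coordinate is \<open>r \<ge> 1\<close>, it is at least a multiple of \<open>r powr (- n - 1/2)\<close>.
\<close>

definition weight :: "real^'n::finite \<Rightarrow> real"
  where "weight z = (\<Prod>i\<in>UNIV. (1 + \<bar>z $ i\<bar>) powr (-1 - coord_exponent TYPE('n)))"

lemma weight_measurable[measurable]: "weight \<in> borel_measurable borel"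
  unfolding weight_def by measurable

lemma weight_pos: "weight z > 0"
  unfolding weight_def by (rule prod_pos) (auto intro!: add_pos_nonneg simp: abs_add_one_gt_zero add.commute)

lemma weight_nonneg: "weight z \<ge> 0"
  using weight_pos[of z] by simp

lemma prod_powr_exponent:
  assumes "r \<ge> 0"
  shows "(\<Prod>i\<in>(UNIV::'n::finite set). r powr e) = r powr (real CARD('n) * e)"
  using assms by (cases "r = 0") (auto simp: powr_powr mult.commute simp flip: powr_realpow)

lemma nn_integral_prod_power_finite:
  "(\<integral>\<^sup>+x. ennreal (\<Prod>i\<in>UNIV. \<bar>x $ i\<bar> powr (-1 + coord_exponent TYPE('n)) * (1 + \<bar>x $ i\<bar>) powr (-2 * coord_exponent TYPE('n)))
      \<partial>(lborel :: (real^'n::finite) measure)) < \<infinity>"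
proof -
  let ?d = "coord_exponent TYPE('n)"
  have "(\<integral>\<^sup>+x. ennreal (\<Prod>i\<in>UNIV. \<bar>x $ i\<bar> powr (-1 + ?d) * (1 + \<bar>x $ i\<bar>) powr (-2 * ?d)) \<partial>(lborel :: (real^'n::finite) measure))
    = (\<integral>\<^sup>+x. (\<Prod>i\<in>UNIV. ennreal (\<bar>x $ i\<bar> powr (-1 + ?d) * (1 + \<bar>x $ i\<bar>) powr (-2 * ?d))) \<partial>(lborel :: (real^'n::finite) measure))"
    by (subst prod_ennreal) auto
  also have "\<dots> = (\<integral>\<^sup>+t. ennreal (\<bar>t\<bar> powr (-1 + ?d) * (1 + \<bar>t\<bar>) powr (-2 * ?d)) \<partial>lborel) ^ CARD('n)"
    by (rule nn_integral_prod_coordinates) measurable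
  also have "\<dots> < \<infinity>"
    using nn_integral_two_sided_power_finite[OF coord_exponent_bounds(1,2)] by (simp add: power_less_top_ennreal)
  finally show ?thesis .
qed

lemma nn_integral_weight_finite: "(\<integral>\<^sup>+z. ennreal (weight z) \<partial>(lborel :: (real^'n::finite) measure)) < \<infinity>"
proof -
  let ?d = "coord_exponent TYPE('n)"
  have "(\<integral>\<^sup>+z. ennreal (weight z) \<partial>(lborel :: (real^'n::finite) measure))
    \<le> (\<integral>\<^sup>+x. ennreal (\<Prod>i\<in>UNIV. \<bar>x $ i\<bar> powr (-1 + ?d) * (1 + \<bar>x $ i\<bar>) powr (-2 * ?d)) \<partial>(lborel :: (real^'n::finite) measure))"
  proof (rule nn_integral_mono_AE)
    show "AE x in (lborel :: (real^'n::finite) measure). ennreal (weight x)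
      \<le> ennreal (\<Prod>i\<in>UNIV. \<bar>x $ i\<bar> powr (-1 + ?d) * (1 + \<bar>x $ i\<bar>) powr (-2 * ?d))"
      using AE_coordinates_nonzero
    proof eventually_elim
      case (elim x)
      have "weight x \<le> (\<Prod>i\<in>UNIV. \<bar>x $ i\<bar> powr (-1 + ?d) * (1 + \<bar>x $ i\<bar>) powr (-2 * ?d))"
        unfolding weight_def
      proof (rule prod_mono, safe)
        fix i
        have "(1 + \<bar>x $ i\<bar>) powr (-1 - ?d) = (1 + \<bar>x $ i\<bar>) powr (-1 + ?d) * (1 + \<bar>x $ i\<bar>) powr (-2 * ?d)"
          by (simp add: powr_add[symmetric] algebra_simps)
        also have "\<dots> \<le> \<bar>x $ i\<bar> powr (-1 + ?d) * (1 + \<bar>x $ i\<bar>) powr (-2 * ?d)"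
          using coord_exponent_bounds[where 'n='n] elim by (intro mult_right_mono powr_mono2') auto
        finally show "(1 + \<bar>x $ i\<bar>) powr (-1 - ?d) \<le> \<bar>x $ i\<bar> powr (-1 + ?d) * (1 + \<bar>x $ i\<bar>) powr (-2 * ?d)" .
      qed auto
      then show ?case by (rule ennreal_leI)
    qed
  qed
  also have "\<dots> < \<infinity>" by (rule nn_integral_prod_power_finite)
  finally show ?thesis .
qed

text \<open>
  The radial function is dominated by a product of functions of the coordinates, since the exponents
  are negative and the norm is at least each coordinate. This avoids polar coordinates.
\<close>

lemma nn_integral_radial_power_finite:
  "(\<integral>\<^sup>+x. ennreal (norm x powr (1/2 - CARD('n)) / (1 + norm x)) \<partial>(lborel :: (real^'n::finite) measure)) < \<infinity>"
proof -
  let ?d = "coord_exponent TYPE('n)"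
  have "(\<integral>\<^sup>+x. ennreal (norm x powr (1/2 - CARD('n)) / (1 + norm x)) \<partial>(lborel :: (real^'n::finite) measure))
    \<le> (\<integral>\<^sup>+x. ennreal (\<Prod>i\<in>UNIV. \<bar>x $ i\<bar> powr (-1 + ?d) * (1 + \<bar>x $ i\<bar>) powr (-2 * ?d)) \<partial>(lborel :: (real^'n::finite) measure))"
  proof (rule nn_integral_mono_AE)
    show "AE x in (lborel :: (real^'n::finite) measure). ennreal (norm x powr (1/2 - CARD('n)) / (1 + norm x))
      \<le> ennreal (\<Prod>i\<in>UNIV. \<bar>x $ i\<bar> powr (-1 + ?d) * (1 + \<bar>x $ i\<bar>) powr (-2 * ?d))"
      using AE_coordinates_nonzero
    proof eventually_elim
      case (elim x)
      have e: "real CARD('n) * (-1 + ?d) = 1/2 - CARD('n)" "real CARD('n) * (-2 * ?d) = -1"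
        using coord_exponent_bounds(3)[where 'n='n] by (simp_all add: algebra_simps)
      have "norm x powr (1/2 - CARD('n)) / (1 + norm x) = norm x powr (1/2 - CARD('n)) * (1 + norm x) powr (-1)"
        by (simp add: powr_minus_divide add_pos_nonneg)
      also have "\<dots> = (\<Prod>i\<in>(UNIV::'n set). norm x powr (-1 + ?d)) * (\<Prod>i\<in>(UNIV::'n set). (1 + norm x) powr (-2 * ?d))"
        by (simp only: prod_powr_exponent norm_ge_zero add_nonneg_nonneg zero_le_one e)
      also have "\<dots> = (\<Prod>i\<in>(UNIV::'n set). norm x powr (-1 + ?d) * (1 + norm x) powr (-2 * ?d))"
        by (rule prod.distrib[symmetric])
      also have "\<dots> \<le> (\<Prod>i\<in>UNIV. \<bar>x $ i\<bar> powr (-1 + ?d) * (1 + \<bar>x $ i\<bar>) powr (-2 * ?d))"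
        by (rule prod_mono) (use elim coord_exponent_bounds[where 'n='n] component_le_norm_cart[of x] in
            \<open>auto intro!: mult_mono powr_mono2'\<close>)
      finally show ?case by (rule ennreal_leI)
    qed
  qed
  also have "\<dots> < \<infinity>" by (rule nn_integral_prod_power_finite)
  finally show ?thesis .
qed

lemma weight_lower_of_max:
  fixes z :: "real^'n::finite"
  assumes j: "\<And>i. \<bar>z $ i\<bar> \<le> r" and r: "r \<ge> 1"
  shows "r powr (- CARD('n) - 1/2) \<le> 2 powr (CARD('n) + 1/2) * weight z"
proof -
  let ?d = "coord_exponent TYPE('n)"
  have e: "real CARD('n) * (-1 - ?d) = - CARD('n) - 1/2"
    using coord_exponent_bounds(3)[where 'n='n] by (simp add: algebra_simps)
  have "(2 * r) powr (- CARD('n) - 1/2) = (\<Prod>i\<in>(UNIV::'n set). (2 * r) powr (-1 - ?d))"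
    using r by (subst prod_powr_exponent) (auto simp only: e)
  also have "\<dots> \<le> weight z"
    unfolding weight_def
  proof (rule prod_mono, safe)
    fix i
    show "(2 * r) powr (-1 - ?d) \<le> (1 + \<bar>z $ i\<bar>) powr (-1 - ?d)"
      using j[of i] r coord_exponent_bounds[where 'n='n] by (intro powr_mono2') auto
  qed auto
  finally have "(2 * r) powr (- CARD('n) - 1/2) \<le> weight z" .
  then have "2 powr (CARD('n) + 1/2) * (2 * r) powr (- CARD('n) - 1/2) \<le> 2 powr (CARD('n) + 1/2) * weight z"
    by (intro mult_left_mono) auto
  moreover have "2 powr (CARD('n) + 1/2) * (2 * r) powr (- CARD('n) - 1/2) = r powr (- CARD('n) - 1/2)"
    using r by (simp add: powr_mult powr_add[symmetric] mult.assoc[symmetric])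
  ultimately show ?thesis by (simp only:)
qed

lemma lborel_nn_integral_translate:
  fixes f :: "'a::euclidean_space \<Rightarrow> ennreal"
  assumes [measurable]: "f \<in> borel_measurable borel"
  shows "(\<integral>\<^sup>+x. f (x - y) \<partial>lborel) = (\<integral>\<^sup>+x. f x \<partial>lborel)"
    "(\<integral>\<^sup>+x. f (y - x) \<partial>lborel) = (\<integral>\<^sup>+x. f x \<partial>lborel)"
proof -
  have "(\<integral>\<^sup>+x. f x \<partial>lborel) = (\<integral>\<^sup>+x. f x \<partial>distr lborel borel ((+) (- y)))" by (simp add: lborel_distr_plus)
  also have "\<dots> = (\<integral>\<^sup>+x. f (x - y) \<partial>lborel)" by (subst nn_integral_distr) auto
  finally show "(\<integral>\<^sup>+x. f (x - y) \<partial>lborel) = (\<integral>\<^sup>+x. f x \<partial>lborel)" by simp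
  have "(\<integral>\<^sup>+x. f x \<partial>lborel) = (\<integral>\<^sup>+x. f (y + x) \<partial>lborel)"
    by (subst lborel_distr_plus[of y, symmetric], subst nn_integral_distr) auto
  also have "\<dots> = (\<integral>\<^sup>+x. f (y - x) \<partial>lborel)"
    by (subst lborel_affine[of "-1" 0], simp, subst nn_integral_density, simp_all, subst nn_integral_distr) auto
  finally show "(\<integral>\<^sup>+x. f (y - x) \<partial>lborel) = (\<integral>\<^sup>+x. f x \<partial>lborel)" by simp
qed

text \<open>
  This replaces Hoelder's inequality: integrating it against a measure and choosing \<open>l\<close>
  as a multiple of the result bounds an average by the average of the power.
\<close>

lemma le_scaled_powr:
  fixes t l P :: real
  assumes "t \<ge> 0" "l > 0" "P \<ge> 1"
  shows "t \<le> l + l powr (1 - P) * t powr P"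
proof (cases "t \<le> l")
  case False
  then have t: "t > l" by simp
  have "t = t powr (1 - P) * t powr P" using t assms by (simp add: powr_add[symmetric])
  also have "\<dots> \<le> l powr (1 - P) * t powr P" using t assms by (intro mult_right_mono powr_mono2') auto
  finally show ?thesis using assms by linarith
qed (use assms in \<open>auto intro: add_increasing2\<close>)

text \<open>
  Convolution of nonnegative functions, as a Lebesgue integral in the extended reals.
\<close>

definition conv :: "('a::euclidean_space \<Rightarrow> real) \<Rightarrow> ('a \<Rightarrow> real) \<Rightarrow> 'a \<Rightarrow> ennreal"
  where "conv W f z = (\<integral>\<^sup>+y. ennreal (W (z - y)) * ennreal (f y) \<partial>lborel)"

lemma conv_measurable[measurable]:
  assumes [measurable]: "W \<in> borel_measurable borel" "f \<in> borel_measurable borel"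
  shows "conv W f \<in> borel_measurable borel"
  unfolding conv_def by measurable

lemma conv_le_bound:
  assumes [measurable]: "W \<in> borel_measurable borel"
    and M: "(\<integral>\<^sup>+y. ennreal (W y) \<partial>lborel) \<le> ennreal M" and f: "AE y in lborel. ennreal (f y) \<le> b"
  shows "conv W f z \<le> ennreal M * b"
proof -
  have "conv W f z \<le> (\<integral>\<^sup>+y. ennreal (W (z - y)) * b \<partial>lborel)"
    unfolding conv_def using f by (intro nn_integral_mono_AE) (auto elim!: eventually_mono intro: mult_left_mono)
  also have "\<dots> = (\<integral>\<^sup>+y. ennreal (W y) \<partial>lborel) * b"
    by (simp add: nn_integral_multc lborel_nn_integral_translate(2)[where f="\<lambda>y. ennreal (W y)"])
  also have "\<dots> \<le> ennreal M * b" by (intro mult_right_mono M) auto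
  finally show ?thesis .
qed

text \<open>
  Young's inequality, up to a constant: \<open>le_scaled_powr\<close> under the integral bounds the convolution by
  half of itself plus a multiple of the convolution of \<open>W\<close> with \<open>f powr P\<close>, to which Tonelli's theorem applies.
\<close>

lemma nn_integral_conv_powr_le:
  fixes W f :: "'a::euclidean_space \<Rightarrow> real"
  assumes [measurable]: "W \<in> borel_measurable borel" "f \<in> borel_measurable borel"
    and W: "\<And>y. W y \<ge> 0" and f: "\<And>y. f y \<ge> 0"
    and M: "(\<integral>\<^sup>+y. ennreal (W y) \<partial>lborel) \<le> ennreal M" "M > 0" and P: "P \<ge> 1"
    and fin: "\<And>z. conv W f z < \<infinity>"
  shows "(\<integral>\<^sup>+z. ennreal (enn2real (conv W f z) powr P) \<partial>lborel)
    \<le> ennreal (2 * (2 * M) powr (P - 1) * M) * (\<integral>\<^sup>+y. ennreal (f y powr P) \<partial>lborel)"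
proof -
  define Ph where "Ph z = (\<integral>\<^sup>+y. ennreal (W (z - y)) * ennreal (f y powr P) \<partial>lborel)" for z
  have pt: "ennreal (enn2real (conv W f z) powr P) \<le> ennreal (2 * (2 * M) powr (P - 1)) * Ph z" for z
  proof -
    define F where "F = enn2real (conv W f z)"
    have cF: "conv W f z = ennreal F" using fin[of z] unfolding F_def by (simp add: less_top)
    have F0: "F \<ge> 0" by (simp add: F_def)
    show ?thesis
    proof (cases "F = 0 \<or> Ph z = \<infinity>")
      case True
      then show ?thesis using M P by (auto simp: F_def[symmetric] ennreal_mult_top)
    next
      case False
      then have Fp: "F > 0" and "Ph z < \<infinity>" using F0 by (auto simp: less_top)
      then obtain ph where ph: "Ph z = ennreal ph" "ph \<ge> 0" by (cases "Ph z") auto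
      (* The first term of le_scaled_powr then contributes at most F / 2, which is absorbed. *)
      define l where "l = F / (2 * M)"
      have l: "l > 0" using Fp M by (simp add: l_def)
      have "conv W f z \<le> (\<integral>\<^sup>+y. ennreal l * ennreal (W (z - y)) + ennreal (l powr (1 - P)) * (ennreal (W (z - y)) * ennreal (f y powr P)) \<partial>lborel)"
        unfolding conv_def
      proof (rule nn_integral_mono)
        fix y
        have "W (z - y) * f y \<le> W (z - y) * (l + l powr (1 - P) * f y powr P)"
          by (intro mult_left_mono le_scaled_powr f l P W)
        then show "ennreal (W (z - y)) * ennreal (f y) \<le> ennreal l * ennreal (W (z - y)) + ennreal (l powr (1 - P)) * (ennreal (W (z - y)) * ennreal (f y powr P))"
          using l W f by (simp add: ennreal_mult[symmetric] ennreal_plus[symmetric] algebra_simps del: ennreal_plus)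
      qed
      also have "\<dots> = ennreal l * (\<integral>\<^sup>+y. ennreal (W (z - y)) \<partial>lborel) + ennreal (l powr (1 - P)) * Ph z"
        unfolding Ph_def by (subst nn_integral_add) (auto simp: nn_integral_cmult)
      also have "(\<integral>\<^sup>+y. ennreal (W (z - y)) \<partial>lborel) = (\<integral>\<^sup>+y. ennreal (W y) \<partial>lborel)"
        by (rule lborel_nn_integral_translate(2)[where f="\<lambda>y. ennreal (W y)"]) measurable
      also have "ennreal l * \<dots> + ennreal (l powr (1 - P)) * Ph z \<le> ennreal l * ennreal M + ennreal (l powr (1 - P)) * Ph z"
        by (intro add_mono mult_left_mono M) auto
      also have "\<dots> = ennreal (l * M + l powr (1 - P) * ph)"
        using l M ph by (simp add: ennreal_mult[symmetric] ennreal_plus[symmetric] del: ennreal_plus)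
      finally have "F \<le> l * M + l powr (1 - P) * ph"
        unfolding cF using l M ph by (subst (asm) ennreal_le_iff) auto
      moreover have "l * M = F / 2" using M by (simp add: l_def)
      ultimately have 1: "F \<le> 2 * (l powr (1 - P) * ph)" by linarith
      have "F powr P = F * F powr (P - 1)" using Fp by (simp add: powr_diff)
      also have "\<dots> \<le> (2 * (l powr (1 - P) * ph)) * F powr (P - 1)" by (intro mult_right_mono 1) auto
      also have "F powr (P - 1) = (2 * M) powr (P - 1) * l powr (P - 1)"
        using M Fp by (simp add: l_def powr_mult[symmetric])
      also have "(2 * (l powr (1 - P) * ph)) * \<dots> = 2 * (2 * M) powr (P - 1) * ph * (l powr (1 - P) * l powr (P - 1))"
        by (simp add: algebra_simps)
      also have "l powr (1 - P) * l powr (P - 1) = 1" using l by (simp add: powr_add[symmetric])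
      finally show ?thesis
        using ph by (simp add: F_def[symmetric] ennreal_mult[symmetric] ennreal_leI)
    qed
  qed
  have "(\<integral>\<^sup>+z. ennreal (enn2real (conv W f z) powr P) \<partial>lborel) \<le> (\<integral>\<^sup>+z. ennreal (2 * (2 * M) powr (P - 1)) * Ph z \<partial>lborel)"
    by (intro nn_integral_mono pt)
  also have "\<dots> = ennreal (2 * (2 * M) powr (P - 1)) * (\<integral>\<^sup>+z. Ph z \<partial>lborel)"
    unfolding Ph_def by (rule nn_integral_cmult) measurable
  also have "(\<integral>\<^sup>+z. Ph z \<partial>lborel) = (\<integral>\<^sup>+y. (\<integral>\<^sup>+z. ennreal (W (z - y)) * ennreal (f y powr P) \<partial>lborel) \<partial>lborel)"
    unfolding Ph_def by (rule lborel_pair.Fubini') measurable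
  also have "\<dots> = (\<integral>\<^sup>+y. (\<integral>\<^sup>+z. ennreal (W z) \<partial>lborel) * ennreal (f y powr P) \<partial>lborel)"
    by (simp add: nn_integral_multc lborel_nn_integral_translate(1)[where f="\<lambda>y. ennreal (W y)"])
  also have "\<dots> = (\<integral>\<^sup>+z. ennreal (W z) \<partial>lborel) * (\<integral>\<^sup>+y. ennreal (f y powr P) \<partial>lborel)"
    by (rule nn_integral_cmult) measurable
  also have "\<dots> \<le> ennreal M * (\<integral>\<^sup>+y. ennreal (f y powr P) \<partial>lborel)" by (intro mult_right_mono M) auto
  finally show ?thesis using M by (simp add: ennreal_mult mult.assoc mult_left_mono)
qed

section \<open>Decay of Fourier integrals by finite differences\<close>

definition fwd_diff :: "'a::ab_group_add \<Rightarrow> ('a \<Rightarrow> complex) \<Rightarrow> 'a \<Rightarrow> complex"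
  where "fwd_diff h f x = f (x + h) - f x"

lemma fwd_diff_Suc: "(fwd_diff h ^^ Suc N) f x = (fwd_diff h ^^ N) f (x + h) - (fwd_diff h ^^ N) f x"
  by (simp add: fwd_diff_def)

lemma fwd_diff_bound:
  fixes x h :: "'a::real_vector"
  assumes "\<And>k. k \<le> N \<Longrightarrow> norm (f (x + real k *\<^sub>R h)) \<le> B"
  shows "norm ((fwd_diff h ^^ N) f x) \<le> 2 ^ N * B"
  using assms
proof (induction N arbitrary: x)
  case 0 then show ?case using 0[of 0] by simp
next
  case (Suc N)
  have "norm (f (x + h + real k *\<^sub>R h)) \<le> B" if "k \<le> N" for k
    using Suc.prems[of "Suc k"] that by (simp add: algebra_simps)
  then have "norm ((fwd_diff h ^^ N) f (x + h)) \<le> 2 ^ N * B" by (rule Suc.IH)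
  moreover have "norm ((fwd_diff h ^^ N) f x) \<le> 2 ^ N * B" using Suc by simp
  ultimately show ?case
    using norm_triangle_ineq4[of "(fwd_diff h ^^ N) f (x + h)" "(fwd_diff h ^^ N) f x"]
    unfolding fwd_diff_Suc by simp
qed

lemma fwd_diff_minus_const: "N > 0 \<Longrightarrow> (fwd_diff h ^^ N) (\<lambda>y. f y - c) x = (fwd_diff h ^^ N) f x"
proof -
  have "fwd_diff h (\<lambda>y. f y - c) = fwd_diff h f" by (simp add: fwd_diff_def fun_eq_iff)
  then show "N > 0 \<Longrightarrow> ?thesis" by (cases N) (simp_all add: funpow_Suc_right del: funpow.simps)
qed

text \<open>
  A relation rather than a derivative operator, because the chains of derivatives below are
  given by explicit formulas away from the origin.
\<close>

definition dir_deriv :: "'n \<Rightarrow> (real^'n::finite \<Rightarrow> complex) \<Rightarrow> (real^'n \<Rightarrow> complex) \<Rightarrow> real^'n \<Rightarrow> bool"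
  where "dir_deriv j f f' \<eta> \<longleftrightarrow> ((\<lambda>t. f (\<eta> + t *\<^sub>R axis j 1)) has_vector_derivative f' \<eta>) (at 0)"

lemma dir_deriv_line:
  assumes "dir_deriv j f f' (\<xi> + t0 *\<^sub>R (s *\<^sub>R axis j 1))"
  shows "((\<lambda>t. f (\<xi> + t *\<^sub>R (s *\<^sub>R axis j 1))) has_vector_derivative s *\<^sub>R f' (\<xi> + t0 *\<^sub>R (s *\<^sub>R axis j 1))) (at t0)"
proof -
  define \<eta> where "\<eta> = \<xi> + t0 *\<^sub>R (s *\<^sub>R axis j 1)"
  have 1: "((\<lambda>t. (t - t0) * s) has_vector_derivative s) (at t0)"
    by (auto intro!: derivative_eq_intros)
  have 2: "((\<lambda>r. f (\<eta> + r *\<^sub>R axis j 1)) has_vector_derivative f' \<eta>) (at ((t0 - t0) * s))"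
    using assms by (simp add: dir_deriv_def \<eta>_def)
  have "(((\<lambda>r. f (\<eta> + r *\<^sub>R axis j 1)) \<circ> (\<lambda>t. (t - t0) * s)) has_vector_derivative s *\<^sub>R f' \<eta>) (at t0)"
    by (rule vector_diff_chain_at[OF 1 2])
  moreover have "(\<lambda>r. f (\<eta> + r *\<^sub>R axis j 1)) \<circ> (\<lambda>t. (t - t0) * s) = (\<lambda>t. f (\<xi> + t *\<^sub>R (s *\<^sub>R axis j 1)))"
    by (rule ext) (simp add: \<eta>_def algebra_simps)
  ultimately show ?thesis by (simp add: \<eta>_def)
qed

lemma fwd_diff_has_derivative:
  assumes "\<And>k. k \<le> N \<Longrightarrow> dir_deriv j f f' (\<xi> + (t0 + real k) *\<^sub>R (s *\<^sub>R axis j 1))"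
  shows "((\<lambda>t. (fwd_diff (s *\<^sub>R axis j 1) ^^ N) f (\<xi> + t *\<^sub>R (s *\<^sub>R axis j 1))) has_vector_derivative
     s *\<^sub>R (fwd_diff (s *\<^sub>R axis j 1) ^^ N) f' (\<xi> + t0 *\<^sub>R (s *\<^sub>R axis j 1))) (at t0)"
  using assms
proof (induction N arbitrary: \<xi>)
  case 0
  then show ?case using dir_deriv_line[of j f f' \<xi> t0 s] 0[of 0] by simp
next
  case (Suc N)
  let ?h = "s *\<^sub>R axis j 1"
  have "dir_deriv j f f' ((\<xi> + ?h) + (t0 + real k) *\<^sub>R ?h)" if "k \<le> N" for k
    using Suc.prems[of "Suc k"] that by (simp add: algebra_simps)
  from Suc.IH[OF this] have "((\<lambda>t. (fwd_diff ?h ^^ N) f ((\<xi> + ?h) + t *\<^sub>R ?h)) has_vector_derivative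
     s *\<^sub>R (fwd_diff ?h ^^ N) f' ((\<xi> + ?h) + t0 *\<^sub>R ?h)) (at t0)" by blast
  moreover have "((\<lambda>t. (fwd_diff ?h ^^ N) f (\<xi> + t *\<^sub>R ?h)) has_vector_derivative
     s *\<^sub>R (fwd_diff ?h ^^ N) f' (\<xi> + t0 *\<^sub>R ?h)) (at t0)" using Suc by simp
  ultimately have "((\<lambda>t. (fwd_diff ?h ^^ N) f ((\<xi> + ?h) + t *\<^sub>R ?h) - (fwd_diff ?h ^^ N) f (\<xi> + t *\<^sub>R ?h)) has_vector_derivative
     (s *\<^sub>R (fwd_diff ?h ^^ N) f' ((\<xi> + ?h) + t0 *\<^sub>R ?h) - s *\<^sub>R (fwd_diff ?h ^^ N) f' (\<xi> + t0 *\<^sub>R ?h))) (at t0)"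
    by (rule has_vector_derivative_diff)
  moreover have "(\<xi> + ?h) + t *\<^sub>R ?h = (\<xi> + t *\<^sub>R ?h) + ?h" for t by (simp add: algebra_simps)
  ultimately show ?case by (simp only: fwd_diff_Suc scaleR_diff_right)
qed

text \<open>
  The mean value theorem, once per order: differences commute with derivatives. The chain \<open>F\<close> of
  derivatives in the direction of the step is restricted to the segment that the difference samples, since the
  segment has to avoid the origin in the application.
\<close>

lemma fwd_diff_derivative_bound:
  assumes "\<And>k t. k < N \<Longrightarrow> t \<in> {0..real N} \<Longrightarrow> dir_deriv j (F k) (F (Suc k)) (\<xi> + t *\<^sub>R (s *\<^sub>R axis j 1))"
    and "\<And>t. t \<in> {0..real N} \<Longrightarrow> norm (F N (\<xi> + t *\<^sub>R (s *\<^sub>R axis j 1))) \<le> B"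
  shows "norm ((fwd_diff (s *\<^sub>R axis j 1) ^^ N) (F 0) \<xi>) \<le> \<bar>s\<bar> ^ N * B"
  using assms
proof (induction N arbitrary: F \<xi>)
  case 0
  then show ?case using 0(2)[of 0] by simp
next
  case (Suc N)
  let ?h = "s *\<^sub>R axis j 1"
  define \<phi> where "\<phi> t = (fwd_diff ?h ^^ N) (F 0) (\<xi> + t *\<^sub>R ?h)" for t :: real
  define \<phi>' where "\<phi>' t = s *\<^sub>R (fwd_diff ?h ^^ N) (F 1) (\<xi> + t *\<^sub>R ?h)" for t :: real
  have d: "(\<phi> has_vector_derivative \<phi>' t) (at t)" if "t \<in> {0..1}" for t
    unfolding \<phi>_def \<phi>'_def
    by (rule fwd_diff_has_derivative) (use Suc.prems(1)[of 0] that in auto)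
  have b: "norm (\<phi>' t) \<le> \<bar>s\<bar> ^ Suc N * B" if t: "t \<in> {0..1}" for t
  proof -
    have eq: "\<xi> + t *\<^sub>R ?h + r *\<^sub>R ?h = \<xi> + (t + r) *\<^sub>R ?h" for r by (simp add: algebra_simps)
    have "norm ((fwd_diff ?h ^^ N) (F (Suc 0)) (\<xi> + t *\<^sub>R ?h)) \<le> \<bar>s\<bar> ^ N * B"
      by (rule Suc.IH[of "\<lambda>k. F (Suc k)"]; subst eq) (use Suc.prems t in auto)
    then show ?thesis by (simp add: \<phi>'_def mult.assoc mult_left_mono)
  qed
  have "norm (\<phi> 1 - \<phi> 0) \<le> (\<bar>s\<bar> ^ Suc N * B) * norm (1 - 0 :: real)"
  proof (rule differentiable_bound[of "{0..1}" \<phi> "\<lambda>t r. r *\<^sub>R \<phi>' t"])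
    fix t :: real assume t: "t \<in> {0..1}"
    show "(\<phi> has_derivative (\<lambda>r. r *\<^sub>R \<phi>' t)) (at t within {0..1})"
      using d[OF t] by (auto simp: has_vector_derivative_def intro: has_derivative_at_withinI)
    show "onorm (\<lambda>r. r *\<^sub>R \<phi>' t) \<le> \<bar>s\<bar> ^ Suc N * B"
      by (rule onorm_le) (use b[OF t] in \<open>simp add: mult.commute mult_left_mono\<close>)
  qed auto
  then show ?case unfolding fwd_diff_Suc by (simp add: \<phi>_def)
qed

text \<open>
  The inverse Fourier transform without its normalising factor.
\<close>

definition ft :: "'a::euclidean_space \<Rightarrow> ('a \<Rightarrow> complex) \<Rightarrow> complex"
  where "ft z f = (LINT \<xi>|lborel. exp (\<i> * complex_of_real (z \<bullet> \<xi>)) * f \<xi>)"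

lemma lborel_integrable_translate:
  fixes f :: "'a::euclidean_space \<Rightarrow> 'b::{banach,second_countable_topology}"
  assumes "integrable lborel f"
  shows "integrable lborel (\<lambda>x. f (x + h))" "(LINT x|lborel. f (x + h)) = (LINT x|lborel. f x)"
proof -
  have [measurable]: "f \<in> borel_measurable borel" using assms by auto
  have "integrable (distr lborel borel ((+) h)) f" using assms by (simp add: lborel_distr_plus)
  then show "integrable lborel (\<lambda>x. f (x + h))" by (subst (asm) integrable_distr_eq) (auto simp: add.commute)
  have "(LINT x|distr lborel borel ((+) h). f x) = (LINT x|lborel. f (h + x))"
    by (rule integral_distr) auto
  then show "(LINT x|lborel. f (x + h)) = (LINT x|lborel. f x)" by (simp add: lborel_distr_plus add.commute)
qed

lemma integrable_exp_mult:
  assumes "integrable lborel f"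
  shows "integrable lborel (\<lambda>\<xi>::'a::euclidean_space. exp (\<i> * complex_of_real (z \<bullet> \<xi>)) * f \<xi>)"
proof -
  have [measurable]: "f \<in> borel_measurable borel" using assms by auto
  show ?thesis
    by (rule Bochner_Integration.integrable_bound[OF assms]) (auto simp: norm_mult)
qed

text \<open>
  The exponential changes its sign under the translation by \<open>h\<close>, so that a difference of the symbol
  doubles the integral instead of cancelling it.
\<close>

lemma ft_fwd_diff:
  assumes f: "integrable lborel f" and zh: "z \<bullet> h = pi"
  shows "integrable lborel (fwd_diff h f)" "ft z (fwd_diff h f) = -2 * ft z f"
proof -
  show "integrable lborel (fwd_diff h f)"
    unfolding fwd_diff_def using lborel_integrable_translate(1)[OF f] f by auto
  let ?E = "\<lambda>\<xi>. exp (\<i> * complex_of_real (z \<bullet> \<xi>))"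
  have i1: "integrable lborel (\<lambda>\<xi>. ?E \<xi> * f (\<xi> + h))"
    by (rule integrable_exp_mult[OF lborel_integrable_translate(1)[OF f]])
  have e: "?E \<xi> = - ?E (\<xi> + h)" for \<xi>
    by (simp add: inner_add_right zh exp_add algebra_simps)
  have "(LINT \<xi>|lborel. ?E \<xi> * f (\<xi> + h)) = (LINT \<xi>|lborel. - (?E (\<xi> + h) * f (\<xi> + h)))"
    by (subst e) simp
  also have "\<dots> = - (LINT \<xi>|lborel. ?E (\<xi> + h) * f (\<xi> + h))" by simp
  also have "\<dots> = - ft z f"
    using lborel_integrable_translate(2)[OF integrable_exp_mult[OF f, of z], of h] by (simp add: ft_def)
  finally have 1: "(LINT \<xi>|lborel. ?E \<xi> * f (\<xi> + h)) = - ft z f" .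
  show "ft z (fwd_diff h f) = -2 * ft z f"
    unfolding ft_def fwd_diff_def right_diff_distrib
    by (subst Bochner_Integration.integral_diff[OF i1 integrable_exp_mult[OF f]]) (simp add: 1 flip: ft_def)
qed

lemma ft_fwd_diff_iter:
  assumes f: "integrable lborel f" and zh: "z \<bullet> h = pi"
  shows "integrable lborel ((fwd_diff h ^^ N) f) \<and> ft z ((fwd_diff h ^^ N) f) = (-2) ^ N * ft z f"
proof (induction N)
  case (Suc N)
  then show ?case using ft_fwd_diff[OF _ zh, of "(fwd_diff h ^^ N) f"] by simp
qed (use f in simp)

lemma norm_ft_le: "norm (ft z f) \<le> (LINT \<xi>|lborel. norm (f \<xi>))"
proof -
  have "norm (ft z f) \<le> (LINT \<xi>|lborel. norm (exp (\<i> * complex_of_real (z \<bullet> \<xi>)) * f \<xi>))"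
    unfolding ft_def by (rule integral_norm_bound)
  then show ?thesis by (simp add: norm_mult)
qed

text \<open>
  Near the origin, within the reach of the difference, the Lipschitz bound at the origin is used, and
  elsewhere the derivative of order \<open>n + 1\<close>. The second regime would give \<open>\<bar>s\<bar>^(n+1) \<bar>\<xi>\<bar>^(-n)\<close>, which just
  fails to be integrable at the origin; half a power of \<open>\<bar>s\<bar> \<le> \<bar>\<xi>\<bar>\<close> is traded for integrability. The same
  majorant also covers the first regime.
\<close>

lemma fwd_diff_singular_bound:
  fixes \<sigma> :: "real^'n::finite \<Rightarrow> complex"
  assumes A: "A \<ge> 0"
    and lip: "\<And>\<xi>. norm (\<sigma> \<xi> - \<sigma>0) \<le> A * norm \<xi>"
    and F0: "F 0 = \<sigma>"
    and der: "\<And>k \<xi>. k \<le> CARD('n) \<Longrightarrow> \<xi> \<noteq> 0 \<Longrightarrow> dir_deriv j (F k) (F (Suc k)) \<xi>"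
    and bd: "\<And>\<xi>. \<xi> \<noteq> 0 \<Longrightarrow> norm (F (Suc CARD('n)) \<xi>) \<le> A * (norm \<xi> powr (- real CARD('n)) / (1 + norm \<xi>))"
    and s: "\<bar>s\<bar> \<le> pi" "s \<noteq> 0"
    and N: "N = Suc CARD('n)"
    and xi: "\<xi> \<noteq> 0"
  shows "norm ((fwd_diff (s *\<^sub>R axis j 1) ^^ N) \<sigma> \<xi>)
     \<le> (2 ^ N * (3 * real N) * (2 * real N) powr (CARD('n) - 1/2) * (1 + 2 * real N * pi)) * A * \<bar>s\<bar> powr (CARD('n) + 1/2)
        * (norm \<xi> powr (1/2 - CARD('n)) / (1 + norm \<xi>))"
    (is "?L \<le> ?C * A * _ * ?G")
proof -
  define \<delta> where "\<delta> = \<bar>s\<bar>"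
  have d: "\<delta> > 0" "\<delta> \<le> pi" using s by (auto simp: \<delta>_def)
  define n where "n = real CARD('n)"
  have n1: "n \<ge> 1" unfolding n_def by (simp add: Suc_leI)
  have Nn: "real N = n + 1" using N by (simp add: n_def)
  have N1: "real N \<ge> 1" using Nn n1 by simp
  let ?h = "s *\<^sub>R axis j 1 :: real^'n"
  have nh: "norm ?h = \<delta>" by (simp add: \<delta>_def)
  have x0: "norm \<xi> > 0" using xi by simp
  have G0: "?G \<ge> 0" by simp
  show ?thesis
  proof (cases "norm \<xi> \<le> 2 * N * \<delta>")
    case True
    have "norm ((fwd_diff ?h ^^ N) (\<lambda>\<xi>. \<sigma> \<xi> - \<sigma>0) \<xi>) \<le> 2 ^ N * (A * (3 * N * \<delta>))"
    proof (rule fwd_diff_bound)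
      fix k assume k: "k \<le> N"
      have "norm (\<xi> + real k *\<^sub>R ?h) \<le> norm \<xi> + real k * \<delta>"
        using norm_triangle_ineq[of \<xi> "real k *\<^sub>R ?h"] by (simp add: \<delta>_def abs_mult)
      also have "\<dots> \<le> 2 * N * \<delta> + N * \<delta>" using True k d by (intro add_mono mult_right_mono) auto
      finally have "norm (\<xi> + real k *\<^sub>R ?h) \<le> 3 * N * \<delta>" by (simp add: mult_ac)
      then show "norm (\<sigma> (\<xi> + real k *\<^sub>R ?h) - \<sigma>0) \<le> A * (3 * N * \<delta>)"
        using lip[of "\<xi> + real k *\<^sub>R ?h"] A by (meson mult_left_mono order_trans)
    qed
    then have 1: "?L \<le> 2 ^ N * (A * (3 * N * \<delta>))" using N by (subst (asm) fwd_diff_minus_const) auto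
    have "(2 * N * \<delta>) powr (1/2 - n) \<le> norm \<xi> powr (1/2 - n)"
      using True x0 n1 by (intro powr_mono2') auto
    moreover have "1 + norm \<xi> \<le> 1 + 2 * N * pi"
    proof -
      have "2 * N * \<delta> \<le> 2 * N * pi" using d by (intro mult_left_mono) auto
      then show ?thesis using True by linarith
    qed
    ultimately have "(2 * N * \<delta>) powr (1/2 - n) / (1 + 2 * N * pi) \<le> norm \<xi> powr (1/2 - n) / (1 + norm \<xi>)"
      using x0 by (intro frac_le) (auto intro: add_pos_nonneg)
    then have g: "(2 * N * \<delta>) powr (1/2 - n) / (1 + 2 * N * pi) \<le> ?G" by (simp add: n_def)
    have "\<delta> = (2 * N) powr (n - 1/2) * (1 + 2 * N * pi) * (\<delta> powr (n + 1/2) * ((2 * N * \<delta>) powr (1/2 - n) / (1 + 2 * N * pi)))"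
    proof -
      have "(2 * N) powr (n - 1/2) * (2 * N) powr (1/2 - n) = 1" using N1 by (simp add: powr_add[symmetric])
      moreover have "\<delta> powr (n + 1/2) * \<delta> powr (1/2 - n) = \<delta>" using d by (simp add: powr_add[symmetric])
      moreover have "1 + 2 * N * pi > 0" using N1 by (simp add: add_pos_nonneg)
      moreover have "(2 * N * \<delta>) powr (1/2 - n) = (2 * N) powr (1/2 - n) * \<delta> powr (1/2 - n)"
        using N1 d by (simp add: powr_mult)
      moreover have "a * c * (p * (b * q / c)) = (a * b) * (p * q)" if "c > 0" for a b c p q :: real
        using that by (simp add: field_simps)
      ultimately show ?thesis by (simp only: mult_1)
    qed
    also have "\<dots> \<le> (2 * N) powr (n - 1/2) * (1 + 2 * N * pi) * (\<delta> powr (n + 1/2) * ?G)"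
      using N1 by (intro mult_left_mono g) auto
    finally have 2: "\<delta> \<le> (2 * N) powr (n - 1/2) * (1 + 2 * N * pi) * (\<delta> powr (n + 1/2) * ?G)" .
    have "?L \<le> (2 ^ N * (3 * N) * A) * \<delta>" using 1 by (simp add: algebra_simps)
    also have "\<dots> \<le> (2 ^ N * (3 * N) * A) * ((2 * N) powr (n - 1/2) * (1 + 2 * N * pi) * (\<delta> powr (n + 1/2) * ?G))"
      using A by (intro mult_left_mono 2) auto
    finally show ?thesis by (simp add: n_def \<delta>_def mult_ac)
  next
    case False
    have far: "norm (\<xi> + t *\<^sub>R ?h) \<ge> norm \<xi> / 2" if t: "t \<in> {0..real N}" for t
    proof -
      have "norm \<xi> - norm (t *\<^sub>R ?h) \<le> norm (\<xi> + t *\<^sub>R ?h)"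
        by (metis norm_diff_ineq)
      moreover have "norm (t *\<^sub>R ?h) = t * \<delta>" using t by (simp add: \<delta>_def abs_mult)
      moreover have "t * \<delta> \<le> N * \<delta>" using t d by (intro mult_right_mono) auto
      ultimately show ?thesis using False by linarith
    qed
    have "norm ((fwd_diff ?h ^^ N) (F 0) \<xi>) \<le> \<bar>s\<bar> ^ N * (A * (2 powr n * 2 * (norm \<xi> powr (- n) / (1 + norm \<xi>))))"
    proof (rule fwd_diff_derivative_bound)
      fix k t assume k: "k < N" and t: "t \<in> {0..real N}"
      have "\<xi> + t *\<^sub>R ?h \<noteq> 0" using far[OF t] x0 by auto
      then show "dir_deriv j (F k) (F (Suc k)) (\<xi> + t *\<^sub>R ?h)" using der k N by auto
    next
      fix t assume t: "t \<in> {0..real N}"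
      let ?e = "\<xi> + t *\<^sub>R ?h"
      have ne: "?e \<noteq> 0" using far[OF t] x0 by auto
      have "norm ?e powr (- n) \<le> (norm \<xi> / 2) powr (- n)"
        using far[OF t] x0 n1 by (intro powr_mono2') auto
      moreover have "1 + norm ?e \<ge> (1 + norm \<xi>) / 2" unfolding add_divide_distrib using far[OF t] by linarith
      ultimately have "norm ?e powr (- n) / (1 + norm ?e) \<le> (norm \<xi> / 2) powr (- n) / ((1 + norm \<xi>) / 2)"
        using x0 by (intro frac_le) (auto intro: add_pos_nonneg)
      also have "(norm \<xi> / 2) powr (- n) = 2 powr n * norm \<xi> powr (- n)"
        using x0 by (simp add: powr_divide powr_minus field_simps)
      finally have "norm ?e powr (- n) / (1 + norm ?e) \<le> 2 powr n * 2 * (norm \<xi> powr (- n) / (1 + norm \<xi>))"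
        by (simp add: field_simps)
      then show "norm (F N ?e) \<le> A * (2 powr n * 2 * (norm \<xi> powr (- n) / (1 + norm \<xi>)))"
        using bd[OF ne] A unfolding N n_def by (meson mult_left_mono order_trans)
    qed
    then have "?L \<le> \<delta> ^ N * (A * (2 powr n * 2 * (norm \<xi> powr (- n) / (1 + norm \<xi>))))"
      by (simp add: F0 \<delta>_def)
    also have "\<delta> ^ N = \<delta> powr (n + 1/2) * \<delta> powr (1/2)"
    proof -
      have "n + 1/2 + 1/2 = real N" using Nn by simp
      then have "\<delta> powr (n + 1/2) * \<delta> powr (1/2) = \<delta> powr real N" by (simp only: powr_add[symmetric])
      then show ?thesis using d by (simp add: powr_realpow)
    qed
    also have "\<delta> powr (n + 1/2) * \<delta> powr (1/2) * (A * (2 powr n * 2 * (norm \<xi> powr (- n) / (1 + norm \<xi>))))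
       \<le> \<delta> powr (n + 1/2) * norm \<xi> powr (1/2) * (A * (2 powr n * 2 * (norm \<xi> powr (- n) / (1 + norm \<xi>))))"
    proof (intro mult_right_mono mult_left_mono powr_mono2)
      have "1 * \<delta> \<le> 2 * N * \<delta>" using N1 d by (intro mult_right_mono) auto
      then show "\<delta> \<le> norm \<xi>" using False by linarith
    qed (use A d in auto)
    also have "\<dots> = (2 powr n * 2) * (A * \<delta> powr (n + 1/2) * (norm \<xi> powr (1/2 - n) / (1 + norm \<xi>)))"
    proof -
      have p: "norm \<xi> powr (1/2) * norm \<xi> powr (- n) = norm \<xi> powr (1/2 - n)" by (simp add: powr_add[symmetric])
      show ?thesis unfolding p[symmetric] by (simp add: mult_ac)
    qed
    also have "\<dots> \<le> ?C * (A * \<delta> powr (n + 1/2) * (norm \<xi> powr (1/2 - n) / (1 + norm \<xi>)))"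
    proof (rule mult_right_mono)
      have "2 powr n * 2 = 2 ^ N" using N by (simp add: n_def powr_realpow)
      moreover have "(2::real) ^ N * 1 * 1 * 1 \<le> ?C"
      proof (intro mult_mono)
        show "1 \<le> (2 * real N) powr (real CARD('n) - 1/2)" 
          unfolding n_def[symmetric] using N1 n1 by (intro ge_one_powr_ge_zero) linarith+
      qed (use N1 in auto)
      ultimately show "2 powr n * 2 \<le> ?C" by simp
    qed (use A x0 in auto)
    finally show ?thesis by (simp add: n_def \<delta>_def mult_ac)
  qed
qed

text \<open>
  The constant depends on the dimension only. This uniformity is what allows a parameter \<open>x\<close> in
  the symbol about which nothing but bounds is known.
\<close>

lemma kernel_decay:
  "\<exists>C>0. \<forall>(\<sigma> :: real^'n::finite \<Rightarrow> complex) \<sigma>0 A F z.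
     A \<ge> 0 \<longrightarrow> integrable lborel \<sigma> \<longrightarrow> (LINT \<xi>|lborel. norm (\<sigma> \<xi>)) \<le> A \<longrightarrow>
     (\<forall>\<xi>. norm (\<sigma> \<xi> - \<sigma>0) \<le> A * norm \<xi>) \<longrightarrow>
     (\<forall>j. F j 0 = \<sigma>) \<longrightarrow>
     (\<forall>j k \<xi>. k \<le> CARD('n) \<longrightarrow> \<xi> \<noteq> 0 \<longrightarrow> dir_deriv j (F j k) (F j (Suc k)) \<xi>) \<longrightarrow>
     (\<forall>j \<xi>. \<xi> \<noteq> 0 \<longrightarrow> norm (F j (Suc CARD('n)) \<xi>) \<le> A * (norm \<xi> powr (- real CARD('n)) / (1 + norm \<xi>))) \<longrightarrow>
     norm (ft z \<sigma>) \<le> C * A * weight z"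
proof -
  define N where "N = Suc CARD('n)"
  define C1 where "C1 = 2 ^ N * (3 * real N) * (2 * real N) powr (CARD('n) - 1/2) * (1 + 2 * real N * pi)"
  have C1: "C1 \<ge> 0" by (simp add: C1_def)
  define G where "G \<xi> = norm \<xi> powr (1/2 - CARD('n)) / (1 + norm \<xi>)" for \<xi> :: "real^'n"
  have [measurable]: "G \<in> borel_measurable borel" unfolding G_def by measurable
  have G0: "G \<xi> \<ge> 0" for \<xi> by (simp add: G_def)
  have Gi: "integrable lborel G"
    by (rule integrableI_nonneg) (use nn_integral_radial_power_finite[where 'n='n] G0 in \<open>auto simp: G_def\<close>)
  define I where "I = (LINT \<xi>|lborel. G \<xi>)"
  have I0: "I \<ge> 0" unfolding I_def by (rule integral_nonneg_AE) (simp add: G0)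
  (* The summand 1 covers the points z all of whose coordinates are below 1. *)
  define C where "C = (C1 * pi powr (CARD('n) + 1/2) * I + 1) * 2 powr (CARD('n) + 1/2)"
  have "C > 0" unfolding C_def using C1 I0 by (intro mult_pos_pos add_nonneg_pos) auto
  moreover have "norm (ft z \<sigma>) \<le> C * A * weight z"
    if A: "A \<ge> 0" and i: "integrable lborel \<sigma>" and iA: "(LINT \<xi>|lborel. norm (\<sigma> \<xi>)) \<le> A"
     and lip: "\<forall>\<xi>. norm (\<sigma> \<xi> - \<sigma>0) \<le> A * norm \<xi>"
     and F0: "\<forall>j. F j 0 = \<sigma>"
     and der: "\<forall>j k \<xi>. k \<le> CARD('n) \<longrightarrow> \<xi> \<noteq> 0 \<longrightarrow> dir_deriv j (F j k) (F j (Suc k)) \<xi>"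
     and bd: "\<forall>j \<xi>. \<xi> \<noteq> 0 \<longrightarrow> norm (F j (Suc CARD('n)) \<xi>) \<le> A * (norm \<xi> powr (- real CARD('n)) / (1 + norm \<xi>))"
   for \<sigma> :: "real^'n \<Rightarrow> complex" and \<sigma>0 A F z
  proof -
    have "\<exists>j. \<forall>i. \<bar>z $ i\<bar> \<le> \<bar>z $ j\<bar>"
    proof -
      have "finite (range (\<lambda>i. \<bar>z $ i\<bar>))" "range (\<lambda>i. \<bar>z $ i\<bar>) \<noteq> {}" by auto
      then have "Max (range (\<lambda>i. \<bar>z $ i\<bar>)) \<in> range (\<lambda>i. \<bar>z $ i\<bar>)" by (rule Max_in)
      then obtain j where "Max (range (\<lambda>i. \<bar>z $ i\<bar>)) = \<bar>z $ j\<bar>" by (rule rangeE)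
      then have "\<bar>z $ i\<bar> \<le> \<bar>z $ j\<bar>" for i by (metis Max_ge finite finite_imageI rangeI)
      then show ?thesis by blast
    qed
    then obtain j where j: "\<And>i. \<bar>z $ i\<bar> \<le> \<bar>z $ j\<bar>" by blast
    show ?thesis
    proof (cases "\<bar>z $ j\<bar> \<ge> 1")
      case False
      have "1 \<le> 2 powr (CARD('n) + 1/2) * weight z"
        using weight_lower_of_max[of z 1] j False by (metis le_cases order_trans powr_one_eq_one)
      then have w: "A * 1 \<le> A * (2 powr (CARD('n) + 1/2) * weight z)" by (intro mult_left_mono A)
      have "norm (ft z \<sigma>) \<le> A" using norm_ft_le[of z \<sigma>] iA by linarith
      also have "A \<le> 1 * 2 powr (CARD('n) + 1/2) * (A * weight z)" using w by (simp add: mult_ac)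
      also have "\<dots> \<le> C * (A * weight z)"
        unfolding C_def using C1 I0 A weight_nonneg[of z] by (intro mult_right_mono) auto
      finally show ?thesis by (simp add: mult_ac)
    next
      case True
      define r where "r = \<bar>z $ j\<bar>"
      (* The signed step length: the sign of z $ j is included, so that z \<bullet> ?h = pi. *)
      define s where "s = pi / z $ j"
      have s: "\<bar>s\<bar> = pi / r" by (simp add: s_def r_def abs_divide)
      have r: "r \<ge> 1" using True by (simp add: r_def)
      have spi: "\<bar>s\<bar> \<le> pi" "s \<noteq> 0" using r True by (auto simp: s s_def divide_le_eq pi_gt_zero)
      let ?h = "s *\<^sub>R axis j 1 :: real^'n"
      have zh: "z \<bullet> ?h = pi" using True by (auto simp: s_def inner_axis)
      let ?D = "(fwd_diff ?h ^^ N) \<sigma>"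
      have D: "integrable lborel ?D" "ft z ?D = (-2) ^ N * ft z \<sigma>"
        using ft_fwd_diff_iter[OF i zh, of N] by auto
      have pt: "norm (?D \<xi>) \<le> C1 * A * \<bar>s\<bar> powr (CARD('n) + 1/2) * G \<xi>" if "\<xi> \<noteq> 0" for \<xi>
        unfolding C1_def G_def
      proof (rule fwd_diff_singular_bound[OF A _ _ _ _ spi N_def that])
        show "norm (\<sigma> \<xi> - \<sigma>0) \<le> A * norm \<xi>" for \<xi> using lip by blast
        show "F j 0 = \<sigma>" using F0 by blast
        show "dir_deriv j (F j k) (F j (Suc k)) \<xi>" if "k \<le> CARD('n)" "\<xi> \<noteq> 0" for k \<xi>
          using der that by blast
        show "norm (F j (Suc CARD('n)) \<xi>) \<le> A * (norm \<xi> powr (- real CARD('n)) / (1 + norm \<xi>))" if "\<xi> \<noteq> 0" for \<xi>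
          using bd that by blast
      qed
      have "norm (ft z \<sigma>) \<le> 2 ^ N * norm (ft z \<sigma>)"
        using mult_right_mono[of 1 "2 ^ N" "norm (ft z \<sigma>)"] by simp
      also have "\<dots> = norm (ft z ?D)" by (simp add: D(2) norm_mult norm_power)
      also have "\<dots> \<le> (LINT \<xi>|lborel. norm (?D \<xi>))" by (rule norm_ft_le)
      also have "\<dots> \<le> (LINT \<xi>|lborel. C1 * A * \<bar>s\<bar> powr (CARD('n) + 1/2) * G \<xi>)"
        by (rule integral_mono_AE) (use D Gi AE_lborel_singleton[of 0] pt in \<open>auto elim!: eventually_mono\<close>)
      also have "\<dots> = C1 * A * \<bar>s\<bar> powr (CARD('n) + 1/2) * I" by (simp add: I_def)
      also have "\<bar>s\<bar> powr (CARD('n) + 1/2) = pi powr (CARD('n) + 1/2) * r powr (- CARD('n) - 1/2)"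
      proof -
        have "\<bar>s\<bar> powr (CARD('n) + 1/2) = pi powr (CARD('n) + 1/2) / r powr (CARD('n) + 1/2)"
          using r by (simp only: s powr_divide)
        also have "\<dots> = pi powr (CARD('n) + 1/2) * r powr (- (CARD('n) + 1/2))"
          by (simp only: powr_minus divide_inverse)
        finally show ?thesis by simp
      qed
      also have "C1 * A * (pi powr (CARD('n) + 1/2) * r powr (- CARD('n) - 1/2)) * I
         \<le> C1 * A * (pi powr (CARD('n) + 1/2) * (2 powr (CARD('n) + 1/2) * weight z)) * I"
        using weight_lower_of_max[of z r] j r A C1 I0 unfolding r_def
        by (intro mult_right_mono mult_left_mono) auto
      also have "\<dots> = (C1 * pi powr (CARD('n) + 1/2) * I) * 2 powr (CARD('n) + 1/2) * (A * weight z)"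
        by (simp add: mult_ac)
      also have "\<dots> \<le> C * (A * weight z)"
        unfolding C_def using A weight_nonneg[of z] by (intro mult_right_mono) auto
      finally show ?thesis by (simp add: mult_ac)
    qed
  qed
  ultimately show ?thesis by blast
qed

section \<open>The Cauchy integral at height one\<close>

text \<open>
  With \<open>w = r * exp (\<i> t)\<close> it says \<open>1 \<le> A * cos t powr p - B * cos (p * t)\<close>. Near \<open>\<bar>t\<bar> = \<pi>/2\<close> the
  cosine of \<open>p * t\<close> is negative because \<open>\<pi>/2 < p * \<pi>/2 \<le> \<pi>\<close>, so a large \<open>B\<close> suffices; on the remaining
  angles \<open>cos t\<close> is bounded below, and a large \<open>A\<close> suffices.
\<close>

lemma powr_half_plane_inequality:
  fixes p :: real
  assumes p: "1 < p" "p \<le> 2"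
  shows "\<exists>A B. 0 \<le> A \<and> 0 \<le> B \<and> (\<forall>w::complex. Re w > 0 \<longrightarrow>
    norm w powr p \<le> A * Re w powr p - B * Re (w powr of_real p))"
proof -
  (* An angle below pi / 2 for which p * t0 is still above pi / 2. *)
  define t0 where "t0 = (pi / (2 * p) + pi / 2) / 2"
  have "pi / (2 * p) < pi / 2" using p by (simp add: field_simps)
  then have t0: "pi / (2 * p) < t0" "t0 < pi / 2" "0 < t0" using p by (auto simp: t0_def add_pos_pos)
  have pt0: "pi / 2 < p * t0" using t0(1) p by (simp add: field_simps)
  have ppi: "p * (pi / 2) \<le> pi" using p by (simp add: field_simps)
  define d where "d = - cos (p * t0)"
  have "p * t0 < p * (pi/2)" using t0 p by simp
  then have "p * t0 < pi" using ppi by linarith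
  then have "cos (p * t0) < cos (pi / 2)" using pt0 by (intro cos_monotone_0_pi) auto
  then have d: "d > 0" by (simp add: d_def)
  have c0: "cos t0 > 0" using t0 by (intro cos_gt_zero) auto
  (* B settles the angles beyond t0, and then A those below, where the second term is at most B. *)
  define B where "B = 1 / d"
  define A where "A = (1 + B) / cos t0 powr p"
  have B0: "B \<ge> 0" using d by (simp add: B_def)
  have A0: "A \<ge> 0" using B0 by (simp add: A_def)
  have ang: "1 \<le> A * cos t powr p - B * cos (p * t)" if t: "\<bar>t\<bar> < pi / 2" for t
  proof (cases "\<bar>t\<bar> \<le> t0")
    case True
    have "cos t0 \<le> cos \<bar>t\<bar>" using True t0 by (intro cos_monotone_0_pi_le) auto
    then have "cos t0 powr p \<le> cos t powr p" using c0 p by (intro powr_mono2) auto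
    then have "A * cos t0 powr p \<le> A * cos t powr p" using A0 by (rule mult_left_mono)
    moreover have "A * cos t0 powr p = 1 + B" using c0 by (simp add: A_def)
    moreover have "B * cos (p * t) \<le> B * 1" using B0 by (intro mult_left_mono) auto
    ultimately show ?thesis by linarith
  next
    case False
    have "p * t0 \<le> p * \<bar>t\<bar>" "p * \<bar>t\<bar> \<le> p * (pi / 2)" using False t p by (auto intro!: mult_left_mono)
    then have "cos (p * \<bar>t\<bar>) \<le> cos (p * t0)" using ppi p t0 by (intro cos_monotone_0_pi_le) (linarith | simp)+
    moreover have "cos (p * \<bar>t\<bar>) = cos (p * t)" by (cases "t \<ge> 0") auto
    ultimately have "cos (p * t) \<le> - d" by (simp add: d_def)
    then have "B * cos (p * t) \<le> B * (- d)" using B0 by (rule mult_left_mono)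
    moreover have "B * (- d) = -1" using d by (simp add: B_def)
    moreover have "A * cos t powr p \<ge> 0" using A0 by simp
    ultimately show ?thesis by linarith
  qed
  have "norm w powr p \<le> A * Re w powr p - B * Re (w powr of_real p)" if w: "Re w > 0" for w :: complex
  proof -
    have w0: "w \<noteq> 0" using w by auto
    define r where "r = norm w"
    have r: "r > 0" using w0 by (simp add: r_def)
    have t: "\<bar>Arg w\<bar> < pi / 2" using w Arg_Re_pos[of w] by blast
    have re: "Re w = r * cos (Arg w)"
      using w0 by (simp add: r_def cos_Arg)
    have c: "cos (Arg w) > 0" using w r re by (simp add: zero_less_mult_iff)
    have rp: "Re (w powr of_real p) = r powr p * cos (p * Arg w)"
    proof -
      have "Ln w = complex_of_real (ln r) + \<i> * of_real (Arg w)"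
        using w0 by (simp add: complex_eq_iff r_def Arg_eq_Im_Ln)
      then have "w powr of_real p = exp (of_real p * (complex_of_real (ln r) + \<i> * of_real (Arg w)))"
        using w0 by (simp add: powr_def)
      then have "Re (w powr of_real p) = exp (p * ln r) * cos (p * Arg w)" by (simp only: Re_exp) simp
      then show ?thesis using r by (simp add: powr_def)
    qed
    have "r powr p * 1 \<le> r powr p * (A * cos (Arg w) powr p - B * cos (p * Arg w))"
      by (rule mult_left_mono[OF ang[OF t]]) simp
    also have "\<dots> = A * Re w powr p - B * Re (w powr of_real p)"
      using r c by (simp add: re rp powr_mult algebra_simps)
    finally show ?thesis by (simp add: r_def)
  qed
  then show ?thesis using A0 B0 by blast
qed

text \<open>
  The Cauchy integral of \<open>f\<close> over \<open>{-N..N}\<close>, as a function of \<open>z + \<i>\<close>: for real \<open>z\<close> it is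
  evaluated at height one, and it extends to the half-plane above height zero. It is normalised so that its
  real part is a Poisson integral.
\<close>

definition cauchy_ext :: "real \<Rightarrow> (real \<Rightarrow> real) \<Rightarrow> complex \<Rightarrow> complex"
  where "cauchy_ext N f z = integral {-N..N} (\<lambda>t. complex_of_real (f t) / (1 - \<i> * (z - of_real t)))"

lemma cauchy_den:
  assumes "Im z > -1"
  shows "1 - \<i> * (z - complex_of_real t) \<noteq> 0" "Re (1 - \<i> * (z - complex_of_real t)) = 1 + Im z"
proof -
  show re: "Re (1 - \<i> * (z - complex_of_real t)) = 1 + Im z" by simp
  show "1 - \<i> * (z - complex_of_real t) \<noteq> 0"
    using assms by (auto simp: complex_eq_iff)
qed

lemma cauchy_den_lower:
  assumes "\<bar>t\<bar> \<le> N" "norm z \<ge> 2 * N + 2"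
  shows "norm (1 - \<i> * (z - complex_of_real t)) \<ge> norm z / 2"
proof -
  have "1 - \<i> * (z - complex_of_real t) = - \<i> * z + (1 + \<i> * of_real t)" by (simp add: algebra_simps)
  then have "norm (1 - \<i> * (z - complex_of_real t)) \<ge> norm (- \<i> * z) - norm (1 + \<i> * complex_of_real t)"
    by (metis norm_diff_ineq)
  moreover have "norm (1 + \<i> * complex_of_real t) \<le> 1 + N"
    using norm_triangle_ineq[of 1 "\<i> * complex_of_real t"] assms by (simp add: norm_mult)
  ultimately show ?thesis using assms(2) by (simp add: norm_mult)
qed

lemma cauchy_integrand_continuous:
  assumes "continuous_on {-N..N} f" "Im z > -1"
  shows "continuous_on {-N..N} (\<lambda>t. complex_of_real (f t) / (1 - \<i> * (z - of_real t)))"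
  using assms(1) cauchy_den(1)[OF assms(2)] by (intro continuous_intros) auto

lemma cauchy_ext_holomorphic:
  assumes f: "continuous_on {-N..N} f"
  shows "cauchy_ext N f holomorphic_on {z. Im z > -1}"
proof -
  have "(\<lambda>z. integral (cbox (-N) N) (\<lambda>t. complex_of_real (f t) / (1 - \<i> * (z - of_real t)))) holomorphic_on {z. Im z > -1}"
  proof (rule leibniz_rule_holomorphic[where fx = "\<lambda>z t. complex_of_real (f t) * \<i> / (1 - \<i> * (z - of_real t))^2"])
    fix z t assume z: "z \<in> {z. Im z > -1}"
    show "((\<lambda>z. complex_of_real (f t) / (1 - \<i> * (z - of_real t))) has_field_derivative
       complex_of_real (f t) * \<i> / (1 - \<i> * (z - of_real t))^2) (at z within {z. Im z > -1})"
      using cauchy_den(1)[of z t] z by (auto intro!: derivative_eq_intros simp: power2_eq_square)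
  next
    fix z :: complex assume z: "z \<in> {z. Im z > -1}"
    show "(\<lambda>t. complex_of_real (f t) / (1 - \<i> * (z - of_real t))) integrable_on cbox (-N) N"
      using cauchy_integrand_continuous[OF f, of z] z by (simp add: integrable_continuous_interval)
  next
    have "continuous_on ({z. Im z > -1} \<times> {-N..N}) (\<lambda>w. f (snd w))"
      by (rule continuous_on_compose2[OF f]) (auto intro: continuous_intros)
    then show "continuous_on ({z. Im z > -1} \<times> cbox (-N) N) (\<lambda>(z, t). complex_of_real (f t) * \<i> / (1 - \<i> * (z - of_real t))^2)"
      using cauchy_den(1) by (auto simp: case_prod_unfold intro!: continuous_intros)
  next
    show "convex {z. Im z > -1}" by (rule convex_halfspace_Im_gt)
  qed
  then show ?thesis by (simp add: cauchy_ext_def[abs_def])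
qed

lemma cauchy_ext_Re:
  assumes f: "continuous_on {-N..N} f" and z: "Im z > -1"
  shows "Re (cauchy_ext N f z) = integral {-N..N} (\<lambda>t. f t * ((1 + Im z) / (norm (1 - \<i> * (z - complex_of_real t)))^2))"
    and "continuous_on {-N..N} (\<lambda>t. f t * ((1 + Im z) / (norm (1 - \<i> * (z - complex_of_real t)))^2))"
proof -
  have i: "(\<lambda>t. complex_of_real (f t) / (1 - \<i> * (z - of_real t))) integrable_on {-N..N}"
    by (rule integrable_continuous_interval[OF cauchy_integrand_continuous[OF f z]])
  have re: "Re (complex_of_real (f t) / (1 - \<i> * (z - of_real t))) = f t * ((1 + Im z) / (norm (1 - \<i> * (z - complex_of_real t)))^2)" for t
    using cauchy_den(2)[OF z, of t] by (simp add: Re_divide' cmod_power2)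
  have "Re (cauchy_ext N f z) = integral {-N..N} (\<lambda>t. Re (complex_of_real (f t) / (1 - \<i> * (z - of_real t))))"
    unfolding cauchy_ext_def by (rule integral_linear[OF i bounded_linear_Re, unfolded o_def, symmetric])
  then show "Re (cauchy_ext N f z) = integral {-N..N} (\<lambda>t. f t * ((1 + Im z) / (norm (1 - \<i> * (z - complex_of_real t)))^2))"
    by (simp only: re)
  show "continuous_on {-N..N} (\<lambda>t. f t * ((1 + Im z) / (norm (1 - \<i> * (z - complex_of_real t)))^2))"
    using f cauchy_den(1)[OF z] by (intro continuous_intros) auto
qed

lemma cauchy_ext_Re_pos:
  assumes f: "continuous_on {-N..N} f" and f0: "\<And>t. t \<in> {-N..N} \<Longrightarrow> f t \<ge> 0"
    and N: "N > 0" and ne: "\<exists>t\<in>{-N..N}. f t \<noteq> 0" and z: "Im z > -1"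
  shows "Re (cauchy_ext N f z) > 0"
proof -
  let ?g = "\<lambda>t. f t * ((1 + Im z) / (norm (1 - \<i> * (z - complex_of_real t)))^2)"
  note eq = cauchy_ext_Re(1)[OF f z] and c = cauchy_ext_Re(2)[OF f z]
  have nn: "?g t \<ge> 0" if "t \<in> {-N..N}" for t using f0[OF that] z by auto
  have "integral {-N..N} ?g \<noteq> 0"
  proof
    assume "integral {-N..N} ?g = 0"
    then have "\<forall>t\<in>{-N..N}. ?g t = 0" using integral_eq_0_iff[OF c _ nn] N by auto
    then show False using ne cauchy_den(1)[OF z] z by auto
  qed
  moreover have "integral {-N..N} ?g \<ge> 0" by (rule integral_nonneg[OF integrable_continuous_interval[OF c] nn])
  ultimately show ?thesis by (simp add: eq)
qed

lemma cauchy_ext_decay: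
  assumes f: "continuous_on {-N..N} f" and f0: "\<And>t. t \<in> {-N..N} \<Longrightarrow> f t \<ge> 0"
    and N: "N > 0" and z: "Im z > -1" "norm z \<ge> 2 * N + 2"
  shows "norm (cauchy_ext N f z) \<le> 2 * integral {-N..N} f / norm z"
proof -
  have z0: "norm z > 0" using z N by linarith
  have "norm (cauchy_ext N f z) \<le> integral {-N..N} (\<lambda>t. f t * (2 / norm z))"
    unfolding cauchy_ext_def
  proof (rule integral_norm_bound_integral)
    show "(\<lambda>t. complex_of_real (f t) / (1 - \<i> * (z - of_real t))) integrable_on {-N..N}"
      by (rule integrable_continuous_interval[OF cauchy_integrand_continuous[OF f z(1)]])
    show "(\<lambda>t. f t * (2 / norm z)) integrable_on {-N..N}"
      by (intro integrable_continuous_interval continuous_intros f)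
    fix t assume t: "t \<in> {-N..N}"
    have "norm (complex_of_real (f t) / (1 - \<i> * (z - of_real t))) = f t / norm (1 - \<i> * (z - complex_of_real t))"
      using f0[OF t] by (simp add: norm_divide)
    also have "\<dots> \<le> f t / (norm z / 2)"
    proof (rule divide_left_mono)
      show "norm z / 2 \<le> norm (1 - \<i> * (z - complex_of_real t))" using cauchy_den_lower[of t N z] t z by auto
      then show "0 < norm (1 - \<i> * (z - complex_of_real t)) * (norm z / 2)" using z0 by (intro mult_pos_pos) linarith+
    qed (rule f0[OF t])
    finally show "norm (complex_of_real (f t) / (1 - \<i> * (z - of_real t))) \<le> f t * (2 / norm z)" by simp
  qed
  also have "\<dots> = integral {-N..N} f * (2 / norm z)" by (rule integral_mult_left)
  finally show ?thesis by (simp add: mult.commute)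
qed

lemma triangle_side_lower:
  assumes "R > 0" "z \<in> closed_segment (complex_of_real R) (\<i> * of_real R) \<or> z \<in> closed_segment (\<i> * of_real R) (complex_of_real (-R))"
  shows "norm z \<ge> R / 2" "Im z \<ge> 0"
proof -
  have key: "norm z \<ge> R / 2 \<and> Im z \<ge> 0" if "\<bar>Re z\<bar> = (1 - u) * R" "Im z = u * R" "0 \<le> u" "u \<le> 1" for u
  proof (cases "u \<le> 1/2")
    case True
    then have "1/2 * R \<le> (1 - u) * R" using assms by (intro mult_right_mono) auto
    then have "R / 2 \<le> norm z" using that(1) abs_Re_le_cmod[of z] by linarith
    then show ?thesis using that assms(1) by simp
  next
    case False
    then have "1/2 * R \<le> u * R" using assms by (intro mult_right_mono) auto
    then have "R / 2 \<le> norm z" using that(2) abs_Im_le_cmod[of z] by linarith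
    then show ?thesis using that assms(1) by simp
  qed
  have "norm z \<ge> R / 2 \<and> Im z \<ge> 0" using assms(2)
  proof
    assume "z \<in> closed_segment (complex_of_real R) (\<i> * of_real R)"
    then obtain u where "0 \<le> u" "u \<le> 1" "z = (1 - u) *\<^sub>R complex_of_real R + u *\<^sub>R (\<i> * of_real R)"
      by (auto simp: in_segment)
    then show ?thesis using assms by (intro key[of u]) (auto simp: scaleR_conv_of_real)
  next
    assume "z \<in> closed_segment (\<i> * of_real R) (complex_of_real (-R))"
    then obtain u where "0 \<le> u" "u \<le> 1" "z = (1 - u) *\<^sub>R (\<i> * of_real R) + u *\<^sub>R complex_of_real (-R)"
      by (auto simp: in_segment)
    then show ?thesis using assms by (intro key[of "1 - u"]) (auto simp: scaleR_conv_of_real)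
  qed
  then show "norm z \<ge> R / 2" "Im z \<ge> 0" by auto
qed

text \<open>
  Cauchy's theorem on the triangle with vertices \<open>-R\<close>, \<open>R\<close> and \<open>\<i> R\<close>. The power is
  holomorphic since the function maps to the right half-plane. On the two upper sides it is
  \<open>O(R powr (- p))\<close> on a length of order \<open>R\<close>, which tends to zero because \<open>p > 1\<close>.
\<close>

lemma cauchy_ext_power_integral:
  fixes p :: real
  assumes f: "continuous_on {-N..N} f" and f0: "\<And>t. t \<in> {-N..N} \<Longrightarrow> f t \<ge> 0"
    and N: "N > 0" and ne: "\<exists>t\<in>{-N..N}. f t \<noteq> 0"
    and p: "p > 1" and R: "R \<ge> 4 * N + 4"
  shows "(\<lambda>x. cauchy_ext N f (of_real x) powr of_real p) integrable_on {-R..R}"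
    and "norm (integral {-R..R} (\<lambda>x. cauchy_ext N f (of_real x) powr of_real p))
      \<le> 4 * (4 * integral {-N..N} f) powr p * R powr (1 - p)"
proof -
  define h where "h z = cauchy_ext N f z powr of_real p" for z
  let ?U = "{z. Im z > -1}" and ?b = "complex_of_real R" and ?c = "\<i> * complex_of_real R" and ?a = "complex_of_real (-R)"
  have R0: "R > 0" using R N by linarith
  have pos: "Re (cauchy_ext N f z) > 0" if "z \<in> ?U" for z
    using cauchy_ext_Re_pos[OF f f0 N ne] that by blast
  have hol: "h holomorphic_on ?U"
    unfolding h_def
    by (intro holomorphic_intros cauchy_ext_holomorphic f) (use pos in \<open>auto simp: complex_nonpos_Reals_iff dest: less_imp_le\<close>, force)
  have "convex ?U" by (rule convex_halfspace_Im_gt)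
  then have hull: "convex hull {?a, ?b, ?c} \<subseteq> ?U" by (rule hull_minimal[rotated]) (use R0 in auto)
  have seg: "closed_segment x y \<subseteq> ?U" if "x \<in> {?a, ?b, ?c}" "y \<in> {?a, ?b, ?c}" for x y
    using that R0 by (intro closed_segment_subset \<open>convex ?U\<close>) auto
  have ci: "h contour_integrable_on linepath x y" if "x \<in> {?a, ?b, ?c}" "y \<in> {?a, ?b, ?c}" for x y
    by (rule contour_integrable_continuous_linepath)
       (use seg[OF that] hol in \<open>blast intro: continuous_on_subset holomorphic_on_imp_continuous_on\<close>)
  have "(h has_contour_integral 0) (linepath ?a ?b +++ linepath ?b ?c +++ linepath ?c ?a)"
    by (rule Cauchy_theorem_triangle) (rule holomorphic_on_subset[OF hol hull])
  then have "0 = contour_integral (linepath ?a ?b +++ linepath ?b ?c +++ linepath ?c ?a) h"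
    by (simp add: contour_integral_unique)
  also have "\<dots> = contour_integral (linepath ?a ?b) h + (contour_integral (linepath ?b ?c) h + contour_integral (linepath ?c ?a) h)"
    using ci by (subst contour_integral_join; (subst contour_integral_join)?) (auto intro!: contour_integrable_joinI)
  finally have sum0: "contour_integral (linepath ?a ?b) h = - (contour_integral (linepath ?b ?c) h + contour_integral (linepath ?c ?a) h)"
    by (metis add_eq_0_iff2)
  define M where "M = integral {-N..N} f"
  have M0: "M \<ge> 0" unfolding M_def by (rule integral_nonneg[OF integrable_continuous_interval[OF f] f0])
  have hb: "norm (h z) \<le> (4 * M / R) powr p" if "z \<in> closed_segment ?b ?c \<or> z \<in> closed_segment ?c ?a" for z
  proof -
    have z: "norm z \<ge> R / 2" "Im z \<ge> 0" using triangle_side_lower[OF R0 that] by auto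
    have "norm (cauchy_ext N f z) \<le> 2 * M / norm z"
      unfolding M_def by (rule cauchy_ext_decay[OF f f0 N]) (use z R in auto)
    also have "\<dots> \<le> 2 * M / (R / 2)" using z R0 M0 by (intro divide_left_mono mult_pos_pos) (linarith | simp)+
    finally have "norm (cauchy_ext N f z) \<le> 4 * M / R" by simp
    then have "norm (cauchy_ext N f z) powr p \<le> (4 * M / R) powr p" using p by (intro powr_mono2) auto
    moreover have "norm (h z) = norm (cauchy_ext N f z) powr p"
      unfolding h_def by (subst norm_powr_real_powr') auto
    ultimately show ?thesis by simp
  qed
  have len: "norm (?c - ?b) \<le> 2 * R" "norm (?a - ?c) \<le> 2 * R"
    using norm_triangle_ineq4[of ?c ?b] norm_triangle_ineq4[of ?a ?c] R0 by (simp_all add: norm_mult)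
  have e: "(4 * M / R) powr p * (2 * R) + (4 * M / R) powr p * (2 * R) = 4 * (4 * M) powr p * R powr (1 - p)"
    using R0 M0 by (simp add: powr_divide powr_diff)
  have "norm (contour_integral (linepath ?b ?c) h) \<le> (4 * M / R) powr p * norm (?c - ?b)"
    by (rule contour_integral_bound_linepath) (use ci hb in auto)
  also have "\<dots> \<le> (4 * M / R) powr p * (2 * R)" by (intro mult_left_mono len) auto
  finally have 1: "norm (contour_integral (linepath ?b ?c) h) \<le> (4 * M / R) powr p * (2 * R)" .
  have "norm (contour_integral (linepath ?c ?a) h) \<le> (4 * M / R) powr p * norm (?a - ?c)"
    by (rule contour_integral_bound_linepath) (use ci hb in auto)
  also have "\<dots> \<le> (4 * M / R) powr p * (2 * R)" by (intro mult_left_mono len) auto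
  finally have 2: "norm (contour_integral (linepath ?c ?a) h) \<le> (4 * M / R) powr p * (2 * R)" .
  have ab: "?a \<in> Reals" "?b \<in> Reals" "Re ?a < Re ?b" using R0 by auto
  show "(\<lambda>x. cauchy_ext N f (of_real x) powr of_real p) integrable_on {-R..R}"
    using ci[of ?a ?b] contour_integrable_linepath_Reals_iff[OF ab, of h] by (simp add: h_def)
  have "norm (integral {-R..R} (\<lambda>x. h (of_real x))) = norm (contour_integral (linepath ?a ?b) h)"
    using contour_integral_linepath_Reals_eq[OF ab, of h] by simp
  also have "\<dots> \<le> 4 * (4 * M) powr p * R powr (1 - p)"
    unfolding sum0 norm_minus_cancel using norm_triangle_le[OF add_mono[OF 1 2]] e by simp
  finally show "norm (integral {-R..R} (\<lambda>x. cauchy_ext N f (of_real x) powr of_real p))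
      \<le> 4 * (4 * integral {-N..N} f) powr p * R powr (1 - p)" by (simp add: h_def M_def)
qed


lemma nn_integral_poisson_finite: "(\<integral>\<^sup>+t. ennreal (1 / (1 + t\<^sup>2)) \<partial>(lborel :: real measure)) < \<infinity>"
proof -
  have "(\<integral>\<^sup>+t. ennreal (1 / (1 + t\<^sup>2)) \<partial>(lborel :: real measure))
     \<le> (\<integral>\<^sup>+t. ennreal 2 * ennreal (\<bar>t\<bar> powr (-1 + 1/2) * (1 + \<bar>t\<bar>) powr (-2 * (1/2))) \<partial>lborel)"
  proof (rule nn_integral_mono_AE)
    show "AE t in lborel. ennreal (1 / (1 + t\<^sup>2)) \<le> ennreal 2 * ennreal (\<bar>t\<bar> powr (-1 + 1/2) * (1 + \<bar>t\<bar>) powr (-2 * (1/2)))"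
      using AE_lborel_singleton[of "0::real"]
    proof eventually_elim
      case (elim t)
      have t: "\<bar>t\<bar> > 0" using elim by simp
      have "\<bar>t\<bar> powr (1/2) * (1 + \<bar>t\<bar>) \<le> 2 * (1 + t\<^sup>2)"
      proof (cases "\<bar>t\<bar> \<le> 1")
        case True
        then have "\<bar>t\<bar> powr (1/2) \<le> 1" using powr_mono2[of "1/2" "\<bar>t\<bar>" 1] by simp
        then have "\<bar>t\<bar> powr (1/2) * (1 + \<bar>t\<bar>) \<le> 1 * 2" using True by (intro mult_mono) auto
        also have "\<dots> \<le> 2 * (1 + t\<^sup>2)" by simp
        finally show ?thesis .
      next
        case False
        then have "\<bar>t\<bar> powr (1/2) \<le> \<bar>t\<bar>" using powr_mono[of "1/2" 1 "\<bar>t\<bar>"] by simp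
        then have "\<bar>t\<bar> powr (1/2) * (1 + \<bar>t\<bar>) \<le> \<bar>t\<bar> * (2 * \<bar>t\<bar>)" using False by (intro mult_mono) auto
        also have "\<dots> = 2 * t\<^sup>2" by (simp add: power2_eq_square)
        finally show ?thesis by simp
      qed
      then have "1 / (1 + t\<^sup>2) \<le> 2 / (\<bar>t\<bar> powr (1/2) * (1 + \<bar>t\<bar>))"
        using t by (simp add: divide_simps mult.commute add_pos_nonneg)
      also have "\<dots> = 2 * (\<bar>t\<bar> powr (-1 + 1/2) * (1 + \<bar>t\<bar>) powr (-2 * (1/2)))"
      proof -
        have "\<bar>t\<bar> powr (-1 + 1/2) = 1 / \<bar>t\<bar> powr (1/2)" using t by (simp add: powr_minus_divide[symmetric])
        moreover have "(1 + \<bar>t\<bar>) powr (-2 * (1/2)) = 1 / (1 + \<bar>t\<bar>)" by (simp add: powr_minus_divide add_pos_nonneg)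
        ultimately show ?thesis by simp
      qed
      finally show ?case by (simp only: ennreal_mult''[symmetric] ennreal_leI powr_ge_zero mult_nonneg_nonneg)
    qed
  qed
  also have "\<dots> = ennreal 2 * (\<integral>\<^sup>+t. ennreal (\<bar>t\<bar> powr (-1 + 1/2) * (1 + \<bar>t\<bar>) powr (-2 * (1/2))) \<partial>lborel)"
    by (rule nn_integral_cmult) measurable
  also have "\<dots> < \<infinity>"
    using nn_integral_two_sided_power_finite[of "1/2"] unfolding infinity_ennreal_def ennreal_mult_less_top by simp
  finally show ?thesis .
qed

lemma nn_integral_le_of_intervals:
  fixes f :: "real \<Rightarrow> ennreal"
  assumes [measurable]: "f \<in> borel_measurable borel"
    and part: "\<And>k::nat. k > 0 \<Longrightarrow> (\<integral>\<^sup>+x. f x * indicator {- real k..real k} x \<partial>lborel) \<le> c"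
  shows "(\<integral>\<^sup>+x. f x \<partial>lborel) \<le> c"
proof -
  let ?I = "\<lambda>k. {- real (Suc k)..real (Suc k)}"
  have "(\<integral>\<^sup>+x. f x \<partial>lborel) = (\<integral>\<^sup>+x. (SUP k. f x * indicator (?I k) x) \<partial>lborel)"
  proof (rule nn_integral_cong)
    fix x
    obtain k where k: "\<bar>x\<bar> \<le> real k" using real_arch_simple by blast
    have "f x \<le> (SUP k. f x * indicator (?I k) x)"
      by (rule SUP_upper2[of k]) (use k in \<open>auto simp: indicator_def abs_le_iff\<close>)
    moreover have "(SUP k. f x * indicator (?I k) x) \<le> f x"
      by (rule SUP_least) (auto simp: indicator_def)
    ultimately show "f x = (SUP k. f x * indicator (?I k) x)" by (rule antisym)
  qed
  also have "\<dots> = (SUP k. \<integral>\<^sup>+x. f x * indicator (?I k) x \<partial>lborel)"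
    by (rule nn_integral_monotone_convergence_SUP) (auto simp: incseq_def le_fun_def indicator_def)
  also have "\<dots> \<le> c" by (rule SUP_least) (rule part, simp)
  finally show ?thesis .
qed

text \<open>
  Truncation keeps continuity on the interval, which the holomorphic extension needs, and makes
  all integrals finite without decay assumptions.
\<close>

definition truncate :: "real \<Rightarrow> (real \<Rightarrow> 'b::real_vector) \<Rightarrow> real \<Rightarrow> 'b"
  where "truncate N f t = indicator {-N..N} t *\<^sub>R f t"

lemma truncate_measurable:
  fixes f :: "real \<Rightarrow> 'b::{second_countable_topology, real_normed_vector}"
  assumes "continuous_on {-N..N} f"
  shows "truncate N f \<in> borel_measurable borel"
  unfolding truncate_def by (rule borel_measurable_continuous_on_indicator) (use assms in auto)

lemma truncate_integrable:
  fixes f :: "real \<Rightarrow> 'b::{banach, second_countable_topology}"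
  assumes "continuous_on {-N..N} f"
  shows "integrable lborel (truncate N f)"
  unfolding truncate_def[abs_def] by (rule borel_integrable_compact) (use assms in auto)

lemma conv_poisson_eq:
  assumes f: "continuous_on {-N..N} f" and f0: "\<And>t. t \<in> {-N..N} \<Longrightarrow> f t \<ge> 0"
  shows "conv (\<lambda>s. 1 / (1 + s\<^sup>2)) (truncate N f) x = ennreal (Re (cauchy_ext N f (of_real x)))"
proof -
  have z: "Im (complex_of_real x) > -1" by simp
  let ?g = "\<lambda>t. f t * ((1 + Im (complex_of_real x)) / (norm (1 - \<i> * (complex_of_real x - complex_of_real t)))^2)"
  have g: "?g t = 1 / (1 + (x - t)\<^sup>2) * f t" for t
    by (simp add: cmod_power2 power2_commute)
  have "(?g has_integral Re (cauchy_ext N f (of_real x))) {-N..N}"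
    unfolding cauchy_ext_Re(1)[OF f z] by (rule integrable_integral[OF integrable_continuous_interval[OF cauchy_ext_Re(2)[OF f z]]])
  then have "(\<integral>\<^sup>+t. ennreal (?g t) * indicator {-N..N} t \<partial>lborel) = ennreal (Re (cauchy_ext N f (of_real x)))"
    by (rule nn_integral_has_integral_lebesgue'[rotated]) (use f0 in auto)
  moreover have "conv (\<lambda>s. 1 / (1 + s\<^sup>2)) (truncate N f) x = (\<integral>\<^sup>+t. ennreal (?g t) * indicator {-N..N} t \<partial>lborel)"
    unfolding conv_def
  proof (rule nn_integral_cong)
    fix t
    show "ennreal (1 / (1 + (x - t)\<^sup>2)) * ennreal (truncate N f t) = ennreal (?g t) * indicator {-N..N} t"
      unfolding g using f0[of t] by (auto simp: truncate_def indicator_def ennreal_mult'[symmetric])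
  qed
  ultimately show ?thesis by simp
qed

text \<open>
  The inequality for the half-plane is integrated over \<open>{-R..R}\<close>. As \<open>R\<close> grows the holomorphic
  term disappears, and what remains is the real part, to which Young's inequality applies.
\<close>

lemma riesz_nonneg:
  fixes p :: real
  assumes p: "1 < p" "p \<le> 2"
  shows "\<exists>C\<ge>0. \<forall>N f. N > 0 \<longrightarrow> continuous_on {-N..N} f \<longrightarrow> (\<forall>t\<in>{-N..N}. f t \<ge> 0) \<longrightarrow>
    (\<integral>\<^sup>+x. ennreal (norm (cauchy_ext N f (of_real x)) powr p) \<partial>lborel)
      \<le> ennreal C * (\<integral>\<^sup>+t. ennreal (norm (truncate N f t) powr p) \<partial>lborel)"
proof -
  obtain A B where AB: "0 \<le> A" "0 \<le> B" "\<And>w::complex. Re w > 0 \<Longrightarrow> norm w powr p \<le> A * Re w powr p - B * Re (w powr of_real p)"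
    using powr_half_plane_inequality[OF p] by blast
  define M where "M = enn2real (\<integral>\<^sup>+t. ennreal (1 / (1 + t\<^sup>2)) \<partial>(lborel :: real measure)) + 1"
  have M: "(\<integral>\<^sup>+t. ennreal (1 / (1 + t\<^sup>2)) \<partial>(lborel :: real measure)) \<le> ennreal M" "M > 0"
  proof -
    have "(\<integral>\<^sup>+t. ennreal (1 / (1 + t\<^sup>2)) \<partial>(lborel :: real measure)) = ennreal (M - 1)"
      using nn_integral_poisson_finite by (simp add: M_def less_top)
    also have "\<dots> \<le> ennreal M" by (rule ennreal_leI) simp
    finally show "(\<integral>\<^sup>+t. ennreal (1 / (1 + t\<^sup>2)) \<partial>(lborel :: real measure)) \<le> ennreal M" .
    show "M > 0" by (simp add: M_def add_nonneg_pos)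
  qed
  define K where "K = 2 * (2 * M) powr (p - 1) * M"
  have K: "K \<ge> 0" using M by (simp add: K_def)
  have "(\<integral>\<^sup>+x. ennreal (norm (cauchy_ext N f (of_real x)) powr p) \<partial>lborel)
      \<le> ennreal (A * K) * (\<integral>\<^sup>+t. ennreal (norm (truncate N f t) powr p) \<partial>lborel)"
    if N: "N > 0" and f: "continuous_on {-N..N} f" and f0: "\<forall>t\<in>{-N..N}. f t \<ge> 0" for N f
  proof (cases "\<exists>t\<in>{-N..N}. f t \<noteq> 0")
    case False
    then have "cauchy_ext N f (of_real x) = 0" for x
      unfolding cauchy_ext_def by (subst integral_cong[where g = "\<lambda>_. 0"]) auto
    then show ?thesis using p by simp
  next
    case True
    have f0': "f t \<ge> 0" if "t \<in> {-N..N}" for t using f0 that by blast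
    define G where "G x = cauchy_ext N f (of_real x)" for x :: real
    have pos: "Re (G x) > 0" for x unfolding G_def by (rule cauchy_ext_Re_pos[OF f f0' N True]) auto
    have Gc: "continuous_on S G" for S
    proof -
      have "continuous_on {z. Im z > -1} (cauchy_ext N f)"
        by (rule holomorphic_on_imp_continuous_on[OF cauchy_ext_holomorphic[OF f]])
      then show ?thesis unfolding G_def
        by (rule continuous_on_compose2) (auto intro!: continuous_intros)
    qed
    have cn: "continuous_on S (\<lambda>x. norm (G x) powr p)" and cr: "continuous_on S (\<lambda>x. Re (G x) powr p)" for S
    proof -
      have "norm (G x) \<noteq> 0" for x using pos[of x] by auto
      then show "continuous_on S (\<lambda>x. norm (G x) powr p)" by (intro continuous_intros Gc) auto
      have "Re (G x) \<noteq> 0" for x using pos[of x] by auto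
      then show "continuous_on S (\<lambda>x. Re (G x) powr p)" by (intro continuous_intros Gc) auto
    qed
    define Q where "Q = (\<integral>\<^sup>+x. ennreal (Re (G x) powr p) \<partial>lborel)"
    have QK: "Q \<le> ennreal K * (\<integral>\<^sup>+t. ennreal (norm (truncate N f t) powr p) \<partial>lborel)"
    proof -
      have cut0: "truncate N f t \<ge> 0" for t using f0 by (auto simp: truncate_def indicator_def)
      have e: "enn2real (conv (\<lambda>s. 1 / (1 + s\<^sup>2)) (truncate N f) x) = Re (G x)" for x
        using conv_poisson_eq[OF f f0'] pos[of x] by (simp add: G_def)
      have "(\<integral>\<^sup>+z. ennreal (enn2real (conv (\<lambda>s. 1 / (1 + s\<^sup>2)) (truncate N f) z) powr p) \<partial>lborel)
        \<le> ennreal (2 * (2 * M) powr (p - 1) * M) * (\<integral>\<^sup>+y. ennreal (truncate N f y powr p) \<partial>lborel)"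
        by (rule nn_integral_conv_powr_le[OF _ truncate_measurable[OF f] _ cut0 M])
           (use p conv_poisson_eq[OF f f0'] in auto)
      then show ?thesis unfolding e Q_def K_def using cut0 by simp
    qed
    have main: "(\<integral>\<^sup>+x. ennreal (norm (G x) powr p) \<partial>lborel) \<le> ennreal A * Q"
    proof (cases "Q = \<infinity> \<and> A > 0")
      case True
      then show ?thesis by (simp add: ennreal_mult_top)
    next
      case QA: False
      define q where "q = enn2real Q"
      have AQ: "ennreal A * Q = ennreal (A * q)"
        using QA AB(1) by (cases "A = 0") (auto simp: q_def ennreal_mult less_top)
      have fin: "\<forall>\<^sub>F R in at_top. A * integral {-R..R} (\<lambda>x. Re (G x) powr p) \<le> A * q"
      proof (cases "A = 0")
        case False
        then have "Q < \<infinity>" using QA AB(1) by (auto simp: less_top)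
        have "integral {-R..R} (\<lambda>x. Re (G x) powr p) \<le> q" for R
        proof -
          have "ennreal (integral {-R..R} (\<lambda>x. Re (G x) powr p)) = (\<integral>\<^sup>+x. ennreal (Re (G x) powr p) * indicator {-R..R} x \<partial>lborel)"
            by (rule nn_integral_has_integral_lebesgue'[symmetric])
               (auto intro!: integrable_integral integrable_continuous_interval cr)
          also have "\<dots> \<le> Q" unfolding Q_def by (rule nn_integral_mono) (auto simp: indicator_def)
          finally have "ennreal (integral {-R..R} (\<lambda>x. Re (G x) powr p)) \<le> ennreal q"
            using \<open>Q < \<infinity>\<close> by (simp add: q_def)
          then show ?thesis by (simp add: q_def ennreal_le_iff)
        qed
        then show ?thesis using AB(1) by (intro always_eventually allI mult_left_mono)
      qed simp
      define L where "L = 4 * (4 * integral {-N..N} f) powr p"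
      have tend: "((\<lambda>R::real. B * (L * R powr (1 - p))) \<longlongrightarrow> 0) at_top"
        using p by (intro tendsto_mult_right_zero tendsto_neg_powr filterlim_ident) auto
      have bd: "integral {-R..R} (\<lambda>x. norm (G x) powr p) \<le> A * integral {-R..R} (\<lambda>x. Re (G x) powr p) + B * (L * R powr (1 - p))"
        if R: "R \<ge> 4 * N + 4" for R
      proof -
        note pi = cauchy_ext_power_integral[OF f f0' N True p(1) R, folded G_def L_def]
        have ir: "(\<lambda>x. Re (G x powr of_real p)) integrable_on {-R..R}"
          using integrable_linear[OF pi(1) bounded_linear_Re] by (simp add: o_def)
        have i1: "(\<lambda>x. Re (G x) powr p) integrable_on {-R..R}"
          by (intro integrable_continuous_interval cr)
        have "integral {-R..R} (\<lambda>x. norm (G x) powr p) \<le> integral {-R..R} (\<lambda>x. A * Re (G x) powr p - B * Re (G x powr of_real p))"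
        proof (rule integral_le)
          show "(\<lambda>x. norm (G x) powr p) integrable_on {-R..R}" by (intro integrable_continuous_interval cn)
          show "(\<lambda>x. A * Re (G x) powr p - B * Re (G x powr of_real p)) integrable_on {-R..R}"
            by (intro integrable_diff integrable_on_mult_right i1 ir)
        qed (use AB(3) pos in blast)
        also have "\<dots> = A * integral {-R..R} (\<lambda>x. Re (G x) powr p) - B * integral {-R..R} (\<lambda>x. Re (G x powr of_real p))"
          using i1 ir by (simp add: integral_diff integrable_on_mult_right)
        also have "integral {-R..R} (\<lambda>x. Re (G x powr of_real p)) = Re (integral {-R..R} (\<lambda>x. G x powr of_real p))"
          using integral_linear[OF pi(1) bounded_linear_Re] by (simp add: o_def)
        finally have 1: "integral {-R..R} (\<lambda>x. norm (G x) powr p) \<le> A * integral {-R..R} (\<lambda>x. Re (G x) powr p)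
            - B * Re (integral {-R..R} (\<lambda>x. G x powr of_real p))" .
        have "- Re (integral {-R..R} (\<lambda>x. G x powr of_real p)) \<le> norm (integral {-R..R} (\<lambda>x. G x powr of_real p))"
          using abs_Re_le_cmod[of "integral {-R..R} (\<lambda>x. G x powr of_real p)"] by linarith
        also have "\<dots> \<le> L * R powr (1 - p)" by (rule pi(2))
        finally have "B * (- Re (integral {-R..R} (\<lambda>x. G x powr of_real p))) \<le> B * (L * R powr (1 - p))"
          using AB(2) by (rule mult_left_mono)
        then show ?thesis using 1 by simp
      qed
      have part: "(\<integral>\<^sup>+x. ennreal (norm (G x) powr p) * indicator {- real k..real k} x \<partial>lborel) \<le> ennreal (A * q)" for k
      proof (rule ennreal_le_epsilon)
        fix e :: real assume e: "e > 0"
        have "\<forall>\<^sub>F R in at_top. B * (L * R powr (1 - p)) < e" using tend e by (rule order_tendstoD)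
        with fin eventually_ge_at_top[of "max (real k) (4 * N + 4)"]
        have "\<forall>\<^sub>F R in at_top. B * (L * R powr (1 - p)) < e \<and> A * integral {-R..R} (\<lambda>x. Re (G x) powr p) \<le> A * q \<and> R \<ge> max (real k) (4 * N + 4)"
          by (simp add: eventually_conj_iff)
        then obtain R where R: "B * (L * R powr (1 - p)) < e" "A * integral {-R..R} (\<lambda>x. Re (G x) powr p) \<le> A * q" "R \<ge> real k" "R \<ge> 4 * N + 4"
          by (auto dest!: eventually_happens)
        have "(\<integral>\<^sup>+x. ennreal (norm (G x) powr p) * indicator {- real k..real k} x \<partial>lborel)
           \<le> (\<integral>\<^sup>+x. ennreal (norm (G x) powr p) * indicator {-R..R} x \<partial>lborel)"
          using R(3) by (intro nn_integral_mono) (auto simp: indicator_def)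
        also have "\<dots> = ennreal (integral {-R..R} (\<lambda>x. norm (G x) powr p))"
          by (rule nn_integral_has_integral_lebesgue') (auto intro!: integrable_integral integrable_continuous_interval cn)
        also have "\<dots> \<le> ennreal (A * q + e)" using bd[OF R(4)] R(1,2) by (intro ennreal_leI) linarith
        also have "\<dots> = ennreal (A * q) + ennreal e" using AB(1) e by (simp add: q_def)
        finally show "(\<integral>\<^sup>+x. ennreal (norm (G x) powr p) * indicator {- real k..real k} x \<partial>lborel) \<le> ennreal (A * q) + ennreal e" .
      qed
      have [measurable]: "G \<in> borel_measurable borel" by (intro borel_measurable_continuous_onI Gc)
      have "(\<integral>\<^sup>+x. ennreal (norm (G x) powr p) \<partial>lborel) \<le> ennreal (A * q)"
        by (rule nn_integral_le_of_intervals) (measurable, rule part)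
      then show ?thesis by (simp add: AQ)
    qed
    have "(\<integral>\<^sup>+x. ennreal (norm (G x) powr p) \<partial>lborel) \<le> ennreal A * (ennreal K * (\<integral>\<^sup>+t. ennreal (norm (truncate N f t) powr p) \<partial>lborel))"
      using main QK by (meson mult_left_mono order_trans zero_le)
    then show ?thesis unfolding G_def using AB(1) K by (simp add: ennreal_mult mult.assoc)
  qed
  then show ?thesis using AB(1) K by (intro exI[of _ "A * K"]) auto
qed


text \<open>
  Both the representation of the operator by a kernel and the adjoint of the Cauchy integral are
  instances.
\<close>

lemma fubini_bounded_kernel:
  fixes u :: "'a::euclidean_space \<Rightarrow> complex" and v :: "'b::euclidean_space \<Rightarrow> complex"
  assumes u: "integrable lborel u" and v: "integrable lborel v"
    and k[measurable]: "(\<lambda>(x, y). k x y) \<in> borel_measurable (borel \<Otimes>\<^sub>M borel)"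
    and B: "\<And>x y. norm (k x y) \<le> B"
  shows "(LINT x|lborel. v x * (LINT y|lborel. u y * k x y)) = (LINT y|lborel. u y * (LINT x|lborel. v x * k x y))"
proof -
  have [measurable]: "u \<in> borel_measurable borel" "v \<in> borel_measurable borel" using u v by auto
  have k'[measurable]: "(\<lambda>(x, y). k x y) \<in> borel_measurable (lborel \<Otimes>\<^sub>M lborel)"
    using k by (simp cong: measurable_cong_sets)
  have B0: "B \<ge> 0" using B[of undefined undefined] norm_ge_zero order_trans by blast
  have "integrable (lborel \<Otimes>\<^sub>M lborel) (\<lambda>(x, y). v x * u y)"
    by (rule lborel_pair.Fubini_integrable) (use u v in \<open>auto simp: norm_mult\<close>)
  then have "integrable (lborel \<Otimes>\<^sub>M lborel) (\<lambda>(x, y). B *\<^sub>R (v x * u y))"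
    by (auto simp: case_prod_unfold)
  then have int: "integrable (lborel \<Otimes>\<^sub>M lborel) (\<lambda>(x, y). v x * (u y * k x y))"
  proof (rule Bochner_Integration.integrable_bound)
    have "norm (v x * (u y * k x y)) \<le> norm (B *\<^sub>R (v x * u y))" for x y
    proof -
      have "norm (v x) * norm (u y) * norm (k x y) \<le> norm (v x) * norm (u y) * B"
        by (intro mult_left_mono B) auto
      then show ?thesis using B0 by (simp add: norm_mult mult_ac)
    qed
    then show "AE w in lborel \<Otimes>\<^sub>M lborel. norm (case w of (x, y) \<Rightarrow> v x * (u y * k x y)) \<le> norm (case w of (x, y) \<Rightarrow> B *\<^sub>R (v x * u y))"
      by (intro AE_I2) (simp only: case_prod_unfold)
    show "(\<lambda>(x, y). v x * (u y * k x y)) \<in> borel_measurable (lborel \<Otimes>\<^sub>M lborel)"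
      using k' by measurable
  qed
  have "(LINT x|lborel. v x * (LINT y|lborel. u y * k x y)) = (LINT x|lborel. (LINT y|lborel. v x * (u y * k x y)))"
    by simp
  also have "\<dots> = (LINT y|lborel. (LINT x|lborel. v x * (u y * k x y)))"
    by (rule lborel_pair.Fubini_integral[OF int, symmetric])
  also have "\<dots> = (LINT y|lborel. u y * (LINT x|lborel. v x * k x y))"
    by (simp add: mult.left_commute)
  finally show ?thesis .
qed

definition cauchy_op :: "(real \<Rightarrow> complex) \<Rightarrow> real \<Rightarrow> complex"
  where "cauchy_op u x = (LINT y|lborel. u y * (1 / (1 - \<i> * complex_of_real (x - y))))"

lemma cauchy_kernel_norm: "norm (1 / (1 - \<i> * complex_of_real s)) \<le> 1"
proof -
  have "1 = \<bar>Re (1 - \<i> * complex_of_real s)\<bar>" by simp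
  also have "\<dots> \<le> norm (1 - \<i> * complex_of_real s)" by (rule abs_Re_le_cmod)
  finally show ?thesis by (simp add: norm_divide divide_le_eq)
qed

lemma cauchy_kernel_measurable[measurable]:
  "(\<lambda>(x::real, y). 1 / (1 - \<i> * complex_of_real (x - y))) \<in> borel_measurable (borel \<Otimes>\<^sub>M borel)"
  by measurable

lemma cauchy_op_integrable:
  assumes "integrable lborel u"
  shows "integrable lborel (\<lambda>y. u y * (1 / (1 - \<i> * complex_of_real (x - y))))"
proof -
  have [measurable]: "u \<in> borel_measurable borel" using assms by auto
  show ?thesis
    by (rule Bochner_Integration.integrable_bound[OF assms])
       (use cauchy_kernel_norm in \<open>auto simp: norm_mult intro!: mult_left_le simp del: times_divide_eq_right of_real_diff\<close>)
qed

lemma cauchy_op_measurable[measurable]: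
  assumes [measurable]: "u \<in> borel_measurable borel"
  shows "cauchy_op u \<in> borel_measurable borel"
  unfolding cauchy_op_def[abs_def] by measurable

lemma cauchy_op_truncate_real:
  assumes f: "continuous_on {-N..N} f"
  shows "cauchy_op (truncate N (\<lambda>t. complex_of_real (f t))) x = cauchy_ext N f (of_real x)"
proof -
  have c: "continuous_on {-N..N} (\<lambda>t. complex_of_real (f t) / (1 - \<i> * (complex_of_real x - of_real t)))"
    by (rule cauchy_integrand_continuous[OF f]) simp
  have "(LINT t:{-N..N}|lborel. complex_of_real (f t) / (1 - \<i> * (complex_of_real x - of_real t))) = cauchy_ext N f (of_real x)"
    unfolding cauchy_ext_def by (rule set_borel_integral_eq_integral(2)[OF borel_integrable_atLeastAtMost'[OF c]])
  then show ?thesis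
    unfolding set_lebesgue_integral_def cauchy_op_def truncate_def by (simp add: divide_inverse mult.assoc)
qed

lemma cauchy_op_add:
  assumes "integrable lborel u" "integrable lborel v"
  shows "cauchy_op (\<lambda>t. u t + c * v t) x = cauchy_op u x + c * cauchy_op v x"
proof -
  have "cauchy_op (\<lambda>t. u t + c * v t) x = (LINT y|lborel. u y * (1 / (1 - \<i> * complex_of_real (x - y))) + c * (v y * (1 / (1 - \<i> * complex_of_real (x - y)))))"
    unfolding cauchy_op_def by (simp add: algebra_simps add_divide_distrib)
  also have "\<dots> = cauchy_op u x + c * cauchy_op v x"
    unfolding cauchy_op_def
    by (subst Bochner_Integration.integral_add)
       (use cauchy_op_integrable assms in \<open>auto simp del: times_divide_eq_right of_real_diff\<close>)
  finally show ?thesis .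
qed

text \<open>
  The estimate for nonnegative functions is transferred to complex ones through the positive
  and negative parts of the real and imaginary parts, which stay continuous.
\<close>

lemma cauchy_op_truncate_complex:
  fixes v :: "real \<Rightarrow> complex"
  assumes v: "continuous_on {-N..N} v"
  defines "a \<equiv> \<lambda>t. max 0 (Re (v t))" and "b \<equiv> \<lambda>t. max 0 (- Re (v t))"
    and "c \<equiv> \<lambda>t. max 0 (Im (v t))" and "d \<equiv> \<lambda>t. max 0 (- Im (v t))"
  shows "cauchy_op (truncate N v) x = cauchy_ext N a (of_real x) - cauchy_ext N b (of_real x)
      + \<i> * (cauchy_ext N c (of_real x) - cauchy_ext N d (of_real x))"
    and "continuous_on {-N..N} a" "continuous_on {-N..N} b" "continuous_on {-N..N} c" "continuous_on {-N..N} d"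
proof -
  show ca: "continuous_on {-N..N} a" and cb: "continuous_on {-N..N} b" and cc: "continuous_on {-N..N} c" and cd: "continuous_on {-N..N} d"
    unfolding a_def b_def c_def d_def by (intro continuous_intros v)+
  let ?t = "\<lambda>f. truncate N (\<lambda>t. complex_of_real (f t))"
  have i: "integrable lborel (?t a)" "integrable lborel (?t b)" "integrable lborel (?t c)" "integrable lborel (?t d)"
    using ca cb cc cd by (auto intro!: truncate_integrable continuous_intros)
  have "truncate N v = (\<lambda>t. ((?t a t + (-1) * ?t b t) + \<i> * ?t c t) + (- \<i>) * ?t d t)"
    by (rule ext) (auto simp: truncate_def a_def b_def c_def d_def complex_eq_iff indicator_def max_def)
  then have "cauchy_op (truncate N v) x = cauchy_op (\<lambda>t. ((?t a t + (-1) * ?t b t) + \<i> * ?t c t) + (- \<i>) * ?t d t) x" by simp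
  also have "\<dots> = cauchy_op (\<lambda>t. (?t a t + (-1) * ?t b t) + \<i> * ?t c t) x + (- \<i>) * cauchy_op (?t d) x"
    using i by (intro cauchy_op_add) auto
  also have "cauchy_op (\<lambda>t. (?t a t + (-1) * ?t b t) + \<i> * ?t c t) x = cauchy_op (\<lambda>t. ?t a t + (-1) * ?t b t) x + \<i> * cauchy_op (?t c) x"
    using i by (intro cauchy_op_add) auto
  also have "cauchy_op (\<lambda>t. ?t a t + (-1) * ?t b t) x = cauchy_op (?t a) x + (-1) * cauchy_op (?t b) x"
    using i by (intro cauchy_op_add) auto
  finally show "cauchy_op (truncate N v) x = cauchy_ext N a (of_real x) - cauchy_ext N b (of_real x)
      + \<i> * (cauchy_ext N c (of_real x) - cauchy_ext N d (of_real x))"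
    by (simp add: cauchy_op_truncate_real ca cb cc cd algebra_simps)
qed

lemma cauchy_op_truncate_continuous:
  assumes v: "continuous_on {-N..N} (v :: real \<Rightarrow> complex)"
  shows "continuous_on S (cauchy_op (truncate N v))"
proof -
  have E: "continuous_on S (\<lambda>x. cauchy_ext N f (of_real x))" if "continuous_on {-N..N} f" for f
  proof -
    have "continuous_on {z. Im z > -1} (cauchy_ext N f)"
      by (rule holomorphic_on_imp_continuous_on[OF cauchy_ext_holomorphic[OF that]])
    then show ?thesis by (rule continuous_on_compose2) (auto intro!: continuous_intros)
  qed
  show ?thesis
    unfolding cauchy_op_truncate_complex(1)[OF v, abs_def]
    by (intro continuous_intros E cauchy_op_truncate_complex(2-5)[OF v])
qed

lemma sum_powr_le:
  fixes p :: real
  assumes "finite I" "\<And>i. i \<in> I \<Longrightarrow> a i \<ge> 0" "p \<ge> 0"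
  shows "(\<Sum>i\<in>I. a i) powr p \<le> real (card I) powr p * (\<Sum>i\<in>I. a i powr p)"
proof (cases "I = {}")
  case False
  obtain j where j: "j \<in> I" "\<And>i. i \<in> I \<Longrightarrow> a i \<le> a j"
  proof -
    have "Max (a ` I) \<in> a ` I" using False assms by (intro Max_in) auto
    then obtain j where "j \<in> I" "Max (a ` I) = a j" by auto
    then show ?thesis using that[of j] assms(1) by (metis Max_ge finite_imageI image_eqI)
  qed
  have "(\<Sum>i\<in>I. a i) \<le> real (card I) * a j" using sum_bounded_above[of I a "a j"] j by simp
  then have "(\<Sum>i\<in>I. a i) powr p \<le> (real (card I) * a j) powr p"
    using assms by (intro powr_mono2 sum_nonneg) auto
  also have "\<dots> = real (card I) powr p * a j powr p" using assms(2)[OF j(1)] by (simp add: powr_mult)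
  also have "a j powr p \<le> (\<Sum>i\<in>I. a i powr p)" by (rule member_le_sum) (use j assms in auto)
  finally show ?thesis by (simp add: mult_left_mono)
qed simp

definition cauchy_bounded :: "real \<Rightarrow> bool"
  where "cauchy_bounded p \<longleftrightarrow> (\<exists>C\<ge>0. \<forall>N v. N > 0 \<longrightarrow> continuous_on {-N..N} (v :: real \<Rightarrow> complex) \<longrightarrow>
    (\<integral>\<^sup>+x. ennreal (norm (cauchy_op (truncate N v) x) powr p) \<partial>lborel)
      \<le> ennreal C * (\<integral>\<^sup>+t. ennreal (norm (truncate N v t) powr p) \<partial>lborel))"

lemma cauchy_bounded_le_2:
  assumes p: "1 < p" "p \<le> 2"
  shows "cauchy_bounded p"
proof -
  obtain C where C: "C \<ge> 0" "\<And>N f. N > 0 \<Longrightarrow> continuous_on {-N..N} f \<Longrightarrow> (\<forall>t\<in>{-N..N}. f t \<ge> 0) \<Longrightarrow>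
    (\<integral>\<^sup>+x. ennreal (norm (cauchy_ext N f (of_real x)) powr p) \<partial>lborel)
      \<le> ennreal C * (\<integral>\<^sup>+t. ennreal (norm (truncate N f t) powr p) \<partial>lborel)"
    using riesz_nonneg[OF p] by blast
  have "(\<integral>\<^sup>+x. ennreal (norm (cauchy_op (truncate N v) x) powr p) \<partial>lborel)
      \<le> ennreal (4 powr p * (4 * C)) * (\<integral>\<^sup>+t. ennreal (norm (truncate N v t) powr p) \<partial>lborel)"
    if N: "N > 0" and v: "continuous_on {-N..N} v" for N and v :: "real \<Rightarrow> complex"
  proof -
    define a where "a = (\<lambda>i::nat. if i = 0 then (\<lambda>t. max 0 (Re (v t))) else if i = 1 then (\<lambda>t. max 0 (- Re (v t)))
       else if i = 2 then (\<lambda>t. max 0 (Im (v t))) else (\<lambda>t. max 0 (- Im (v t))))"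
    have ac: "continuous_on {-N..N} (a i)" for i
      using cauchy_op_truncate_complex(2-5)[OF v] by (auto simp: a_def)
    have a0: "a i t \<ge> 0" for i t by (auto simp: a_def)
    have av: "a i t \<le> norm (v t)" for i t
      using abs_Re_le_cmod[of "v t"] abs_Im_le_cmod[of "v t"] by (auto simp: a_def)
    let ?g = "\<lambda>i x. norm (cauchy_ext N (a i) (of_real x))"
    have gm: "(\<lambda>x. ?g i x) \<in> borel_measurable borel" for i
    proof -
      have "continuous_on {z. Im z > -1} (cauchy_ext N (a i))"
        by (rule holomorphic_on_imp_continuous_on[OF cauchy_ext_holomorphic[OF ac]])
      then have "continuous_on UNIV (\<lambda>x. cauchy_ext N (a i) (of_real x))"
        by (rule continuous_on_compose2) (auto intro!: continuous_intros)
      then show ?thesis by (intro borel_measurable_continuous_onI continuous_intros)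
    qed
    have S4: "{..<4} = {0, 1, 2, 3::nat}" by auto
    have pt: "norm (cauchy_op (truncate N v) x) powr p \<le> 4 powr p * (\<Sum>i<4. ?g i x powr p)" for x
    proof -
      have "norm (cauchy_op (truncate N v) x) \<le> ?g 0 x + ?g 1 x + (?g 2 x + ?g 3 x)"
        unfolding cauchy_op_truncate_complex(1)[OF v] a_def
        by (intro norm_triangle_le add_mono order_trans[OF norm_triangle_ineq4]) (auto simp: norm_mult intro: norm_triangle_ineq4)
      also have "\<dots> = (\<Sum>i<4. ?g i x)" by (simp add: S4)
      finally have "norm (cauchy_op (truncate N v) x) powr p \<le> (\<Sum>i<4. ?g i x) powr p"
        using p by (intro powr_mono2) auto
      also have "\<dots> \<le> 4 powr p * (\<Sum>i<4. ?g i x powr p)"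
        using sum_powr_le[of "{..<4::nat}" "\<lambda>i. ?g i x" p] p by simp
      finally show ?thesis .
    qed
    have "(\<integral>\<^sup>+x. ennreal (norm (cauchy_op (truncate N v) x) powr p) \<partial>lborel)
       \<le> (\<integral>\<^sup>+x. ennreal (4 powr p) * (\<Sum>i<4. ennreal (?g i x powr p)) \<partial>lborel)"
    proof (rule nn_integral_mono)
      fix x show "ennreal (norm (cauchy_op (truncate N v) x) powr p) \<le> ennreal (4 powr p) * (\<Sum>i<4. ennreal (?g i x powr p))"
        using pt[of x] by (subst sum_ennreal) (auto simp: ennreal_mult[symmetric] sum_nonneg intro!: ennreal_leI)
    qed
    also have "\<dots> = ennreal (4 powr p) * (\<Sum>i<4. \<integral>\<^sup>+x. ennreal (?g i x powr p) \<partial>lborel)"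
    proof -
      have [measurable]: "(\<lambda>x. ennreal (?g i x powr p)) \<in> borel_measurable lborel" for i
        using gm[of i] by simp
      have "(\<integral>\<^sup>+x. ennreal (4 powr p) * (\<Sum>i<4. ennreal (?g i x powr p)) \<partial>lborel)
         = ennreal (4 powr p) * (\<integral>\<^sup>+x. (\<Sum>i<4. ennreal (?g i x powr p)) \<partial>lborel)"
        by (rule nn_integral_cmult) measurable
      also have "(\<integral>\<^sup>+x. (\<Sum>i<(4::nat). ennreal (?g i x powr p)) \<partial>lborel) = (\<Sum>i<4. \<integral>\<^sup>+x. ennreal (?g i x powr p) \<partial>lborel)"
        by (rule nn_integral_sum) measurable
      finally show ?thesis .
    qed
    also have "\<dots> \<le> ennreal (4 powr p) * (\<Sum>i<(4::nat). ennreal C * (\<integral>\<^sup>+t. ennreal (norm (truncate N v t) powr p) \<partial>lborel))"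
    proof (intro mult_left_mono sum_mono)
      fix i :: nat
      have "(\<integral>\<^sup>+x. ennreal (?g i x powr p) \<partial>lborel) \<le> ennreal C * (\<integral>\<^sup>+t. ennreal (norm (truncate N (a i) t) powr p) \<partial>lborel)"
        by (rule C(2)[OF N ac]) (use a0 in auto)
      also have "\<dots> \<le> ennreal C * (\<integral>\<^sup>+t. ennreal (norm (truncate N v t) powr p) \<partial>lborel)"
        using a0 av p by (intro mult_left_mono nn_integral_mono ennreal_leI powr_mono2) (auto simp: truncate_def indicator_def)
      finally show "(\<integral>\<^sup>+x. ennreal (?g i x powr p) \<partial>lborel) \<le> ennreal C * (\<integral>\<^sup>+t. ennreal (norm (truncate N v t) powr p) \<partial>lborel)" .
    qed auto
    also have "\<dots> = ennreal (4 powr p * (4 * C)) * (\<integral>\<^sup>+t. ennreal (norm (truncate N v t) powr p) \<partial>lborel)"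
      using C(1) by (simp add: ennreal_mult mult.assoc)
    finally show ?thesis .
  qed
  then show ?thesis unfolding cauchy_bounded_def using C(1) by (intro exI[of _ "4 powr p * (4 * C)"]) auto
qed


text \<open>
  The kernel at \<open>-s\<close> is the complex conjugate of the kernel at \<open>s\<close>, so the transpose satisfies
  the same estimates as the operator.
\<close>

lemma cauchy_op_adjoint:
  assumes u: "integrable lborel u" and v: "integrable lborel v"
  shows "(LINT x|lborel. v x * cauchy_op u x) = (LINT y|lborel. u y * cnj (cauchy_op (\<lambda>x. cnj (v x)) y))"
proof -
  have "(LINT x|lborel. v x * cauchy_op u x) = (LINT y|lborel. u y * (LINT x|lborel. v x * (1 / (1 - \<i> * complex_of_real (x - y)))))"
    unfolding cauchy_op_def
    by (rule fubini_bounded_kernel[OF u v, where B = 1]) (measurable, rule cauchy_kernel_norm)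
  moreover have "(LINT x|lborel. v x * (1 / (1 - \<i> * complex_of_real (x - y)))) = cnj (cauchy_op (\<lambda>x. cnj (v x)) y)" for y
  proof -
    have "cnj (cauchy_op (\<lambda>x. cnj (v x)) y) = (LINT x|lborel. cnj (cnj (v x) * (1 / (1 - \<i> * complex_of_real (y - x)))))"
      unfolding cauchy_op_def
      by (rule integral_bounded_linear[OF bounded_linear_cnj cauchy_op_integrable, symmetric]) (use v in simp)
    also have "\<dots> = (LINT x|lborel. v x * (1 / (1 - \<i> * complex_of_real (x - y))))"
      by (rule Bochner_Integration.integral_cong) (auto simp: algebra_simps)
    finally show ?thesis by simp
  qed
  ultimately show ?thesis by simp
qed

lemma weighted_young:
  fixes p q :: real
  assumes "p > 1" "q > 1" "1/p + 1/q = 1" "a \<ge> 0" "b \<ge> 0" "l > 0"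
  shows "a * b \<le> l powr p * a powr p + l powr (- q) * b powr q"
proof -
  have "a * b = (l * a) * (b / l)" using assms by simp
  also have "\<dots> \<le> (l * a) powr p / p + (b / l) powr q / q"
    using assms by (intro Youngs_inequality) auto
  also have "\<dots> \<le> (l * a) powr p + (b / l) powr q"
    using assms by (intro add_mono) (auto simp: divide_le_eq mult_left_le_one_le intro!: mult_le_cancel_left1[THEN iffD2])
  also have "\<dots> = l powr p * a powr p + l powr (- q) * b powr q"
    using assms by (simp add: powr_mult powr_divide powr_minus_divide)
  finally show ?thesis .
qed

text \<open>
  Test \<open>w = cauchy_op u\<close> against \<open>v = \<bar>w\<bar> powr (p - 2) * cnj w\<close> on an interval: the pairing is the
  integral \<open>j\<close> of \<open>\<bar>w\<bar> powr p\<close>, and so is the integral of \<open>\<bar>v\<bar> powr q\<close>. Young's inequality with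
  the parameter \<open>l\<close> bounds \<open>j\<close> by a multiple of the integral of \<open>\<bar>u\<bar> powr p\<close> plus at most \<open>j / 2\<close>, which
  is absorbed because \<open>j\<close> is finite.
\<close>

lemma cauchy_bounded_dual:
  fixes p q :: real
  assumes p: "p > 2" and q: "1/p + 1/q = 1" "q > 1" and bq: "cauchy_bounded q"
  shows "cauchy_bounded p"
proof -
  obtain C where C: "C \<ge> 0" "\<And>N v. N > 0 \<Longrightarrow> continuous_on {-N..N} (v :: real \<Rightarrow> complex) \<Longrightarrow>
    (\<integral>\<^sup>+x. ennreal (norm (cauchy_op (truncate N v) x) powr q) \<partial>lborel)
      \<le> ennreal C * (\<integral>\<^sup>+t. ennreal (norm (truncate N v t) powr q) \<partial>lborel)"
    using bq unfolding cauchy_bounded_def by blast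
  (* The parameter of the weighted inequality, chosen such that the second term is at most j / 2. *)
  define l where "l = (2 * C + 1) powr (1 / q)"
  have l: "l > 0" using C(1) by (simp add: l_def)
  have lq: "l powr (- q) * C \<le> 1 / 2"
  proof -
    have "l powr (- q) = 1 / (2 * C + 1)" using C(1) q(2) by (simp add: l_def powr_powr powr_minus_divide)
    moreover have "1 / (2 * C + 1) * C \<le> 1 / 2" using C(1) by (simp add: field_simps)
    ultimately show ?thesis by simp
  qed
  have pq: "(p - 1) * q = p" using q p by (simp add: field_simps)
  have "(\<integral>\<^sup>+x. ennreal (norm (cauchy_op (truncate N u) x) powr p) \<partial>lborel)
      \<le> ennreal (2 * l powr p) * (\<integral>\<^sup>+t. ennreal (norm (truncate N u t) powr p) \<partial>lborel)"
    if N: "N > 0" and u: "continuous_on {-N..N} u" for N and u :: "real \<Rightarrow> complex"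
  proof -
    define w where "w = cauchy_op (truncate N u)"
    have wc: "continuous_on S w" for S unfolding w_def by (rule cauchy_op_truncate_continuous[OF u])
    have [measurable]: "w \<in> borel_measurable borel" by (intro borel_measurable_continuous_onI wc)
    have um[measurable]: "truncate N u \<in> borel_measurable borel" by (rule truncate_measurable[OF u])
    have ui: "integrable lborel (truncate N u)" by (rule truncate_integrable[OF u])
    define v where "v x = complex_of_real (norm (w x) powr (p - 2)) * cnj (w x)" for x
    have vc: "continuous_on S v" for S
      unfolding v_def using p by (intro continuous_intros continuous_on_powr' wc) auto
    have vw: "v x * w x = complex_of_real (norm (w x) powr p)" for x
    proof (cases "w x = 0")
      case False
      have "cnj (w x) * w x = complex_of_real (norm (w x) powr 2)"
      proof -
        have "norm (w x) powr 2 = (norm (w x))\<^sup>2" using False powr_realpow[of "norm (w x)" 2] by simp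
        then show ?thesis using complex_norm_square[of "w x"] by (simp only: mult.commute)
      qed
      then have "v x * w x = complex_of_real (norm (w x) powr (p - 2) * norm (w x) powr 2)"
        by (simp add: v_def mult.assoc)
      moreover have "norm (w x) powr (p - 2) * norm (w x) powr 2 = norm (w x) powr p"
        by (simp only: powr_add[symmetric]) simp
      ultimately show ?thesis by (simp only:)
    qed (use p in \<open>simp add: v_def\<close>)
    have nv: "norm (v x) powr q = norm (w x) powr p" for x
    proof (cases "w x = 0")
      case False
      have "norm (v x) = norm (w x) powr (p - 2) * norm (w x) powr 1" using False by (simp add: v_def norm_mult)
      also have "\<dots> = norm (w x) powr (p - 1)" by (simp only: powr_add[symmetric]) simp
      finally show ?thesis by (simp add: powr_powr pq)
    qed (use p q in \<open>simp add: v_def\<close>)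
    have part: "(\<integral>\<^sup>+x. ennreal (norm (w x) powr p) * indicator {- real k..real k} x \<partial>lborel)
      \<le> ennreal (2 * l powr p) * (\<integral>\<^sup>+t. ennreal (norm (truncate N u t) powr p) \<partial>lborel)" if k: "k > 0" for k :: nat
    proof (cases "(\<integral>\<^sup>+t. ennreal (norm (truncate N u t) powr p) \<partial>lborel) = \<infinity>")
      case True
      then show ?thesis using l by (simp add: ennreal_mult_top)
    next
      case ufin: False
      let ?K = "real k"
      have wpc: "continuous_on S (\<lambda>x. norm (w x) powr p)" for S
        using p by (intro continuous_intros continuous_on_powr' wc) auto
      define j where "j = integral {-?K..?K} (\<lambda>x. norm (w x) powr p)"
      have jI: "(\<integral>\<^sup>+x. ennreal (norm (w x) powr p) * indicator {-?K..?K} x \<partial>lborel) = ennreal j"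
        unfolding j_def by (rule nn_integral_has_integral_lebesgue') (auto intro!: integrable_integral integrable_continuous_interval wpc)
      have j0: "j \<ge> 0" unfolding j_def by (intro integral_nonneg integrable_continuous_interval wpc) auto
      have vi: "integrable lborel (truncate ?K v)" by (rule truncate_integrable[OF vc])
      have [measurable]: "truncate ?K v \<in> borel_measurable borel" by (rule truncate_measurable[OF vc])
      have ct: "(\<lambda>x. cnj (truncate ?K v x)) = truncate ?K (\<lambda>x. cnj (v x))" by (auto simp: truncate_def)
      define T where "T = cauchy_op (\<lambda>x. cnj (truncate ?K v x))"
      have [measurable]: "T \<in> borel_measurable borel" 
        unfolding T_def ct by (intro cauchy_op_measurable truncate_measurable continuous_intros vc)
      have "complex_of_real j = (LINT x|lborel. truncate ?K v x * w x)"
      proof -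
        have "(LINT x|lborel. truncate ?K v x * w x) = (LINT x|lborel. complex_of_real (indicator {-?K..?K} x *\<^sub>R norm (w x) powr p))"
          by (rule Bochner_Integration.integral_cong) (auto simp: truncate_def vw[symmetric] indicator_def)
        also have "\<dots> = complex_of_real (LINT x:{-?K..?K}|lborel. norm (w x) powr p)"
          by (simp only: integral_complex_of_real set_lebesgue_integral_def)
        also have "(LINT x:{-?K..?K}|lborel. norm (w x) powr p) = j"
          unfolding j_def by (rule set_borel_integral_eq_integral(2)[OF borel_integrable_atLeastAtMost'[OF wpc]])
        finally show ?thesis by simp
      qed
      also have "\<dots> = (LINT y|lborel. truncate N u y * cnj (T y))"
        unfolding w_def T_def by (rule cauchy_op_adjoint[OF ui vi])
      finally have "j = norm (LINT y|lborel. truncate N u y * cnj (T y))" using j0 by (metis norm_of_real abs_of_nonneg)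
      then have "ennreal j \<le> (\<integral>\<^sup>+y. ennreal (norm (truncate N u y * cnj (T y))) \<partial>lborel)"
        using integral_norm_bound_ennreal[of lborel "\<lambda>y. truncate N u y * cnj (T y)"]
        by (metis ennreal_0 not_integrable_integral_eq norm_zero zero_le)
      also have "\<dots> \<le> (\<integral>\<^sup>+y. ennreal (l powr p) * ennreal (norm (truncate N u y) powr p) + ennreal (l powr (- q)) * ennreal (norm (T y) powr q) \<partial>lborel)"
      proof (rule nn_integral_mono)
        fix y
        have "norm (truncate N u y) * norm (T y) \<le> l powr p * norm (truncate N u y) powr p + l powr (- q) * norm (T y) powr q"
          by (rule weighted_young) (use p q l in auto)
        then show "ennreal (norm (truncate N u y * cnj (T y))) \<le> ennreal (l powr p) * ennreal (norm (truncate N u y) powr p) + ennreal (l powr (- q)) * ennreal (norm (T y) powr q)"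
          by (simp add: norm_mult ennreal_mult[symmetric] ennreal_plus[symmetric] del: ennreal_plus)
      qed
      also have "\<dots> = ennreal (l powr p) * (\<integral>\<^sup>+y. ennreal (norm (truncate N u y) powr p) \<partial>lborel) + ennreal (l powr (- q)) * (\<integral>\<^sup>+y. ennreal (norm (T y) powr q) \<partial>lborel)"
        by (subst nn_integral_add) (simp_all add: nn_integral_cmult)
      also have "(\<integral>\<^sup>+y. ennreal (norm (T y) powr q) \<partial>lborel) \<le> ennreal C * (\<integral>\<^sup>+t. ennreal (norm (truncate ?K (\<lambda>x. cnj (v x)) t) powr q) \<partial>lborel)"
        unfolding T_def ct by (rule C(2)) (use k vc in \<open>auto intro!: continuous_intros\<close>)
      also have "(\<integral>\<^sup>+t. ennreal (norm (truncate ?K (\<lambda>x. cnj (v x)) t) powr q) \<partial>lborel)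
          = (\<integral>\<^sup>+x. ennreal (norm (w x) powr p) * indicator {-?K..?K} x \<partial>lborel)"
        by (rule nn_integral_cong) (use q in \<open>auto simp: truncate_def indicator_def nv\<close>)
      also have "\<dots> = ennreal j" by (rule jI)
      finally have le: "ennreal j \<le> ennreal (l powr p) * (\<integral>\<^sup>+y. ennreal (norm (truncate N u y) powr p) \<partial>lborel)
           + ennreal (l powr (- q)) * (ennreal C * ennreal j)"
        by (simp add: mult_left_mono add_left_mono)
      obtain U where U: "(\<integral>\<^sup>+y. ennreal (norm (truncate N u y) powr p) \<partial>lborel) = ennreal U" "U \<ge> 0"
        using ufin by (cases "(\<integral>\<^sup>+y. ennreal (norm (truncate N u y) powr p) \<partial>lborel)") auto
      have "ennreal j \<le> ennreal (l powr p * U + l powr (- q) * (C * j))"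
        using le C(1) j0 U by (simp add: ennreal_mult[symmetric] ennreal_plus[symmetric] del: ennreal_plus)
      then have "j \<le> l powr p * U + l powr (- q) * C * j"
        using C(1) j0 U(2) by (subst (asm) ennreal_le_iff) (auto simp: mult.assoc)
      also have "l powr (- q) * C * j \<le> 1/2 * j" by (rule mult_right_mono[OF lq j0])
      finally have "j \<le> 2 * l powr p * U" by simp
      then show ?thesis unfolding jI U(1) using U(2) by (simp add: ennreal_mult[symmetric] ennreal_leI)
    qed
    have "(\<integral>\<^sup>+x. ennreal (norm (w x) powr p) \<partial>lborel)
        \<le> ennreal (2 * l powr p) * (\<integral>\<^sup>+t. ennreal (norm (truncate N u t) powr p) \<partial>lborel)"
      by (rule nn_integral_le_of_intervals) (measurable, rule part)
    then show ?thesis by (simp add: w_def)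
  qed
  then show ?thesis unfolding cauchy_bounded_def by (intro exI[of _ "2 * l powr p"]) auto
qed

lemma cauchy_bounded: "p > 1 \<Longrightarrow> cauchy_bounded p"
proof (cases "p \<le> 2")
  case False
  define q where "q = p / (p - 1)"
  have q: "1/p + 1/q = 1" "q > 1" "q \<le> 2" using False by (auto simp: q_def field_simps)
  show ?thesis by (rule cauchy_bounded_dual[OF _ q(1,2) cauchy_bounded_le_2[OF q(2,3)]]) (use False in simp)
qed (rule cauchy_bounded_le_2)

text \<open>
  The constant for truncated functions does not depend on the interval, so Fatou's lemma gives
  the estimate for the function itself.
\<close>

theorem cauchy_op_Lp:
  assumes p: "p > 1"
  shows "\<exists>C\<ge>0. \<forall>u. continuous_on UNIV u \<longrightarrow> integrable lborel u \<longrightarrow>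
    (\<integral>\<^sup>+x. ennreal (norm (cauchy_op u x) powr p) \<partial>lborel) \<le> ennreal C * (\<integral>\<^sup>+t. ennreal (norm (u t) powr p) \<partial>lborel)"
proof -
  obtain C where C: "C \<ge> 0" "\<And>N v. N > 0 \<Longrightarrow> continuous_on {-N..N} (v :: real \<Rightarrow> complex) \<Longrightarrow>
    (\<integral>\<^sup>+x. ennreal (norm (cauchy_op (truncate N v) x) powr p) \<partial>lborel)
      \<le> ennreal C * (\<integral>\<^sup>+t. ennreal (norm (truncate N v t) powr p) \<partial>lborel)"
    using cauchy_bounded[OF p] unfolding cauchy_bounded_def by blast
  have "(\<integral>\<^sup>+x. ennreal (norm (cauchy_op u x) powr p) \<partial>lborel) \<le> ennreal C * (\<integral>\<^sup>+t. ennreal (norm (u t) powr p) \<partial>lborel)"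
    if uc: "continuous_on UNIV u" and ui: "integrable lborel u" for u
  proof -
    have [measurable]: "u \<in> borel_measurable borel" using ui by auto
    let ?w = "\<lambda>k::nat. cauchy_op (truncate (real (Suc k)) u)"
    have uc': "continuous_on {-real (Suc k)..real (Suc k)} u" for k using uc by (rule continuous_on_subset) simp
    have wm: "?w k \<in> borel_measurable borel" for k
      by (intro cauchy_op_measurable truncate_measurable uc')
    have lim: "(\<lambda>k. ?w k x) \<longlonglongrightarrow> cauchy_op u x" for x
      unfolding cauchy_op_def
    proof (rule integral_dominated_convergence[where w = "\<lambda>y. norm (u y)"])
      show "AE y in lborel. (\<lambda>k. truncate (real (Suc k)) u y * (1 / (1 - \<i> * complex_of_real (x - y)))) \<longlonglongrightarrow> u y * (1 / (1 - \<i> * complex_of_real (x - y)))"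
      proof (rule AE_I2)
        fix y
        obtain n where n: "\<bar>y\<bar> \<le> real n" using real_arch_simple by blast
        have "\<forall>\<^sub>F k in sequentially. truncate (real (Suc k)) u y = u y"
          using eventually_ge_at_top[of n] by eventually_elim (use n in \<open>auto simp: truncate_def indicator_def abs_le_iff\<close>)
        then have "(\<lambda>k. truncate (real (Suc k)) u y) \<longlonglongrightarrow> u y" by (rule tendsto_eventually)
        then show "(\<lambda>k. truncate (real (Suc k)) u y * (1 / (1 - \<i> * complex_of_real (x - y)))) \<longlonglongrightarrow> u y * (1 / (1 - \<i> * complex_of_real (x - y)))"
          by (rule tendsto_mult_right)
      qed
      show "AE y in lborel. norm (truncate (real (Suc k)) u y * (1 / (1 - \<i> * complex_of_real (x - y)))) \<le> norm (u y)" for k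
      proof (rule AE_I2)
        fix y
        have "norm (truncate (real (Suc k)) u y) \<le> norm (u y)" by (auto simp: truncate_def indicator_def)
        then have "norm (truncate (real (Suc k)) u y) * norm (1 / (1 - \<i> * complex_of_real (x - y))) \<le> norm (u y) * 1"
          by (intro mult_mono cauchy_kernel_norm) auto
        then show "norm (truncate (real (Suc k)) u y * (1 / (1 - \<i> * complex_of_real (x - y)))) \<le> norm (u y)" by (simp only: norm_mult mult_1_right)
      qed
      show "(\<lambda>y. truncate (real (Suc k)) u y * (1 / (1 - \<i> * complex_of_real (x - y)))) \<in> borel_measurable lborel" for k
        using truncate_measurable[OF uc', of k] by measurable
    qed (use ui in auto)
    have "(\<integral>\<^sup>+x. ennreal (norm (cauchy_op u x) powr p) \<partial>lborel) = (\<integral>\<^sup>+x. liminf (\<lambda>k. ennreal (norm (?w k x) powr p)) \<partial>lborel)"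
    proof (rule nn_integral_cong)
      fix x
      have "(\<lambda>k. ennreal (norm (?w k x) powr p)) \<longlonglongrightarrow> ennreal (norm (cauchy_op u x) powr p)"
        by (intro tendsto_ennrealI tendsto_powr2 tendsto_norm lim) (use p in auto)
      then show "ennreal (norm (cauchy_op u x) powr p) = liminf (\<lambda>k. ennreal (norm (?w k x) powr p))"
        by (intro lim_imp_Liminf[symmetric]) auto
    qed
    also have "\<dots> \<le> liminf (\<lambda>k. \<integral>\<^sup>+x. ennreal (norm (?w k x) powr p) \<partial>lborel)"
      by (rule nn_integral_liminf) (use wm in measurable)
    also have "\<dots> \<le> ennreal C * (\<integral>\<^sup>+t. ennreal (norm (u t) powr p) \<partial>lborel)"
    proof (rule Liminf_le)
      have "(\<integral>\<^sup>+x. ennreal (norm (?w k x) powr p) \<partial>lborel) \<le> ennreal C * (\<integral>\<^sup>+t. ennreal (norm (u t) powr p) \<partial>lborel)" for k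
      proof -
        have "(\<integral>\<^sup>+x. ennreal (norm (?w k x) powr p) \<partial>lborel) \<le> ennreal C * (\<integral>\<^sup>+t. ennreal (norm (truncate (real (Suc k)) u t) powr p) \<partial>lborel)"
          by (rule C(2)[OF _ uc']) simp
        also have "\<dots> \<le> ennreal C * (\<integral>\<^sup>+t. ennreal (norm (u t) powr p) \<partial>lborel)"
          using p by (intro mult_left_mono nn_integral_mono ennreal_leI powr_mono2) (auto simp: truncate_def indicator_def)
        finally show ?thesis .
      qed
      then show "\<forall>\<^sub>F k in sequentially. (\<integral>\<^sup>+x. ennreal (norm (?w k x) powr p) \<partial>lborel) \<le> ennreal C * (\<integral>\<^sup>+t. ennreal (norm (u t) powr p) \<partial>lborel)"
        by simp
    qed simp
    finally show ?thesis .
  qed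
  then show ?thesis using C(1) by blast
qed

section \<open>Symbol bounds along a coordinate direction\<close>

lemma one_plus_norm_nonzero [simp]: "1 + norm x \<noteq> 0"
  using norm_ge_zero[of x] by linarith

text \<open>
  The exponent \<open>e\<close> measures decay at infinity, \<open>d\<close> the order of the singularity at the origin.
\<close>

definition sym_weight :: "real \<Rightarrow> real \<Rightarrow> 'a::real_normed_vector \<Rightarrow> real"
  where "sym_weight e d \<xi> = (1 + norm \<xi>) powr (- e) * norm \<xi> powr (- d)"

lemma sym_weight_nonneg: "sym_weight e d \<xi> \<ge> 0" by (simp add: sym_weight_def)

lemma sym_weight_mult: "sym_weight e d \<xi> * sym_weight e' d' \<xi> = sym_weight (e + e') (d + d') \<xi>"
proof -
  have "sym_weight e d \<xi> * sym_weight e' d' \<xi>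
     = ((1 + norm \<xi>) powr (- e) * (1 + norm \<xi>) powr (- e')) * (norm \<xi> powr (- d) * norm \<xi> powr (- d'))"
    by (simp add: sym_weight_def mult_ac)
  also have "\<dots> = sym_weight (e + e') (d + d') \<xi>"
    unfolding sym_weight_def powr_add[symmetric] by (simp add: algebra_simps)
  finally show ?thesis .
qed

text \<open>
  Since \<open>\<bar>\<xi>\<bar> \<le> 1 + \<bar>\<xi>\<bar>\<close>, decay at infinity may be traded for singularity at the origin.
\<close>

lemma sym_weight_mono:
  assumes "0 \<le> k" "e' + k \<le> e" "d' = d + k" "\<xi> \<noteq> 0"
  shows "sym_weight e d \<xi> \<le> sym_weight e' d' \<xi>"
proof -
  have "sym_weight e d \<xi> \<le> sym_weight (e' + k) d \<xi>"
    unfolding sym_weight_def using assms by (intro mult_right_mono powr_mono) auto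
  also have "\<dots> = sym_weight e' d' \<xi> * ((1 + norm \<xi>) powr (- k) * norm \<xi> powr k)"
    using sym_weight_mult[of e' d' \<xi> k "- k"] assms by (simp add: sym_weight_def)
  also have "\<dots> \<le> sym_weight e' d' \<xi> * ((1 + norm \<xi>) powr (- k) * (1 + norm \<xi>) powr k)"
    using assms by (intro mult_left_mono powr_mono2 sym_weight_nonneg) auto
  also have "\<dots> = sym_weight e' d' \<xi>" by (simp add: powr_add[symmetric])
  finally show ?thesis .
qed

lemma dir_deriv_transform:
  assumes "dir_deriv j f f' \<xi>" and S: "open S" "\<xi> \<in> S" "\<And>\<eta>. \<eta> \<in> S \<Longrightarrow> f \<eta> = g \<eta>" and "f' \<xi> = g' \<xi>"
  shows "dir_deriv j g g' \<xi>"
  unfolding dir_deriv_def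
proof (rule has_vector_derivative_transform_within_open)
  show "((\<lambda>t. f (\<xi> + t *\<^sub>R axis j 1)) has_vector_derivative g' \<xi>) (at 0)"
    using assms(1,5) by (simp add: dir_deriv_def)
  have "continuous_on UNIV (\<lambda>t::real. \<xi> + t *\<^sub>R axis j 1)" by (intro continuous_intros)
  then have "open ((\<lambda>t::real. \<xi> + t *\<^sub>R axis j 1) -` S)" using S(1) by (simp add: continuous_on_open_vimage)
  then show "open {t. \<xi> + t *\<^sub>R axis j 1 \<in> S}" by (simp add: vimage_def)
qed (use S in auto)

lemma dir_deriv_mult:
  assumes "dir_deriv j f f' \<xi>" "dir_deriv j g g' \<xi>"
  shows "dir_deriv j (\<lambda>\<xi>. f \<xi> * g \<xi>) (\<lambda>\<xi>. f \<xi> * g' \<xi> + f' \<xi> * g \<xi>) \<xi>"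
  using has_vector_derivative_mult[OF assms[unfolded dir_deriv_def]] by (simp add: dir_deriv_def)

lemma dir_deriv_exp:
  assumes "dir_deriv j (\<lambda>\<xi>. complex_of_real (\<theta> \<xi>)) \<theta>' \<xi>"
  shows "dir_deriv j (\<lambda>\<xi>. exp (\<i> * complex_of_real (\<theta> \<xi>))) (\<lambda>\<xi>. \<i> * (\<theta>' \<xi> * exp (\<i> * complex_of_real (\<theta> \<xi>)))) \<xi>"
proof -
  have 1: "((\<lambda>t. \<i> * complex_of_real (\<theta> (\<xi> + t *\<^sub>R axis j 1))) has_vector_derivative \<i> * \<theta>' \<xi>) (at 0)"
    using assms unfolding dir_deriv_def by (rule has_vector_derivative_mult_right)
  have "((exp \<circ> (\<lambda>t. \<i> * complex_of_real (\<theta> (\<xi> + t *\<^sub>R axis j 1)))) has_vector_derivative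
      (\<i> * \<theta>' \<xi>) * exp (\<i> * complex_of_real (\<theta> (\<xi> + 0 *\<^sub>R axis j 1)))) (at 0)"
    by (rule field_vector_diff_chain_at[OF 1]) (auto intro: DERIV_exp)
  then show ?thesis by (simp add: dir_deriv_def o_def mult_ac)
qed

context
  fixes j :: "'n::finite" and X :: "'x set"
begin

text \<open>
  Families of symbols, indexed by \<open>x \<in> X\<close>, that have \<open>k\<close> derivatives in direction \<open>j\<close> away from the
  origin, with bounds that are uniform in \<open>x\<close>. Each derivative makes the singularity at the origin worse
  by one power but keeps the decay at infinity, which is provided by a cut-off in the end.
\<close>

primrec sym_class :: "nat \<Rightarrow> real \<Rightarrow> real \<Rightarrow> ('x \<Rightarrow> real^'n \<Rightarrow> complex) \<Rightarrow> bool"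
  where
    "sym_class 0 e d f \<longleftrightarrow> (\<exists>C. \<forall>x\<in>X. \<forall>\<xi>. \<xi> \<noteq> 0 \<longrightarrow> norm (f x \<xi>) \<le> C * sym_weight e d \<xi>)"
  | "sym_class (Suc k) e d f \<longleftrightarrow>
      (\<exists>C. \<forall>x\<in>X. \<forall>\<xi>. \<xi> \<noteq> 0 \<longrightarrow> norm (f x \<xi>) \<le> C * sym_weight e d \<xi>) \<and>
      (\<exists>f'. (\<forall>x\<in>X. \<forall>\<xi>. \<xi> \<noteq> 0 \<longrightarrow> dir_deriv j (f x) (f' x) \<xi>) \<and> sym_class k e (d + 1) f')"

lemma sym_class_bound:
  "sym_class k e d f \<Longrightarrow> \<exists>C\<ge>0. \<forall>x\<in>X. \<forall>\<xi>. \<xi> \<noteq> 0 \<longrightarrow> norm (f x \<xi>) \<le> C * sym_weight e d \<xi>"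
proof -
  assume "sym_class k e d f"
  then obtain C where C: "\<forall>x\<in>X. \<forall>\<xi>. \<xi> \<noteq> 0 \<longrightarrow> norm (f x \<xi>) \<le> C * sym_weight e d \<xi>"
    by (cases k) auto
  have "norm (f x \<xi>) \<le> \<bar>C\<bar> * sym_weight e d \<xi>" if "x \<in> X" "\<xi> \<noteq> 0" for x \<xi>
    using C that mult_right_mono[OF abs_ge_self[of C] sym_weight_nonneg[of e d \<xi>]] by (meson order_trans)
  then show ?thesis by (metis abs_ge_zero)
qed

lemma sym_class_Suc_D: "sym_class (Suc k) e d f \<Longrightarrow> sym_class k e d f"
proof (induction k arbitrary: d f)
  case (Suc k)
  from Suc.prems obtain f' where "\<forall>x\<in>X. \<forall>\<xi>. \<xi> \<noteq> 0 \<longrightarrow> dir_deriv j (f x) (f' x) \<xi>" "sym_class (Suc k) e (d + 1) f'"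
    by auto
  with Suc.IH[of "d + 1" f'] Suc.prems show ?case by auto
qed simp

lemma sym_class_mono:
  assumes "sym_class k e d f" "0 \<le> r" "e' + r \<le> e" "d' = d + r"
  shows "sym_class k e' d' f"
  using assms
proof (induction k arbitrary: d d' f)
  case 0
  then obtain C where C: "C \<ge> 0" "\<forall>x\<in>X. \<forall>\<xi>. \<xi> \<noteq> 0 \<longrightarrow> norm (f x \<xi>) \<le> C * sym_weight e d \<xi>"
    using sym_class_bound[OF 0(1)] by blast
  then have "norm (f x \<xi>) \<le> C * sym_weight e' d' \<xi>" if "x \<in> X" "\<xi> \<noteq> 0" for x \<xi>
    using that mult_left_mono[OF sym_weight_mono[OF 0(2-4) that(2)] C(1)] by (meson order_trans)
  then show ?case by auto
next
  case (Suc k)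
  obtain C where C: "C \<ge> 0" "\<forall>x\<in>X. \<forall>\<xi>. \<xi> \<noteq> 0 \<longrightarrow> norm (f x \<xi>) \<le> C * sym_weight e d \<xi>"
    using sym_class_bound[OF Suc.prems(1)] by blast
  then have "norm (f x \<xi>) \<le> C * sym_weight e' d' \<xi>" if "x \<in> X" "\<xi> \<noteq> 0" for x \<xi>
    using that mult_left_mono[OF sym_weight_mono[OF Suc.prems(2-4) that(2)] C(1)] by (meson order_trans)
  moreover obtain f' where "\<forall>x\<in>X. \<forall>\<xi>. \<xi> \<noteq> 0 \<longrightarrow> dir_deriv j (f x) (f' x) \<xi>" "sym_class k e (d + 1) f'"
    using Suc.prems by auto
  moreover have "sym_class k e' (d' + 1) f'"
    using Suc.IH[OF \<open>sym_class k e (d + 1) f'\<close> Suc.prems(2,3), of "d' + 1"] Suc.prems(4) by simp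
  ultimately show ?case by auto
qed

lemma sym_class_add:
  assumes "sym_class k e d f" "sym_class k e d g"
  shows "sym_class k e d (\<lambda>x \<xi>. f x \<xi> + g x \<xi>)"
proof -
  have b: "\<exists>C. \<forall>x\<in>X. \<forall>\<xi>. \<xi> \<noteq> 0 \<longrightarrow> norm (f x \<xi> + g x \<xi>) \<le> C * sym_weight e d \<xi>"
    if "sym_class k e d f" "sym_class k e d g" for k d f g
  proof -
    from sym_class_bound[OF that(1)] sym_class_bound[OF that(2)] obtain C D where
      C: "\<forall>x\<in>X. \<forall>\<xi>. \<xi> \<noteq> 0 \<longrightarrow> norm (f x \<xi>) \<le> C * sym_weight e d \<xi>" and
      D: "\<forall>x\<in>X. \<forall>\<xi>. \<xi> \<noteq> 0 \<longrightarrow> norm (g x \<xi>) \<le> D * sym_weight e d \<xi>" by metis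
    have "norm (f x \<xi> + g x \<xi>) \<le> (C + D) * sym_weight e d \<xi>" if "x \<in> X" "\<xi> \<noteq> 0" for x \<xi>
      using C D that norm_triangle_ineq[of "f x \<xi>" "g x \<xi>"] by (smt (verit) distrib_right)
    then show ?thesis by blast
  qed
  show ?thesis using assms
  proof (induction k arbitrary: d f g)
    case 0 then show ?case using b[of 0 d f g] by simp
  next
    case (Suc k)
    obtain f' g' where f': "\<forall>x\<in>X. \<forall>\<xi>. \<xi> \<noteq> 0 \<longrightarrow> dir_deriv j (f x) (f' x) \<xi>" "sym_class k e (d + 1) f'"
      and g': "\<forall>x\<in>X. \<forall>\<xi>. \<xi> \<noteq> 0 \<longrightarrow> dir_deriv j (g x) (g' x) \<xi>" "sym_class k e (d + 1) g'"
      using Suc.prems by auto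
    have "dir_deriv j (\<lambda>\<xi>. f x \<xi> + g x \<xi>) (\<lambda>\<xi>. f' x \<xi> + g' x \<xi>) \<xi>" if "x \<in> X" "\<xi> \<noteq> 0" for x \<xi>
      using f' g' that unfolding dir_deriv_def by (auto intro: has_vector_derivative_add)
    then show ?case using b[OF Suc.prems] Suc.IH[OF f'(2) g'(2)] by fastforce
  qed
qed

lemma sym_class_mult:
  assumes "sym_class k e d f" "sym_class k e' d' g"
  shows "sym_class k (e + e') (d + d') (\<lambda>x \<xi>. f x \<xi> * g x \<xi>)"
proof -
  have b: "\<exists>C. \<forall>x\<in>X. \<forall>\<xi>. \<xi> \<noteq> 0 \<longrightarrow> norm (f x \<xi> * g x \<xi>) \<le> C * sym_weight (e + e') (d + d') \<xi>"
    if "sym_class k e d f" "sym_class k e' d' g" for k d d' f g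
  proof -
    from sym_class_bound[OF that(1)] sym_class_bound[OF that(2)] obtain C D where C0: "C \<ge> 0" and
      C: "\<forall>x\<in>X. \<forall>\<xi>. \<xi> \<noteq> 0 \<longrightarrow> norm (f x \<xi>) \<le> C * sym_weight e d \<xi>" and
      D: "\<forall>x\<in>X. \<forall>\<xi>. \<xi> \<noteq> 0 \<longrightarrow> norm (g x \<xi>) \<le> D * sym_weight e' d' \<xi>" by metis
    have "norm (f x \<xi> * g x \<xi>) \<le> (C * D) * sym_weight (e + e') (d + d') \<xi>" if "x \<in> X" "\<xi> \<noteq> 0" for x \<xi>
    proof -
      have "norm (f x \<xi> * g x \<xi>) \<le> (C * sym_weight e d \<xi>) * (D * sym_weight e' d' \<xi>)"
        unfolding norm_mult using C D that C0 by (intro mult_mono) (auto simp: sym_weight_nonneg)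
      also have "\<dots> = (C * D) * (sym_weight e d \<xi> * sym_weight e' d' \<xi>)" by (simp add: mult_ac)
      finally show ?thesis by (simp add: sym_weight_mult)
    qed
    then show ?thesis by blast
  qed
  show ?thesis using assms
  proof (induction k arbitrary: d d' f g)
    case 0 then show ?case using b[of 0 d f d' g] by simp
  next
    case (Suc k)
    obtain f' g' where f': "\<forall>x\<in>X. \<forall>\<xi>. \<xi> \<noteq> 0 \<longrightarrow> dir_deriv j (f x) (f' x) \<xi>" "sym_class k e (d + 1) f'"
      and g': "\<forall>x\<in>X. \<forall>\<xi>. \<xi> \<noteq> 0 \<longrightarrow> dir_deriv j (g x) (g' x) \<xi>" "sym_class k e' (d' + 1) g'"
      using Suc.prems by auto
    have "dir_deriv j (\<lambda>\<xi>. f x \<xi> * g x \<xi>) (\<lambda>\<xi>. f x \<xi> * g' x \<xi> + f' x \<xi> * g x \<xi>) \<xi>" if "x \<in> X" "\<xi> \<noteq> 0" for x \<xi>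
      using f'(1) g'(1) that by (intro dir_deriv_mult) auto
    moreover have "sym_class k (e + e') (d + d' + 1) (\<lambda>x \<xi>. f x \<xi> * g' x \<xi> + f' x \<xi> * g x \<xi>)"
      using Suc.IH[OF sym_class_Suc_D[OF Suc.prems(1)] g'(2)] Suc.IH[OF f'(2) sym_class_Suc_D[OF Suc.prems(2)]]
      by (intro sym_class_add) (simp_all add: algebra_simps)
    ultimately show ?case using b[OF Suc.prems] by fastforce
  qed
qed

lemma sym_class_of_chain:
  assumes "\<And>i x \<xi>. i < k \<Longrightarrow> x \<in> X \<Longrightarrow> \<xi> \<noteq> 0 \<Longrightarrow> dir_deriv j (F i x) (F (Suc i) x) \<xi>"
    and "\<And>i. i \<le> k \<Longrightarrow> \<exists>C. \<forall>x\<in>X. \<forall>\<xi>. \<xi> \<noteq> 0 \<longrightarrow> norm (F i x \<xi>) \<le> C * sym_weight e (d + real i) \<xi>"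
  shows "sym_class k e d (F 0)"
  using assms
proof (induction k arbitrary: d F)
  case 0 then show ?case using 0(2)[of 0] by simp
next
  case (Suc k)
  have "sym_class k e (d + 1) (F (Suc 0))"
  proof (rule Suc.IH)
    show "\<exists>C. \<forall>x\<in>X. \<forall>\<xi>. \<xi> \<noteq> 0 \<longrightarrow> norm (F (Suc i) x \<xi>) \<le> C * sym_weight e (d + 1 + real i) \<xi>" if "i \<le> k" for i
      using Suc.prems(2)[of "Suc i"] that by (simp add: algebra_simps)
  qed (use Suc.prems(1) in auto)
  moreover have "\<forall>x\<in>X. \<forall>\<xi>. \<xi> \<noteq> 0 \<longrightarrow> dir_deriv j (F 0 x) (F (Suc 0) x) \<xi>" using Suc.prems(1)[of 0] by auto
  ultimately show ?case using Suc.prems(2)[of 0] by auto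
qed

text \<open>
  A symbol that is smooth at the origin does not gain decay by differentiation; \<open>k\<close> powers of decay
  are sacrificed in order to fit it into the class.
\<close>

lemma sym_class_of_regular_chain:
  assumes "\<And>i x \<xi>. i < k \<Longrightarrow> x \<in> X \<Longrightarrow> \<xi> \<noteq> 0 \<Longrightarrow> dir_deriv j (F i x) (F (Suc i) x) \<xi>"
    and "\<And>i. i \<le> k \<Longrightarrow> \<exists>C\<ge>0. \<forall>x\<in>X. \<forall>\<xi>. \<xi> \<noteq> 0 \<longrightarrow> norm (F i x \<xi>) \<le> C * (1 + norm \<xi>) powr (- e - real k)"
  shows "sym_class k e 0 (F 0)"
proof (rule sym_class_of_chain)
  fix i assume i: "i \<le> k"
  from assms(2)[OF this] obtain C where C: "C \<ge> 0"
    "\<forall>x\<in>X. \<forall>\<xi>. \<xi> \<noteq> 0 \<longrightarrow> norm (F i x \<xi>) \<le> C * (1 + norm \<xi>) powr (- e - real k)" by blast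
  have "norm (F i x \<xi>) \<le> C * sym_weight e (0 + real i) \<xi>" if "x \<in> X" "\<xi> \<noteq> 0" for x \<xi>
  proof -
    have "norm (F i x \<xi>) \<le> C * sym_weight (e + k) 0 \<xi>" using C that by (simp add: sym_weight_def algebra_simps)
    also have "\<dots> \<le> C * sym_weight e (0 + real i) \<xi>"
      by (rule mult_left_mono[OF sym_weight_mono[of "real i"] C(1)]) (use i that in auto)
    finally show ?thesis .
  qed
  then show "\<exists>C. \<forall>x\<in>X. \<forall>\<xi>. \<xi> \<noteq> 0 \<longrightarrow> norm (F i x \<xi>) \<le> C * sym_weight e (0 + real i) \<xi>" by blast
qed (rule assms(1))

text \<open>
  The converse of \<open>sym_class_of_chain\<close>: the derivatives hidden in the recursion become an explicit
  sequence.
\<close>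

lemma chain_of_sym_class:
  assumes "sym_class k e d f"
  shows "\<exists>F C. F 0 = f \<and> (\<forall>i<k. \<forall>x\<in>X. \<forall>\<xi>. \<xi> \<noteq> 0 \<longrightarrow> dir_deriv j (F i x) (F (Suc i) x) \<xi>) \<and>
     C \<ge> 0 \<and> (\<forall>x\<in>X. \<forall>\<xi>. \<xi> \<noteq> 0 \<longrightarrow> norm (F k x \<xi>) \<le> C * sym_weight e (d + real k) \<xi>)"
  using assms
proof (induction k arbitrary: d f)
  case 0
  from sym_class_bound[OF 0] obtain C where "C\<ge>0" "\<forall>x\<in>X. \<forall>\<xi>. \<xi> \<noteq> 0 \<longrightarrow> norm (f x \<xi>) \<le> C * sym_weight e d \<xi>" by blast
  then show ?case by (intro exI[of _ "\<lambda>_. f"] exI[of _ C]) auto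
next
  case (Suc k)
  obtain f' where f': "\<forall>x\<in>X. \<forall>\<xi>. \<xi> \<noteq> 0 \<longrightarrow> dir_deriv j (f x) (f' x) \<xi>" "sym_class k e (d + 1) f'"
    using Suc.prems by auto
  from Suc.IH[OF f'(2)] obtain F C where F: "F 0 = f'"
    "\<forall>i<k. \<forall>x\<in>X. \<forall>\<xi>. \<xi> \<noteq> 0 \<longrightarrow> dir_deriv j (F i x) (F (Suc i) x) \<xi>" "C \<ge> 0"
    "\<forall>x\<in>X. \<forall>\<xi>. \<xi> \<noteq> 0 \<longrightarrow> norm (F k x \<xi>) \<le> C * sym_weight e (d + 1 + real k) \<xi>" by blast
  show ?case
    by (intro exI[of _ "case_nat f F"] exI[of _ C])
       (use F f' in \<open>auto simp: less_Suc_eq_0_disj algebra_simps\<close>)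
qed

lemma sym_class_const:
  assumes "\<And>x. x \<in> X \<Longrightarrow> norm (c x) \<le> B"
  shows "sym_class k 0 0 (\<lambda>x \<xi>. c x)"
proof -
  have "sym_class k 0 0 ((\<lambda>i x \<xi>. if i = 0 then c x else 0) (0::nat))"
  proof (rule sym_class_of_chain[where F = "\<lambda>i x \<xi>. if i = 0 then c x else 0"])
    fix i
    have "norm (if i = 0 then c x else 0) \<le> \<bar>B\<bar> * sym_weight 0 (0 + real i) \<xi>" if "x \<in> X" "\<xi> \<noteq> 0" for x \<xi>
      using assms[OF that(1)] that by (auto simp: sym_weight_def)
    then show "\<exists>C. \<forall>x\<in>X. \<forall>\<xi>::real^'n. \<xi> \<noteq> 0 \<longrightarrow> norm (if i = 0 then c x else 0) \<le> C * sym_weight 0 (0 + real i) \<xi>"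
      by blast
  qed (auto simp: dir_deriv_def)
  then show ?thesis by simp
qed

text \<open>
  The derivative of \<open>exp (\<i> \<theta>)\<close> is \<open>\<i> \<theta>'\<close> times the same function, so its derivatives do not decay at
  infinity; each costs one power of growth there.
\<close>

lemma sym_class_exp:
  assumes "\<And>x \<xi>. x \<in> X \<Longrightarrow> \<xi> \<noteq> 0 \<Longrightarrow> dir_deriv j (\<lambda>\<xi>. complex_of_real (\<theta> x \<xi>)) (\<theta>' x) \<xi>"
    and "sym_class k 0 0 \<theta>'"
  shows "sym_class k (- real k) 0 (\<lambda>x \<xi>. exp (\<i> * complex_of_real (\<theta> x \<xi>)))"
  using assms(2)
proof (induction k)
  case 0
  then show ?case by (auto simp: sym_weight_def intro!: exI[of _ 1])
next
  case (Suc k)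
  have IH: "sym_class k (- real k) 0 (\<lambda>x \<xi>. exp (\<i> * complex_of_real (\<theta> x \<xi>)))"
    by (rule Suc.IH[OF sym_class_Suc_D[OF Suc.prems]])
  let ?f' = "\<lambda>x \<xi>. \<i> * (\<theta>' x \<xi> * exp (\<i> * complex_of_real (\<theta> x \<xi>)))"
  have "sym_class k (0 + (0 + (- real k))) (0 + (0 + 0)) ?f'"
    by (rule sym_class_mult[OF sym_class_const[of _ 1] sym_class_mult[OF sym_class_Suc_D[OF Suc.prems] IH]]) auto
  then have cls: "sym_class k (- real (Suc k)) (0 + 1) ?f'" by (rule sym_class_mono[where r = 1]) auto
  have der: "dir_deriv j (\<lambda>\<xi>. exp (\<i> * complex_of_real (\<theta> x \<xi>))) (?f' x) \<xi>" if "x \<in> X" "\<xi> \<noteq> 0" for x \<xi>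
    by (rule dir_deriv_exp[OF assms(1)[OF that]])
  have bd: "norm (exp (\<i> * complex_of_real (\<theta> x \<xi>))) \<le> 1 * sym_weight (- real (Suc k)) 0 \<xi>" if "\<xi> \<noteq> 0" for x and \<xi> :: "real^'n"
  proof -
    have "1 \<le> (1 + norm \<xi>) powr real (Suc k)" by (rule ge_one_powr_ge_zero) auto
    then show ?thesis using that by (simp only: sym_weight_def minus_minus minus_zero powr_zero_eq_one norm_exp_i_times) simp
  qed
  show ?case
    unfolding sym_class.simps
    by (intro conjI exI[of _ 1] exI[of _ ?f'] ballI allI impI bd der cls)
qed

end

section \<open>Partial derivatives and homogeneous phases\<close>

lemma iter_deriv_partial:
  assumes f: "smooth_on S f" and S: "open S" "\<xi> \<in> S"
  shows "((\<lambda>t. iter_deriv \<alpha> f (\<xi> + t *\<^sub>R axis j 1)) has_vector_derivative iter_deriv (j # \<alpha>) f \<xi>) (at 0)"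
proof -
  let ?h = "iter_deriv \<alpha> f"
  have "?h differentiable (at \<xi>)"
  proof -
    have "?h differentiable (at \<xi> within S)" using f S by (auto simp: smooth_on_def differentiable_on_def)
    then show ?thesis using at_within_open[OF S(2,1)] by simp
  qed
  then have 1: "?h differentiable (at (\<xi> + 0 *\<^sub>R axis j 1))" by simp
  have "(\<lambda>t::real. \<xi> + t *\<^sub>R axis j 1) differentiable (at 0)"
    by (intro derivative_intros)
  then have "(?h \<circ> (\<lambda>t::real. \<xi> + t *\<^sub>R axis j 1)) differentiable (at 0)"
    using 1 by (rule differentiable_chain_at)
  then show ?thesis by (simp add: partial_deriv_def vector_derivative_works o_def)
qed

lemma iter_deriv_dir_deriv:
  assumes "smooth_on S f" "open S" "\<xi> \<in> S"
  shows "dir_deriv j (iter_deriv \<alpha> f) (iter_deriv (j # \<alpha>) f) \<xi>"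
  unfolding dir_deriv_def by (rule iter_deriv_partial[OF assms])

lemma smooth_on_continuous: "smooth_on S f \<Longrightarrow> continuous_on S (iter_deriv \<alpha> f)"
  unfolding smooth_on_def by (blast intro: differentiable_imp_continuous_on)

lemma derivative_of_partials:
  fixes f :: "real^'n::finite \<Rightarrow> 'b::real_normed_vector"
  assumes f': "(f has_derivative f') (at z)"
  shows "f' h = (\<Sum>i\<in>UNIV. h $ i *\<^sub>R partial_deriv i f z)"
proof -
  interpret f': bounded_linear f' using f' by (rule has_derivative_bounded_linear)
  have p: "partial_deriv i f z = f' (axis i 1)" for i
  proof -
    have "((\<lambda>t. f (z + t *\<^sub>R axis i 1)) has_derivative (\<lambda>t. f' (t *\<^sub>R axis i 1))) (at 0)"
    proof -
      have "((\<lambda>t::real. z + t *\<^sub>R axis i 1) has_derivative (\<lambda>t. t *\<^sub>R axis i 1)) (at 0)"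
        by (auto intro!: derivative_eq_intros)
      moreover have "(f has_derivative f') (at (z + 0 *\<^sub>R axis i 1))" using f' by simp
      ultimately have "((f \<circ> (\<lambda>t::real. z + t *\<^sub>R axis i 1)) has_derivative (f' \<circ> (\<lambda>t. t *\<^sub>R axis i 1))) (at 0)"
        by (rule diff_chain_at)
      then show ?thesis by (simp add: o_def)
    qed
    then have "((\<lambda>t. f (z + t *\<^sub>R axis i 1)) has_vector_derivative f' (axis i 1)) (at 0)"
      by (simp add: has_vector_derivative_def f'.scaleR)
    then show ?thesis unfolding partial_deriv_def by (rule vector_derivative_at)
  qed
  have "h = (\<Sum>i\<in>UNIV. h $ i *\<^sub>R axis i 1)" by (simp add: vec_eq_iff axis_def if_distrib cong: if_cong)
  then have "f' h = f' (\<Sum>i\<in>UNIV. h $ i *\<^sub>R axis i 1)" by simp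
  also have "\<dots> = (\<Sum>i\<in>UNIV. h $ i *\<^sub>R partial_deriv i f z)" by (simp add: f'.sum f'.scaleR p)
  finally show ?thesis .
qed

lemma partials_lipschitz:
  fixes f :: "real^'n::finite \<Rightarrow> 'b::real_normed_vector" and B :: real
  assumes f: "f differentiable_on S" and S: "open S" "closed_segment x y \<subseteq> S"
    and B: "\<And>z i. z \<in> closed_segment x y \<Longrightarrow> norm (partial_deriv i f z) \<le> B"
  shows "norm (f x - f y) \<le> (CARD('n) * B) * norm (x - y)"
proof -
  have "\<exists>f'. (f has_derivative f') (at z)" if "z \<in> closed_segment x y" for z
    using f S that unfolding differentiable_on_def differentiable_def by (metis at_within_open subsetD)
  then obtain F where F: "\<And>z. z \<in> closed_segment x y \<Longrightarrow> (f has_derivative F z) (at z)" by metis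
  show ?thesis
  proof (rule differentiable_bound[of "closed_segment x y" f F])
    fix z assume z: "z \<in> closed_segment x y"
    show "(f has_derivative F z) (at z within closed_segment x y)"
      using F[OF z] by (rule has_derivative_at_withinI)
    show "onorm (F z) \<le> CARD('n) * B"
    proof (rule onorm_le)
      fix h
      have "norm (F z h) \<le> (\<Sum>i\<in>UNIV. norm (h $ i *\<^sub>R partial_deriv i f z))"
        unfolding derivative_of_partials[OF F[OF z]] by (rule norm_sum)
      also have "\<dots> \<le> (\<Sum>i\<in>(UNIV::'n set). norm h * B)"
        unfolding norm_scaleR by (intro sum_mono mult_mono B z component_le_norm_cart[of h, simplified]) auto
      finally show "norm (F z h) \<le> CARD('n) * B * norm h" by (simp add: mult_ac)
    qed
  qed auto
qed

text \<open>
  By expansion of the square the norm is at least \<open>1 / sqrt 2\<close>.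
\<close>

lemma closed_segment_avoids_zero:
  fixes x y :: "'a::real_inner"
  assumes "norm x = 1" "norm y = 1" "x \<bullet> y \<ge> 0" "z \<in> closed_segment x y"
  shows "norm z \<ge> 1 / 2"
proof -
  obtain u where u: "0 \<le> u" "u \<le> 1" "z = (1 - u) *\<^sub>R x + u *\<^sub>R y" using assms(4) by (auto simp: in_segment)
  have "(norm z)^2 = (1 - u)^2 * (x \<bullet> x) + 2 * (u * (1 - u) * (x \<bullet> y)) + u^2 * (y \<bullet> y)"
    unfolding power2_norm_eq_inner u(3)
    by (simp add: inner_add_left inner_add_right inner_commute algebra_simps power2_eq_square)
  moreover have "x \<bullet> x = 1" "y \<bullet> y = 1" using assms by (simp_all add: norm_eq_1)
  ultimately have "(norm z)^2 = (1 - u)^2 + 2 * (u * (1 - u) * (x \<bullet> y)) + u^2" by simp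
  moreover have "u * (1 - u) * (x \<bullet> y) \<ge> 0" using u assms by simp
  moreover have "(1 - u)^2 + u^2 \<ge> (1/2)^2"
  proof -
    have "(1 - u)^2 + u^2 = 2 * (u - 1/2)^2 + 1/2" by (simp add: power2_eq_square algebra_simps)
    moreover have "(u - 1/2)^2 \<ge> 0" by simp
    ultimately show ?thesis by (simp add: power2_eq_square)
  qed
  ultimately have "(1/2)^2 \<le> (norm z)^2" by linarith
  then show ?thesis by (rule power2_le_imp_le) simp
qed

lemma open_punctured: "open (- {0::'a::real_normed_vector})"
  by (simp add: open_Compl)

lemma partial_deriv_homogeneous:
  fixes \<phi> :: "real^'n::finite \<Rightarrow> real"
  assumes hom: "\<And>\<xi> t. \<xi> \<noteq> 0 \<Longrightarrow> t > 0 \<Longrightarrow> \<phi> (t *\<^sub>R \<xi>) = t * \<phi> \<xi>"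
    and sm: "smooth_on (- {0}) \<phi>" and xi: "\<xi> \<noteq> 0" and t: "t > 0"
  shows "partial_deriv j \<phi> (t *\<^sub>R \<xi>) = partial_deriv j \<phi> \<xi>"
proof -
  let ?e = "axis j 1 :: real^'n"
  have 1: "((\<lambda>r. \<phi> (\<xi> + r *\<^sub>R ?e)) has_vector_derivative partial_deriv j \<phi> \<xi>) (at 0)"
    using iter_deriv_partial[OF sm open_punctured, of \<xi> "[]" j] xi by simp
  have 2: "((\<lambda>s. s / t) has_vector_derivative 1 / t) (at 0)"
    using t by (auto intro!: derivative_eq_intros)
  have "(((\<lambda>r. \<phi> (\<xi> + r *\<^sub>R ?e)) \<circ> (\<lambda>s. s / t)) has_vector_derivative (1 / t) *\<^sub>R partial_deriv j \<phi> \<xi>) (at 0)"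
    by (rule vector_diff_chain_at[OF 2]) (use 1 in simp)
  then have "((\<lambda>s. t * \<phi> (\<xi> + (s / t) *\<^sub>R ?e)) has_vector_derivative t * ((1 / t) *\<^sub>R partial_deriv j \<phi> \<xi>)) (at 0)"
    unfolding o_def by (rule has_vector_derivative_mult_right)
  then have 3: "((\<lambda>s. t * \<phi> (\<xi> + (s / t) *\<^sub>R ?e)) has_vector_derivative partial_deriv j \<phi> \<xi>) (at 0)"
    using t by simp
  have op: "open {s. \<xi> + (s / t) *\<^sub>R ?e \<noteq> 0}"
    by (intro open_Collect_neq continuous_intros) (use t in auto)
  have "((\<lambda>s. \<phi> (t *\<^sub>R \<xi> + s *\<^sub>R ?e)) has_vector_derivative partial_deriv j \<phi> \<xi>) (at 0)"
  proof (rule has_vector_derivative_transform_within_open[OF 3 op])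
    fix s assume s: "s \<in> {s. \<xi> + (s / t) *\<^sub>R ?e \<noteq> 0}"
    have "t *\<^sub>R \<xi> + s *\<^sub>R ?e = t *\<^sub>R (\<xi> + (s / t) *\<^sub>R ?e)" using t by (simp add: scaleR_add_right)
    then show "t * \<phi> (\<xi> + (s / t) *\<^sub>R ?e) = \<phi> (t *\<^sub>R \<xi> + s *\<^sub>R ?e)" using hom[of "\<xi> + (s / t) *\<^sub>R ?e" t] s t by simp
  qed (use xi in simp)
  then show ?thesis unfolding partial_deriv_def by (rule vector_derivative_at)
qed

text \<open>
  By homogeneity both points may be taken on the unit sphere. In dimension at least two there is a
  further unit vector, orthogonal to \<open>axis i0 1\<close> and at an angle of at most \<open>\<pi>/2\<close> with the first
  point. The two segments through it stay at distance \<open>1/2\<close> from the origin, where the second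
  derivatives are bounded.
\<close>

lemma homogeneous_gradient_oscillation:
  fixes \<phi> :: "real^'n::finite \<Rightarrow> real" and C :: real
  assumes card: "CARD('n) \<ge> 2"
    and hom: "\<And>\<xi> t. \<xi> \<noteq> 0 \<Longrightarrow> t > 0 \<Longrightarrow> \<phi> (t *\<^sub>R \<xi>) = t * \<phi> \<xi>"
    and sm: "smooth_on (- {0}) \<phi>"
    and C: "\<And>i k \<xi>. \<xi> \<noteq> 0 \<Longrightarrow> norm (iter_deriv [k, i] \<phi> \<xi>) \<le> C / norm \<xi>" "C \<ge> 0"
    and xi: "\<xi> \<noteq> 0"
  shows "\<bar>partial_deriv j \<phi> \<xi> - partial_deriv j \<phi> (axis i0 1)\<bar> \<le> 8 * CARD('n) * C"
proof -
  define f where "f = partial_deriv j \<phi>"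
  have fd: "f differentiable_on (- {0})"
    using sm unfolding smooth_on_def f_def by (metis iter_deriv.simps)
  have step: "\<bar>f x - f y\<bar> \<le> 4 * CARD('n) * C" if x: "norm x = 1" and y: "norm y = 1" and xy: "x \<bullet> y \<ge> 0" for x y
  proof -
    have seg: "norm z \<ge> 1/2" if "z \<in> closed_segment x y" for z
      by (rule closed_segment_avoids_zero[OF x y xy that])
    have "norm (f x - f y) \<le> (CARD('n) * (2 * C)) * norm (x - y)"
    proof (rule partials_lipschitz[OF fd])
      show "open (- {0::real^'n})" by (rule open_punctured)
      show "closed_segment x y \<subseteq> - {0}" using seg by force
      fix z i assume z: "z \<in> closed_segment x y"
      have z0: "norm z > 0" using seg[OF z] by linarith
      then have "norm (partial_deriv i f z) \<le> C / norm z" using C(1)[of z i j] by (auto simp: f_def)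
      also have "\<dots> \<le> C / (1/2)" using seg[OF z] z0 C(2) by (intro divide_left_mono) auto
      finally show "norm (partial_deriv i f z) \<le> 2 * C" by simp
    qed
    also have "\<dots> \<le> (CARD('n) * (2 * C)) * 2"
      using norm_triangle_ineq4[of x y] x y C(2) by (intro mult_left_mono) auto
    finally show ?thesis by simp
  qed
  obtain k where k: "k \<noteq> i0"
  proof -
    have "\<not> is_singleton (UNIV :: 'n set)" using card by (simp add: is_singleton_altdef)
    then show ?thesis using that by (metis UNIV_I UNIV_eq_I is_singletonI singletonI singleton_iff)
  qed
  define u where "u = (1 / norm \<xi>) *\<^sub>R \<xi>"
  have u1: "norm u = 1" using xi by (simp add: u_def)
  (* The sign makes the angle between u and e at most pi / 2. *)
  define e :: "real^'n" where "e = (if u $ k \<ge> 0 then axis k 1 else - axis k 1)"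
  have e1: "norm e = 1" by (simp add: e_def)
  have "f \<xi> = f u"
  proof -
    have "\<xi> = norm \<xi> *\<^sub>R u" using xi by (simp add: u_def)
    moreover have "u \<noteq> 0" using u1 by auto
    ultimately show ?thesis unfolding f_def using partial_deriv_homogeneous[OF hom sm, of u "norm \<xi>" j] xi by simp
  qed
  moreover have "\<bar>f u - f e\<bar> \<le> 4 * CARD('n) * C"
    by (rule step[OF u1 e1]) (auto simp: e_def inner_axis)
  moreover have "\<bar>f e - f (axis i0 1)\<bar> \<le> 4 * CARD('n) * C"
    by (rule step[OF e1]) (use k in \<open>auto simp: e_def inner_axis_axis\<close>)
  ultimately show ?thesis by (simp add: f_def)
qed

text \<open>
  The difference \<open>\<theta>\<close> is homogeneous of degree one and has bounded gradient, and therefore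
  \<open>\<theta> \<xi> / 2 = \<theta> \<xi> - \<theta> (\<xi> / 2)\<close> is bounded by a multiple of \<open>\<bar>\<xi>\<bar> / 2\<close>.
\<close>

lemma homogeneous_linear_part:
  fixes \<phi> :: "real^'n::finite \<Rightarrow> real" and C :: real
  assumes card: "CARD('n) \<ge> 2"
    and hom: "\<And>\<xi> t. \<xi> \<noteq> 0 \<Longrightarrow> t > 0 \<Longrightarrow> \<phi> (t *\<^sub>R \<xi>) = t * \<phi> \<xi>"
    and sm: "smooth_on (- {0}) \<phi>"
    and C: "\<And>i k \<xi>. \<xi> \<noteq> 0 \<Longrightarrow> norm (iter_deriv [k, i] \<phi> \<xi>) \<le> C / norm \<xi>" "C \<ge> 0"
    and xi: "\<xi> \<noteq> 0"
  shows "\<bar>\<phi> \<xi> - gradient \<phi> (axis i0 1) \<bullet> \<xi>\<bar> \<le> (CARD('n) * (8 * CARD('n) * C)) * norm \<xi>"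
proof -
  define g where "g = gradient \<phi> (axis i0 1)"
  define \<theta> where "\<theta> \<eta> = \<phi> \<eta> - g \<bullet> \<eta>" for \<eta>
  have \<phi>d: "\<phi> differentiable_on (- {0})" using sm unfolding smooth_on_def by (metis iter_deriv.simps(1))
  have \<theta>d: "\<theta> differentiable_on (- {0})"
    unfolding \<theta>_def
    by (intro differentiable_on_diff \<phi>d linear_imp_differentiable_on linear_linear[THEN iffD1] bounded_linear_inner_right)
  have pd: "partial_deriv j \<theta> \<eta> = partial_deriv j \<phi> \<eta> - g $ j" if "\<eta> \<noteq> 0" for j \<eta>
  proof -
    have 1: "((\<lambda>t. \<phi> (\<eta> + t *\<^sub>R axis j 1)) has_vector_derivative partial_deriv j \<phi> \<eta>) (at 0)"
      using iter_deriv_partial[OF sm open_punctured, of \<eta> "[]" j] that by simp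
    have "((\<lambda>t. g \<bullet> (\<eta> + t *\<^sub>R axis j 1)) has_vector_derivative g $ j) (at 0)"
    proof -
      have "((\<lambda>t. g \<bullet> \<eta> + t * g $ j) has_vector_derivative g $ j) (at 0)"
        by (auto intro!: derivative_eq_intros)
      then show ?thesis by (simp add: inner_add_right inner_axis)
    qed
    then have "((\<lambda>t. \<theta> (\<eta> + t *\<^sub>R axis j 1)) has_vector_derivative partial_deriv j \<phi> \<eta> - g $ j) (at 0)"
      unfolding \<theta>_def by (rule has_vector_derivative_diff[OF 1])
    then show ?thesis by (subst partial_deriv_def) (rule vector_derivative_at)
  qed
  have "\<theta> ((1/2) *\<^sub>R \<xi>) = (1/2) * \<theta> \<xi>" using hom[OF xi, of "1/2"] by (simp add: \<theta>_def algebra_simps)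
  then have eq: "\<theta> \<xi> - \<theta> ((1/2) *\<^sub>R \<xi>) = (1/2) * \<theta> \<xi>" by simp
  have nz: "z \<noteq> 0" if z: "z \<in> closed_segment \<xi> ((1/2) *\<^sub>R \<xi>)" for z
  proof -
    obtain u where u: "0 \<le> u" "u \<le> 1" "z = (1 - u) *\<^sub>R \<xi> + u *\<^sub>R ((1/2) *\<^sub>R \<xi>)" using z by (auto simp: in_segment)
    have "z = ((1 - u) + u * (1/2)) *\<^sub>R \<xi>" by (simp only: u(3) scaleR_add_left scaleR_scaleR)
    moreover have "(1 - u) + u * (1/2) \<noteq> 0" using u by auto
    ultimately show ?thesis using xi by (simp only: scaleR_eq_0_iff) blast
  qed
  have "norm (\<theta> \<xi> - \<theta> ((1/2) *\<^sub>R \<xi>)) \<le> (CARD('n) * (8 * CARD('n) * C)) * norm (\<xi> - (1/2) *\<^sub>R \<xi>)"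
  proof (rule partials_lipschitz[OF \<theta>d])
    show "closed_segment \<xi> ((1/2) *\<^sub>R \<xi>) \<subseteq> - {0}" using nz by auto
    fix z i assume z: "z \<in> closed_segment \<xi> ((1/2) *\<^sub>R \<xi>)"
    show "norm (partial_deriv i \<theta> z) \<le> 8 * CARD('n) * C"
      using homogeneous_gradient_oscillation[OF card hom sm C nz[OF z], of i i0] nz[OF z]
      by (simp add: pd g_def gradient_def)
  qed (rule open_punctured)
  moreover have "\<xi> - (1/2) *\<^sub>R \<xi> = (1/2) *\<^sub>R \<xi>" 
  proof -
    have "\<xi> - (1/2) *\<^sub>R \<xi> = (1 - 1/2) *\<^sub>R \<xi>" by (simp only: scaleR_diff_left scaleR_one)
    then show ?thesis by simp
  qed
  ultimately show ?thesis unfolding eq by (simp add: \<theta>_def g_def abs_mult mult_ac)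
qed

section \<open>Uniform bounds, measurability and Schwartz functions\<close>

lemma continuous_bound_from_dense:
  fixes g :: "'a::metric_space \<Rightarrow> real"
  assumes g: "continuous_on S g" and D: "D \<subseteq> S" "S \<subseteq> closure D" and b: "\<And>d. d \<in> D \<Longrightarrow> g d \<le> C"
    and x: "x \<in> S"
  shows "g x \<le> C"
proof -
  have "x \<in> closure D" using D x by blast
  then obtain d where d: "\<And>n::nat. d n \<in> D" "d \<longlonglongrightarrow> x" unfolding closure_sequential by blast
  have "(\<lambda>n. g (d n)) \<longlonglongrightarrow> g x"
    using g d x D(1) unfolding continuous_on_sequentially o_def by blast
  then show ?thesis by (rule LIMSEQ_le_const2) (use b d in auto)
qed

text \<open>
  For each single \<open>\<xi>\<close> the bound holds almost everywhere, with an exceptional set that depends on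
  \<open>\<xi>\<close>. A countable dense set of frequencies and continuity in \<open>\<xi>\<close> give one exceptional set.
\<close>

lemma sup_Linf_AE:
  fixes f :: "real^'n::finite \<Rightarrow> real^'n \<Rightarrow> 'b::real_normed_vector"
  assumes fin: "(SUP \<xi>\<in>S. ennreal (w \<xi>) * Linf_norm (\<lambda>x. f x \<xi>)) < \<infinity>"
    and w: "\<And>\<xi>. \<xi> \<in> S \<Longrightarrow> w \<xi> \<ge> 0"
    and c: "\<And>x. continuous_on S (\<lambda>\<xi>. w \<xi> * norm (f x \<xi>))"
  shows "\<exists>C\<ge>0. AE x in lebesgue. \<forall>\<xi>\<in>S. w \<xi> * norm (f x \<xi>) \<le> C"
proof -
  define C where "C = enn2real (SUP \<xi>\<in>S. ennreal (w \<xi>) * Linf_norm (\<lambda>x. f x \<xi>))"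
  have C: "(SUP \<xi>\<in>S. ennreal (w \<xi>) * Linf_norm (\<lambda>x. f x \<xi>)) = ennreal C" using fin by (simp add: C_def less_top)
  have one: "AE x in lebesgue. w \<xi> * norm (f x \<xi>) \<le> C" if "\<xi> \<in> S" for \<xi>
  proof -
    have "AE x in lebesgue. ennreal (norm (f x \<xi>)) \<le> Linf_norm (\<lambda>x. f x \<xi>)"
      unfolding Linf_norm_def by (rule esssup_AE)
    then show ?thesis
    proof eventually_elim
      case (elim x)
      have "ennreal (w \<xi> * norm (f x \<xi>)) = ennreal (w \<xi>) * ennreal (norm (f x \<xi>))"
        using w[OF that] by (simp add: ennreal_mult)
      also have "\<dots> \<le> ennreal (w \<xi>) * Linf_norm (\<lambda>x. f x \<xi>)" by (rule mult_left_mono[OF elim]) simp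
      also have "\<dots> \<le> ennreal C" unfolding C[symmetric] by (rule SUP_upper[OF that])
      finally show ?case by (simp add: C_def ennreal_le_iff)
    qed
  qed
  obtain D where D: "countable D" "D \<subseteq> S" "S \<subseteq> closure D" using separable by blast
  have "AE x in lebesgue. \<forall>\<xi>\<in>D. w \<xi> * norm (f x \<xi>) \<le> C"
    by (subst AE_ball_countable[OF D(1)]) (use one D(2) in auto)
  then have "AE x in lebesgue. \<forall>\<xi>\<in>S. w \<xi> * norm (f x \<xi>) \<le> C"
    by eventually_elim (use continuous_bound_from_dense[OF c D(2,3)] in blast)
  moreover have "C \<ge> 0" by (simp add: C_def)
  ultimately show ?thesis by blast
qed

lemma japanese_bracket_bounds: "japanese_bracket \<xi> \<ge> 1" "japanese_bracket \<xi> \<le> 1 + norm \<xi>"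
proof -
  show "japanese_bracket \<xi> \<ge> 1" by (simp add: japanese_bracket_def)
  have "1 + (norm \<xi>)\<^sup>2 \<le> (1 + norm \<xi>)\<^sup>2" by (simp add: power2_eq_square algebra_simps)
  then show "japanese_bracket \<xi> \<le> 1 + norm \<xi>" unfolding japanese_bracket_def by (intro real_le_lsqrt) auto
qed

text \<open>
  All derivatives share one polynomial rate of growth, which a cut-off in frequency turns into
  decay of any order.
\<close>

lemma Linf_S_bounds:
  fixes a :: "real^'n::finite \<Rightarrow> real^'n \<Rightarrow> complex"
  assumes a: "a \<in> Linf_S m \<rho>" and rho: "\<rho> \<ge> 0"
  shows "\<exists>X. (AE x in lebesgue. x \<in> X) \<and>
    (\<forall>\<alpha>. \<exists>C\<ge>0. \<forall>x\<in>X. \<forall>\<xi>. norm (iter_deriv \<alpha> (a x) \<xi>) \<le> C * (1 + norm \<xi>) powr \<bar>m\<bar>)"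
proof -
  let ?w = "\<lambda>\<alpha> \<xi>::real^'n. japanese_bracket \<xi> powr (- m + \<rho> * real (length \<alpha>))"
  have "\<exists>C\<ge>0. AE x in lebesgue. \<forall>\<xi>\<in>UNIV. ?w \<alpha> \<xi> * norm (iter_deriv \<alpha> (a x) \<xi>) \<le> C" for \<alpha> :: "'n list"
  proof (rule sup_Linf_AE)
    show "(SUP \<xi>\<in>UNIV. ennreal (?w \<alpha> \<xi>) * Linf_norm (\<lambda>x. iter_deriv \<alpha> (a x) \<xi>)) < \<infinity>"
      using a by (auto simp: Linf_S_def)
    fix x
    have "continuous_on UNIV (iter_deriv \<alpha> (a x))"
      by (rule smooth_on_continuous) (use a in \<open>auto simp: Linf_S_def\<close>)
    moreover have "continuous_on UNIV (\<lambda>\<xi>::real^'n. japanese_bracket \<xi>)"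
      unfolding japanese_bracket_def by (intro continuous_intros)
    moreover have "japanese_bracket \<xi> \<noteq> 0" for \<xi> :: "real^'n" using japanese_bracket_bounds(1)[of \<xi>] by linarith
    ultimately show "continuous_on UNIV (\<lambda>\<xi>. ?w \<alpha> \<xi> * norm (iter_deriv \<alpha> (a x) \<xi>))"
      by (intro continuous_intros) auto
  qed simp
  then have "\<forall>\<alpha>. \<exists>C. C \<ge> 0 \<and> (AE x in lebesgue. \<forall>\<xi>\<in>UNIV. ?w \<alpha> \<xi> * norm (iter_deriv \<alpha> (a x) \<xi>) \<le> C)" by blast
  from choice[OF this] obtain C where C: "\<And>\<alpha>. C \<alpha> \<ge> 0" "\<And>\<alpha>. AE x in lebesgue. \<forall>\<xi>\<in>UNIV. ?w \<alpha> \<xi> * norm (iter_deriv \<alpha> (a x) \<xi>) \<le> C \<alpha>" by blast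
  define X where "X = {x. \<forall>\<alpha>. \<forall>\<xi>\<in>UNIV. ?w \<alpha> \<xi> * norm (iter_deriv \<alpha> (a x) \<xi>) \<le> C \<alpha>}"
  have "AE x in lebesgue. x \<in> X" unfolding X_def mem_Collect_eq AE_all_countable using C(2) by blast
  moreover have "norm (iter_deriv \<alpha> (a x) \<xi>) \<le> C \<alpha> * (1 + norm \<xi>) powr \<bar>m\<bar>" if "x \<in> X" for \<alpha> x \<xi>
  proof -
    let ?e = "- m + \<rho> * real (length \<alpha>)"
    have j: "japanese_bracket \<xi> > 0" using japanese_bracket_bounds(1)[of \<xi>] by linarith
    have "norm (iter_deriv \<alpha> (a x) \<xi>) = japanese_bracket \<xi> powr (- ?e) * (?w \<alpha> \<xi> * norm (iter_deriv \<alpha> (a x) \<xi>))"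
      using j by (simp add: mult.assoc[symmetric] powr_add[symmetric])
    also have "\<dots> \<le> japanese_bracket \<xi> powr (- ?e) * C \<alpha>"
      using that by (intro mult_left_mono) (auto simp: X_def)
    also have "\<dots> \<le> (1 + norm \<xi>) powr \<bar>m\<bar> * C \<alpha>"
    proof (rule mult_right_mono[OF _ C(1)])
      have "- ?e \<le> \<bar>m\<bar>" using rho by (simp add: abs_if) (smt (verit) mult_nonneg_nonneg of_nat_0_le_iff)
      then have "japanese_bracket \<xi> powr (- ?e) \<le> japanese_bracket \<xi> powr \<bar>m\<bar>"
        by (rule powr_mono) (rule japanese_bracket_bounds)
      also have "\<dots> \<le> (1 + norm \<xi>) powr \<bar>m\<bar>"
        using j japanese_bracket_bounds(2)[of \<xi>] by (intro powr_mono2) auto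
      finally show "japanese_bracket \<xi> powr (- ?e) \<le> (1 + norm \<xi>) powr \<bar>m\<bar>" .
    qed
    finally show ?thesis by (simp add: mult.commute)
  qed
  ultimately show ?thesis using C(1) by blast
qed

lemma Linf_Phi_bounds:
  fixes \<phi> :: "real^'n::finite \<Rightarrow> real^'n \<Rightarrow> real"
  assumes \<phi>: "\<phi> \<in> Linf_Phi k"
  shows "\<exists>X. (AE x in lebesgue. x \<in> X) \<and>
    (\<forall>\<alpha>. length \<alpha> \<ge> k \<longrightarrow> (\<exists>C\<ge>0. \<forall>x\<in>X. \<forall>\<xi>. \<xi> \<noteq> 0 \<longrightarrow> norm (iter_deriv \<alpha> (\<phi> x) \<xi>) \<le> C * norm \<xi> powr (1 - real (length \<alpha>))))"
proof -
  let ?w = "\<lambda>\<alpha> \<xi>::real^'n. norm \<xi> powr (- 1 + real (length \<alpha>))"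
  have "\<exists>C\<ge>0. AE x in lebesgue. \<forall>\<xi>\<in>-{0}. ?w \<alpha> \<xi> * norm (iter_deriv \<alpha> (\<phi> x) \<xi>) \<le> C" if "length \<alpha> \<ge> k" for \<alpha> :: "'n list"
  proof (rule sup_Linf_AE)
    show "(SUP \<xi>\<in>-{0}. ennreal (?w \<alpha> \<xi>) * Linf_norm (\<lambda>x. iter_deriv \<alpha> (\<phi> x) \<xi>)) < \<infinity>"
      using \<phi> that by (auto simp: Linf_Phi_def)
    fix x
    have "continuous_on (-{0}) (iter_deriv \<alpha> (\<phi> x))"
      by (rule smooth_on_continuous) (use \<phi> in \<open>auto simp: Linf_Phi_def\<close>)
    then show "continuous_on (-{0}) (\<lambda>\<xi>. ?w \<alpha> \<xi> * norm (iter_deriv \<alpha> (\<phi> x) \<xi>))"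
      by (intro continuous_intros) auto
  qed simp
  then have "\<forall>\<alpha>. \<exists>C. length \<alpha> \<ge> k \<longrightarrow> C \<ge> 0 \<and> (AE x in lebesgue. \<forall>\<xi>\<in>-{0}. ?w \<alpha> \<xi> * norm (iter_deriv \<alpha> (\<phi> x) \<xi>) \<le> C)" by blast
  from choice[OF this] obtain C where C: "\<And>\<alpha>. length \<alpha> \<ge> k \<Longrightarrow> C \<alpha> \<ge> 0"
    "\<And>\<alpha>. length \<alpha> \<ge> k \<Longrightarrow> AE x in lebesgue. \<forall>\<xi>\<in>-{0}. ?w \<alpha> \<xi> * norm (iter_deriv \<alpha> (\<phi> x) \<xi>) \<le> C \<alpha>" by blast
  define X where "X = {x. \<forall>\<alpha>. length \<alpha> \<ge> k \<longrightarrow> (\<forall>\<xi>\<in>-{0}. ?w \<alpha> \<xi> * norm (iter_deriv \<alpha> (\<phi> x) \<xi>) \<le> C \<alpha>)}"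
  have "AE x in lebesgue. x \<in> X"
    unfolding X_def mem_Collect_eq AE_all_countable
  proof
    fix \<alpha> :: "'n list"
    show "AE x in lebesgue. length \<alpha> \<ge> k \<longrightarrow> (\<forall>\<xi>\<in>-{0}. ?w \<alpha> \<xi> * norm (iter_deriv \<alpha> (\<phi> x) \<xi>) \<le> C \<alpha>)"
      by (cases "length \<alpha> \<ge> k") (use C(2)[of \<alpha>] in auto)
  qed
  moreover have "norm (iter_deriv \<alpha> (\<phi> x) \<xi>) \<le> C \<alpha> * norm \<xi> powr (1 - real (length \<alpha>))"
    if "x \<in> X" "length \<alpha> \<ge> k" "\<xi> \<noteq> 0" for \<alpha> x \<xi>
  proof -
    have "norm (iter_deriv \<alpha> (\<phi> x) \<xi>) = norm \<xi> powr (1 - real (length \<alpha>)) * (?w \<alpha> \<xi> * norm (iter_deriv \<alpha> (\<phi> x) \<xi>))"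
      using that by (simp add: mult.assoc[symmetric] powr_add[symmetric])
    also have "\<dots> \<le> norm \<xi> powr (1 - real (length \<alpha>)) * C \<alpha>"
      using that by (intro mult_left_mono) (auto simp: X_def)
    finally show ?thesis by (simp add: mult.commute)
  qed
  ultimately show ?thesis using C(1) by blast
qed

lemma vec_eq_sum_axis: "(x :: real^'n::finite) = (\<Sum>i\<in>UNIV. (x $ i) *\<^sub>R axis i 1)"
  by (simp add: vec_eq_iff axis_def if_distrib cong: if_cong)

lemma borel_measurable_vec_components:
  fixes g :: "'a \<Rightarrow> real^'n::finite"
  assumes "\<And>i. (\<lambda>x. g x $ i) \<in> borel_measurable M"
  shows "g \<in> borel_measurable M"
proof -
  have "(\<lambda>x. \<Sum>i\<in>UNIV. (g x $ i) *\<^sub>R (axis i 1 :: real^'n)) \<in> borel_measurable M"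
    by (intro borel_measurable_sum borel_measurable_scaleR borel_measurable_const assms)
  then show ?thesis by (simp flip: vec_eq_sum_axis)
qed

text \<open>
  The grids are countable and contain the origin, which is rounded to itself.
\<close>

definition grid_round :: "nat \<Rightarrow> real^'n::finite \<Rightarrow> real^'n"
  where "grid_round k \<xi> = (\<Sum>i\<in>UNIV. (of_int \<lfloor>\<xi> $ i * real (Suc k)\<rfloor> / real (Suc k)) *\<^sub>R axis i 1)"

lemma grid_round_measurable[measurable]: "grid_round k \<in> borel_measurable borel"
  unfolding grid_round_def by measurable

lemma grid_round_zero: "grid_round k 0 = 0" by (simp add: grid_round_def)

lemma grid_round_tendsto: "(\<lambda>k. grid_round k \<xi>) \<longlonglongrightarrow> \<xi>"
proof -
  have "(\<lambda>k. of_int \<lfloor>t * real (Suc k)\<rfloor> / real (Suc k)) \<longlonglongrightarrow> t" for t :: real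
  proof (rule tendsto_sandwich)
    show "(\<lambda>k. t - 1 / real (Suc k)) \<longlonglongrightarrow> t"
      using tendsto_diff[OF tendsto_const LIMSEQ_inverse_real_of_nat, of t] by (simp add: inverse_eq_divide)
    show "\<forall>\<^sub>F k in sequentially. t - 1 / real (Suc k) \<le> of_int \<lfloor>t * real (Suc k)\<rfloor> / real (Suc k)"
    proof (rule always_eventually, rule allI)
      fix k
      have "t * real (Suc k) - 1 \<le> of_int \<lfloor>t * real (Suc k)\<rfloor>" by linarith
      then have "(t * real (Suc k) - 1) / real (Suc k) \<le> of_int \<lfloor>t * real (Suc k)\<rfloor> / real (Suc k)" by (rule divide_right_mono) simp
      then show "t - 1 / real (Suc k) \<le> of_int \<lfloor>t * real (Suc k)\<rfloor> / real (Suc k)" by (simp add: diff_divide_distrib)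
    qed
    show "\<forall>\<^sub>F k in sequentially. of_int \<lfloor>t * real (Suc k)\<rfloor> / real (Suc k) \<le> t"
      by (rule always_eventually) (auto simp: divide_le_eq)
  qed simp
  then have "(\<lambda>k. grid_round k \<xi>) \<longlonglongrightarrow> (\<Sum>i\<in>UNIV. (\<xi> $ i) *\<^sub>R axis i 1)"
    unfolding grid_round_def by (intro tendsto_intros)
  then show ?thesis by (simp flip: vec_eq_sum_axis)
qed

lemma grid_round_countable: "countable (range (grid_round k :: real^'n::finite \<Rightarrow> real^'n))"
proof -
  have "range (grid_round k :: real^'n \<Rightarrow> real^'n) \<subseteq> range (\<lambda>m::'n \<Rightarrow> int. \<Sum>i\<in>UNIV. (of_int (m i) / real (Suc k)) *\<^sub>R axis i 1)"
  proof
    fix y assume "y \<in> range (grid_round k :: real^'n \<Rightarrow> real^'n)"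
    then obtain \<xi> where "y = grid_round k \<xi>" by blast
    then show "y \<in> range (\<lambda>m::'n \<Rightarrow> int. \<Sum>i\<in>UNIV. (of_int (m i) / real (Suc k)) *\<^sub>R axis i 1)"
      unfolding grid_round_def by (intro image_eqI[where x = "\<lambda>i. \<lfloor>\<xi> $ i * real (Suc k)\<rfloor>"]) auto
  qed
  then show ?thesis by (rule countable_subset) simp
qed

text \<open>
  Functions that are measurable in one variable and continuous in the other are jointly measurable:
  they are limits of their values at rounded frequencies. The origin is excluded because a phase has no
  controlled value there.
\<close>

lemma caratheodory_measurable:
  fixes f :: "real^'n::finite \<Rightarrow> real^'n \<Rightarrow> complex"
  assumes meas: "\<And>\<xi>. \<xi> \<noteq> 0 \<Longrightarrow> (\<lambda>x. f x \<xi>) \<in> borel_measurable lebesgue"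
    and cont: "\<And>x. continuous_on (- {0}) (f x)"
  shows "(\<lambda>(x, \<xi>). if \<xi> = 0 then 0 else f x \<xi>) \<in> borel_measurable (lebesgue \<Otimes>\<^sub>M lborel)"
proof -
  define h where "h x \<xi> = (if \<xi> = 0 then 0 else f x \<xi>)" for x \<xi>
  have hm: "(\<lambda>x. h x \<xi>) \<in> borel_measurable lebesgue" for \<xi>
    using meas[of \<xi>] by (cases "\<xi> = 0") (auto simp: h_def)
  have "(\<lambda>w. h (fst w) (snd w)) \<in> borel_measurable (lebesgue \<Otimes>\<^sub>M (lborel :: (real^'n) measure))"
  proof (rule borel_measurable_LIMSEQ_metric[where f = "\<lambda>k w. h (fst w) (grid_round k (snd w))"])
    fix k
    show "(\<lambda>w. h (fst w) (grid_round k (snd w))) \<in> borel_measurable (lebesgue \<Otimes>\<^sub>M lborel)"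
    proof (rule measurable_compose_countable'[where I = "range (grid_round k)" and f = "\<lambda>\<eta> w. h (fst w) \<eta>" and g = "\<lambda>w. grid_round k (snd w)"])
      show "countable (range (grid_round k :: real^'n \<Rightarrow> real^'n))" by (rule grid_round_countable)
      show "(\<lambda>w. h (fst w) \<eta>) \<in> borel_measurable (lebesgue \<Otimes>\<^sub>M lborel)" for \<eta>
        by (rule measurable_compose[OF measurable_fst hm])
      have "(\<lambda>w. grid_round k (snd w)) \<in> borel_measurable (lebesgue \<Otimes>\<^sub>M (lborel :: (real^'n) measure))"
        by measurable
      then have "(\<lambda>w. grid_round k (snd w)) -` {a} \<inter> space (lebesgue \<Otimes>\<^sub>M lborel) \<in> sets (lebesgue \<Otimes>\<^sub>M (lborel :: (real^'n) measure))" for a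
        by (rule measurable_sets) simp
      then show "(\<lambda>w. grid_round k (snd w)) \<in> lebesgue \<Otimes>\<^sub>M lborel \<rightarrow>\<^sub>M count_space (range (grid_round k :: real^'n \<Rightarrow> real^'n))"
        by (subst measurable_count_space_eq_countable[OF grid_round_countable]) auto
    qed
  next
    fix w :: "(real^'n) \<times> (real^'n)"
    obtain x \<xi> where w: "w = (x, \<xi>)" by (cases w)
    show "(\<lambda>k. h (fst w) (grid_round k (snd w))) \<longlonglongrightarrow> h (fst w) (snd w)"
    proof (cases "\<xi> = 0")
      case True
      then show ?thesis by (simp add: w grid_round_zero)
    next
      case False
      have "isCont (f x) \<xi>" using cont[of x] False by (simp add: continuous_on_eq_continuous_at open_punctured)
      then have "(\<lambda>k. f x (grid_round k \<xi>)) \<longlonglongrightarrow> f x \<xi>" by (rule isCont_tendsto_compose) (rule grid_round_tendsto)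
      moreover have "\<forall>\<^sub>F k in sequentially. f x (grid_round k \<xi>) = h x (grid_round k \<xi>)"
        using tendsto_imp_eventually_ne[OF grid_round_tendsto False] by eventually_elim (simp add: h_def)
      ultimately have "(\<lambda>k. h x (grid_round k \<xi>)) \<longlonglongrightarrow> f x \<xi>" by (rule Lim_transform_eventually)
      then show ?thesis using False by (simp add: w h_def)
    qed
  qed
  then show ?thesis by (simp add: h_def case_prod_unfold)
qed

text \<open>
  The gradient is a limit of difference quotients along a sequence of steps; steps of at most \<open>1/2\<close>
  keep the sampled frequencies away from the origin.
\<close>

lemma gradient_measurable:
  fixes \<phi> :: "real^'n::finite \<Rightarrow> real^'n \<Rightarrow> real"
  assumes meas: "\<And>\<xi>. \<xi> \<noteq> 0 \<Longrightarrow> (\<lambda>x. \<phi> x \<xi>) \<in> borel_measurable lebesgue"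
    and sm: "\<And>x. smooth_on (- {0}) (\<phi> x)" and z: "norm \<zeta> = 1"
  shows "(\<lambda>x. gradient (\<phi> x) \<zeta>) \<in> borel_measurable lebesgue"
proof (rule borel_measurable_vec_components)
  fix i
  (* The double successor makes the steps at most 1 / 2, below the norm of \<zeta>. *)
  define s where "s k = 1 / real (Suc (Suc k))" for k
  have s: "s k \<noteq> 0" "0 < s k" "s k \<le> 1/2" for k by (auto simp: s_def field_simps)
  have s0: "s \<longlonglongrightarrow> 0"
    unfolding s_def using LIMSEQ_Suc[OF LIMSEQ_inverse_real_of_nat] by (simp add: inverse_eq_divide)
  have ne: "\<zeta> + s k *\<^sub>R axis i 1 \<noteq> 0" "\<zeta> \<noteq> 0" for k
  proof -
    show "\<zeta> \<noteq> 0" using z by auto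
    show "\<zeta> + s k *\<^sub>R axis i 1 \<noteq> 0"
    proof
      assume "\<zeta> + s k *\<^sub>R axis i 1 = 0"
      then have "\<zeta> = - (s k *\<^sub>R axis i 1)" by (rule eq_neg_iff_add_eq_0[THEN iffD2])
      then have "norm \<zeta> = s k" using s(2)[of k] by simp
      then show False using z s(3)[of k] by simp
    qed
  qed
  have "(\<lambda>x. partial_deriv i (\<phi> x) \<zeta>) \<in> borel_measurable lebesgue"
  proof (rule borel_measurable_LIMSEQ_real[where u = "\<lambda>k x. (\<phi> x (\<zeta> + s k *\<^sub>R axis i 1) - \<phi> x \<zeta>) / s k"])
    show "(\<lambda>x. (\<phi> x (\<zeta> + s k *\<^sub>R axis i 1) - \<phi> x \<zeta>) / s k) \<in> borel_measurable lebesgue" for k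
      using meas[OF ne(1)] meas[OF ne(2)] by measurable
    fix x
    have "((\<lambda>t. \<phi> x (\<zeta> + t *\<^sub>R axis i 1)) has_vector_derivative partial_deriv i (\<phi> x) \<zeta>) (at 0)"
      using iter_deriv_partial[OF sm[of x] open_punctured, of \<zeta> "[]" i] ne(2) by simp
    then have "((\<lambda>t. \<phi> x (\<zeta> + t *\<^sub>R axis i 1)) has_real_derivative partial_deriv i (\<phi> x) \<zeta>) (at 0)"
      by (simp add: has_real_derivative_iff_has_vector_derivative)
    then have "((\<lambda>t. (\<phi> x (\<zeta> + t *\<^sub>R axis i 1) - \<phi> x \<zeta>) / t) \<longlongrightarrow> partial_deriv i (\<phi> x) \<zeta>) (at 0)"
      by (simp add: has_field_derivative_iff)
    moreover have "filterlim s (at 0) sequentially" using s0 s(1) by (simp add: filterlim_at)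
    ultimately show "(\<lambda>k. (\<phi> x (\<zeta> + s k *\<^sub>R axis i 1) - \<phi> x \<zeta>) / s k) \<longlonglongrightarrow> partial_deriv i (\<phi> x) \<zeta>"
      by (rule filterlim_compose)
  qed
  then show "(\<lambda>x. gradient (\<phi> x) \<zeta> $ i) \<in> borel_measurable lebesgue" by (simp add: gradient_def)
qed

text \<open>
  The power \<open>2n\<close> of the Japanese bracket is \<open>(1 + \<bar>x\<bar>^2)^n\<close>, and each of its \<open>n\<close> factors dominates
  one factor of the reciprocal weight up to a factor two.
\<close>

lemma schwartz_weight_bound:
  fixes u :: "real^'n::finite \<Rightarrow> complex"
  assumes u: "u \<in> schwartz_space"
  shows "continuous_on UNIV u" "\<exists>C\<ge>0. \<forall>x. norm (u x) \<le> C * weight x"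
proof -
  have sm: "smooth_on UNIV u" using u by (simp add: schwartz_space_def)
  then show "continuous_on UNIV u" using smooth_on_continuous[of UNIV u "[]"] by simp
  have "bounded (range (\<lambda>x. japanese_bracket x ^ (2 * CARD('n)) *\<^sub>R iter_deriv [] u x))"
    using u unfolding schwartz_space_def by blast
  then obtain B where B: "\<And>x. norm (japanese_bracket x ^ (2 * CARD('n)) *\<^sub>R u x) \<le> B"
    unfolding bounded_iff by auto
  have "B \<ge> 0" using B[of 0] norm_ge_zero order_trans by blast
  have w: "1 \<le> 2 ^ CARD('n) * weight x * japanese_bracket x ^ (2 * CARD('n))" for x :: "real^'n"
  proof -
    have "japanese_bracket x ^ (2 * CARD('n)) = (\<Prod>i\<in>(UNIV::'n set). 1 + (norm x)\<^sup>2)"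
      by (simp add: japanese_bracket_def power_mult)
    then have eq: "2 ^ CARD('n) * weight x * japanese_bracket x ^ (2 * CARD('n))
       = (\<Prod>i\<in>UNIV. 2 * (1 + \<bar>x $ i\<bar>) powr (-1 - coord_exponent TYPE('n)) * (1 + (norm x)\<^sup>2))"
      by (simp add: weight_def prod.distrib)
    have "1 \<le> 2 * (1 + \<bar>x $ i\<bar>) powr (-1 - coord_exponent TYPE('n)) * (1 + (norm x)\<^sup>2)" for i
    proof -
      let ?t = "\<bar>x $ i\<bar>"
      have "(1 + ?t)\<^sup>2 \<le> 2 * (1 + ?t\<^sup>2)"
        using zero_le_power2[of "1 - ?t"] by (simp add: power2_eq_square algebra_simps)
      also have "\<dots> \<le> 2 * (1 + (norm x)\<^sup>2)" using power_mono[OF component_le_norm_cart[of x i] abs_ge_zero, of 2] by simp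
      finally have 1: "(1 + ?t)\<^sup>2 \<le> 2 * (1 + (norm x)\<^sup>2)" .
      have "1 \<le> (1 + ?t) powr (1 - coord_exponent TYPE('n))"
        using coord_exponent_bounds(2)[where 'n='n] by (intro ge_one_powr_ge_zero) auto
      also have "\<dots> = (1 + ?t) powr (-1 - coord_exponent TYPE('n)) * (1 + ?t) powr 2"
        by (simp only: powr_add[symmetric]) simp
      also have "(1 + ?t) powr 2 = (1 + ?t)\<^sup>2" by simp
      also have "(1 + ?t) powr (-1 - coord_exponent TYPE('n)) * (1 + ?t)\<^sup>2
         \<le> (1 + ?t) powr (-1 - coord_exponent TYPE('n)) * (2 * (1 + (norm x)\<^sup>2))"
        by (intro mult_left_mono 1) auto
      finally show ?thesis by (simp only: mult_ac)
    qed
    then have "(\<Prod>i\<in>(UNIV::'n set). (1::real)) \<le> (\<Prod>i\<in>UNIV. 2 * (1 + \<bar>x $ i\<bar>) powr (-1 - coord_exponent TYPE('n)) * (1 + (norm x)\<^sup>2))"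
      by (intro prod_mono) auto
    then show ?thesis unfolding eq by simp
  qed
  have "norm (u x) \<le> (2 ^ CARD('n) * B) * weight x" for x
  proof -
    have "norm (u x) * 1 \<le> norm (u x) * (2 ^ CARD('n) * weight x * japanese_bracket x ^ (2 * CARD('n)))"
      by (intro mult_left_mono w) auto
    also have "\<dots> = 2 ^ CARD('n) * weight x * norm (japanese_bracket x ^ (2 * CARD('n)) *\<^sub>R u x)"
      using japanese_bracket_bounds(1)[of x] by simp
    also have "\<dots> \<le> 2 ^ CARD('n) * weight x * B" by (intro mult_left_mono B) (simp add: weight_nonneg)
    finally show ?thesis by (simp add: mult_ac)
  qed
  then show "\<exists>C\<ge>0. \<forall>x. norm (u x) \<le> C * weight x" using \<open>B \<ge> 0\<close> by (intro exI[of _ "2 ^ CARD('n) * B"]) auto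
qed

lemma integrable_weight: "integrable lborel (weight :: real^'n::finite \<Rightarrow> real)"
  by (rule integrableI_nonneg) (use nn_integral_weight_finite[where 'n='n] weight_nonneg in auto)

lemma schwartz_integrable:
  assumes "u \<in> schwartz_space"
  shows "integrable lborel u" "u \<in> borel_measurable borel"
proof -
  show m: "u \<in> borel_measurable borel" by (rule borel_measurable_continuous_onI[OF schwartz_weight_bound(1)[OF assms]])
  obtain C where "C \<ge> 0" "\<forall>x. norm (u x) \<le> C * weight x" using schwartz_weight_bound(2)[OF assms] by blast
  then show "integrable lborel u"
    by (intro Bochner_Integration.integrable_bound[OF integrable_mult_right[OF integrable_weight, of C]])
       (use m in \<open>auto simp: abs_mult weight_nonneg\<close>)
qed

section \<open>From pointwise majorants to Lebesgue norms\<close>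

lemma fourier_lborel:
  assumes [measurable]: "u \<in> borel_measurable borel"
  shows "fourier u \<xi> = (LINT y|lborel. u y * exp (- (\<i> * complex_of_real (y \<bullet> \<xi>))))"
proof -
  have "fourier u \<xi> = (LINT y|lborel. exp (- (\<i> * complex_of_real (y \<bullet> \<xi>))) * u y)"
    unfolding fourier_def by (rule integral_completion) measurable
  then show ?thesis by (simp add: mult.commute)
qed

lemma fourier_measurable:
  fixes u :: "real^'n::finite \<Rightarrow> complex"
  assumes [measurable]: "u \<in> borel_measurable borel"
  shows "fourier u \<in> borel_measurable borel"
  unfolding fourier_lborel[OF assms, abs_def] by measurable

text \<open>
  The frequency integral is a convolution with the Fourier integral of the symbol.
\<close>

lemma oscillatory_integral_kernel:
  fixes u :: "real^'n::finite \<Rightarrow> complex"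
  assumes u: "integrable lborel u" and \<sigma>: "integrable lborel \<sigma>"
  shows "(LINT \<xi>|lborel. exp (\<i> * complex_of_real (z \<bullet> \<xi>)) * \<sigma> \<xi> * fourier u \<xi>) = (LINT y|lborel. u y * ft (z - y) \<sigma>)"
proof -
  have [measurable]: "u \<in> borel_measurable borel" using u by auto
  let ?v = "\<lambda>\<xi>. exp (\<i> * complex_of_real (z \<bullet> \<xi>)) * \<sigma> \<xi>"
  have "(LINT \<xi>|lborel. ?v \<xi> * fourier u \<xi>) = (LINT \<xi>|lborel. ?v \<xi> * (LINT y|lborel. u y * exp (- (\<i> * complex_of_real (y \<bullet> \<xi>)))))"
    by (simp add: fourier_lborel)
  also have "\<dots> = (LINT y|lborel. u y * (LINT \<xi>|lborel. ?v \<xi> * exp (- (\<i> * complex_of_real (y \<bullet> \<xi>)))))"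
  proof (rule fubini_bounded_kernel[OF u integrable_exp_mult[OF \<sigma>], where B = 1])
    have "(\<lambda>(\<xi>, y::real^'n). exp (- (\<i> * complex_of_real (y \<bullet> \<xi>)))) \<in> borel_measurable borel"
      by (intro borel_measurable_continuous_onI) (auto simp: case_prod_unfold intro!: continuous_intros)
    then show "(\<lambda>(\<xi>, y::real^'n). exp (- (\<i> * complex_of_real (y \<bullet> \<xi>)))) \<in> borel_measurable (borel \<Otimes>\<^sub>M borel)"
      by (simp add: borel_prod)
    show "norm (exp (- (\<i> * complex_of_real (y \<bullet> \<xi>)))) \<le> 1" for \<xi> y :: "real^'n"
      by (simp add: norm_exp_eq_Re)
  qed
  also have "\<dots> = (LINT y|lborel. u y * ft (z - y) \<sigma>)"
  proof -
    have "?v \<xi> * exp (- (\<i> * complex_of_real (y \<bullet> \<xi>))) = exp (\<i> * complex_of_real ((z - y) \<bullet> \<xi>)) * \<sigma> \<xi>" for y \<xi>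
    proof -
      have "exp (\<i> * complex_of_real ((z - y) \<bullet> \<xi>)) = exp (\<i> * complex_of_real (z \<bullet> \<xi>)) * exp (- (\<i> * complex_of_real (y \<bullet> \<xi>)))"
        by (simp add: exp_add[symmetric] inner_diff_left algebra_simps)
      then show ?thesis by (simp add: mult_ac)
    qed
    then show ?thesis by (simp only: ft_def)
  qed
  finally show ?thesis .
qed

text \<open>
  The dependence on \<open>z\<close> is only through the argument of the convolution; below \<open>z\<close> is the gradient
  of the phase at a spatial point.
\<close>

lemma oscillatory_integral_bound:
  fixes u :: "real^'n::finite \<Rightarrow> complex"
  assumes u: "integrable lborel u" and \<sigma>: "integrable lborel \<sigma>"
    and K: "\<And>s. norm (ft s \<sigma>) \<le> K * weight s" and K0: "K \<ge> 0"
  shows "ennreal (norm (LINT \<xi>|lborel. exp (\<i> * complex_of_real (z \<bullet> \<xi>)) * \<sigma> \<xi> * fourier u \<xi>))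
     \<le> ennreal K * conv weight (\<lambda>y. norm (u y)) z"
proof -
  have [measurable]: "u \<in> borel_measurable borel" using u by auto
  let ?I = "LINT y|lborel. u y * ft (z - y) \<sigma>"
  have "ennreal (norm ?I) \<le> (\<integral>\<^sup>+y. ennreal (norm (u y * ft (z - y) \<sigma>)) \<partial>lborel)"
  proof (cases "integrable lborel (\<lambda>y. u y * ft (z - y) \<sigma>)")
    case True
    then show ?thesis by (rule integral_norm_bound_ennreal)
  next
    case False
    then show ?thesis by (simp add: not_integrable_integral_eq)
  qed
  also have "\<dots> \<le> (\<integral>\<^sup>+y. ennreal K * (ennreal (weight (z - y)) * ennreal (norm (u y))) \<partial>lborel)"
  proof (rule nn_integral_mono)
    fix y
    have "norm (u y * ft (z - y) \<sigma>) \<le> norm (u y) * (K * weight (z - y))"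
      unfolding norm_mult by (intro mult_left_mono K) auto
    also have "\<dots> = K * (weight (z - y) * norm (u y))" by (simp add: mult_ac)
    finally show "ennreal (norm (u y * ft (z - y) \<sigma>)) \<le> ennreal K * (ennreal (weight (z - y)) * ennreal (norm (u y)))"
      using K0 by (simp add: ennreal_mult[symmetric] weight_nonneg ennreal_leI)
  qed
  also have "\<dots> = ennreal K * conv weight (\<lambda>y. norm (u y)) z"
    unfolding conv_def by (rule nn_integral_cmult) measurable
  finally show ?thesis unfolding oscillatory_integral_kernel[OF u \<sigma>] .
qed

definition weight_mass :: "'n::finite itself \<Rightarrow> real"
  where "weight_mass _ = enn2real (\<integral>\<^sup>+z. ennreal (weight z) \<partial>(lborel :: (real^'n) measure)) + 1"

lemma weight_mass:
  "(\<integral>\<^sup>+z. ennreal (weight z) \<partial>(lborel :: (real^'n::finite) measure)) \<le> ennreal (weight_mass TYPE('n))"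
  "weight_mass TYPE('n) > 0"
proof -
  show "weight_mass TYPE('n) > 0" by (simp add: weight_mass_def add_nonneg_pos)
  have "(\<integral>\<^sup>+z. ennreal (weight z) \<partial>(lborel :: (real^'n) measure)) = ennreal (weight_mass TYPE('n) - 1)"
    using nn_integral_weight_finite[where 'n='n] by (simp add: weight_mass_def less_top)
  also have "\<dots> \<le> ennreal (weight_mass TYPE('n))" by (rule ennreal_leI) simp
  finally show "(\<integral>\<^sup>+z. ennreal (weight z) \<partial>(lborel :: (real^'n) measure)) \<le> ennreal (weight_mass TYPE('n))" .
qed

lemma conv_weight_finite:
  fixes u :: "real^'n::finite \<Rightarrow> complex"
  assumes u: "u \<in> schwartz_space"
  shows "conv weight (\<lambda>y. norm (u y)) z < \<infinity>"
proof -
  obtain C where C: "C \<ge> 0" "\<forall>x. norm (u x) \<le> C * weight x" using schwartz_weight_bound(2)[OF u] by blast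
  have w1: "weight x \<le> 1" for x :: "real^'n"
  proof -
    have "weight x \<le> (\<Prod>i\<in>(UNIV::'n set). 1)"
      unfolding weight_def
    proof (rule prod_mono, safe)
      fix i
      have "(1 + \<bar>x $ i\<bar>) powr (-1 - coord_exponent TYPE('n)) \<le> (1 + \<bar>x $ i\<bar>) powr 0"
        using coord_exponent_bounds(1)[where 'n='n] by (intro powr_mono) auto
      then show "(1 + \<bar>x $ i\<bar>) powr (-1 - coord_exponent TYPE('n)) \<le> 1" by (simp split: if_splits)
    qed auto
    then show ?thesis by simp
  qed
  have "norm (u x) \<le> C" for x using C mult_left_mono[OF w1[of x] C(1)] by (metis mult_1_right order_trans)
  then have "conv weight (\<lambda>y. norm (u y)) z \<le> ennreal (weight_mass TYPE('n)) * ennreal C"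
    by (intro conv_le_bound weight_mass) (auto intro!: AE_I2 ennreal_leI)
  also have "\<dots> < \<infinity>" by (simp add: ennreal_mult_less_top)
  finally show ?thesis .
qed

text \<open>
  All finite exponents are reduced to this: finitely many functions \<open>G i\<close> with bounded norms, composed with
  expanding maps.
\<close>

lemma Lp_from_majorants:
  fixes T :: "real^'n::finite \<Rightarrow> complex" and g :: "nat \<Rightarrow> real^'n \<Rightarrow> real^'n" and G :: "nat \<Rightarrow> real^'n \<Rightarrow> real"
  assumes P: "P \<ge> 1"
    and g: "\<And>i. i < N \<Longrightarrow> g i \<in> borel_measurable lebesgue"
    and c: "c > 0" "\<And>i x y. i < N \<Longrightarrow> c * norm (x - y) \<le> norm (g i x - g i y)"
    and G: "\<And>i. i < N \<Longrightarrow> G i \<in> borel_measurable borel" "\<And>i z. i < N \<Longrightarrow> G i z \<ge> 0"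
    and T: "AE x in lebesgue. norm (T x) \<le> (\<Sum>i<N. G i (g i x))"
    and B: "\<And>i. i < N \<Longrightarrow> (\<integral>\<^sup>+z. ennreal (G i z powr P) \<partial>lborel) \<le> ennreal K * I" and K: "K \<ge> 0"
  shows "(\<integral>\<^sup>+x. ennreal (norm (T x) powr P) \<partial>lebesgue)
    \<le> ennreal (real N powr P * (real N * ((2 * CARD('n) / c) ^ CARD('n) * K))) * I"
proof -
  let ?c = "(2 * CARD('n) / c) ^ CARD('n)"
  have c0: "?c \<ge> 0" using c by simp
  have Gg: "(\<lambda>x. ennreal (G i (g i x) powr P)) \<in> borel_measurable lebesgue" if "i < N" for i
    using measurable_compose[OF g[OF that] G(1)[OF that]] by measurable
  have "(\<integral>\<^sup>+x. ennreal (norm (T x) powr P) \<partial>lebesgue) \<le> (\<integral>\<^sup>+x. ennreal (real N powr P) * (\<Sum>i<N. ennreal (G i (g i x) powr P)) \<partial>lebesgue)"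
  proof (rule nn_integral_mono_AE)
    show "AE x in lebesgue. ennreal (norm (T x) powr P) \<le> ennreal (real N powr P) * (\<Sum>i<N. ennreal (G i (g i x) powr P))"
      using T
    proof eventually_elim
      case (elim x)
      have "norm (T x) powr P \<le> (\<Sum>i<N. G i (g i x)) powr P" using elim P by (intro powr_mono2) auto
      also have "\<dots> \<le> real (card {..<N}) powr P * (\<Sum>i<N. G i (g i x) powr P)"
        by (rule sum_powr_le) (use G(2) P in auto)
      finally show ?case
        by (subst sum_ennreal) (auto simp: ennreal_mult[symmetric] sum_nonneg intro!: ennreal_leI)
    qed
  qed
  also have "\<dots> = ennreal (real N powr P) * (\<integral>\<^sup>+x. (\<Sum>i<N. ennreal (G i (g i x) powr P)) \<partial>lebesgue)"
    by (rule nn_integral_cmult) (intro borel_measurable_sum, use Gg in auto)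
  also have "(\<integral>\<^sup>+x. (\<Sum>i<N. ennreal (G i (g i x) powr P)) \<partial>lebesgue) = (\<Sum>i<N. \<integral>\<^sup>+x. ennreal (G i (g i x) powr P) \<partial>lebesgue)"
    by (rule nn_integral_sum) (use Gg in auto)
  also have "ennreal (real N powr P) * \<dots> \<le> ennreal (real N powr P) * (\<Sum>i<N. ennreal ?c * (ennreal K * I))"
  proof (intro mult_left_mono sum_mono)
    fix i assume "i \<in> {..<N}"
    then have i: "i < N" by simp
    have "(\<integral>\<^sup>+x. ennreal (G i (g i x) powr P) \<partial>lebesgue) \<le> ennreal ((2 * DIM(real^'n) / c) ^ DIM(real^'n)) * (\<integral>\<^sup>+z. ennreal (G i z powr P) \<partial>lborel)"
      by (rule nn_integral_expanding_le[OF g[OF i] c(1) c(2)[OF i]]) (use G(1)[OF i] in measurable)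
    also have "\<dots> \<le> ennreal ?c * (ennreal K * I)" by (simp add: mult_left_mono B[OF i])
    finally show "(\<integral>\<^sup>+x. ennreal (G i (g i x) powr P) \<partial>lebesgue) \<le> ennreal ?c * (ennreal K * I)" .
  qed auto
  also have "\<dots> = ennreal (real N powr P * (real N * (?c * K))) * I"
    using c0 K by (simp add: ennreal_mult mult.assoc ennreal_of_nat_eq_real_of_nat)
  finally show ?thesis .
qed

text \<open>
  If the norm of \<open>u\<close> is infinite, the claim is trivial only for a positive constant; this is why \<open>C + 1\<close> is
  used instead of \<open>C\<close>.
\<close>

lemma bounded_on_Lp_finite:
  fixes T :: "(real^'n::finite \<Rightarrow> complex) \<Rightarrow> real^'n \<Rightarrow> complex"
  assumes p: "1 \<le> p" "p < \<infinity>" and m: "\<And>u. u \<in> schwartz_space \<Longrightarrow> T u \<in> borel_measurable lebesgue"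
    and C: "C \<ge> 0" and b: "\<And>u. u \<in> schwartz_space \<Longrightarrow> (\<integral>\<^sup>+x. ennreal (norm (T u x) powr enn2real p) \<partial>lebesgue)
      \<le> ennreal C * (\<integral>\<^sup>+x. ennreal (norm (u x) powr enn2real p) \<partial>lebesgue)"
  shows "bounded_on_Lp p T"
  unfolding bounded_on_Lp_def
proof (intro exI ballI conjI)
  let ?P = "enn2real p" and ?D = "(C + 1) powr (1 / enn2real p)"
  have P: "?P \<ge> 1" using p enn2real_mono[of 1 p] by (simp add: less_top)
  have D: "?D > 0" using C by simp
  fix u :: "real^'n \<Rightarrow> complex" assume u: "u \<in> schwartz_space"
  show "T u \<in> borel_measurable lebesgue" by (rule m[OF u])
  define I where "I = (\<integral>\<^sup>+x. ennreal (norm (u x) powr ?P) \<partial>lebesgue)"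
  define J where "J = (\<integral>\<^sup>+x. ennreal (norm (T u x) powr ?P) \<partial>lebesgue)"
  have JI: "J \<le> ennreal C * I" unfolding I_def J_def by (rule b[OF u])
  have np: "p \<noteq> \<infinity>" using p by simp
  show "Lp_norm p (T u) \<le> ennreal ?D * Lp_norm p u"
  proof (cases "I = \<infinity>")
    case True
    then have "Lp_norm p u = \<infinity>" using np by (simp add: Lp_norm_def I_def[symmetric])
    then show ?thesis using D by (simp add: ennreal_mult_top)
  next
    case False
    then obtain i where i: "I = ennreal i" "i \<ge> 0" by (cases I) auto
    have "J \<le> ennreal (C * i)" using JI C i by (simp add: ennreal_mult)
    then obtain j where j: "J = ennreal j" "0 \<le> j" "j \<le> C * i"
      using C i(2) by (cases J) (auto simp: top_unique)
    have "j powr (1 / ?P) \<le> ((C + 1) * i) powr (1 / ?P)"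
      using j C i(2) P by (intro powr_mono2) (auto simp: algebra_simps)
    also have "\<dots> = ?D * i powr (1 / ?P)" using C i(2) by (simp add: powr_mult)
    finally have "ennreal (j powr (1 / ?P)) \<le> ennreal ?D * ennreal (i powr (1 / ?P))"
      by (simp add: ennreal_mult[symmetric] ennreal_leI)
    then show ?thesis
      using np i j(1,2) by (simp add: Lp_norm_def I_def[symmetric] J_def[symmetric])
  qed
qed

lemma bounded_on_Lp_infinity:
  fixes T :: "(real^'n::finite \<Rightarrow> complex) \<Rightarrow> real^'n \<Rightarrow> complex"
  assumes m: "\<And>u. u \<in> schwartz_space \<Longrightarrow> T u \<in> borel_measurable lebesgue"
    and K: "K \<ge> 0" and T: "\<And>u. u \<in> schwartz_space \<Longrightarrow> AE x in lebesgue. ennreal (norm (T u x)) \<le> ennreal K * conv weight (\<lambda>y. norm (u y)) (g x)"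
  shows "bounded_on_Lp \<infinity> T"
  unfolding bounded_on_Lp_def
proof (intro exI ballI conjI)
  fix u :: "real^'n \<Rightarrow> complex" assume u: "u \<in> schwartz_space"
  show "T u \<in> borel_measurable lebesgue" by (rule m[OF u])
  have [measurable]: "T u \<in> borel_measurable lebesgue" by (rule m[OF u])
  have [measurable]: "u \<in> borel_measurable borel" by (rule schwartz_integrable[OF u])
  have "AE y in lebesgue. ennreal (norm (u y)) \<le> Linf_norm u" unfolding Linf_norm_def by (rule esssup_AE)
  then have ae: "AE y in lborel. ennreal (norm (u y)) \<le> Linf_norm u"
    by (subst (asm) AE_completion_iff) measurable
  show "Lp_norm \<infinity> (T u) \<le> ennreal (K * weight_mass TYPE('n)) * Lp_norm \<infinity> u"
  proof -
    have "Linf_norm (T u) \<le> ennreal (K * weight_mass TYPE('n)) * Linf_norm u"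
      unfolding Linf_norm_def[of "T u"]
    proof (rule esssup_I)
      show "AE x in lebesgue. ennreal (norm (T u x)) \<le> ennreal (K * weight_mass TYPE('n)) * Linf_norm u"
        using T[OF u]
      proof eventually_elim
        case (elim x)
        have "conv weight (\<lambda>y. norm (u y)) (g x) \<le> ennreal (weight_mass TYPE('n)) * Linf_norm u"
          by (rule conv_le_bound[OF _ weight_mass(1) ae]) measurable
        then have "ennreal K * conv weight (\<lambda>y. norm (u y)) (g x) \<le> ennreal K * (ennreal (weight_mass TYPE('n)) * Linf_norm u)"
          by (rule mult_left_mono) simp
        then show ?case using elim K weight_mass(2)[where 'n='n] by (simp add: ennreal_mult mult.assoc)
      qed
    qed measurable
    then show ?thesis by (simp add: Lp_norm_def)
  qed
qed

lemma conv_weight_Lp: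
  fixes u :: "real^'n::finite \<Rightarrow> complex"
  assumes u: "u \<in> schwartz_space" and P: "P \<ge> 1" and K: "K \<ge> 0"
  defines "G \<equiv> \<lambda>z. K * enn2real (conv weight (\<lambda>y. norm (u y)) z)"
  shows "G \<in> borel_measurable borel" "\<And>z. G z \<ge> 0"
    "(\<integral>\<^sup>+z. ennreal (G z powr P) \<partial>lborel)
      \<le> ennreal (K powr P * (2 * (2 * weight_mass TYPE('n)) powr (P - 1) * weight_mass TYPE('n))) * (\<integral>\<^sup>+y. ennreal (norm (u y) powr P) \<partial>lborel)"
proof -
  have [measurable]: "u \<in> borel_measurable borel" by (rule schwartz_integrable[OF u])
  show "G \<in> borel_measurable borel" unfolding G_def by measurable
  show "\<And>z. G z \<ge> 0" using K by (simp add: G_def)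
  let ?M = "weight_mass TYPE('n)"
  have "(\<integral>\<^sup>+z. ennreal (G z powr P) \<partial>lborel) = (\<integral>\<^sup>+z. ennreal (K powr P) * ennreal (enn2real (conv weight (\<lambda>y. norm (u y)) z) powr P) \<partial>lborel)"
    using K by (intro nn_integral_cong) (simp add: G_def powr_mult ennreal_mult[symmetric])
  also have "\<dots> = ennreal (K powr P) * (\<integral>\<^sup>+z. ennreal (enn2real (conv weight (\<lambda>y. norm (u y)) z) powr P) \<partial>lborel)"
    by (rule nn_integral_cmult) measurable
  also have "\<dots> \<le> ennreal (K powr P) * (ennreal (2 * (2 * ?M) powr (P - 1) * ?M) * (\<integral>\<^sup>+y. ennreal (norm (u y) powr P) \<partial>lborel))"
    by (intro mult_left_mono nn_integral_conv_powr_le weight_mass P conv_weight_finite u weight_nonneg) auto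
  also have "\<dots> = ennreal (K powr P * (2 * (2 * ?M) powr (P - 1) * ?M)) * (\<integral>\<^sup>+y. ennreal (norm (u y) powr P) \<partial>lborel)"
    using weight_mass(2)[where 'n='n] by (simp add: ennreal_mult mult.assoc)
  finally show "(\<integral>\<^sup>+z. ennreal (G z powr P) \<partial>lborel)
      \<le> ennreal (K powr P * (2 * (2 * ?M) powr (P - 1) * ?M)) * (\<integral>\<^sup>+y. ennreal (norm (u y) powr P) \<partial>lborel)" .
qed

section \<open>Kernels with bounds uniform in a parameter\<close>

lemma iter_deriv_locally_zero:
  fixes f :: "real^'n::finite \<Rightarrow> 'b::real_normed_vector"
  assumes S: "open S" and z: "\<And>\<xi>. \<xi> \<in> S \<Longrightarrow> f \<xi> = 0" and x: "\<xi> \<in> S"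
  shows "iter_deriv \<alpha> f \<xi> = 0"
  using x
proof (induction \<alpha> arbitrary: \<xi>)
  case Nil then show ?case using z by simp
next
  case (Cons i \<alpha>)
  have op: "open {t. \<xi> + t *\<^sub>R axis i 1 \<in> S}"
  proof -
    have "continuous_on UNIV (\<lambda>t::real. \<xi> + t *\<^sub>R axis i 1)" by (intro continuous_intros)
    then have "open ((\<lambda>t::real. \<xi> + t *\<^sub>R axis i 1) -` S)" using S by (simp add: continuous_on_open_vimage)
    then show ?thesis by (simp add: vimage_def)
  qed
  have "((\<lambda>t. iter_deriv \<alpha> f (\<xi> + t *\<^sub>R axis i 1)) has_vector_derivative 0) (at 0)"
    by (rule has_vector_derivative_transform_within_open[OF has_vector_derivative_const op])
       (use Cons in auto)
  then show ?case by (simp add: partial_deriv_def vector_derivative_at)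
qed

text \<open>
  Outside the support all derivatives vanish, so a compactly supported function decays faster than every
  power.
\<close>

lemma test_function_bounds:
  fixes \<chi>\<^sub>0 :: "real^'n::finite \<Rightarrow> complex"
  assumes chi: "\<chi>\<^sub>0 \<in> test_functions"
  shows "\<exists>C\<ge>0. \<forall>\<xi>. norm (iter_deriv \<alpha> \<chi>\<^sub>0 \<xi>) \<le> C * (1 + norm \<xi>) powr (- E)"
proof -
  have sm: "smooth_on UNIV \<chi>\<^sub>0" using chi by (simp add: test_functions_def)
  have "bounded (closure {x. \<chi>\<^sub>0 x \<noteq> 0})" using chi by (auto simp: test_functions_def compact_imp_bounded)
  then obtain R where R: "\<And>x. x \<in> closure {x. \<chi>\<^sub>0 x \<noteq> 0} \<Longrightarrow> norm x \<le> R" unfolding bounded_iff by blast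
  have "compact (cball (0::real^'n) R)" by simp
  moreover have "continuous_on (cball 0 R) (\<lambda>\<xi>. norm (iter_deriv \<alpha> \<chi>\<^sub>0 \<xi>) * (1 + norm \<xi>) powr E)"
    using continuous_on_subset[OF smooth_on_continuous[OF sm]] by (intro continuous_intros) auto
  ultimately have "bounded ((\<lambda>\<xi>. norm (iter_deriv \<alpha> \<chi>\<^sub>0 \<xi>) * (1 + norm \<xi>) powr E) ` cball 0 R)"
    by (intro compact_imp_bounded compact_continuous_image)
  then obtain C where C: "\<And>\<xi>. \<xi> \<in> cball 0 R \<Longrightarrow> norm (norm (iter_deriv \<alpha> \<chi>\<^sub>0 \<xi>) * (1 + norm \<xi>) powr E) \<le> C"
    unfolding bounded_iff by blast
  have "norm (iter_deriv \<alpha> \<chi>\<^sub>0 \<xi>) \<le> \<bar>C\<bar> * (1 + norm \<xi>) powr (- E)" for \<xi>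
  proof (cases "norm \<xi> \<le> R")
    case True
    have "norm (iter_deriv \<alpha> \<chi>\<^sub>0 \<xi>) = (norm (iter_deriv \<alpha> \<chi>\<^sub>0 \<xi>) * (1 + norm \<xi>) powr E) * (1 + norm \<xi>) powr (- E)"
      by (simp add: mult.assoc powr_add[symmetric])
    also have "\<dots> \<le> \<bar>C\<bar> * (1 + norm \<xi>) powr (- E)"
      using C[of \<xi>] True by (intro mult_right_mono) auto
    finally show ?thesis .
  next
    case False
    have "\<chi>\<^sub>0 \<eta> = 0" if "\<eta> \<in> {\<eta>. R < norm \<eta>}" for \<eta>
      using R[of \<eta>] that closure_subset[of "{x. \<chi>\<^sub>0 x \<noteq> 0}"] by force
    moreover have "open {\<eta> :: real^'n. R < norm \<eta>}" by (intro open_Collect_less continuous_intros)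
    ultimately have "iter_deriv \<alpha> \<chi>\<^sub>0 \<xi> = 0" using False by (intro iter_deriv_locally_zero[of "{\<eta>. R < norm \<eta>}"]) auto
    then show ?thesis by simp
  qed
  then show ?thesis by (metis abs_ge_zero)
qed

lemma inverse_power_le_weight: "(1 + norm \<xi>) powr (- 2 * real CARD('n)) \<le> weight (\<xi> :: real^'n::finite)"
proof -
  have "(1 + norm \<xi>) powr (- 2 * real CARD('n)) = (\<Prod>i\<in>(UNIV::'n set). (1 + norm \<xi>) powr (-2))"
    by (subst prod_powr_exponent) (auto simp: mult.commute)
  also have "\<dots> \<le> weight \<xi>"
    unfolding weight_def
  proof (rule prod_mono, safe)
    fix i
    have "(1 + norm \<xi>) powr (-2) \<le> (1 + norm \<xi>) powr (-1 - coord_exponent TYPE('n))"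
      using coord_exponent_bounds(2)[where 'n='n] by (intro powr_mono) auto
    also have "\<dots> \<le> (1 + \<bar>\<xi> $ i\<bar>) powr (-1 - coord_exponent TYPE('n))"
      using coord_exponent_bounds(1)[where 'n='n] component_le_norm_cart[of \<xi> i] by (intro powr_mono2') auto
    finally show "(1 + norm \<xi>) powr (-2) \<le> (1 + \<bar>\<xi> $ i\<bar>) powr (-1 - coord_exponent TYPE('n))" .
  qed auto
  finally show ?thesis .
qed

text \<open>
  The conditions of \<open>kernel_decay\<close>, packaged for a family of symbols. The first derivative is
  required to belong to a class without singularity, so that \<open>n\<close> further derivatives lead to the
  singularity \<open>n\<close> at the order \<open>n + 1\<close>.
\<close>

lemma uniform_kernel_bound:
  fixes \<sigma> :: "'x \<Rightarrow> real^'n::finite \<Rightarrow> complex"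
  assumes meas: "\<And>x. x \<in> X \<Longrightarrow> \<sigma> x \<in> borel_measurable borel"
    and bd: "\<And>x \<xi>. x \<in> X \<Longrightarrow> norm (\<sigma> x \<xi>) \<le> A0 * (1 + norm \<xi>) powr (- 2 * real CARD('n))" and A0: "A0 \<ge> 0"
    and lip: "\<And>x \<xi>. x \<in> X \<Longrightarrow> norm (\<sigma> x \<xi> - s0 x) \<le> A1 * norm \<xi>" and A1: "A1 \<ge> 0"
    and der: "\<And>j. \<exists>\<sigma>'. (\<forall>x\<in>X. \<forall>\<xi>. \<xi> \<noteq> 0 \<longrightarrow> dir_deriv j (\<sigma> x) (\<sigma>' x) \<xi>) \<and> sym_class j X CARD('n) 1 0 \<sigma>'"
  shows "\<exists>K\<ge>0. \<forall>x\<in>X. integrable lborel (\<sigma> x) \<and> (\<forall>z. norm (ft z (\<sigma> x)) \<le> K * weight z)"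
proof -
  have "\<exists>F C. F 0 = \<sigma> \<and> (\<forall>k\<le>CARD('n). \<forall>x\<in>X. \<forall>\<xi>. \<xi> \<noteq> 0 \<longrightarrow> dir_deriv j (F k x) (F (Suc k) x) \<xi>) \<and> C \<ge> 0 \<and>
     (\<forall>x\<in>X. \<forall>\<xi>. \<xi> \<noteq> 0 \<longrightarrow> norm (F (Suc CARD('n)) x \<xi>) \<le> C * (norm \<xi> powr (- real CARD('n)) / (1 + norm \<xi>)))" for j
  proof -
    obtain \<sigma>' where \<sigma>': "\<forall>x\<in>X. \<forall>\<xi>. \<xi> \<noteq> 0 \<longrightarrow> dir_deriv j (\<sigma> x) (\<sigma>' x) \<xi>" "sym_class j X CARD('n) 1 0 \<sigma>'"
      using der by blast
    obtain F C where F: "F 0 = \<sigma>'" "\<forall>i<CARD('n). \<forall>x\<in>X. \<forall>\<xi>. \<xi> \<noteq> 0 \<longrightarrow> dir_deriv j (F i x) (F (Suc i) x) \<xi>"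
       "C \<ge> 0" "\<forall>x\<in>X. \<forall>\<xi>. \<xi> \<noteq> 0 \<longrightarrow> norm (F CARD('n) x \<xi>) \<le> C * sym_weight 1 (0 + real CARD('n)) \<xi>"
      using chain_of_sym_class[OF \<sigma>'(2)] by blast
    have w: "sym_weight 1 (0 + real CARD('n)) \<xi> = norm \<xi> powr (- real CARD('n)) / (1 + norm \<xi>)" for \<xi> :: "real^'n"
      by (simp add: sym_weight_def powr_minus_divide add_pos_nonneg)
    have "\<forall>k\<le>CARD('n). \<forall>x\<in>X. \<forall>\<xi>. \<xi> \<noteq> 0 \<longrightarrow> dir_deriv j (case_nat \<sigma> F k x) (case_nat \<sigma> F (Suc k) x) \<xi>"
    proof (intro allI impI ballI)
      fix k x \<xi> assume "k \<le> CARD('n)" "x \<in> X" "\<xi> \<noteq> (0::real^'n)"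
      then show "dir_deriv j (case_nat \<sigma> F k x) (case_nat \<sigma> F (Suc k) x) \<xi>"
        using \<sigma>'(1) F(1,2) by (cases k) auto
    qed
    then show ?thesis
      using F(3,4) unfolding w by (intro exI[of _ "case_nat \<sigma> F"] exI[of _ C]) auto
  qed
  then have "\<forall>j. \<exists>FC. fst FC 0 = \<sigma> \<and> (\<forall>k\<le>CARD('n). \<forall>x\<in>X. \<forall>\<xi>. \<xi> \<noteq> 0 \<longrightarrow> dir_deriv j (fst FC k x) (fst FC (Suc k) x) \<xi>) \<and> snd FC \<ge> 0 \<and>
     (\<forall>x\<in>X. \<forall>\<xi>. \<xi> \<noteq> 0 \<longrightarrow> norm (fst FC (Suc CARD('n)) x \<xi>) \<le> snd FC * (norm \<xi> powr (- real CARD('n)) / (1 + norm \<xi>)))"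
    by auto
  from choice[OF this] obtain FC where FC: "\<And>j. fst (FC j) 0 = \<sigma>"
    "\<And>j k x \<xi>. k \<le> CARD('n) \<Longrightarrow> x \<in> X \<Longrightarrow> \<xi> \<noteq> 0 \<Longrightarrow> dir_deriv j (fst (FC j) k x) (fst (FC j) (Suc k) x) \<xi>"
    "\<And>j. snd (FC j) \<ge> (0::real)"
    "\<And>j x \<xi>. x \<in> X \<Longrightarrow> \<xi> \<noteq> 0 \<Longrightarrow> norm (fst (FC j) (Suc CARD('n)) x \<xi>) \<le> snd (FC j) * (norm \<xi> powr (- real CARD('n)) / (1 + norm \<xi>))"
    by blast
  obtain C where C: "C > 0" "\<And>(\<sigma> :: real^'n \<Rightarrow> complex) \<sigma>0 A F z.
     A \<ge> 0 \<Longrightarrow> integrable lborel \<sigma> \<Longrightarrow> (LINT \<xi>|lborel. norm (\<sigma> \<xi>)) \<le> A \<Longrightarrow>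
     (\<forall>\<xi>. norm (\<sigma> \<xi> - \<sigma>0) \<le> A * norm \<xi>) \<Longrightarrow>
     (\<forall>j. F j 0 = \<sigma>) \<Longrightarrow>
     (\<forall>j k \<xi>. k \<le> CARD('n) \<longrightarrow> \<xi> \<noteq> 0 \<longrightarrow> dir_deriv j (F j k) (F j (Suc k)) \<xi>) \<Longrightarrow>
     (\<forall>j \<xi>. \<xi> \<noteq> 0 \<longrightarrow> norm (F j (Suc CARD('n)) \<xi>) \<le> A * (norm \<xi> powr (- real CARD('n)) / (1 + norm \<xi>))) \<Longrightarrow>
     norm (ft z \<sigma>) \<le> C * A * weight z"
    using kernel_decay[where 'n='n] by blast
  define I where "I = (LINT \<xi>|lborel. weight (\<xi> :: real^'n))"
  have I0: "I \<ge> 0" unfolding I_def by (rule integral_nonneg_AE) (simp add: weight_nonneg)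
  define A where "A = A0 * I + A1 + (\<Sum>j\<in>UNIV. snd (FC j))"
  have s0: "(\<Sum>j\<in>UNIV. snd (FC j)) \<ge> 0" by (intro sum_nonneg FC(3))
  have A: "A \<ge> 0" "A0 * I \<le> A" "A1 \<le> A" unfolding A_def using A0 A1 I0 s0 by auto
  have As: "snd (FC j) \<le> A" for j
  proof -
    have "snd (FC j) \<le> (\<Sum>j\<in>UNIV. snd (FC j))" by (rule member_le_sum) (auto intro: FC(3))
    then show ?thesis unfolding A_def using A0 A1 I0 by (simp add: add_increasing)
  qed
  have "integrable lborel (\<sigma> x) \<and> (\<forall>z. norm (ft z (\<sigma> x)) \<le> (C * A) * weight z)" if x: "x \<in> X" for x
  proof -
    have b: "norm (\<sigma> x \<xi>) \<le> A0 * weight \<xi>" for \<xi>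
      using bd[OF x, of \<xi>] mult_left_mono[OF inverse_power_le_weight[of \<xi>] A0] by linarith
    have i: "integrable lborel (\<sigma> x)"
      by (rule Bochner_Integration.integrable_bound[OF integrable_mult_right[OF integrable_weight, of A0]])
         (use meas[OF x] b A0 in \<open>auto simp: abs_mult weight_nonneg\<close>)
    have n: "(LINT \<xi>|lborel. norm (\<sigma> x \<xi>)) \<le> A"
    proof -
      have "(LINT \<xi>|lborel. norm (\<sigma> x \<xi>)) \<le> (LINT \<xi>|lborel. A0 * weight (\<xi> :: real^'n))"
        by (rule Bochner_Integration.integral_mono) (use i b integrable_weight in auto)
      also have "\<dots> = A0 * I" by (simp add: I_def)
      finally show ?thesis using A(2) by linarith
    qed
    have "norm (ft z (\<sigma> x)) \<le> C * A * weight z" for z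
    proof (rule C(2)[OF A(1) i n, where F = "\<lambda>j k. fst (FC j) k x" and ?\<sigma>0.0 = "s0 x"])
      show "\<forall>\<xi>. norm (\<sigma> x \<xi> - s0 x) \<le> A * norm \<xi>"
        using lip[OF x] mult_right_mono[OF A(3) norm_ge_zero] by (meson order_trans)
      show "\<forall>j. fst (FC j) 0 x = \<sigma> x" using FC(1) by simp
      show "\<forall>j k \<xi>. k \<le> CARD('n) \<longrightarrow> \<xi> \<noteq> 0 \<longrightarrow> dir_deriv j (fst (FC j) k x) (fst (FC j) (Suc k) x) \<xi>"
        using FC(2) x by blast
      show "\<forall>j \<xi>. \<xi> \<noteq> 0 \<longrightarrow> norm (fst (FC j) (Suc CARD('n)) x \<xi>) \<le> A * (norm \<xi> powr (- real CARD('n)) / (1 + norm \<xi>))"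
      proof (intro allI impI)
        fix j and \<xi> :: "real^'n" assume nz: "\<xi> \<noteq> 0"
        have "snd (FC j) * (norm \<xi> powr (- real CARD('n)) / (1 + norm \<xi>)) \<le> A * (norm \<xi> powr (- real CARD('n)) / (1 + norm \<xi>))"
          by (rule mult_right_mono[OF As]) simp
        then show "norm (fst (FC j) (Suc CARD('n)) x \<xi>) \<le> A * (norm \<xi> powr (- real CARD('n)) / (1 + norm \<xi>))"
          using FC(4)[OF x nz, of j] by linarith
      qed
    qed
    then show ?thesis using i by simp
  qed
  then show ?thesis using C(1) A(1) by (intro exI[of _ "C * A"]) auto
qed

lemma FIO_integrand_measurable:
  fixes a :: "real^'n::finite \<Rightarrow> real^'n \<Rightarrow> complex"
  assumes a: "a \<in> Linf_S m \<rho>" and \<phi>: "\<phi> \<in> Linf_Phi k" and chi: "\<chi>\<^sub>0 \<in> test_functions"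
  shows "(\<lambda>(x, \<xi>). if \<xi> = 0 then 0 else exp (\<i> * complex_of_real (\<phi> x \<xi>)) * a x \<xi> * \<chi>\<^sub>0 \<xi>)
     \<in> borel_measurable (lebesgue \<Otimes>\<^sub>M lborel)"
proof (rule caratheodory_measurable)
  fix \<xi> :: "real^'n" assume "\<xi> \<noteq> 0"
  then have [measurable]: "(\<lambda>x. \<phi> x \<xi>) \<in> borel_measurable lebesgue" "(\<lambda>x. a x \<xi>) \<in> borel_measurable lebesgue"
    using a \<phi> by (auto simp: Linf_S_def Linf_Phi_def)
  show "(\<lambda>x. exp (\<i> * complex_of_real (\<phi> x \<xi>)) * a x \<xi> * \<chi>\<^sub>0 \<xi>) \<in> borel_measurable lebesgue" by measurable
next
  fix x
  have "continuous_on (- {0}) (\<phi> x)"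
    using smooth_on_continuous[of "- {0}" "\<phi> x" "[]"] \<phi> by (simp add: Linf_Phi_def)
  moreover have "continuous_on (- {0}) (a x)"
    using continuous_on_subset[OF smooth_on_continuous[of UNIV "a x" "[]"]] a by (simp add: Linf_S_def)
  moreover have "continuous_on (- {0}) \<chi>\<^sub>0"
    using continuous_on_subset[OF smooth_on_continuous[of UNIV \<chi>\<^sub>0 "[]"]] chi by (simp add: test_functions_def)
  ultimately show "continuous_on (- {0}) (\<lambda>\<xi>. exp (\<i> * complex_of_real (\<phi> x \<xi>)) * a x \<xi> * \<chi>\<^sub>0 \<xi>)"
    by (intro continuous_intros)
qed

text \<open>
  The value at the origin is replaced by zero, which does not change the integral but makes the
  integrand jointly measurable.
\<close>

lemma low_freq_FIO_lborel:
  fixes a :: "real^'n::finite \<Rightarrow> real^'n \<Rightarrow> complex"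
  assumes a: "a \<in> Linf_S m \<rho>" and \<phi>: "\<phi> \<in> Linf_Phi k" and chi: "\<chi>\<^sub>0 \<in> test_functions" and u: "u \<in> schwartz_space"
  shows "low_freq_FIO a \<phi> \<chi>\<^sub>0 u x = 1 / (2 * complex_of_real pi) ^ CARD('n) *
      (LINT \<xi>|lborel. (if \<xi> = 0 then 0 else exp (\<i> * complex_of_real (\<phi> x \<xi>)) * a x \<xi> * \<chi>\<^sub>0 \<xi>) * fourier u \<xi>)"
    and "low_freq_FIO a \<phi> \<chi>\<^sub>0 u \<in> borel_measurable lebesgue"
proof -
  let ?h = "\<lambda>x \<xi>. if \<xi> = 0 then 0 else exp (\<i> * complex_of_real (\<phi> x \<xi>)) * a x \<xi> * \<chi>\<^sub>0 \<xi>"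
  have hm[measurable]: "(\<lambda>(x, \<xi>). ?h x \<xi>) \<in> borel_measurable (lebesgue \<Otimes>\<^sub>M lborel)"
    by (rule FIO_integrand_measurable[OF a \<phi> chi])
  have h1: "?h x \<in> borel_measurable borel" for x
    using measurable_compose[OF measurable_Pair1'[of x lebesgue lborel] hm] by simp
  have [measurable]: "fourier u \<in> borel_measurable borel"
    by (rule fourier_measurable[OF schwartz_integrable(2)[OF u]])
  have eq: "low_freq_FIO a \<phi> \<chi>\<^sub>0 u x = 1 / (2 * complex_of_real pi) ^ CARD('n) * (LINT \<xi>|lborel. ?h x \<xi> * fourier u \<xi>)" for x
  proof -
    let ?f = "\<lambda>\<xi>. exp (\<i> * complex_of_real (\<phi> x \<xi>)) * a x \<xi> * \<chi>\<^sub>0 \<xi> * fourier u \<xi>"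
    have ff: "?f = (\<lambda>\<xi>. if \<xi> = 0 then ?f 0 else ?h x \<xi> * fourier u \<xi>)" by auto
    have m2: "(\<lambda>\<xi>. ?h x \<xi> * fourier u \<xi>) \<in> borel_measurable borel" using h1[of x] by measurable
    have m1: "?f \<in> borel_measurable borel"
      by (subst ff) (rule measurable_If, simp, rule m2, simp)
    have "(LINT \<xi>|lebesgue. ?f \<xi>) = (LINT \<xi>|lborel. ?f \<xi>)" by (rule integral_completion) (use m1 in simp)
    also have "\<dots> = (LINT \<xi>|lborel. ?h x \<xi> * fourier u \<xi>)"
    proof (rule integral_cong_AE)
      show "AE \<xi> in lborel. ?f \<xi> = ?h x \<xi> * fourier u \<xi>"
        using AE_lborel_singleton[of "0::real^'n"] by eventually_elim simp
    qed (use m1 m2 in simp_all)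
    finally show ?thesis by (simp add: low_freq_FIO_def)
  qed
  then show "low_freq_FIO a \<phi> \<chi>\<^sub>0 u x = 1 / (2 * complex_of_real pi) ^ CARD('n) * (LINT \<xi>|lborel. ?h x \<xi> * fourier u \<xi>)" .
  have "(\<lambda>x. LINT \<xi>|lborel. ?h x \<xi> * fourier u \<xi>) \<in> borel_measurable lebesgue"
  proof (rule lborel.borel_measurable_lebesgue_integral)
    have "(\<lambda>w. (case w of (x, \<xi>) \<Rightarrow> ?h x \<xi>) * fourier u (snd w)) \<in> borel_measurable (lebesgue \<Otimes>\<^sub>M lborel)"
      by (intro borel_measurable_times hm) measurable
    then show "(\<lambda>(x, \<xi>). ?h x \<xi> * fourier u \<xi>) \<in> borel_measurable (lebesgue \<Otimes>\<^sub>M lborel)"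
      by (simp only: case_prod_unfold)
  qed
  then show "low_freq_FIO a \<phi> \<chi>\<^sub>0 u \<in> borel_measurable lebesgue"
    unfolding eq[abs_def] by measurable
qed

section \<open>The cut-off amplitude and phases in dimension at least two\<close>

lemma norm_exp_i_minus_one: "norm (exp (\<i> * complex_of_real t) - 1) \<le> \<bar>t\<bar>"
proof -
  have "norm (exp (\<i> * complex_of_real t) - 1) = 2 * \<bar>sin (t / 2)\<bar>"
    using dist_exp_i_1[of t] by (simp add: dist_norm)
  also have "\<dots> \<le> \<bar>t\<bar>" using abs_sin_x_le_abs_x[of "t / 2"] by simp
  finally show ?thesis .
qed

lemma has_vector_derivative_complex_of_real:
  "(f has_vector_derivative D) F \<Longrightarrow> ((\<lambda>x. complex_of_real (f x)) has_vector_derivative complex_of_real D) F"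
  by (rule has_vector_derivative_of_real) (simp add: has_real_derivative_iff_has_vector_derivative)

lemma regular_class:
  fixes f :: "'x \<Rightarrow> real^'n::finite \<Rightarrow> complex"
  assumes f: "\<And>x. x \<in> X \<Longrightarrow> smooth_on UNIV (f x)"
    and b: "\<And>\<alpha>. \<exists>C\<ge>0. \<forall>x\<in>X. \<forall>\<xi>. norm (iter_deriv \<alpha> (f x) \<xi>) \<le> C * (1 + norm \<xi>) powr (- e - real k)"
  shows "sym_class j X k e 0 (\<lambda>x. iter_deriv (replicate i j) (f x))"
proof -
  have "sym_class j X k e 0 ((\<lambda>r x. iter_deriv (replicate (r + i) j) (f x)) 0)"
  proof (rule sym_class_of_regular_chain[where F = "\<lambda>r x. iter_deriv (replicate (r + i) j) (f x)"])
    fix r x and \<xi> :: "real^'n" assume "x \<in> X"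
    then show "dir_deriv j (iter_deriv (replicate (r + i) j) (f x)) (iter_deriv (replicate (Suc r + i) j) (f x)) \<xi>"
      using iter_deriv_dir_deriv[OF f, of x \<xi> j "replicate (r + i) j"] by simp
  next
    fix r
    show "\<exists>C\<ge>0. \<forall>x\<in>X. \<forall>\<xi>. \<xi> \<noteq> 0 \<longrightarrow> norm (iter_deriv (replicate (r + i) j) (f x) \<xi>) \<le> C * (1 + norm \<xi>) powr (- e - real k)"
      using b[of "replicate (r + i) j"] by blast
  qed
  then show ?thesis by simp
qed

text \<open>
  On the segment from \<open>\<xi>\<close> to the origin the growth factor of the derivatives is largest at \<open>\<xi>\<close>.
\<close>

lemma lipschitz_at_zero:
  fixes f :: "'x \<Rightarrow> real^'n::finite \<Rightarrow> complex" and E :: real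
  assumes f: "\<And>x. x \<in> Y \<Longrightarrow> smooth_on UNIV (f x)" and E: "E \<ge> 0"
    and bd: "\<And>\<alpha>. \<exists>C\<ge>0. \<forall>x\<in>Y. \<forall>\<xi>. norm (iter_deriv \<alpha> (f x) \<xi>) \<le> C * (1 + norm \<xi>) powr E"
  shows "\<exists>C\<ge>0. \<forall>x\<in>Y. \<forall>\<xi>. norm (f x \<xi> - f x 0) \<le> C * (1 + norm \<xi>) powr E * norm \<xi>"
proof -
  have "\<forall>i. \<exists>C. C \<ge> 0 \<and> (\<forall>x\<in>Y. \<forall>\<xi>. norm (iter_deriv [i] (f x) \<xi>) \<le> C * (1 + norm \<xi>) powr E)"
    using bd by blast
  from choice[OF this] obtain C where C: "\<And>i. C i \<ge> (0::real)" "\<And>i x \<xi>. x \<in> Y \<Longrightarrow> norm (iter_deriv [i] (f x) \<xi>) \<le> C i * (1 + norm \<xi>) powr E" by blast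
  define D where "D = (\<Sum>i\<in>UNIV. C i)"
  have D: "D \<ge> 0" "C i \<le> D" for i unfolding D_def by (auto intro: sum_nonneg C member_le_sum)
  have "norm (f x \<xi> - f x 0) \<le> (CARD('n) * D) * (1 + norm \<xi>) powr E * norm \<xi>" if x: "x \<in> Y" for x \<xi>
  proof -
    have "norm (f x \<xi> - f x 0) \<le> (CARD('n) * (D * (1 + norm \<xi>) powr E)) * norm (\<xi> - 0)"
    proof (rule partials_lipschitz[where S = UNIV])
      have "iter_deriv [] (f x) differentiable_on UNIV" using f[OF x] unfolding smooth_on_def by blast
      then show "f x differentiable_on UNIV" by simp
      fix z i assume z: "z \<in> closed_segment \<xi> 0"
      have nz: "norm z \<le> norm \<xi>" using segment_bound1[of z 0 \<xi>] z by (simp add: closed_segment_commute)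
      have "norm (partial_deriv i (f x) z) \<le> C i * (1 + norm z) powr E" using C(2)[OF x, of i z] by simp
      also have "\<dots> \<le> D * (1 + norm \<xi>) powr E"
        using D C(1) nz E by (intro mult_mono powr_mono2) auto
      finally show "norm (partial_deriv i (f x) z) \<le> D * (1 + norm \<xi>) powr E" .
    qed auto
    then show ?thesis by (simp add: mult_ac)
  qed
  then show ?thesis using D(1) by (intro exI[of _ "CARD('n) * D"]) auto
qed

text \<open>
  The set \<open>X\<close> collects the points \<open>x\<close> at which the bounds hold for all frequencies; in the
  application it has full measure.
\<close>

locale cutoff_amplitude =
  fixes a :: "real^'n::finite \<Rightarrow> real^'n \<Rightarrow> complex" and \<chi>\<^sub>0 :: "real^'n \<Rightarrow> complex" and X :: "(real^'n) set" and M :: real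
  assumes a_smooth: "\<And>x. smooth_on UNIV (a x)"
    and chi: "\<chi>\<^sub>0 \<in> test_functions"
    and M: "M \<ge> 0"
    and a_bound: "\<And>\<alpha>. \<exists>C\<ge>0. \<forall>x\<in>X. \<forall>\<xi>. norm (iter_deriv \<alpha> (a x) \<xi>) \<le> C * (1 + norm \<xi>) powr M"
begin

definition b where "b x \<xi> = a x \<xi> * \<chi>\<^sub>0 \<xi>"

definition b' where "b' j x \<xi> = a x \<xi> * iter_deriv [j] \<chi>\<^sub>0 \<xi> + iter_deriv [j] (a x) \<xi> * \<chi>\<^sub>0 \<xi>"

lemma chi_smooth: "smooth_on UNIV \<chi>\<^sub>0" using chi by (simp add: test_functions_def)

lemma b_dir_deriv: "dir_deriv j (b x) (b' j x) \<xi>"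
proof -
  have 1: "dir_deriv j (a x) (iter_deriv [j] (a x)) \<xi>"
    using iter_deriv_dir_deriv[OF a_smooth, of \<xi> j "[]" x] by simp
  have 2: "dir_deriv j \<chi>\<^sub>0 (iter_deriv [j] \<chi>\<^sub>0) \<xi>"
    using iter_deriv_dir_deriv[OF chi_smooth, of \<xi> j "[]"] by simp
  show ?thesis using dir_deriv_mult[OF 1 2] by (simp add: b_def[abs_def] b'_def[abs_def])
qed

lemma a_class: "sym_class j X k (- M - real k) 0 (\<lambda>x. iter_deriv (replicate i j) (a x))"
  by (rule regular_class) (use a_smooth a_bound in auto)

lemma chi_class: "sym_class j X k e 0 (\<lambda>x. iter_deriv (replicate i j) \<chi>\<^sub>0)"
proof (rule regular_class)
  show "\<exists>C\<ge>0. \<forall>x\<in>X. \<forall>\<xi>. norm (iter_deriv \<alpha> \<chi>\<^sub>0 \<xi>) \<le> C * (1 + norm \<xi>) powr (- e - real k)" for \<alpha>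
    using test_function_bounds[OF chi, of \<alpha> "e + real k"] by (simp add: minus_diff_commute) (metis minus_diff_eq)
qed (rule chi_smooth)

lemma b_class: "sym_class j X k e 0 b"
proof -
  have "sym_class j X k ((- M - real k) + (e + M + real k)) (0 + 0) (\<lambda>x \<xi>. iter_deriv (replicate 0 j) (a x) \<xi> * iter_deriv (replicate 0 j) \<chi>\<^sub>0 \<xi>)"
    by (rule sym_class_mult[OF a_class chi_class])
  then show ?thesis by (simp add: b_def[abs_def])
qed

lemma b'_class: "sym_class j X k e 0 (b' j)"
proof -
  have 1: "sym_class j X k ((- M - real k) + (e + M + real k)) (0 + 0) (\<lambda>x \<xi>. iter_deriv (replicate 0 j) (a x) \<xi> * iter_deriv (replicate 1 j) \<chi>\<^sub>0 \<xi>)"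
    by (rule sym_class_mult[OF a_class chi_class])
  have 2: "sym_class j X k ((- M - real k) + (e + M + real k)) (0 + 0) (\<lambda>x \<xi>. iter_deriv (replicate 1 j) (a x) \<xi> * iter_deriv (replicate 0 j) \<chi>\<^sub>0 \<xi>)"
    by (rule sym_class_mult[OF a_class chi_class])
  show ?thesis using sym_class_add[OF 1 2] by (simp add: b'_def[abs_def])
qed

lemma b_bound: "\<exists>C\<ge>0. \<forall>x\<in>X. \<forall>\<xi>. norm (b x \<xi>) \<le> C * (1 + norm \<xi>) powr (- E)"
proof -
  obtain C where C: "C \<ge> 0" "\<forall>x\<in>X. \<forall>\<xi>. norm (iter_deriv [] (a x) \<xi>) \<le> C * (1 + norm \<xi>) powr M" using a_bound by blast
  obtain D where D: "D \<ge> 0" "\<forall>\<xi>. norm (iter_deriv [] \<chi>\<^sub>0 \<xi>) \<le> D * (1 + norm \<xi>) powr (- (M + E))"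
    using test_function_bounds[OF chi] by blast
  have "norm (b x \<xi>) \<le> (C * D) * (1 + norm \<xi>) powr (- E)" if "x \<in> X" for x \<xi>
  proof -
    have "norm (b x \<xi>) \<le> (C * (1 + norm \<xi>) powr M) * (D * (1 + norm \<xi>) powr (- (M + E)))"
      unfolding b_def norm_mult using C D that by (intro mult_mono) auto
    also have "\<dots> = (C * D) * ((1 + norm \<xi>) powr M * (1 + norm \<xi>) powr (- (M + E)))" by (simp add: mult_ac)
    also have "(1 + norm \<xi>) powr M * (1 + norm \<xi>) powr (- (M + E)) = (1 + norm \<xi>) powr (- E)"
      by (simp only: powr_add[symmetric]) simp
    finally show ?thesis .
  qed
  then show ?thesis using C(1) D(1) by (intro exI[of _ "C * D"]) auto
qed

lemma b_lipschitz: "\<exists>C\<ge>0. \<forall>x\<in>X. \<forall>\<xi>. norm (b x \<xi> - b x 0) \<le> C * norm \<xi>"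
proof -
  obtain A where A: "A \<ge> 0" "\<forall>x\<in>X. \<forall>\<xi>. norm (a x \<xi> - a x 0) \<le> A * (1 + norm \<xi>) powr M * norm \<xi>"
    using lipschitz_at_zero[of X a, OF a_smooth M a_bound] by blast
  have "\<exists>C\<ge>0. \<forall>x\<in>(UNIV::unit set). \<forall>\<xi>. norm (\<chi>\<^sub>0 \<xi> - \<chi>\<^sub>0 0) \<le> C * (1 + norm \<xi>) powr 0 * norm \<xi>"
  proof (rule lipschitz_at_zero)
    show "\<exists>C\<ge>0. \<forall>x\<in>UNIV. \<forall>\<xi>. norm (iter_deriv \<alpha> \<chi>\<^sub>0 \<xi>) \<le> C * (1 + norm \<xi>) powr 0" for \<alpha>
      using test_function_bounds[OF chi, of \<alpha> 0] by simp
  qed (use chi_smooth in auto)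
  then obtain B where B: "B \<ge> 0" "\<forall>\<xi>. norm (\<chi>\<^sub>0 \<xi> - \<chi>\<^sub>0 0) \<le> B * norm \<xi>" by auto
  obtain C where C: "C \<ge> 0" "\<forall>x\<in>X. \<forall>\<xi>. norm (iter_deriv [] (a x) \<xi>) \<le> C * (1 + norm \<xi>) powr M" using a_bound by blast
  obtain D where D: "D \<ge> 0" "\<forall>\<xi>. norm (iter_deriv [] \<chi>\<^sub>0 \<xi>) \<le> D * (1 + norm \<xi>) powr (- M)"
    using test_function_bounds[OF chi] by blast
  have "norm (b x \<xi> - b x 0) \<le> (A * D + C * B) * norm \<xi>" if x: "x \<in> X" for x \<xi>
  proof -
    have "b x \<xi> - b x 0 = (a x \<xi> - a x 0) * \<chi>\<^sub>0 \<xi> + a x 0 * (\<chi>\<^sub>0 \<xi> - \<chi>\<^sub>0 0)" by (simp add: b_def algebra_simps)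
    then have "norm (b x \<xi> - b x 0) \<le> norm (a x \<xi> - a x 0) * norm (\<chi>\<^sub>0 \<xi>) + norm (a x 0) * norm (\<chi>\<^sub>0 \<xi> - \<chi>\<^sub>0 0)"
      using norm_triangle_ineq[of "(a x \<xi> - a x 0) * \<chi>\<^sub>0 \<xi>" "a x 0 * (\<chi>\<^sub>0 \<xi> - \<chi>\<^sub>0 0)"] by (simp add: norm_mult)
    also have "\<dots> \<le> (A * (1 + norm \<xi>) powr M * norm \<xi>) * (D * (1 + norm \<xi>) powr (- M)) + C * (B * norm \<xi>)"
    proof -
      have "norm (a x 0) \<le> C" using C(2)[rule_format, OF x, of 0] by simp
      then show ?thesis using A B C D x by (intro add_mono mult_mono) auto
    qed
    also have "(A * (1 + norm \<xi>) powr M * norm \<xi>) * (D * (1 + norm \<xi>) powr (- M)) = A * D * norm \<xi> * ((1 + norm \<xi>) powr M * (1 + norm \<xi>) powr (- M))"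
      by (simp add: mult_ac)
    also have "(1 + norm \<xi>) powr M * (1 + norm \<xi>) powr (- M) = 1" by (simp add: powr_add[symmetric])
    finally show ?thesis by (simp add: algebra_simps)
  qed
  then show ?thesis using A B C D by (intro exI[of _ "A * D + C * B"]) auto
qed

lemma b_continuous: "continuous_on S (b x)"
proof -
  have "continuous_on S (a x)" "continuous_on S \<chi>\<^sub>0"
    using continuous_on_subset[OF smooth_on_continuous[OF a_smooth, of "[]" x]]
      continuous_on_subset[OF smooth_on_continuous[OF chi_smooth, of "[]"]] by auto
  then show ?thesis unfolding b_def[abs_def] by (intro continuous_intros)
qed

end

text \<open>
  After the linear part of the phase is split off, the symbol \<open>\<sigma>\<close> has bounded first derivatives
  and is Lipschitz at the origin, because \<open>\<theta>\<close> has bounded gradient and is \<open>O(\<bar>\<xi>\<bar>)\<close>. The value at the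
  origin is set to the limit.
\<close>

lemma (in cutoff_amplitude) curved_phase_kernel:
  fixes \<phi> :: "real^'n \<Rightarrow> real^'n \<Rightarrow> real" and \<zeta> :: "real^'n"
  assumes card: "CARD('n) \<ge> 2"
    and hom: "\<And>x \<xi> t. \<xi> \<noteq> 0 \<Longrightarrow> t > 0 \<Longrightarrow> \<phi> x (t *\<^sub>R \<xi>) = t * \<phi> x \<xi>"
    and sm: "\<And>x. smooth_on (- {0}) (\<phi> x)"
    and \<phi>b: "\<And>\<alpha>. length \<alpha> \<ge> 2 \<Longrightarrow> \<exists>C\<ge>0. \<forall>x\<in>X. \<forall>\<xi>. \<xi> \<noteq> 0 \<longrightarrow> norm (iter_deriv \<alpha> (\<phi> x) \<xi>) \<le> C * norm \<xi> powr (1 - real (length \<alpha>))"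
    and z: "\<zeta> = axis i0 1"
  defines "\<sigma> \<equiv> \<lambda>x \<xi>. (if \<xi> = 0 then b x 0 else exp (\<i> * complex_of_real (\<phi> x \<xi> - gradient (\<phi> x) \<zeta> \<bullet> \<xi>)) * b x \<xi>)"
  shows "\<exists>K\<ge>0. \<forall>x\<in>X. integrable lborel (\<sigma> x) \<and> (\<forall>s. norm (ft s (\<sigma> x)) \<le> K * weight s)"
proof -
  define \<theta> where "\<theta> x \<xi> = \<phi> x \<xi> - gradient (\<phi> x) \<zeta> \<bullet> \<xi>" for x \<xi>
  define \<theta>' where "\<theta>' j x \<xi> = complex_of_real (partial_deriv j (\<phi> x) \<xi> - gradient (\<phi> x) \<zeta> $ j)" for j x \<xi>
  have "\<forall>ki. \<exists>C. C \<ge> 0 \<and> (\<forall>x\<in>X. \<forall>\<xi>. \<xi> \<noteq> 0 \<longrightarrow> norm (iter_deriv [fst ki, snd ki] (\<phi> x) \<xi>) \<le> C * norm \<xi> powr (1 - real (length [fst ki, snd ki])))"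
    using \<phi>b[of "[fst ki, snd ki]" for ki] by (metis length_Cons length_0_conv list.size(3) numeral_2_eq_2 order_refl)
  from choice[OF this] obtain C2 where C2: "\<And>ki. C2 ki \<ge> (0::real)"
    "\<And>ki x \<xi>. x \<in> X \<Longrightarrow> \<xi> \<noteq> 0 \<Longrightarrow> norm (iter_deriv [fst ki, snd ki] (\<phi> x) \<xi>) \<le> C2 ki * norm \<xi> powr (1 - real (length [fst ki, snd ki]))" by blast
  define C where "C = (\<Sum>ki\<in>UNIV. C2 ki)"
  have C: "C \<ge> 0" "C2 ki \<le> C" for ki unfolding C_def by (auto intro: sum_nonneg C2 member_le_sum)
  have hess: "norm (iter_deriv [k, i] (\<phi> x) \<xi>) \<le> C / norm \<xi>" if "x \<in> X" "\<xi> \<noteq> 0" for i k x \<xi>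
  proof -
    have "norm (iter_deriv [k, i] (\<phi> x) \<xi>) \<le> C2 (k, i) * norm \<xi> powr (-1)" using C2(2)[OF that, of "(k, i)"] by simp
    also have "\<dots> \<le> C * norm \<xi> powr (-1)" by (intro mult_right_mono C) auto
    also have "\<dots> = C / norm \<xi>" using that by (simp add: powr_minus_divide)
    finally show ?thesis .
  qed
  define B where "B = 8 * real CARD('n) * C"
  have B0: "B \<ge> 0" using C by (simp add: B_def)
  have osc: "norm (\<theta>' j x \<xi>) \<le> B" if "x \<in> X" "\<xi> \<noteq> 0" for j x \<xi>
    using homogeneous_gradient_oscillation[OF card hom sm hess[OF that(1)] C(1) that(2), of j i0]
    unfolding \<theta>'_def norm_of_real by (simp add: B_def gradient_def z)
  have lin: "\<bar>\<theta> x \<xi>\<bar> \<le> (real CARD('n) * B) * norm \<xi>" if "x \<in> X" "\<xi> \<noteq> 0" for x \<xi>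
    using homogeneous_linear_part[OF card hom sm hess[OF that(1)] C(1) that(2), of i0]
    by (simp add: B_def \<theta>_def z)
  have \<theta>d: "dir_deriv j (\<lambda>\<xi>. complex_of_real (\<theta> x \<xi>)) (\<theta>' j x) \<xi>" if "\<xi> \<noteq> 0" for j x \<xi>
  proof -
    have 1: "((\<lambda>t. \<phi> x (\<xi> + t *\<^sub>R axis j 1)) has_vector_derivative partial_deriv j (\<phi> x) \<xi>) (at 0)"
      using iter_deriv_partial[OF sm[of x] open_punctured, of \<xi> "[]" j] that by simp
    have "((\<lambda>t. gradient (\<phi> x) \<zeta> \<bullet> \<xi> + t * gradient (\<phi> x) \<zeta> $ j) has_vector_derivative gradient (\<phi> x) \<zeta> $ j) (at 0)"
      by (auto intro!: derivative_eq_intros)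
    then have 2: "((\<lambda>t. gradient (\<phi> x) \<zeta> \<bullet> (\<xi> + t *\<^sub>R axis j 1)) has_vector_derivative gradient (\<phi> x) \<zeta> $ j) (at 0)"
      by (simp add: inner_add_right inner_axis)
    show ?thesis unfolding dir_deriv_def \<theta>_def \<theta>'_def
      by (rule has_vector_derivative_complex_of_real[OF has_vector_derivative_diff[OF 1 2]])
  qed
  have \<theta>'class: "sym_class j X k 0 0 (\<theta>' j)" for j k
  proof -
    define F where "F r x \<xi> = (if r = 0 then \<theta>' j x \<xi> else complex_of_real (iter_deriv (replicate (Suc r) j) (\<phi> x) \<xi>))" for r x \<xi>
    have "sym_class j X k 0 0 (F 0)"
    proof (rule sym_class_of_chain)
      fix r x and \<xi> :: "real^'n" assume x: "x \<in> X" and nz: "\<xi> \<noteq> 0"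
      have d: "((\<lambda>t. iter_deriv (replicate (Suc r) j) (\<phi> x) (\<xi> + t *\<^sub>R axis j 1)) has_vector_derivative iter_deriv (replicate (Suc (Suc r)) j) (\<phi> x) \<xi>) (at 0)"
        using iter_deriv_partial[OF sm[of x] open_punctured, of \<xi> "replicate (Suc r) j" j] nz by simp
      show "dir_deriv j (F r x) (F (Suc r) x) \<xi>"
      proof (cases "r = 0")
        case True
        have "((\<lambda>t. complex_of_real (partial_deriv j (\<phi> x) (\<xi> + t *\<^sub>R axis j 1) - gradient (\<phi> x) \<zeta> $ j)) has_vector_derivative
            complex_of_real (iter_deriv (replicate (Suc (Suc 0)) j) (\<phi> x) \<xi> - 0)) (at 0)"
          using d True by (intro has_vector_derivative_complex_of_real has_vector_derivative_diff has_vector_derivative_const) simp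
        then show ?thesis using True by (simp add: dir_deriv_def F_def \<theta>'_def)
      next
        case False
        then show ?thesis using has_vector_derivative_complex_of_real[OF d] by (simp add: dir_deriv_def F_def)
      qed
    next
      fix r
      show "\<exists>C. \<forall>x\<in>X. \<forall>\<xi>. \<xi> \<noteq> 0 \<longrightarrow> norm (F r x \<xi>) \<le> C * sym_weight 0 (0 + real r) \<xi>"
      proof (cases "r = 0")
        case True
        then show ?thesis using osc by (intro exI[of _ B]) (auto simp: F_def sym_weight_def)
      next
        case False
        have "length (replicate (Suc r) j) \<ge> 2" using False by simp
        from \<phi>b[OF this] obtain D where "\<forall>x\<in>X. \<forall>\<xi>. \<xi> \<noteq> 0 \<longrightarrow> norm (iter_deriv (replicate (Suc r) j) (\<phi> x) \<xi>) \<le> D * norm \<xi> powr (1 - real (length (replicate (Suc r) j)))" by blast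
        then show ?thesis using False by (intro exI[of _ D]) (auto simp: F_def sym_weight_def simp del: replicate_Suc)
      qed
    qed
    then show ?thesis by (simp add: F_def[abs_def])
  qed
  have e\<theta>: "sym_class j X CARD('n) (- real CARD('n)) 0 (\<lambda>x \<xi>. exp (\<i> * complex_of_real (\<theta> x \<xi>)))" for j
    by (rule sym_class_exp[OF _ \<theta>'class]) (rule \<theta>d)
  let ?n = "real CARD('n)"
  define \<sigma>' where "\<sigma>' j x \<xi> = exp (\<i> * complex_of_real (\<theta> x \<xi>)) * (b' j x \<xi> + \<i> * (\<theta>' j x \<xi> * b x \<xi>))" for j x \<xi>
  have \<sigma>'class: "sym_class j X CARD('n) 1 0 (\<sigma>' j)" for j
  proof -
    have "sym_class j X CARD('n) (0 + (0 + (?n + 1))) (0 + (0 + 0)) (\<lambda>x \<xi>. \<i> * (\<theta>' j x \<xi> * b x \<xi>))"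
      by (rule sym_class_mult[OF sym_class_const[where c = "\<lambda>_. \<i>" and B = 1] sym_class_mult[OF \<theta>'class b_class]]) auto
    then have "sym_class j X CARD('n) (?n + 1) 0 (\<lambda>x \<xi>. \<i> * (\<theta>' j x \<xi> * b x \<xi>))" by simp
    from sym_class_mult[OF e\<theta> sym_class_add[OF b'_class this]] show ?thesis by (simp add: \<sigma>'_def[abs_def])
  qed
  have \<sigma>d: "dir_deriv j (\<sigma> x) (\<sigma>' j x) \<xi>" if nz: "\<xi> \<noteq> 0" for j x \<xi>
  proof -
    have e: "dir_deriv j (\<lambda>\<xi>. exp (\<i> * complex_of_real (\<theta> x \<xi>))) (\<lambda>\<xi>. \<i> * (\<theta>' j x \<xi> * exp (\<i> * complex_of_real (\<theta> x \<xi>)))) \<xi>"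
      by (rule dir_deriv_exp[OF \<theta>d[OF nz]])
    show ?thesis
    proof (rule dir_deriv_transform[OF dir_deriv_mult[OF e b_dir_deriv] open_punctured])
      show "\<xi> \<in> - {0}" using nz by simp
    qed (auto simp: \<sigma>_def \<theta>_def \<sigma>'_def algebra_simps)
  qed
  obtain Cb where Cb: "Cb \<ge> 0" "\<forall>x\<in>X. \<forall>\<xi>. norm (b x \<xi>) \<le> Cb * (1 + norm \<xi>) powr (- (2 * ?n))" using b_bound by blast
  obtain Cl where Cl: "Cl \<ge> 0" "\<forall>x\<in>X. \<forall>\<xi>. norm (b x \<xi> - b x 0) \<le> Cl * norm \<xi>" using b_lipschitz by blast
  have bC: "norm (b x \<xi>) \<le> Cb" if "x \<in> X" for x \<xi>
  proof -
    have "(1 + norm \<xi>) powr (- (2 * ?n)) \<le> (1 + norm \<xi>) powr 0" by (intro powr_mono) auto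
    then have "Cb * (1 + norm \<xi>) powr (- (2 * ?n)) \<le> Cb * 1" using Cb(1) by (intro mult_left_mono) auto
    then show ?thesis using Cb(2) that by (smt (verit) mult_1_right)
  qed
  show ?thesis
  proof (rule uniform_kernel_bound[where ?s0.0 = "\<lambda>x. b x 0" and ?A0.0 = Cb and ?A1.0 = "Cl + ?n * B * Cb"])
    fix x assume x: "x \<in> X"
    have "continuous_on (- {0}) (\<phi> x)" using smooth_on_continuous[OF sm[of x], of "[]"] by simp
    then have "continuous_on (- {0}) (\<lambda>\<xi>. exp (\<i> * complex_of_real (\<theta> x \<xi>)) * b x \<xi>)"
      unfolding \<theta>_def by (intro continuous_intros b_continuous)
    then have "(\<lambda>\<xi>. indicator (- {0}) \<xi> *\<^sub>R (exp (\<i> * complex_of_real (\<theta> x \<xi>)) * b x \<xi>)) \<in> borel_measurable borel"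
      by (intro borel_measurable_continuous_on_indicator) (auto intro: borel_open open_punctured)
    then have m: "(\<lambda>\<xi>. indicator (- {0}) \<xi> *\<^sub>R (exp (\<i> * complex_of_real (\<theta> x \<xi>)) * b x \<xi>) + indicator {0} \<xi> *\<^sub>R b x 0) \<in> borel_measurable borel"
      by measurable
    have "\<sigma> x = (\<lambda>\<xi>. indicator (- {0}) \<xi> *\<^sub>R (exp (\<i> * complex_of_real (\<theta> x \<xi>)) * b x \<xi>) + indicator {0} \<xi> *\<^sub>R b x 0)"
      by (rule ext) (auto simp: \<sigma>_def \<theta>_def indicator_def)
    with m show "\<sigma> x \<in> borel_measurable borel" by simp
    fix \<xi> :: "real^'n"
    have ns: "norm (\<sigma> x \<xi>) = norm (b x \<xi>)" by (simp add: \<sigma>_def norm_mult)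
    show "norm (\<sigma> x \<xi>) \<le> Cb * (1 + norm \<xi>) powr (- 2 * ?n)" using Cb(2) x by (simp add: ns)
    show "norm (\<sigma> x \<xi> - b x 0) \<le> (Cl + ?n * B * Cb) * norm \<xi>"
    proof (cases "\<xi> = 0")
      case False
      have "\<sigma> x \<xi> - b x 0 = (exp (\<i> * complex_of_real (\<theta> x \<xi>)) - 1) * b x \<xi> + (b x \<xi> - b x 0)"
        using False by (simp add: \<sigma>_def \<theta>_def algebra_simps)
      then have "norm (\<sigma> x \<xi> - b x 0) \<le> norm (exp (\<i> * complex_of_real (\<theta> x \<xi>)) - 1) * norm (b x \<xi>) + norm (b x \<xi> - b x 0)"
        by (metis norm_mult norm_triangle_ineq)
      also have "\<dots> \<le> (?n * B * norm \<xi>) * Cb + Cl * norm \<xi>"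
      proof (intro add_mono mult_mono bC x)
        show "norm (exp (\<i> * complex_of_real (\<theta> x \<xi>)) - 1) \<le> ?n * B * norm \<xi>"
          using norm_exp_i_minus_one[of "\<theta> x \<xi>"] lin[OF x False] by linarith
      qed (use Cl x B0 in auto)
      finally show ?thesis by (simp add: algebra_simps)
    qed (use Cl x in \<open>simp add: \<sigma>_def\<close>)
  next
    fix j
    show "\<exists>\<sigma>'. (\<forall>x\<in>X. \<forall>\<xi>. \<xi> \<noteq> 0 \<longrightarrow> dir_deriv j (\<sigma> x) (\<sigma>' x) \<xi>) \<and> sym_class j X CARD('n) 1 0 \<sigma>'"
      using \<sigma>d \<sigma>'class by blast
  qed (use Cb Cl B0 in auto)
qed

section \<open>The half-line in dimension one\<close>

lemma (in cutoff_amplitude) amplitude_kernel: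
  "\<exists>K\<ge>0. \<forall>x\<in>X. integrable lborel (b x) \<and> (\<forall>s. norm (ft s (b x)) \<le> K * weight s)"
proof -
  obtain Cb where Cb: "Cb \<ge> 0" "\<forall>x\<in>X. \<forall>\<xi>. norm (b x \<xi>) \<le> Cb * (1 + norm \<xi>) powr (- (2 * real CARD('n)))" using b_bound by blast
  obtain Cl where Cl: "Cl \<ge> 0" "\<forall>x\<in>X. \<forall>\<xi>. norm (b x \<xi> - b x 0) \<le> Cl * norm \<xi>" using b_lipschitz by blast
  show ?thesis
  proof (rule uniform_kernel_bound[where ?s0.0 = "\<lambda>x. b x 0" and ?A0.0 = Cb and ?A1.0 = Cl])
    show "\<exists>\<sigma>'. (\<forall>x\<in>X. \<forall>\<xi>. \<xi> \<noteq> 0 \<longrightarrow> dir_deriv j (b x) (\<sigma>' x) \<xi>) \<and> sym_class j X CARD('n) 1 0 \<sigma>'" for j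
      using b_dir_deriv b'_class by blast
    show "b x \<in> borel_measurable borel" for x by (intro borel_measurable_continuous_onI b_continuous)
  qed (use Cb Cl in auto)
qed

lemma exp_minus_le_power:
  fixes E :: real
  shows "\<exists>C\<ge>0. \<forall>r\<ge>0. exp (- r) \<le> C * (1 + r) powr (- E)"
proof -
  (* 1 + t <= exp t is applied to t = r / D, and D >= 1 gives 1 + r <= D * (1 + r / D). *)
  define D where "D = max 1 E"
  have D: "D \<ge> 1" "D \<ge> E" by (auto simp: D_def)
  have "exp (- r) \<le> D powr D * (1 + r) powr (- E)" if r: "r \<ge> 0" for r :: real
  proof -
    have "1 + r \<le> D * (1 + r / D)" using D(1) r by (simp add: field_simps)
    also have "\<dots> \<le> D * exp (r / D)" using D(1) exp_ge_add_one_self[of "r / D"] by (intro mult_left_mono) auto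
    finally have 1: "1 + r \<le> D * exp (r / D)" .
    have "(1 + r) powr E \<le> (1 + r) powr D" using D(2) r by (intro powr_mono) auto
    also have "\<dots> \<le> (D * exp (r / D)) powr D" using 1 r D(1) by (intro powr_mono2) auto
    also have "\<dots> = D powr D * exp r" using D(1) by (simp add: powr_mult exp_powr_real)
    finally have "exp (- r) * (1 + r) powr E * (1 + r) powr (- E) \<le> exp (- r) * (D powr D * exp r) * (1 + r) powr (- E)"
      by (intro mult_left_mono mult_right_mono) auto
    moreover have "exp (- r) * (1 + r) powr E * (1 + r) powr (- E) = exp (- r)"
      using r by (simp add: mult.assoc powr_add[symmetric])
    moreover have "exp (- r) * (D powr D * exp r) * (1 + r) powr (- E) = D powr D * (1 + r) powr (- E)"
      by (simp add: exp_minus)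
    ultimately show ?thesis by simp
  qed
  then show ?thesis by (metis powr_ge_zero)
qed

text \<open>
  A fixed symbol with the jump of a half-line at the origin, chosen because its Fourier integral is
  the Cauchy kernel.
\<close>

definition half_exp :: "'n::finite \<Rightarrow> real^'n \<Rightarrow> complex"
  where "half_exp j \<xi> = (if \<xi> $ j \<ge> 0 then complex_of_real (exp (- (\<xi> $ j))) else 0)"

context
  fixes j :: "'n::finite"
  assumes one: "CARD('n) = 1"
begin

lemma UNIV_j: "(UNIV :: 'n set) = {j}"
  using one by (metis UNIV_I card_1_singletonE singletonD)

lemma index_eq: "i = j"
  using UNIV_j by auto

lemma vec_eq_axis: "\<xi> = axis j (\<xi> $ j)"
proof (subst vec_eq_iff, rule allI)
  fix i :: 'n
  show "\<xi> $ i = axis j (\<xi> $ j) $ i" using index_eq[of i] by (simp add: axis_def)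
qed

lemma norm_vec1: "norm (\<xi> :: real^'n) = \<bar>\<xi> $ j\<bar>"
  by (simp add: norm_vec_def UNIV_j L2_set_def)

lemma inner_vec1: "s \<bullet> (\<xi> :: real^'n) = s $ j * \<xi> $ j"
  by (simp add: inner_vec_def UNIV_j)

lemma vec1_nonzero: "(\<xi> :: real^'n) \<noteq> 0 \<longleftrightarrow> \<xi> $ j \<noteq> 0"
  using norm_vec1[of \<xi>] by auto

text \<open>
  In dimension one the vectors are the reals, up to a measure-preserving map.
\<close>

lemma distr_vec1: "distr lborel borel (\<lambda>x::real^'n. x $ j) = lborel"
proof (rule measure_eqI)
  fix A assume "A \<in> sets (distr lborel borel (\<lambda>x::real^'n. x $ j))"
  then have [measurable]: "A \<in> sets borel" by simp
  have "emeasure (distr lborel borel (\<lambda>x::real^'n. x $ j)) A = (\<integral>\<^sup>+t. indicator A t \<partial>distr lborel borel (\<lambda>x::real^'n. x $ j))"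
    by simp
  also have "\<dots> = (\<integral>\<^sup>+x. indicator A ((x::real^'n) $ j) \<partial>lborel)"
    by (rule nn_integral_distr) auto
  also have "\<dots> = (\<integral>\<^sup>+x. (\<Prod>i\<in>UNIV. indicator A ((x::real^'n) $ i)) \<partial>lborel)"
    by (simp add: UNIV_j)
  also have "\<dots> = (\<integral>\<^sup>+t. indicator A t \<partial>lborel) ^ CARD('n)"
    by (rule nn_integral_prod_coordinates) measurable
  also have "\<dots> = emeasure lborel A" by (simp add: one)
  finally show "emeasure (distr lborel borel (\<lambda>x::real^'n. x $ j)) A = emeasure lborel A" .
qed simp

lemma vec1_integral:
  fixes f :: "real \<Rightarrow> complex"
  assumes [measurable]: "f \<in> borel_measurable borel"
  shows "(LINT x|lborel. f ((x::real^'n) $ j)) = (LINT t|lborel. f t)"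
    "integrable lborel (\<lambda>x::real^'n. f (x $ j)) \<longleftrightarrow> integrable lborel f"
proof -
  have "(LINT t|distr lborel borel (\<lambda>x::real^'n. x $ j). f t) = (LINT x|lborel. f ((x::real^'n) $ j))"
    by (rule integral_distr) auto
  then show "(LINT x|lborel. f ((x::real^'n) $ j)) = (LINT t|lborel. f t)" by (simp add: distr_vec1)
  have "integrable (distr lborel borel (\<lambda>x::real^'n. x $ j)) f \<longleftrightarrow> integrable lborel (\<lambda>x::real^'n. f (x $ j))"
    by (rule integrable_distr_eq) auto
  then show "integrable lborel (\<lambda>x::real^'n. f (x $ j)) \<longleftrightarrow> integrable lborel f" by (simp add: distr_vec1)
qed

lemma vec1_nn_integral:
  assumes [measurable]: "f \<in> borel_measurable borel"
  shows "(\<integral>\<^sup>+x. f ((x::real^'n) $ j) \<partial>lborel) = (\<integral>\<^sup>+t. f t \<partial>lborel)"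
proof -
  have "(\<integral>\<^sup>+t. f t \<partial>distr lborel borel (\<lambda>x::real^'n. x $ j)) = (\<integral>\<^sup>+x. f ((x::real^'n) $ j) \<partial>lborel)"
    by (rule nn_integral_distr) auto
  then show ?thesis by (simp add: distr_vec1)
qed

lemma half_exp_bound: "\<exists>C\<ge>0. \<forall>\<xi>::real^'n. norm (half_exp j \<xi>) \<le> C * (1 + norm \<xi>) powr (- E)"
proof -
  obtain C where C: "C \<ge> 0" "\<forall>r\<ge>0. exp (- r) \<le> C * (1 + r) powr (- E)" using exp_minus_le_power by blast
  then show ?thesis by (intro exI[of _ C]) (auto simp: half_exp_def norm_vec1)
qed

lemma half_exp_measurable[measurable]: "half_exp j \<in> borel_measurable (borel :: (real^'n) measure)"
  unfolding half_exp_def[abs_def] by measurable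

lemma half_exp_integrable: "integrable lborel (half_exp j :: real^'n \<Rightarrow> complex)"
proof -
  obtain C where C: "C \<ge> 0" "\<forall>\<xi>::real^'n. norm (half_exp j \<xi>) \<le> C * (1 + norm \<xi>) powr (- (2 * real CARD('n)))"
    using half_exp_bound by blast
  have "norm (half_exp j \<xi>) \<le> C * weight \<xi>" for \<xi> :: "real^'n"
    using C(2)[rule_format, of \<xi>] mult_left_mono[OF inverse_power_le_weight[of \<xi>] C(1)] by simp
  then show ?thesis
    by (intro Bochner_Integration.integrable_bound[OF integrable_mult_right[OF integrable_weight, of C]])
       (use C(1) in \<open>auto simp: abs_mult weight_nonneg\<close>)
qed

lemma half_line_open: "open {\<eta>::real^'n. \<eta> $ j > 0}" "open {\<eta>::real^'n. \<eta> $ j < 0}"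
  by (intro open_Collect_less continuous_intros)+

text \<open>
  In dimension one the complement of the origin splits into two open half-lines, so a restriction to
  one of them is differentiable away from the origin.
\<close>

lemma dir_deriv_half_line:
  fixes f f' :: "real^'n \<Rightarrow> complex"
  assumes "dir_deriv j f f' \<xi>" "\<xi> \<noteq> 0"
  shows "dir_deriv j (\<lambda>\<eta>. if \<eta> $ j \<ge> 0 then f \<eta> else 0) (\<lambda>\<eta>. if \<eta> $ j \<ge> 0 then f' \<eta> else 0) \<xi>"
proof (cases "\<xi> $ j > 0")
  case True
  show ?thesis by (rule dir_deriv_transform[OF assms(1) half_line_open(1)]) (use True in auto)
next
  case False
  then have neg: "\<xi> $ j < 0" using vec1_nonzero[of \<xi>] assms(2) by linarith
  have "dir_deriv j (\<lambda>\<eta>. 0) (\<lambda>\<eta>. 0) \<xi>" by (simp add: dir_deriv_def)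
  then show ?thesis by (rule dir_deriv_transform[OF _ half_line_open(2)]) (use neg in auto)
qed

lemma half_exp_dir_deriv: "(\<xi>::real^'n) \<noteq> 0 \<Longrightarrow> dir_deriv j (half_exp j) (\<lambda>\<eta>. - half_exp j \<eta>) \<xi>"
proof -
  assume nz: "\<xi> \<noteq> 0"
  have "((\<lambda>t. exp (- (\<xi> $ j + t))) has_vector_derivative - exp (- (\<xi> $ j))) (at 0)"
    by (auto intro!: derivative_eq_intros simp: has_real_derivative_iff_has_vector_derivative[symmetric])
  then have "((\<lambda>t. complex_of_real (exp (- (\<xi> $ j + t)))) has_vector_derivative complex_of_real (- exp (- (\<xi> $ j)))) (at 0)"
    by (rule has_vector_derivative_complex_of_real)
  then have "dir_deriv j (\<lambda>\<eta>. complex_of_real (exp (- (\<eta> $ j)))) (\<lambda>\<eta>. - complex_of_real (exp (- (\<eta> $ j)))) \<xi>"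
    by (simp add: dir_deriv_def axis_def)
  from dir_deriv_half_line[OF this nz] show ?thesis
    by (simp add: half_exp_def[abs_def] if_distrib[of uminus] cong: if_cong)
qed

lemma half_exp_class: "sym_class j X k e 0 (\<lambda>x. half_exp j :: real^'n \<Rightarrow> complex)"
proof -
  have "sym_class j X k e 0 ((\<lambda>r x \<xi>. (- 1) ^ r * half_exp j \<xi>) (0::nat))"
  proof (rule sym_class_of_regular_chain[where F = "\<lambda>r x \<xi>. (- 1) ^ r * half_exp j \<xi>"])
    fix r x and \<xi> :: "real^'n" assume "\<xi> \<noteq> 0"
    from half_exp_dir_deriv[OF this]
    have "((\<lambda>t. (- 1) ^ r * half_exp j (\<xi> + t *\<^sub>R axis j 1)) has_vector_derivative (- 1) ^ r * (- half_exp j \<xi>)) (at 0)"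
      unfolding dir_deriv_def by (rule has_vector_derivative_mult_right)
    then show "dir_deriv j (\<lambda>\<xi>. (- 1) ^ r * half_exp j \<xi>) (\<lambda>\<xi>. (- 1) ^ Suc r * half_exp j \<xi>) \<xi>" by (simp add: dir_deriv_def)
  next
    fix r
    obtain C where "C \<ge> 0" "\<forall>\<xi>::real^'n. norm (half_exp j \<xi>) \<le> C * (1 + norm \<xi>) powr (- (e + real k))"
      using half_exp_bound by blast
    then show "\<exists>C\<ge>0. \<forall>x\<in>X. \<forall>\<xi>::real^'n. \<xi> \<noteq> 0 \<longrightarrow> norm ((- 1) ^ r * half_exp j \<xi>) \<le> C * (1 + norm \<xi>) powr (- e - real k)"
      by (intro exI[of _ C]) (simp add: norm_mult norm_power)
  qed
  then show ?thesis by simp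
qed

lemma half_line_class: "sym_class j X k 0 0 (\<lambda>x \<xi>. if (\<xi>::real^'n) $ j \<ge> 0 then 1 else 0)"
proof -
  have "sym_class j X k 0 0 ((\<lambda>r x \<xi>. if r = 0 \<and> (\<xi>::real^'n) $ j \<ge> 0 then 1 else 0) (0::nat))"
  proof (rule sym_class_of_chain[where F = "\<lambda>r x \<xi>. if r = 0 \<and> (\<xi>::real^'n) $ j \<ge> 0 then 1 else 0"])
    fix r :: nat and x and \<xi> :: "real^'n" assume nz: "\<xi> \<noteq> 0"
    show "dir_deriv j (\<lambda>\<xi>. if r = 0 \<and> \<xi> $ j \<ge> 0 then 1 else 0) (\<lambda>\<xi>. if Suc r = 0 \<and> \<xi> $ j \<ge> 0 then 1 else 0) \<xi>"
    proof (cases "r = 0")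
      case True
      have "dir_deriv j (\<lambda>\<eta>. 1) (\<lambda>\<eta>. 0) \<xi>" by (simp add: dir_deriv_def)
      from dir_deriv_half_line[OF this nz] show ?thesis using True by simp
    qed (simp add: dir_deriv_def)
  next
    fix r :: nat
    show "\<exists>C. \<forall>x\<in>X. \<forall>\<xi>::real^'n. \<xi> \<noteq> 0 \<longrightarrow> norm (if r = 0 \<and> \<xi> $ j \<ge> 0 then 1 else 0 :: complex) \<le> C * sym_weight 0 (0 + real r) \<xi>"
      by (intro exI[of _ 1]) (auto simp: sym_weight_def)
  qed
  then show ?thesis by simp
qed

text \<open>
  The integral of \<open>exp (- c * t)\<close> over the half-line is \<open>1 / c\<close>, here with \<open>c = 1 - \<i> * s $ j\<close>.
\<close>

lemma ft_half_exp: "ft s (half_exp j) = 1 / (1 - \<i> * complex_of_real ((s::real^'n) $ j))"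
proof -
  define c where "c = 1 - \<i> * complex_of_real (s $ j)"
  have c0: "c \<noteq> 0" unfolding c_def using cauchy_den(1)[of "of_real (s $ j)" 0] by simp
  define f where "f t = indicator {0..} t *\<^sub>R exp (- c * complex_of_real t)" for t :: real
  have [measurable]: "f \<in> borel_measurable borel" unfolding f_def by measurable
  have eq: "exp (\<i> * complex_of_real (s \<bullet> \<xi>)) * half_exp j \<xi> = f (\<xi> $ j)" for \<xi> :: "real^'n"
  proof -
    have "exp (- c * complex_of_real (\<xi> $ j)) = exp (\<i> * complex_of_real (s $ j * \<xi> $ j)) * exp (- complex_of_real (\<xi> $ j))"
      by (simp add: c_def exp_add[symmetric] algebra_simps)
    then show ?thesis by (simp add: f_def half_exp_def inner_vec1 indicator_def exp_of_real[symmetric] del: exp_of_real)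
  qed
  have "integrable lborel (\<lambda>\<xi>::real^'n. f (\<xi> $ j))"
    using integrable_exp_mult[OF half_exp_integrable, of s] by (simp only: eq)
  then have fi: "integrable lborel f" by (simp add: vec1_integral(2))
  have part: "(LINT t|lborel. indicator {..y} t *\<^sub>R f t) = (1 - exp (- c * complex_of_real y)) / c" if y: "y \<ge> 0" for y
  proof -
    have "(LINT t|lborel. indicator {..y} t *\<^sub>R f t) = (LINT t:{0..y}|lborel. exp (- c * complex_of_real t))"
      unfolding set_lebesgue_integral_def f_def by (rule Bochner_Integration.integral_cong) (auto simp: indicator_def)
    also have "\<dots> = integral {0..y} (\<lambda>t. exp (- c * complex_of_real t))"
      by (rule set_borel_integral_eq_integral(2)[OF borel_integrable_atLeastAtMost']) (intro continuous_intros)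
    also have "\<dots> = (1 - exp (- c * complex_of_real y)) / c"
    proof (rule integral_unique)
      have "((\<lambda>t. exp (- c * complex_of_real t)) has_integral (- exp (- c * complex_of_real y) / c) - (- exp (- c * complex_of_real 0) / c)) {0..y}"
      proof (rule fundamental_theorem_of_calculus[OF y])
        fix t assume "t \<in> {0..y}"
        have "((\<lambda>z. - exp (- c * z) / c) has_field_derivative exp (- c * complex_of_real t)) (at (complex_of_real t))"
          using c0 by (auto intro!: derivative_eq_intros)
        then have "((\<lambda>t. - exp (- c * complex_of_real t) / c) has_vector_derivative exp (- c * complex_of_real t)) (at t)"
          by (rule has_vector_derivative_real_field)
        then show "((\<lambda>t. - exp (- c * complex_of_real t) / c) has_vector_derivative exp (- c * complex_of_real t)) (at t within {0..y})"
          by (rule has_vector_derivative_at_within)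
      qed
      then show "((\<lambda>t. exp (- c * complex_of_real t)) has_integral (1 - exp (- c * complex_of_real y)) / c) {0..y}"
        by (simp add: diff_divide_distrib)
    qed
    finally show ?thesis .
  qed
  have "((\<lambda>y. LINT t|lborel. indicator {..y} t *\<^sub>R f t) \<longlongrightarrow> (LINT t|lborel. f t)) at_top"
    by (rule tendsto_integral_at_top) (use fi in auto)
  moreover have "((\<lambda>y. LINT t|lborel. indicator {..y} t *\<^sub>R f t) \<longlongrightarrow> (1 - 0) / c) at_top"
  proof (rule Lim_transform_eventually)
    have "((\<lambda>y. exp (- c * complex_of_real y)) \<longlongrightarrow> 0) at_top"
    proof (rule tendsto_norm_zero_cancel)
      have n: "norm (exp (- c * complex_of_real y)) = exp (- y)" for y by (simp add: norm_exp_eq_Re c_def)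
      show "((\<lambda>y. norm (exp (- c * complex_of_real y))) \<longlongrightarrow> 0) at_top"
        unfolding n by (rule filterlim_compose[OF exp_at_bot filterlim_uminus_at_bot_at_top])
    qed
    then show "((\<lambda>y. (1 - exp (- c * complex_of_real y)) / c) \<longlongrightarrow> (1 - 0) / c) at_top"
      using c0 by (intro tendsto_intros)
    show "\<forall>\<^sub>F y in at_top. (1 - exp (- c * complex_of_real y)) / c = (LINT t|lborel. indicator {..y} t *\<^sub>R f t)"
      using eventually_ge_at_top[of 0] by eventually_elim (simp add: part)
  qed
  ultimately have "(LINT t|lborel. f t) = 1 / c" using tendsto_unique[OF trivial_limit_at_top_linorder] by force
  moreover have "ft s (half_exp j) = (LINT t|lborel. f t)"
    unfolding ft_def eq by (rule vec1_integral(1)) measurable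
  ultimately show ?thesis by (simp add: c_def)
qed

lemma half_exp_operator:
  fixes u :: "real^'n \<Rightarrow> complex"
  assumes u: "integrable lborel u"
  shows "(LINT \<xi>|lborel. exp (\<i> * complex_of_real (z \<bullet> \<xi>)) * half_exp j \<xi> * fourier u \<xi>) = cauchy_op (\<lambda>t. u (axis j t)) (z $ j)"
proof -
  have [measurable]: "u \<in> borel_measurable borel" using u by auto
  have am: "(\<lambda>t. axis j t :: real^'n) \<in> borel_measurable borel"
    by (rule borel_measurable_vec_components) (simp add: axis_def)
  have [measurable]: "(\<lambda>t. u (axis j t)) \<in> borel_measurable borel" by (rule measurable_compose[OF am]) measurable
  have "(LINT \<xi>|lborel. exp (\<i> * complex_of_real (z \<bullet> \<xi>)) * half_exp j \<xi> * fourier u \<xi>) = (LINT y|lborel. u y * ft (z - y) (half_exp j))"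
    by (rule oscillatory_integral_kernel[OF u half_exp_integrable])
  also have "\<dots> = (LINT y|lborel. u (axis j (y $ j)) * (1 / (1 - \<i> * complex_of_real (z $ j - y $ j))))"
    by (simp add: ft_half_exp vec_eq_axis[symmetric])
  also have "\<dots> = (LINT t|lborel. u (axis j t) * (1 / (1 - \<i> * complex_of_real (z $ j - t))))"
    by (rule vec1_integral(1)[where f = "\<lambda>t. u (axis j t) * (1 / (1 - \<i> * complex_of_real (z $ j - t)))"]) measurable
  finally show ?thesis by (simp add: cauchy_op_def)
qed

end

text \<open>
  The restriction to the half-line jumps by the value at the origin, and the subtracted exponential
  jumps by the same amount. The remainder is Lipschitz at the origin.
\<close>

lemma (in cutoff_amplitude) half_line_kernel:
  fixes j :: 'n
  assumes one: "CARD('n) = 1"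
  defines "\<sigma> \<equiv> \<lambda>x \<xi>. if \<xi> $ j \<ge> 0 then b x \<xi> - b x 0 * half_exp j \<xi> else 0"
  shows "\<exists>K\<ge>0. \<forall>x\<in>X. integrable lborel (\<sigma> x) \<and> (\<forall>s. norm (ft s (\<sigma> x)) \<le> K * weight s)"
proof -
  obtain Cb where Cb: "Cb \<ge> 0" "\<forall>x\<in>X. \<forall>\<xi>. norm (b x \<xi>) \<le> Cb * (1 + norm \<xi>) powr (- 2)" using b_bound by blast
  obtain Cl where Cl: "Cl \<ge> 0" "\<forall>x\<in>X. \<forall>\<xi>. norm (b x \<xi> - b x 0) \<le> Cl * norm \<xi>" using b_lipschitz by blast
  obtain Ce where Ce: "Ce \<ge> 0" "\<forall>\<xi>::real^'n. norm (half_exp j \<xi>) \<le> Ce * (1 + norm \<xi>) powr (- 2)" using half_exp_bound[OF one] by blast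
  have b0: "norm (b x 0) \<le> Cb" if "x \<in> X" for x using Cb(2)[rule_format, OF that, of 0] by simp
  define \<sigma>' where "\<sigma>' x \<xi> = (if \<xi> $ j \<ge> 0 then 1 else 0) * b' j x \<xi> + b x 0 * half_exp j \<xi>" for x \<xi>
  have idx: "i = j" for i by (rule index_eq[OF one])
  show ?thesis
  proof (rule uniform_kernel_bound[where ?s0.0 = "\<lambda>x. 0" and ?A0.0 = "Cb + Cb * Ce" and ?A1.0 = "Cl + Cb"])
    fix x assume x: "x \<in> X"
    have [measurable]: "b x \<in> borel_measurable borel" by (intro borel_measurable_continuous_onI b_continuous)
    have [measurable]: "half_exp j \<in> borel_measurable (borel :: (real^'n) measure)" by (rule half_exp_measurable[OF one])
    show "\<sigma> x \<in> borel_measurable borel" unfolding \<sigma>_def by measurable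
    fix \<xi> :: "real^'n"
    let ?w = "(1 + norm \<xi>) powr (- 2)"
    have "norm (b x \<xi> - b x 0 * half_exp j \<xi>) \<le> norm (b x \<xi>) + norm (b x 0) * norm (half_exp j \<xi>)"
      using norm_triangle_ineq4[of "b x \<xi>" "b x 0 * half_exp j \<xi>"] by (simp add: norm_mult)
    also have "\<dots> \<le> Cb * ?w + Cb * (Ce * ?w)"
      using Cb Ce x b0[OF x] by (intro add_mono mult_mono) auto
    finally have "norm (b x \<xi> - b x 0 * half_exp j \<xi>) \<le> (Cb + Cb * Ce) * ?w" by (simp add: algebra_simps)
    then show "norm (\<sigma> x \<xi>) \<le> (Cb + Cb * Ce) * (1 + norm \<xi>) powr (- 2 * real CARD('n))"
      using Cb Ce by (simp add: \<sigma>_def one)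
    show "norm (\<sigma> x \<xi> - 0) \<le> (Cl + Cb) * norm \<xi>"
    proof (cases "\<xi> $ j \<ge> 0")
      case True
      have e: "norm (1 - half_exp j \<xi>) \<le> norm \<xi>"
      proof -
        have "norm (1 - half_exp j \<xi>) = 1 - exp (- (\<xi> $ j))"
          using True by (simp add: half_exp_def norm_of_real[symmetric] del: norm_of_real) (metis abs_of_nonneg diff_ge_0_iff_ge exp_le_one_iff neg_le_0_iff_le norm_of_real of_real_1 of_real_diff)
        also have "\<dots> \<le> \<xi> $ j" using exp_ge_add_one_self[of "- (\<xi> $ j)"] by linarith
        finally show ?thesis using True by (simp add: norm_vec1[OF one, of _ j])
      qed
      have "\<sigma> x \<xi> = (b x \<xi> - b x 0) + b x 0 * (1 - half_exp j \<xi>)" using True by (simp add: \<sigma>_def algebra_simps)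
      then have "norm (\<sigma> x \<xi>) \<le> norm (b x \<xi> - b x 0) + norm (b x 0) * norm (1 - half_exp j \<xi>)"
        by (metis norm_mult norm_triangle_ineq)
      also have "\<dots> \<le> Cl * norm \<xi> + Cb * norm \<xi>" using Cl x b0[OF x] e Cb(1) by (intro add_mono mult_mono) auto
      finally show ?thesis by (simp add: algebra_simps)
    qed (use Cl Cb in \<open>simp add: \<sigma>_def\<close>)
  next
    fix i
    have "dir_deriv j (\<sigma> x) (\<sigma>' x) \<xi>" if "\<xi> \<noteq> 0" for x \<xi>
    proof -
      have 1: "((\<lambda>t. b x 0 * half_exp j (\<xi> + t *\<^sub>R axis j 1)) has_vector_derivative b x 0 * (- half_exp j \<xi>)) (at 0)"
        using half_exp_dir_deriv[OF one that] unfolding dir_deriv_def by (rule has_vector_derivative_mult_right)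
      have "dir_deriv j (\<lambda>\<eta>. b x \<eta> - b x 0 * half_exp j \<eta>) (\<lambda>\<eta>. b' j x \<eta> - b x 0 * (- half_exp j \<eta>)) \<xi>"
        using has_vector_derivative_diff[OF b_dir_deriv[unfolded dir_deriv_def] 1] by (simp add: dir_deriv_def)
      from dir_deriv_half_line[OF one this that] show ?thesis
        unfolding \<sigma>_def by (rule dir_deriv_transform[OF _ open_UNIV]) (auto simp: \<sigma>'_def half_exp_def)
    qed
    moreover have "sym_class j X CARD('n) 1 0 \<sigma>'"
    proof -
      have 1: "sym_class j X CARD('n) (0 + 1) (0 + 0) (\<lambda>x \<xi>. (if \<xi> $ j \<ge> 0 then 1 else 0) * b' j x \<xi>)"
        by (rule sym_class_mult[OF half_line_class[OF one] b'_class])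
      have 2: "sym_class j X CARD('n) (0 + 1) (0 + 0) (\<lambda>x \<xi>. b x 0 * half_exp j \<xi>)"
        by (rule sym_class_mult[OF sym_class_const[where B = Cb] half_exp_class[OF one]]) (rule b0)
      show ?thesis using sym_class_add[OF 1 2] by (simp add: \<sigma>'_def[abs_def])
    qed
    ultimately show "\<exists>\<sigma>'. (\<forall>x\<in>X. \<forall>\<xi>. \<xi> \<noteq> 0 \<longrightarrow> dir_deriv i (\<sigma> x) (\<sigma>' x) \<xi>) \<and> sym_class i X CARD('n) 1 0 \<sigma>'"
      unfolding idx[of i] by blast
  qed (use Cb Cl Ce in auto)
qed

section \<open>The low-frequency operator\<close>

lemma fourier_bounded:
  assumes u: "integrable lborel u"
  shows "norm (fourier u \<xi>) \<le> (LINT y|lborel. norm (u y))"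
proof -
  have [measurable]: "u \<in> borel_measurable borel" using u by auto
  have "norm (fourier u \<xi>) \<le> (LINT y|lborel. norm (u y * exp (- (\<i> * complex_of_real (y \<bullet> \<xi>)))))"
    unfolding fourier_lborel[OF \<open>u \<in> borel_measurable borel\<close>] by (rule integral_norm_bound)
  then show ?thesis by (simp add: norm_mult norm_exp_eq_Re)
qed

lemma integrable_mult_fourier:
  fixes u :: "real^'n::finite \<Rightarrow> complex"
  assumes u: "integrable lborel u" and \<sigma>: "integrable lborel \<sigma>"
  shows "integrable lborel (\<lambda>\<xi>. exp (\<i> * complex_of_real (z \<bullet> \<xi>)) * \<sigma> \<xi> * fourier u \<xi>)"
proof -
  define C where "C = (LINT y|lborel. norm (u y))"
  have m: "fourier u \<in> borel_measurable borel" by (rule fourier_measurable) (use u in auto)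
  have i: "integrable lborel (\<lambda>\<xi>. complex_of_real C * (exp (\<i> * complex_of_real (z \<bullet> \<xi>)) * \<sigma> \<xi>))"
    by (intro integrable_mult_right integrable_exp_mult \<sigma>)
  have C0: "C \<ge> 0" unfolding C_def by (rule integral_nonneg_AE) simp
  show ?thesis
  proof (rule Bochner_Integration.integrable_bound[OF i])
    show "(\<lambda>\<xi>. exp (\<i> * complex_of_real (z \<bullet> \<xi>)) * \<sigma> \<xi> * fourier u \<xi>) \<in> borel_measurable lborel"
    proof (rule borel_measurable_times)
      show "(\<lambda>\<xi>. exp (\<i> * complex_of_real (z \<bullet> \<xi>)) * \<sigma> \<xi>) \<in> borel_measurable lborel"
        using integrable_exp_mult[OF \<sigma>, of z] by (rule borel_measurable_integrable)
    qed (use m in simp)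
    have "norm (exp (\<i> * complex_of_real (z \<bullet> \<xi>)) * \<sigma> \<xi> * fourier u \<xi>)
        \<le> norm (complex_of_real C * (exp (\<i> * complex_of_real (z \<bullet> \<xi>)) * \<sigma> \<xi>))" for \<xi>
      using mult_left_mono[OF fourier_bounded[OF u, of \<xi>, folded C_def], of "norm (\<sigma> \<xi>)"] C0
      by (simp add: norm_mult mult_ac)
    then show "AE \<xi> in lborel. norm (exp (\<i> * complex_of_real (z \<bullet> \<xi>)) * \<sigma> \<xi> * fourier u \<xi>)
        \<le> norm (complex_of_real C * (exp (\<i> * complex_of_real (z \<bullet> \<xi>)) * \<sigma> \<xi>))" by simp
  qed
qed

lemma norm_FIO_constant: "norm (1 / (2 * complex_of_real pi) ^ k) \<le> 1"
proof -
  have "1 \<le> 2 * pi" using pi_ge_two by linarith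
  then have "1 \<le> (2 * pi) ^ k" by (rule one_le_power)
  then show ?thesis by (simp add: norm_divide norm_power norm_mult divide_le_eq)
qed

lemma norm_FIO_constant_mult: "norm (1 / (2 * complex_of_real pi) ^ k * S) \<le> norm S"
  unfolding norm_mult[of _ S] using mult_right_mono[OF norm_FIO_constant[of k] norm_ge_zero[of S]] by simp

lemma cutoff_amplitude_of_Linf:
  fixes a :: "real^'n::finite \<Rightarrow> real^'n \<Rightarrow> complex" and \<phi> :: "real^'n \<Rightarrow> real^'n \<Rightarrow> real"
  assumes rho: "0 \<le> \<rho>" and a: "a \<in> Linf_S m \<rho>" and \<phi>: "\<phi> \<in> Linf_Phi 2" and chi: "\<chi>\<^sub>0 \<in> test_functions"
  obtains X where "AE x in lebesgue. x \<in> X" "cutoff_amplitude a \<chi>\<^sub>0 X \<bar>m\<bar>"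
    "\<And>\<alpha>. length \<alpha> \<ge> 2 \<Longrightarrow> \<exists>C\<ge>0. \<forall>x\<in>X. \<forall>\<xi>. \<xi> \<noteq> 0 \<longrightarrow> norm (iter_deriv \<alpha> (\<phi> x) \<xi>) \<le> C * norm \<xi> powr (1 - real (length \<alpha>))"
proof -
  obtain Xa where Xa: "AE x in lebesgue. x \<in> Xa"
    "\<And>\<alpha>. \<exists>C\<ge>0. \<forall>x\<in>Xa. \<forall>\<xi>. norm (iter_deriv \<alpha> (a x) \<xi>) \<le> C * (1 + norm \<xi>) powr \<bar>m\<bar>"
    using Linf_S_bounds[OF a rho] by blast
  obtain Xp where Xp: "AE x in lebesgue. x \<in> Xp"
    "\<And>\<alpha>. length \<alpha> \<ge> 2 \<Longrightarrow> \<exists>C\<ge>0. \<forall>x\<in>Xp. \<forall>\<xi>. \<xi> \<noteq> 0 \<longrightarrow> norm (iter_deriv \<alpha> (\<phi> x) \<xi>) \<le> C * norm \<xi> powr (1 - real (length \<alpha>))"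
    using Linf_Phi_bounds[OF \<phi>] by blast
  show ?thesis
  proof (rule that[of "Xa \<inter> Xp"])
    show "AE x in lebesgue. x \<in> Xa \<inter> Xp" using Xa(1) Xp(1) by eventually_elim simp
    show "cutoff_amplitude a \<chi>\<^sub>0 (Xa \<inter> Xp) \<bar>m\<bar>"
    proof
      show "smooth_on UNIV (a x)" for x using a by (simp add: Linf_S_def)
      show "\<exists>C\<ge>0. \<forall>x\<in>Xa \<inter> Xp. \<forall>\<xi>. norm (iter_deriv \<alpha> (a x) \<xi>) \<le> C * (1 + norm \<xi>) powr \<bar>m\<bar>" for \<alpha>
        using Xa(2)[of \<alpha>] by blast
    qed (use chi in auto)
    show "\<exists>C\<ge>0. \<forall>x\<in>Xa \<inter> Xp. \<forall>\<xi>. \<xi> \<noteq> 0 \<longrightarrow> norm (iter_deriv \<alpha> (\<phi> x) \<xi>) \<le> C * norm \<xi> powr (1 - real (length \<alpha>))"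
      if "length \<alpha> \<ge> 2" for \<alpha> using Xp(2)[OF that] by blast
  qed
qed

text \<open>
  Almost everywhere the operator is an oscillatory integral whose linear phase is \<open>gradient (\<phi> x) \<zeta>\<close> and
  whose symbol has a kernel dominated by the weight.
\<close>

lemma FIO_majorant_higher_dim:
  fixes a :: "real^'n::finite \<Rightarrow> real^'n \<Rightarrow> complex" and \<phi> :: "real^'n \<Rightarrow> real^'n \<Rightarrow> real"
  assumes card: "CARD('n) \<ge> 2" and rho: "0 \<le> \<rho>" and a: "a \<in> Linf_S m \<rho>" and \<phi>: "\<phi> \<in> Linf_Phi 2"
    and chi: "\<chi>\<^sub>0 \<in> test_functions"
  shows "\<exists>K\<ge>0. \<forall>u\<in>schwartz_space. AE x in lebesgue.
     ennreal (norm (low_freq_FIO a \<phi> \<chi>\<^sub>0 u x)) \<le> ennreal K * conv weight (\<lambda>y. norm (u y)) (gradient (\<phi> x) (axis i0 1))"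
proof -
  let ?\<zeta> = "axis i0 1 :: real^'n"
  obtain X where X: "AE x in lebesgue. x \<in> X" "cutoff_amplitude a \<chi>\<^sub>0 X \<bar>m\<bar>"
    "\<And>\<alpha>. length \<alpha> \<ge> 2 \<Longrightarrow> \<exists>C\<ge>0. \<forall>x\<in>X. \<forall>\<xi>. \<xi> \<noteq> 0 \<longrightarrow> norm (iter_deriv \<alpha> (\<phi> x) \<xi>) \<le> C * norm \<xi> powr (1 - real (length \<alpha>))"
    using cutoff_amplitude_of_Linf[OF rho a \<phi> chi] by blast
  interpret cutoff_amplitude a \<chi>\<^sub>0 X "\<bar>m\<bar>" by (rule X(2))
  let ?\<sigma> = "\<lambda>x \<xi>. if \<xi> = 0 then b x 0 else exp (\<i> * complex_of_real (\<phi> x \<xi> - gradient (\<phi> x) ?\<zeta> \<bullet> \<xi>)) * b x \<xi>"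
  have "\<exists>K\<ge>0. \<forall>x\<in>X. integrable lborel (?\<sigma> x) \<and> (\<forall>s. norm (ft s (?\<sigma> x)) \<le> K * weight s)"
    by (rule curved_phase_kernel[OF card _ _ X(3) refl]) (use \<phi> in \<open>auto simp: Linf_Phi_def\<close>)
  then obtain K where K: "K \<ge> 0" "\<And>x. x \<in> X \<Longrightarrow> integrable lborel (?\<sigma> x)" "\<And>x s. x \<in> X \<Longrightarrow> norm (ft s (?\<sigma> x)) \<le> K * weight s"
    by blast
  have "ennreal (norm (low_freq_FIO a \<phi> \<chi>\<^sub>0 u x)) \<le> ennreal K * conv weight (\<lambda>y. norm (u y)) (gradient (\<phi> x) ?\<zeta>)"
    if u: "u \<in> schwartz_space" and x: "x \<in> X" for u x
  proof -
    let ?g = "gradient (\<phi> x) ?\<zeta>"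
    have ui: "integrable lborel u" by (rule schwartz_integrable[OF u])
    let ?h = "\<lambda>\<xi>. (if \<xi> = 0 then 0 else exp (\<i> * complex_of_real (\<phi> x \<xi>)) * a x \<xi> * \<chi>\<^sub>0 \<xi>) * fourier u \<xi>"
    let ?k = "\<lambda>\<xi>. exp (\<i> * complex_of_real (?g \<bullet> \<xi>)) * ?\<sigma> x \<xi> * fourier u \<xi>"
    have hk: "?h \<xi> = ?k \<xi>" if "\<xi> \<noteq> 0" for \<xi>
    proof -
      have "exp (\<i> * complex_of_real (\<phi> x \<xi>)) = exp (\<i> * complex_of_real (?g \<bullet> \<xi>)) * exp (\<i> * complex_of_real (\<phi> x \<xi> - ?g \<bullet> \<xi>))"
        by (simp add: exp_add[symmetric] algebra_simps)
      then show ?thesis using that by (simp add: b_def mult_ac)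
    qed
    have ki: "integrable lborel ?k" by (rule integrable_mult_fourier[OF ui K(2)[OF x]])
    have "(LINT \<xi>|lborel. ?h \<xi>) = (LINT \<xi>|lborel. ?k \<xi>)"
    proof (rule integral_cong_AE)
      have km: "?k \<in> borel_measurable lborel" using ki by auto
      have "?h = (\<lambda>\<xi>. if \<xi> = 0 then 0 else ?k \<xi>)" using hk by fastforce
      then show "?h \<in> borel_measurable lborel" using km by simp
      show "?k \<in> borel_measurable lborel" by (rule km)
      show "AE \<xi> in lborel. ?h \<xi> = ?k \<xi>"
        using AE_lborel_singleton[of "0::real^'n"] by eventually_elim (rule hk)
    qed
    then have "low_freq_FIO a \<phi> \<chi>\<^sub>0 u x = 1 / (2 * complex_of_real pi) ^ CARD('n) * (LINT \<xi>|lborel. ?k \<xi>)"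
      using low_freq_FIO_lborel(1)[OF a \<phi> chi u, of x] by (simp only:)
    then have "norm (low_freq_FIO a \<phi> \<chi>\<^sub>0 u x) \<le> norm (LINT \<xi>|lborel. ?k \<xi>)"
      by (simp only: norm_FIO_constant_mult)
    then have "ennreal (norm (low_freq_FIO a \<phi> \<chi>\<^sub>0 u x)) \<le> ennreal (norm (LINT \<xi>|lborel. ?k \<xi>))" by (rule ennreal_leI)
    also have "\<dots> \<le> ennreal K * conv weight (\<lambda>y. norm (u y)) ?g"
      by (rule oscillatory_integral_bound[OF ui K(2)[OF x] K(3)[OF x] K(1)])
    finally show ?thesis .
  qed
  then have "\<forall>u\<in>schwartz_space. AE x in lebesgue.
     ennreal (norm (low_freq_FIO a \<phi> \<chi>\<^sub>0 u x)) \<le> ennreal K * conv weight (\<lambda>y. norm (u y)) (gradient (\<phi> x) ?\<zeta>)"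
    using X(1) by (auto elim!: eventually_mono)
  then show ?thesis using K(1) by blast
qed

lemma norm_five_terms_le:
  fixes d :: complex
  shows "norm (A + (B - C) + d * (E - F)) \<le> norm A + (norm B + norm C) + norm d * (norm E + norm F)"
proof -
  have "norm (A + (B - C) + d * (E - F)) \<le> norm A + norm (B - C) + norm d * norm (E - F)"
    using norm_triangle_ineq[of "A + (B - C)" "d * (E - F)"] norm_triangle_ineq[of A "B - C"] by (simp add: norm_mult)
  moreover have "norm d * norm (E - F) \<le> norm d * (norm E + norm F)"
    by (rule mult_left_mono[OF norm_triangle_ineq4]) simp
  ultimately show ?thesis using norm_triangle_ineq4[of B C] by linarith
qed

text \<open>
  On the half-line through \<open>axis j s\<close> with \<open>s = \<plusminus> 1\<close> the phase is \<open>t * \<phi> (axis j s)\<close> at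
  \<open>t *\<^sub>R axis j s\<close>, so its derivative is constant there.
\<close>

lemma phase_dim_one:
  fixes \<phi> :: "real^'n::finite \<Rightarrow> real"
  assumes one: "CARD('n) = 1"
    and hom: "\<And>\<xi> t. \<xi> \<noteq> 0 \<Longrightarrow> t > 0 \<Longrightarrow> \<phi> (t *\<^sub>R \<xi>) = t * \<phi> \<xi>"
    and nz: "\<xi> \<noteq> 0"
  shows "\<phi> \<xi> = gradient \<phi> (if \<xi> $ j \<ge> 0 then axis j 1 else axis j (- 1)) \<bullet> \<xi>"
proof -
  have lin: "partial_deriv j \<phi> (axis j s) = s * \<phi> (axis j s)" if s: "\<bar>s\<bar> = 1" for s :: real
  proof -
    have ss: "s * s = 1" using s by (metis abs_mult_self_eq mult_1)
    have 0: "((\<lambda>t. (1 + s * t) * \<phi> (axis j s)) has_vector_derivative s * \<phi> (axis j s)) (at 0)"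
      by (auto intro!: derivative_eq_intros simp: has_real_derivative_iff_has_vector_derivative[symmetric])
    have "((\<lambda>t. \<phi> (axis j s + t *\<^sub>R axis j 1)) has_vector_derivative s * \<phi> (axis j s)) (at 0)"
    proof (rule has_vector_derivative_transform_within_open[OF 0])
      show "open {t. 1 + s * t > 0}" by (intro open_Collect_less continuous_intros)
      fix t assume t: "t \<in> {t. 1 + s * t > 0}"
      have "axis j s + t *\<^sub>R axis j 1 = (1 + s * t) *\<^sub>R (axis j s :: real^'n)"
        using ss by (simp add: vec_eq_iff axis_def algebra_simps)
      moreover have "(axis j s :: real^'n) \<noteq> 0" using s by (auto simp: axis_eq_0_iff)
      ultimately show "(1 + s * t) * \<phi> (axis j s) = \<phi> (axis j s + t *\<^sub>R axis j 1)" using hom t by simp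
    qed simp
    then show ?thesis unfolding partial_deriv_def by (rule vector_derivative_at)
  qed
  define s :: real where "s = (if \<xi> $ j \<ge> 0 then 1 else - 1)"
  have s: "\<bar>s\<bar> = 1" "\<bar>\<xi> $ j\<bar> * s = \<xi> $ j" "s * \<xi> $ j = \<bar>\<xi> $ j\<bar>" by (auto simp: s_def)
  have \<xi>j: "\<bar>\<xi> $ j\<bar> > 0" using nz vec1_nonzero[OF one, of \<xi> j] by simp
  have "\<xi> = \<bar>\<xi> $ j\<bar> *\<^sub>R axis j s"
    by (subst vec_eq_axis[OF one, of \<xi> j]) (simp add: vec_eq_iff axis_def s(2))
  then have "\<phi> \<xi> = \<bar>\<xi> $ j\<bar> * \<phi> (axis j s)"
    using hom[of "axis j s" "\<bar>\<xi> $ j\<bar>"] \<xi>j s(1) by (auto simp: axis_eq_0_iff)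
  also have "\<dots> = (s * \<phi> (axis j s)) * \<xi> $ j" using s(3) by (simp add: mult_ac)
  also have "\<dots> = gradient \<phi> (axis j s) \<bullet> \<xi>"
    by (simp add: inner_vec1[OF one, of _ _ j] gradient_def lin[OF s(1)])
  finally have "\<phi> \<xi> = gradient \<phi> (axis j s) \<bullet> \<xi>" .
  moreover have "axis j s = (if \<xi> $ j \<ge> 0 then axis j 1 else axis j (- 1))" by (simp add: s_def)
  ultimately show ?thesis by (simp only:)
qed

text \<open>
  The phase factor is the exponential of the slope \<open>gm x\<close> on the whole line, plus the difference of those of \<open>gp x\<close>
  and \<open>gm x\<close> on the positive half-line. The first term has the smooth symbol \<open>b\<close> on the whole line. In the other two, \<open>b\<close> on the half-line is
  split into the part without jump and a multiple of \<open>half_exp\<close>.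
\<close>

lemma FIO_majorant_dim_one:
  fixes a :: "real^'n::finite \<Rightarrow> real^'n \<Rightarrow> complex" and \<phi> :: "real^'n \<Rightarrow> real^'n \<Rightarrow> real" and j :: 'n
  assumes one: "CARD('n) = 1" and rho: "0 \<le> \<rho>" and a: "a \<in> Linf_S m \<rho>" and \<phi>: "\<phi> \<in> Linf_Phi 2"
    and chi: "\<chi>\<^sub>0 \<in> test_functions"
  defines "gp \<equiv> \<lambda>x. gradient (\<phi> x) (axis j 1)" and "gm \<equiv> \<lambda>x. gradient (\<phi> x) (axis j (- 1))"
  shows "\<exists>K\<ge>0. \<exists>B\<ge>0. \<forall>u\<in>schwartz_space. AE x in lebesgue.
     norm (low_freq_FIO a \<phi> \<chi>\<^sub>0 u x) \<le>
       K * enn2real (conv weight (\<lambda>y. norm (u y)) (gm x)) + K * enn2real (conv weight (\<lambda>y. norm (u y)) (gp x))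
       + B * norm (cauchy_op (\<lambda>t. u (axis j t)) (gm x $ j)) + B * norm (cauchy_op (\<lambda>t. u (axis j t)) (gp x $ j))"
proof -
  obtain X where X: "AE x in lebesgue. x \<in> X" "cutoff_amplitude a \<chi>\<^sub>0 X \<bar>m\<bar>"
    by (rule cutoff_amplitude_of_Linf[OF rho a \<phi> chi]) (rule that)
  interpret cutoff_amplitude a \<chi>\<^sub>0 X "\<bar>m\<bar>" by (rule X(2))
  define \<sigma> where "\<sigma> x \<xi> = (if \<xi> $ j \<ge> 0 then b x \<xi> - b x 0 * half_exp j \<xi> else 0)" for x \<xi>
  obtain K1 where K1: "K1 \<ge> 0" "\<And>x. x \<in> X \<Longrightarrow> integrable lborel (b x)" "\<And>x s. x \<in> X \<Longrightarrow> norm (ft s (b x)) \<le> K1 * weight s"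
    using amplitude_kernel by blast
  obtain K2 where K2: "K2 \<ge> 0" "\<And>x. x \<in> X \<Longrightarrow> integrable lborel (\<sigma> x)" "\<And>x s. x \<in> X \<Longrightarrow> norm (ft s (\<sigma> x)) \<le> K2 * weight s"
    using half_line_kernel[OF one, of j] unfolding \<sigma>_def[abs_def] by blast
  obtain B where B: "B \<ge> 0" "\<forall>x\<in>X. \<forall>\<xi>. norm (b x \<xi>) \<le> B * (1 + norm \<xi>) powr (- 0)" using b_bound by blast
  have "norm (low_freq_FIO a \<phi> \<chi>\<^sub>0 u x) \<le>
       (K1 + K2) * enn2real (conv weight (\<lambda>y. norm (u y)) (gm x)) + (K1 + K2) * enn2real (conv weight (\<lambda>y. norm (u y)) (gp x))
       + B * norm (cauchy_op (\<lambda>t. u (axis j t)) (gm x $ j)) + B * norm (cauchy_op (\<lambda>t. u (axis j t)) (gp x $ j))"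
    if u: "u \<in> schwartz_space" and x: "x \<in> X" for u x
  proof -
    have ui: "integrable lborel u" by (rule schwartz_integrable[OF u])
    have b0: "norm (b x 0) \<le> B" using B(2)[rule_format, OF x, of 0] by simp
    have hi: "integrable lborel (half_exp j :: real^'n \<Rightarrow> complex)" by (rule half_exp_integrable[OF one])
    define J where "J z \<tau> = (LINT \<xi>|lborel. exp (\<i> * complex_of_real (z \<bullet> \<xi>)) * \<tau> \<xi> * fourier u \<xi>)" for z \<tau>
    let ?e = "\<lambda>z \<tau> \<xi>. exp (\<i> * complex_of_real (z \<bullet> \<xi>)) * \<tau> \<xi> * fourier u \<xi>"
    let ?h = "\<lambda>\<xi>. (if \<xi> = 0 then 0 else exp (\<i> * complex_of_real (\<phi> x \<xi>)) * a x \<xi> * \<chi>\<^sub>0 \<xi>) * fourier u \<xi>"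
    let ?k = "\<lambda>\<xi>. ?e (gm x) (b x) \<xi> + (?e (gp x) (\<sigma> x) \<xi> - ?e (gm x) (\<sigma> x) \<xi>)
        + b x 0 * (?e (gp x) (half_exp j) \<xi> - ?e (gm x) (half_exp j) \<xi>)"
    have ei: "integrable lborel (?e z (b x))" "integrable lborel (?e z (\<sigma> x))" "integrable lborel (?e z (half_exp j))" for z
      using integrable_mult_fourier[OF ui] K1(2)[OF x] K2(2)[OF x] hi by blast+
    (* On the positive half-line the terms with gm cancel; on the negative one \<sigma> and half_exp vanish. *)
    have hk: "?h \<xi> = ?k \<xi>" if nz: "\<xi> \<noteq> 0" for \<xi>
    proof -
      have hom: "\<phi> x (t *\<^sub>R \<eta>) = t * \<phi> x \<eta>" if "\<eta> \<noteq> 0" "t > 0" for \<eta> t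
        using \<phi> that by (auto simp: Linf_Phi_def)
      note ph = phase_dim_one[OF one hom nz, of j]
      show ?thesis
      proof (cases "\<xi> $ j \<ge> 0")
        case True
        then have "\<phi> x \<xi> = gp x \<bullet> \<xi>" using ph by (simp add: gp_def)
        then show ?thesis using nz True by (simp add: b_def \<sigma>_def algebra_simps)
      next
        case False
        then have "\<phi> x \<xi> = gm x \<bullet> \<xi>" using ph by (simp add: gm_def)
        then show ?thesis using nz False by (simp add: b_def \<sigma>_def half_exp_def)
      qed
    qed
    have ki: "integrable lborel ?k"
      by (intro Bochner_Integration.integrable_add Bochner_Integration.integrable_diff integrable_mult_right ei)
    have "(LINT \<xi>|lborel. ?h \<xi>) = (LINT \<xi>|lborel. ?k \<xi>)"
    proof (rule integral_cong_AE)
      have km: "?k \<in> borel_measurable lborel" using ki by auto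
      have "?h = (\<lambda>\<xi>. if \<xi> = 0 then 0 else ?k \<xi>)"
      proof
        fix \<xi> show "?h \<xi> = (if \<xi> = 0 then 0 else ?k \<xi>)" using hk[of \<xi>] by (cases "\<xi> = 0") simp_all
      qed
      then show "?h \<in> borel_measurable lborel" using km by simp
      show "?k \<in> borel_measurable lborel" by (rule km)
      show "AE \<xi> in lborel. ?h \<xi> = ?k \<xi>"
        using AE_lborel_singleton[of "0::real^'n"] by eventually_elim (rule hk)
    qed
    also have "\<dots> = J (gm x) (b x) + (J (gp x) (\<sigma> x) - J (gm x) (\<sigma> x)) + b x 0 * (J (gp x) (half_exp j) - J (gm x) (half_exp j))"
      unfolding J_def
        Bochner_Integration.integral_add[OF Bochner_Integration.integrable_add[OF ei(1) Bochner_Integration.integrable_diff[OF ei(2) ei(2)]]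
          integrable_mult_right[OF Bochner_Integration.integrable_diff[OF ei(3) ei(3)]]]
        Bochner_Integration.integral_add[OF ei(1) Bochner_Integration.integrable_diff[OF ei(2) ei(2)]]
        Bochner_Integration.integral_diff[OF ei(2) ei(2)] integral_mult_right_zero Bochner_Integration.integral_diff[OF ei(3) ei(3)]
      by (rule refl)
    finally have "low_freq_FIO a \<phi> \<chi>\<^sub>0 u x = 1 / (2 * complex_of_real pi) ^ CARD('n) *
       (J (gm x) (b x) + (J (gp x) (\<sigma> x) - J (gm x) (\<sigma> x)) + b x 0 * (J (gp x) (half_exp j) - J (gm x) (half_exp j)))" (is "_ = _ * ?S")
      using low_freq_FIO_lborel(1)[OF a \<phi> chi u, of x] by (simp only:)
    then have "norm (low_freq_FIO a \<phi> \<chi>\<^sub>0 u x) \<le> norm ?S"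
      by (simp only: norm_FIO_constant_mult)
    also have "\<dots> \<le> norm (J (gm x) (b x)) + (norm (J (gp x) (\<sigma> x)) + norm (J (gm x) (\<sigma> x)))
       + norm (b x 0) * (norm (J (gp x) (half_exp j)) + norm (J (gm x) (half_exp j)))"
      by (rule norm_five_terms_le)
    also have "\<dots> \<le> (K1 + K2) * enn2real (conv weight (\<lambda>y. norm (u y)) (gm x)) + (K1 + K2) * enn2real (conv weight (\<lambda>y. norm (u y)) (gp x))
       + B * norm (cauchy_op (\<lambda>t. u (axis j t)) (gm x $ j)) + B * norm (cauchy_op (\<lambda>t. u (axis j t)) (gp x $ j))"
    proof -
      have bound: "norm (J z \<tau>) \<le> K * enn2real (conv weight (\<lambda>y. norm (u y)) z)"
        if "integrable lborel \<tau>" "\<And>s. norm (ft s \<tau>) \<le> K * weight s" "K \<ge> 0" for z \<tau> K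
      proof -
        have "ennreal (norm (J z \<tau>)) \<le> ennreal K * conv weight (\<lambda>y. norm (u y)) z"
          unfolding J_def by (rule oscillatory_integral_bound[OF ui that])
        also have "\<dots> = ennreal (K * enn2real (conv weight (\<lambda>y. norm (u y)) z))"
          using conv_weight_finite[OF u, of z] that(3) by (simp add: ennreal_mult less_top)
        finally show ?thesis using that(3) by (subst (asm) ennreal_le_iff) auto
      qed
      have Jh: "J z (half_exp j) = cauchy_op (\<lambda>t. u (axis j t)) (z $ j)" for z
        unfolding J_def by (rule half_exp_operator[OF one ui])
      define cm where "cm = enn2real (conv weight (\<lambda>y. norm (u y)) (gm x))"
      define cp where "cp = enn2real (conv weight (\<lambda>y. norm (u y)) (gp x))"
      define hm where "hm = norm (cauchy_op (\<lambda>t. u (axis j t)) (gm x $ j))"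
      define hp where "hp = norm (cauchy_op (\<lambda>t. u (axis j t)) (gp x $ j))"
      have 1: "norm (J (gm x) (b x)) \<le> K1 * cm" "norm (J (gp x) (\<sigma> x)) \<le> K2 * cp" "norm (J (gm x) (\<sigma> x)) \<le> K2 * cm"
        unfolding cm_def cp_def by (rule bound K1(2,3)[OF x] K1(1) K2(2,3)[OF x] K2(1))+
      have 2: "norm (b x 0) * (hp + hm) \<le> B * (hp + hm)"
        by (rule mult_right_mono[OF b0]) (simp add: hp_def hm_def)
      have 3: "0 \<le> K1 * cp" using K1(1) by (simp add: cp_def)
      have "norm (J (gm x) (b x)) + (norm (J (gp x) (\<sigma> x)) + norm (J (gm x) (\<sigma> x))) + norm (b x 0) * (hp + hm)
          \<le> (K1 + K2) * cm + (K1 + K2) * cp + B * hm + B * hp"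
        using 1 2 3 unfolding distrib_left distrib_right by linarith
      then show ?thesis unfolding Jh by (simp only: cm_def cp_def hm_def hp_def)
    qed
    finally show ?thesis .
  qed
  then have "\<forall>u\<in>schwartz_space. AE x in lebesgue.
     norm (low_freq_FIO a \<phi> \<chi>\<^sub>0 u x) \<le>
       (K1 + K2) * enn2real (conv weight (\<lambda>y. norm (u y)) (gm x)) + (K1 + K2) * enn2real (conv weight (\<lambda>y. norm (u y)) (gp x))
       + B * norm (cauchy_op (\<lambda>t. u (axis j t)) (gm x $ j)) + B * norm (cauchy_op (\<lambda>t. u (axis j t)) (gp x $ j))"
    using X(1) by (auto elim!: eventually_mono)
  moreover have "K1 + K2 \<ge> 0" using K1(1) K2(1) by simp
  ultimately show ?thesis using B(1) by (intro exI[of _ "K1 + K2"] exI[of _ B] conjI)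
qed

text \<open>
  Four majorants, two of them convolutions and two Cauchy integrals. The latter are bounded for finite exponents
  above one.
\<close>

lemma FIO_bounded_dim_one:
  fixes a :: "real^'n::finite \<Rightarrow> real^'n \<Rightarrow> complex" and \<phi> :: "real^'n \<Rightarrow> real^'n \<Rightarrow> real"
  assumes one: "CARD('n) = 1" and rho: "0 \<le> \<rho>" and a: "a \<in> Linf_S m \<rho>" and \<phi>: "\<phi> \<in> Linf_Phi 2"
    and nd: "rough_nondegenerate \<phi>" and chi: "\<chi>\<^sub>0 \<in> test_functions" and p: "1 < p" "p < \<infinity>"
  shows "bounded_on_Lp p (low_freq_FIO a \<phi> \<chi>\<^sub>0)"
proof -
  fix j :: 'n
  define P where "P = enn2real p"
  have P: "P > 1"
  proof -
    obtain r where "p = ennreal r" "r \<ge> 0" using p(2) by (cases p) auto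
    then show ?thesis using p(1) by (simp add: P_def ennreal_less_iff flip: ennreal_1)
  qed
  obtain c where c: "c > 0" "\<And>x y \<xi>. \<xi> \<noteq> 0 \<Longrightarrow> norm (gradient (\<phi> x) \<xi> - gradient (\<phi> y) \<xi>) \<ge> c * norm (x - y)"
    using nd unfolding rough_nondegenerate_def by blast
  define gp where "gp x = gradient (\<phi> x) (axis j 1)" for x
  define gm where "gm x = gradient (\<phi> x) (axis j (- 1))" for x
  have ax: "(axis j s :: real^'n) \<noteq> 0" "norm (axis j s :: real^'n) = 1" if "\<bar>s\<bar> = 1" for s :: real
    using that norm_vec1[OF one, of "axis j s" j] by (auto simp: axis_eq_0_iff)
  have gmeas: "(\<lambda>x. gradient (\<phi> x) (axis j s)) \<in> borel_measurable lebesgue" if "\<bar>s\<bar> = 1" for s :: real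
    by (rule gradient_measurable) (use \<phi> ax[OF that] in \<open>auto simp: Linf_Phi_def\<close>)
  define g where "g i = (if i = 0 \<or> i = 2 then gm else gp)" for i :: nat
  have g: "g i \<in> borel_measurable lebesgue" for i
    using gmeas[of 1] gmeas[of "-1"] by (simp add: g_def gp_def[abs_def] gm_def[abs_def])
  have ge: "c * norm (x - y) \<le> norm (g i x - g i y)" for i x y
    using c(2)[OF ax(1)[of 1]] c(2)[OF ax(1)[of "-1"]] by (simp add: g_def gp_def gm_def)
  obtain K B where KB: "K \<ge> 0" "B \<ge> 0" "\<And>u. u \<in> schwartz_space \<Longrightarrow> AE x in lebesgue.
     norm (low_freq_FIO a \<phi> \<chi>\<^sub>0 u x) \<le>
       K * enn2real (conv weight (\<lambda>y. norm (u y)) (gm x)) + K * enn2real (conv weight (\<lambda>y. norm (u y)) (gp x))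
       + B * norm (cauchy_op (\<lambda>t. u (axis j t)) (gm x $ j)) + B * norm (cauchy_op (\<lambda>t. u (axis j t)) (gp x $ j))"
    using FIO_majorant_dim_one[OF one rho a \<phi> chi, of j] unfolding gp_def gm_def by blast
  obtain C where C: "C \<ge> 0" "\<And>v. continuous_on UNIV v \<Longrightarrow> integrable lborel v \<Longrightarrow>
    (\<integral>\<^sup>+x. ennreal (norm (cauchy_op v x) powr P) \<partial>lborel) \<le> ennreal C * (\<integral>\<^sup>+t. ennreal (norm (v t) powr P) \<partial>lborel)"
    using cauchy_op_Lp[OF P] by blast
  define D where "D = max (K powr P * (2 * (2 * weight_mass TYPE('n)) powr (P - 1) * weight_mass TYPE('n))) (B powr P * C)"
  have D0: "D \<ge> 0" unfolding D_def using C(1) by (simp add: le_max_iff_disj)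
  show ?thesis
  proof (rule bounded_on_Lp_finite)
    show "1 \<le> p" "p < \<infinity>" using p by auto
    fix u :: "real^'n \<Rightarrow> complex" assume u: "u \<in> schwartz_space"
    show "low_freq_FIO a \<phi> \<chi>\<^sub>0 u \<in> borel_measurable lebesgue" by (rule low_freq_FIO_lborel(2)[OF a \<phi> chi u])
    have um[measurable]: "u \<in> borel_measurable borel" by (rule schwartz_integrable[OF u])
    define I where "I = (\<integral>\<^sup>+y. ennreal (norm (u y) powr P) \<partial>lborel)"
    define v where "v t = u (axis j t)" for t
    have uv: "u y = v (y $ j)" for y by (simp add: v_def vec_eq_axis[OF one, symmetric])
    have axc: "continuous_on UNIV (\<lambda>t::real. axis j t :: real^'n)"
    proof -
      have "continuous_on UNIV (\<lambda>t::real. t *\<^sub>R (axis j 1 :: real^'n))" by (intro continuous_intros)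
      then show ?thesis by (rule continuous_on_eq) (simp add: vec_eq_iff axis_def)
    qed
    have vc: "continuous_on UNIV v"
      unfolding v_def by (rule continuous_on_compose2[OF schwartz_weight_bound(1)[OF u] axc]) simp
    have vm[measurable]: "v \<in> borel_measurable borel" by (rule borel_measurable_continuous_onI[OF vc])
    have vi: "integrable lborel v"
      using schwartz_integrable(1)[OF u] vec1_integral(2)[OF one vm, of j] by (simp flip: uv)
    have vI: "(\<integral>\<^sup>+t. ennreal (norm (v t) powr P) \<partial>lborel) = I"
      unfolding I_def uv by (rule vec1_nn_integral[OF one, symmetric]) measurable
    define G where "G i = (if i < 2 then (\<lambda>z. K * enn2real (conv weight (\<lambda>y. norm (u y)) z)) else (\<lambda>z. B * norm (cauchy_op v (z $ j))))" for i :: nat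
    have Gm: "G i \<in> borel_measurable borel" for i
      unfolding G_def using conv_weight_Lp(1)[OF u _ KB(1), of P] P by (cases "i < 2") auto
    have G0: "G i z \<ge> 0" for i z using KB by (simp add: G_def)
    have GI: "(\<integral>\<^sup>+z. ennreal (G i z powr P) \<partial>lborel) \<le> ennreal D * I" for i
    proof (cases "i < 2")
      case True
      have "(\<integral>\<^sup>+z. ennreal (G i z powr P) \<partial>lborel) \<le> ennreal (K powr P * (2 * (2 * weight_mass TYPE('n)) powr (P - 1) * weight_mass TYPE('n))) * I"
        using conv_weight_Lp(3)[OF u _ KB(1), of P] P True by (simp add: G_def I_def)
      also have "\<dots> \<le> ennreal D * I" by (intro mult_right_mono ennreal_leI) (auto simp: D_def)
      finally show ?thesis .
    next
      case False
      have "(\<integral>\<^sup>+z. ennreal (G i z powr P) \<partial>lborel) = (\<integral>\<^sup>+z. ennreal (B powr P) * ennreal (norm (cauchy_op v ((z::real^'n) $ j)) powr P) \<partial>lborel)"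
      proof (rule nn_integral_cong)
        fix z :: "real^'n"
        have "G i z = B * norm (cauchy_op v (z $ j))" using False by (simp add: G_def)
        then show "ennreal (G i z powr P) = ennreal (B powr P) * ennreal (norm (cauchy_op v (z $ j)) powr P)"
          by (simp only: powr_mult ennreal_mult powr_ge_zero)
      qed
      also have "\<dots> = ennreal (B powr P) * (\<integral>\<^sup>+z. ennreal (norm (cauchy_op v ((z::real^'n) $ j)) powr P) \<partial>lborel)"
        by (rule nn_integral_cmult) measurable
      also have "(\<integral>\<^sup>+z. ennreal (norm (cauchy_op v ((z::real^'n) $ j)) powr P) \<partial>lborel) = (\<integral>\<^sup>+t. ennreal (norm (cauchy_op v t) powr P) \<partial>lborel)"
        by (rule vec1_nn_integral[OF one]) measurable
      also have "\<dots> \<le> ennreal C * I" using C(2)[OF vc vi] by (simp add: vI)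
      finally have "(\<integral>\<^sup>+z. ennreal (G i z powr P) \<partial>lborel) \<le> ennreal (B powr P * C) * I"
        using C(1) by (simp add: ennreal_mult mult.assoc mult_left_mono)
      also have "\<dots> \<le> ennreal D * I" by (intro mult_right_mono ennreal_leI) (auto simp: D_def)
      finally show ?thesis .
    qed
    have S4: "{..<4} = {0, 1, 2, 3::nat}" by auto
    have T: "AE x in lebesgue. norm (low_freq_FIO a \<phi> \<chi>\<^sub>0 u x) \<le> (\<Sum>i<4. G i (g i x))"
      using KB(3)[OF u] by eventually_elim (simp add: S4 G_def g_def v_def[abs_def])
    have "(\<integral>\<^sup>+x. ennreal (norm (low_freq_FIO a \<phi> \<chi>\<^sub>0 u x) powr P) \<partial>lebesgue)
      \<le> ennreal (real 4 powr P * (real 4 * ((2 * CARD('n) / c) ^ CARD('n) * D))) * I"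
      by (rule Lp_from_majorants[where g = g and G = G, OF _ g c(1) ge Gm G0 _ GI D0]) (use P T in auto)
    then show "(\<integral>\<^sup>+x. ennreal (norm (low_freq_FIO a \<phi> \<chi>\<^sub>0 u x) powr enn2real p) \<partial>lebesgue)
      \<le> ennreal (real 4 powr P * (real 4 * ((2 * CARD('n) / c) ^ CARD('n) * D))) * (\<integral>\<^sup>+x. ennreal (norm (u x) powr enn2real p) \<partial>lebesgue)"
      by (simp add: I_def P_def nn_integral_completion)
  qed (use D0 c(1) in \<open>auto intro!: mult_nonneg_nonneg\<close>)
qed

text \<open>
  A single convolution majorizes the operator, so all exponents including the endpoints are covered.
\<close>

lemma FIO_bounded_higher_dim:
  fixes a :: "real^'n::finite \<Rightarrow> real^'n \<Rightarrow> complex" and \<phi> :: "real^'n \<Rightarrow> real^'n \<Rightarrow> real"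
  assumes card: "CARD('n) \<ge> 2" and rho: "0 \<le> \<rho>" and a: "a \<in> Linf_S m \<rho>" and \<phi>: "\<phi> \<in> Linf_Phi 2"
    and nd: "rough_nondegenerate \<phi>" and chi: "\<chi>\<^sub>0 \<in> test_functions" and p: "1 \<le> p"
  shows "bounded_on_Lp p (low_freq_FIO a \<phi> \<chi>\<^sub>0)"
proof -
  fix i0 :: 'n
  define g where "g x = gradient (\<phi> x) (axis i0 1)" for x
  obtain c where c: "c > 0" "\<And>x y \<xi>. \<xi> \<noteq> 0 \<Longrightarrow> norm (gradient (\<phi> x) \<xi> - gradient (\<phi> y) \<xi>) \<ge> c * norm (x - y)"
    using nd unfolding rough_nondegenerate_def by blast
  have ge: "c * norm (x - y) \<le> norm (g x - g y)" for x y
    unfolding g_def by (rule c(2)) (simp add: axis_eq_0_iff)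
  have gm: "g \<in> borel_measurable lebesgue"
    unfolding g_def by (rule gradient_measurable) (use \<phi> in \<open>auto simp: Linf_Phi_def\<close>)
  obtain K where K: "K \<ge> 0" "\<And>u. u \<in> schwartz_space \<Longrightarrow> AE x in lebesgue.
     ennreal (norm (low_freq_FIO a \<phi> \<chi>\<^sub>0 u x)) \<le> ennreal K * conv weight (\<lambda>y. norm (u y)) (g x)"
    using FIO_majorant_higher_dim[OF card rho a \<phi> chi, of i0] unfolding g_def by blast
  have meas: "low_freq_FIO a \<phi> \<chi>\<^sub>0 u \<in> borel_measurable lebesgue" if "u \<in> schwartz_space" for u
    by (rule low_freq_FIO_lborel(2)[OF a \<phi> chi that])
  show ?thesis
  proof (cases "p = \<infinity>")
    case True
    then show ?thesis using bounded_on_Lp_infinity[OF meas K(1) K(2)] by simp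
  next
    case False
    then have pf: "p < \<infinity>" by (simp add: less_top)
    define P where "P = enn2real p"
    have P: "P \<ge> 1" using p pf enn2real_mono[of 1 p] by (simp add: P_def)
    define D where "D = K powr P * (2 * (2 * weight_mass TYPE('n)) powr (P - 1) * weight_mass TYPE('n))"
    have D0: "D \<ge> 0" unfolding D_def using weight_mass(2)[where 'n='n] by simp
    show ?thesis
    proof (rule bounded_on_Lp_finite[OF p pf meas])
      fix u :: "real^'n \<Rightarrow> complex" assume u: "u \<in> schwartz_space"
      define G where "G z = K * enn2real (conv weight (\<lambda>y. norm (u y)) z)" for z
      note GL = conv_weight_Lp[OF u P K(1), folded G_def D_def]
      have T: "AE x in lebesgue. norm (low_freq_FIO a \<phi> \<chi>\<^sub>0 u x) \<le> (\<Sum>i<(1::nat). G (g x))"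
        using K(2)[OF u]
      proof eventually_elim
        case (elim x)
        have "ennreal K * conv weight (\<lambda>y. norm (u y)) (g x) = ennreal (G (g x))"
          using conv_weight_finite[OF u, of "g x"] K(1) by (simp add: G_def ennreal_mult less_top)
        then have "ennreal (norm (low_freq_FIO a \<phi> \<chi>\<^sub>0 u x)) \<le> ennreal (G (g x))" using elim by simp
        then show ?case using K(1) by (subst (asm) ennreal_le_iff) (auto simp: G_def)
      qed
      have "(\<integral>\<^sup>+x. ennreal (norm (low_freq_FIO a \<phi> \<chi>\<^sub>0 u x) powr P) \<partial>lebesgue)
        \<le> ennreal (real 1 powr P * (real 1 * ((2 * CARD('n) / c) ^ CARD('n) * D))) * (\<integral>\<^sup>+y. ennreal (norm (u y) powr P) \<partial>lborel)"
        by (rule Lp_from_majorants[where g = "\<lambda>_. g" and G = "\<lambda>_. G", OF P gm c(1) ge _ _ T _ D0]) (use GL in \<open>auto simp: G_def[abs_def]\<close>)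
      then show "(\<integral>\<^sup>+x. ennreal (norm (low_freq_FIO a \<phi> \<chi>\<^sub>0 u x) powr enn2real p) \<partial>lebesgue)
        \<le> ennreal (real 1 powr P * (real 1 * ((2 * CARD('n) / c) ^ CARD('n) * D))) * (\<integral>\<^sup>+x. ennreal (norm (u x) powr enn2real p) \<partial>lebesgue)"
        by (simp add: P_def nn_integral_completion)
    qed (use D0 c(1) in \<open>auto intro!: mult_nonneg_nonneg\<close>)
  qed
qed

theorem theorem1p2p11:
  fixes a :: "real^'n::finite \<Rightarrow> real^'n \<Rightarrow> complex"
    and \<phi> :: "real^'n \<Rightarrow> real^'n \<Rightarrow> real"
    and \<chi>\<^sub>0 :: "real^'n \<Rightarrow> complex"
    and m \<rho> :: real
    and p :: ennreal
  assumes "0 \<le> \<rho>" and "\<rho> \<le> 1"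
    and "a \<in> Linf_S m \<rho>"
    and "\<phi> \<in> Linf_Phi 2"
    and "rough_nondegenerate \<phi>"
    and "\<chi>\<^sub>0 \<in> test_functions"
    and "1 \<le> p"
    and "CARD('n) = 1 \<Longrightarrow> 1 < p \<and> p < \<infinity>"
  shows "bounded_on_Lp p (low_freq_FIO a \<phi> \<chi>\<^sub>0)"
proof (cases "CARD('n) = 1")
  case True
  then show ?thesis using FIO_bounded_dim_one[OF True assms(1,3-6)] assms(8) by blast
next
  case False
  have "CARD('n) > 0" by simp
  then have "CARD('n) \<ge> 2" using False by linarith
  then show ?thesis using FIO_bounded_higher_dim assms by blast
qed

end
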